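(* Let $L:\mathscr D'(\Omega)\to\mathscr D'(\Omega)$ be linear, and let $L_{\mathbb X}:\mathbb G(\Omega_{\mathbb X})\to\mathbb G(\Omega_{\mathbb X})$ be any function such that $L_{\mathbb X}$ maps $\mathscr D_{\mathbb X}'(\Omega_{\mathbb X})$ into itself and $\Phi([L_{\mathbb X}(f)])=L(\Phi([f]))$ for all $f\in\mathscr D_{\mathbb X}'(\Omega_{\mathbb X})$. Let $T\in\mathscr D'(\Omega)$. Then the problem $L(v)=T$ has a solution $v\in\mathscr D'(\Omega)$ if and only if the problem $L_{\mathbb X}(u)=T_{\mathbb X}$ (equality of functions on $\Omega_{\mathbb X}$) has a solution $u\in\mathscr D_{\mathbb X}'(\Omega_{\mathbb X})$ for some $T_{\mathbb X}\in\mathscr D_{\mathbb X}'(\Omega_{\mathbb X})$ satisfying $\Phi([T_{\mathbb X}])=T$.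
   Context: Work in a nonstandard extension $A\mapsto{}^*A$ of the standard universe that is saturated for families of at most $|\mathscr D'(\Omega)|$ internal sets. ${}^*\mathbb R_{fin}$ is the ring of finite hyperreals; $x\approx y$ means $x-y$ is infinitesimal; ${}^\circ x$ is the standard part of a finite $x$ (componentwise in ${}^*\mathbb R^k$). Fix an infinite $N_0\in{}^*\mathbb N$, let $N=N_0!$, $\varepsilon=1/N$, and $\mathbb X=\{n\varepsilon: n\in{}^*\mathbb Z,\ -N^2\le n\le N^2\}$. Let $\Omega\subseteq\mathbb R^k$ be open and $\Omega_{\mathbb X}={}^*\Omega\cap\mathbb X^k$. $\mathbb G(\Omega_{\mathbb X})$ is the set of internal functions $\Omega_{\mathbb X}\to{}^*\mathbb R$. Inner product: $\langle f,g\rangle=\varepsilon^k\sum_{x\in\mathbb X^k}f(x)g(x)$, functions being $0$ outside their domain. Finite differences: $\mathbb D_if(x)=\varepsilon^{-1}(f(x+\varepsilon e_i)-f(x))$ and $\mathbb D^\alpha=\mathbb D_1^{\alpha_1}\cdots\mathbb D_k^{\alpha_k}$. A point $x\in\Omega_{\mathbb X}$ is nearstandard in $\Omega$ if $x\approx y$ for some $y\in\Omega$. $f$ is of class $S^0$ if $f(x)$ is finite for some nearstandard $x$ and $f(x)\approx f(y)$ for all nearstandard $x\approx y$; it is of class $S^\infty$ if $\mathbb D^\alpha f$ is of class $S^0$ for every standard multi-index $\alpha$. Test functions: $\mathscr D_{\mathbb X}(\Omega_{\mathbb X})$ is the set of $f\in\mathbb G(\Omega_{\mathbb X})$ of class $S^\infty$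 such that, for some compact $K\subset\Omega$, every $x$ with $f(x)\ne0$ is finite with ${}^\circ x\in K$. Grid distributions: $\mathscr D_{\mathbb X}'(\Omega_{\mathbb X})=\{f\in\mathbb G(\Omega_{\mathbb X}):\langle f,\varphi\rangle\in{}^*\mathbb R_{fin}\ \forall\varphi\in\mathscr D_{\mathbb X}(\Omega_{\mathbb X})\}$. Write $f\equiv g$ iff $\langle f,\varphi\rangle\approx\langle g,\varphi\rangle$ for all $\varphi\in\mathscr D_{\mathbb X}(\Omega_{\mathbb X})$, with $[f]$ the class of $f$. $\Phi:\mathscr D_{\mathbb X}'(\Omega_{\mathbb X})/\!\equiv\ \to\mathscr D'(\Omega)$ is the isomorphism of real vector spaces given by $\langle\Phi([f]),\varphi\rangle={}^\circ\langle f,{}^*\varphi|_{\Omega_{\mathbb X}}\rangle$ for $\varphi\in\mathscr D(\Omega)$. *)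

theory Defs
  imports "HOL-Analysis.Analysis"
begin

section \<open>Nonstandard extensions\<close>

text \<open>
  The part of the superstructure over a field \<open>'r\<close> in which all objects of this development live:
  scalars, vectors, scalar functions on \<open>'r ^ 'n\<close>, and sets of such objects. The standard universe
  is \<open>(real, 'n) entity\<close>; as usual for superstructures, the objects of the nonstandard universe
  \<open>('h, 'n) entity\<close> are genuine functions and genuine sets over the field \<open>'h\<close> of hyperreals, some
  of which are internal.
\<close>

datatype ('r, 'n::finite) entity =
    Num (the_Num: 'r)
  | Vec (the_Vec: "'r ^ 'n")
  | Fun (the_Fun: "'r ^ 'n \<Rightarrow> 'r")
  | NumSet (the_NumSet: "'r set")
  | VecSet (the_VecSet: "('r ^ 'n) set")
  | FunSet (the_FunSet: "('r ^ 'n \<Rightarrow> 'r) set")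

fun mem :: "('r, 'n::finite) entity \<Rightarrow> ('r, 'n) entity \<Rightarrow> bool" where
  "mem (Num a) (NumSet A) \<longleftrightarrow> a \<in> A"
| "mem (Vec v) (VecSet A) \<longleftrightarrow> v \<in> A"
| "mem (Fun f) (FunSet A) \<longleftrightarrow> f \<in> A"
| "mem _ _ \<longleftrightarrow> False"

text \<open>
  First-order formulas with variables named by natural numbers. There is a relation symbol for every
  finitary relation on the standard universe; the remaining atoms (order, addition, multiplication,
  \<open>v\<close> has \<open>i\<close>-th component \<open>x\<close>, \<open>f(v) = x\<close>, membership) have a fixed meaning in both universes.
\<close>

datatype 'n::finite formula =
    Rel "(real, 'n) entity list set" "nat list"
  | Eq nat nat
  | Less nat nat
  | Plus nat nat nat
  | Times nat nat nat
  | Comp nat 'n nat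
  | App nat nat nat
  | Mem nat nat
  | Neg "'n formula"
  | Conj "'n formula" "'n formula"
  | All nat "'n formula"

text \<open>Satisfaction, with quantifiers ranging over \<open>D\<close> and relation symbols interpreted by \<open>I\<close>.\<close>

primrec sat ::
  "('r::linordered_field, 'n::finite) entity set \<Rightarrow>
   ((real, 'n) entity list set \<Rightarrow> ('r, 'n) entity list set) \<Rightarrow>
   (nat \<Rightarrow> ('r, 'n) entity) \<Rightarrow> 'n formula \<Rightarrow> bool" where
  "sat D I e (Rel R xs) \<longleftrightarrow> map e xs \<in> I R"
| "sat D I e (Eq x y) \<longleftrightarrow> e x = e y"
| "sat D I e (Less x y) \<longleftrightarrow> (\<exists>a b. e x = Num a \<and> e y = Num b \<and> a < b)"
| "sat D I e (Plus x y z) \<longleftrightarrow> (\<exists>a b. e x = Num a \<and> e y = Num b \<and> e z = Num (a + b))"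
| "sat D I e (Times x y z) \<longleftrightarrow> (\<exists>a b. e x = Num a \<and> e y = Num b \<and> e z = Num (a * b))"
| "sat D I e (Comp v i x) \<longleftrightarrow> (\<exists>w. e v = Vec w \<and> e x = Num (w $ i))"
| "sat D I e (App f v x) \<longleftrightarrow> (\<exists>g w. e f = Fun g \<and> e v = Vec w \<and> e x = Num (g w))"
| "sat D I e (Mem x y) \<longleftrightarrow> mem (e x) (e y)"
| "sat D I e (Neg p) \<longleftrightarrow> \<not> sat D I e p"
| "sat D I e (Conj p q) \<longleftrightarrow> sat D I e p \<and> sat D I e q"
| "sat D I e (All x p) \<longleftrightarrow> (\<forall>d\<in>D. sat D I (e(x := d)) p)"

record ('h, 'n) extension =
  star :: "(real, 'n::finite) entity \<Rightarrow> ('h, 'n) entity"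
  star_rel :: "(real, 'n) entity list set \<Rightarrow> ('h, 'n) entity list set"

text \<open>The internal entities are the elements of the extension of the standard universe.\<close>

definition internal :: "('h, 'n::finite) extension \<Rightarrow> ('h, 'n) entity set" where
  "internal E = {d. [d] \<in> star_rel E {[c] | c. True}}"

text \<open>
  \<open>'h\<close> is the set of all hyperreals, \<open>'h ^ 'n\<close> the set of all vectors of hyperreals, elements of
  internal sets are internal, and the transfer principle holds.
\<close>

definition nonstandard_extension :: "('h::linordered_field, 'n::finite) extension \<Rightarrow> bool" where
  "nonstandard_extension E \<longleftrightarrow>
     (\<forall>a. Num a \<in> internal E) \<and>
     (\<forall>v. Vec v \<in> internal E) \<and>
     (\<forall>A x. A \<in> internal E \<longrightarrow> mem x A \<longrightarrow> x \<in> internal E) \<and>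
     (\<forall>p e. sat UNIV id e p \<longleftrightarrow> sat (internal E) (star_rel E) (star E \<circ> e) p)"

definition internal_sets :: "('h, 'n::finite) extension \<Rightarrow> ('h, 'n) entity set set" where
  "internal_sets E = {{x. mem x A} | A. A \<in> internal E}"

text \<open>Saturation for families of at most \<open>|S|\<close> internal sets.\<close>

definition saturated :: "('h, 'n::finite) extension \<Rightarrow> 's set \<Rightarrow> bool" where
  "saturated E S \<longleftrightarrow>
     (\<forall>F. F \<subseteq> internal_sets E \<longrightarrow> F \<lesssim> S \<longrightarrow>
        (\<forall>G. G \<subseteq> F \<longrightarrow> finite G \<longrightarrow> \<Inter>G \<noteq> {}) \<longrightarrow> \<Inter>F \<noteq> {})"


subsection \<open>Hyperreal numbers\<close>

definition hfinite :: "'h::linordered_field \<Rightarrow> bool" where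
  "hfinite x \<longleftrightarrow> (\<exists>n::nat. \<bar>x\<bar> \<le> of_nat n)"

definition infinitesimal :: "'h::linordered_field \<Rightarrow> bool" where
  "infinitesimal x \<longleftrightarrow> (\<forall>n::nat. \<bar>x\<bar> < 1 / of_nat (Suc n))"

definition approx :: "'h::linordered_field \<Rightarrow> 'h \<Rightarrow> bool" where
  "approx x y \<longleftrightarrow> infinitesimal (x - y)"

definition vapprox :: "'h::linordered_field ^ 'n::finite \<Rightarrow> 'h ^ 'n \<Rightarrow> bool" where
  "vapprox x y \<longleftrightarrow> (\<forall>i. approx (x $ i) (y $ i))"

definition hreal :: "('h, 'n::finite) extension \<Rightarrow> real \<Rightarrow> 'h" where
  "hreal E r = the_Num (star E (Num r))"

definition hvec :: "('h, 'n::finite) extension \<Rightarrow> real ^ 'n \<Rightarrow> 'h ^ 'n" where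
  "hvec E v = the_Vec (star E (Vec v))"

definition st :: "('h::linordered_field, 'n::finite) extension \<Rightarrow> 'h \<Rightarrow> real" where
  "st E x = (THE r. approx x (hreal E r))"

definition hfun :: "('h, 'n::finite) extension \<Rightarrow> (real ^ 'n \<Rightarrow> real) \<Rightarrow> 'h ^ 'n \<Rightarrow> 'h" where
  "hfun E f = the_Fun (star E (Fun f))"

definition hnum_set :: "('h, 'n::finite) extension \<Rightarrow> real set \<Rightarrow> 'h set" where
  "hnum_set E A = the_NumSet (star E (NumSet A))"

definition hvec_set :: "('h, 'n::finite) extension \<Rightarrow> (real ^ 'n) set \<Rightarrow> ('h ^ 'n) set" where
  "hvec_set E A = the_VecSet (star E (VecSet A))"

definition hfact :: "('h, 'n::finite) extension \<Rightarrow> 'h \<Rightarrow> 'h" where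
  "hfact E a = (THE b. [Num a, Num b] \<in> star_rel E {[Num (of_nat n), Num (fact n)] | n. True})"

text \<open>The sum of an internal function over a hyperfinite set.\<close>

definition hsum :: "('h, 'n::finite) extension \<Rightarrow> ('h ^ 'n) set \<Rightarrow> ('h ^ 'n \<Rightarrow> 'h) \<Rightarrow> 'h" where
  "hsum E A f = (THE s. [VecSet A, Fun f, Num s] \<in>
      star_rel E {[VecSet B, Fun g, Num (\<Sum>x\<in>B. g x)] | B g. finite B})"


section \<open>Test functions and distributions\<close>

definition partial :: "'n::finite \<Rightarrow> (real ^ 'n \<Rightarrow> real) \<Rightarrow> real ^ 'n \<Rightarrow> real" where
  "partial i f = (\<lambda>x. frechet_derivative f (at x) (axis i 1))"

text \<open>
  Higher derivatives, both here and for finite differences below, are indexed by lists of directions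
  instead of multi-indices; the order of the list is irrelevant.
\<close>

abbreviation partials :: "'n::finite list \<Rightarrow> (real ^ 'n \<Rightarrow> real) \<Rightarrow> real ^ 'n \<Rightarrow> real" where
  "partials is f \<equiv> foldr partial is f"

definition smooth :: "(real ^ 'n::finite \<Rightarrow> real) \<Rightarrow> bool" where
  "smooth f \<longleftrightarrow> (\<forall>is x. partials is f differentiable at x)"

text \<open>Test functions on \<open>\<Omega>\<close> are extended by \<open>0\<close> to the whole space.\<close>

definition test_functions :: "(real ^ 'n::finite) set \<Rightarrow> (real ^ 'n \<Rightarrow> real) set" where
  "test_functions \<Omega> =
     {\<phi>. smooth \<phi> \<and> compact (closure {x. \<phi> x \<noteq> 0}) \<and> closure {x. \<phi> x \<noteq> 0} \<subseteq> \<Omega>}"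

definition tends_test ::
  "(real ^ 'n::finite) set \<Rightarrow> (nat \<Rightarrow> real ^ 'n \<Rightarrow> real) \<Rightarrow> (real ^ 'n \<Rightarrow> real) \<Rightarrow> bool" where
  "tends_test \<Omega> \<phi> \<psi> \<longleftrightarrow>
     (\<forall>n. \<phi> n \<in> test_functions \<Omega>) \<and> \<psi> \<in> test_functions \<Omega> \<and>
     (\<exists>K. compact K \<and> K \<subseteq> \<Omega> \<and> (\<forall>n x. \<phi> n x \<noteq> 0 \<longrightarrow> x \<in> K)) \<and>
     (\<forall>is. uniform_limit UNIV (\<lambda>n. partials is (\<phi> n)) (partials is \<psi>) sequentially)"

text \<open>
  A distribution takes the value \<open>0\<close> outside the test functions, so that distributions are equal iff
  they agree on test functions, and the vector space operations are pointwise.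
\<close>

definition distributions :: "(real ^ 'n::finite) set \<Rightarrow> ((real ^ 'n \<Rightarrow> real) \<Rightarrow> real) set" where
  "distributions \<Omega> =
     {T. (\<forall>\<phi>. \<phi> \<notin> test_functions \<Omega> \<longrightarrow> T \<phi> = 0) \<and>
         (\<forall>\<phi>\<in>test_functions \<Omega>. \<forall>\<psi>\<in>test_functions \<Omega>. T (\<lambda>x. \<phi> x + \<psi> x) = T \<phi> + T \<psi>) \<and>
         (\<forall>c. \<forall>\<phi>\<in>test_functions \<Omega>. T (\<lambda>x. c * \<phi> x) = c * T \<phi>) \<and>
         (\<forall>\<phi> \<psi>. tends_test \<Omega> \<phi> \<psi> \<longrightarrow> (\<lambda>n. T (\<phi> n)) \<longlonglongrightarrow> T \<psi>)}"

definition linear_on_distributions ::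
  "(real ^ 'n::finite) set \<Rightarrow> (((real ^ 'n \<Rightarrow> real) \<Rightarrow> real) \<Rightarrow> ((real ^ 'n \<Rightarrow> real) \<Rightarrow> real)) \<Rightarrow> bool" where
  "linear_on_distributions \<Omega> L \<longleftrightarrow>
     (\<forall>S\<in>distributions \<Omega>. L S \<in> distributions \<Omega>) \<and>
     (\<forall>S\<in>distributions \<Omega>. \<forall>T\<in>distributions \<Omega>. L (\<lambda>\<phi>. S \<phi> + T \<phi>) = (\<lambda>\<phi>. L S \<phi> + L T \<phi>)) \<and>
     (\<forall>c. \<forall>S\<in>distributions \<Omega>. L (\<lambda>\<phi>. c * S \<phi>) = (\<lambda>\<phi>. c * L S \<phi>))"


section \<open>Grid functions\<close>

definition grid :: "('h::linordered_field, 'n::finite) extension \<Rightarrow> 'h \<Rightarrow> 'h set" where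
  "grid E N = {n * (1 / N) | n. n \<in> hnum_set E \<int> \<and> - (N\<^sup>2) \<le> n \<and> n \<le> N\<^sup>2}"

definition grid_vecs :: "('h::linordered_field, 'n::finite) extension \<Rightarrow> 'h \<Rightarrow> ('h ^ 'n) set" where
  "grid_vecs E N = {x. \<forall>i. x $ i \<in> grid E N}"

definition grid_domain ::
  "('h::linordered_field, 'n::finite) extension \<Rightarrow> 'h \<Rightarrow> (real ^ 'n) set \<Rightarrow> ('h ^ 'n) set" where
  "grid_domain E N \<Omega> = hvec_set E \<Omega> \<inter> grid_vecs E N"

text \<open>
  Internal functions on the grid domain, extended by \<open>0\<close>. The extension is again internal because
  the grid domain is an internal set.
\<close>

definition grid_functions ::
  "('h::linordered_field, 'n::finite) extension \<Rightarrow> 'h \<Rightarrow> (real ^ 'n) set \<Rightarrow> ('h ^ 'n \<Rightarrow> 'h) set" where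
  "grid_functions E N \<Omega> =
     {f. Fun f \<in> internal E \<and> (\<forall>x. x \<notin> grid_domain E N \<Omega> \<longrightarrow> f x = 0)}"

definition grid_inner ::
  "('h::linordered_field, 'n::finite) extension \<Rightarrow> 'h \<Rightarrow> ('h ^ 'n \<Rightarrow> 'h) \<Rightarrow> ('h ^ 'n \<Rightarrow> 'h) \<Rightarrow> 'h" where
  "grid_inner E N f g = (1 / N) ^ CARD('n) * hsum E (grid_vecs E N) (\<lambda>x. f x * g x)"

definition grid_diff ::
  "'h::linordered_field \<Rightarrow> 'n::finite \<Rightarrow> ('h ^ 'n \<Rightarrow> 'h) \<Rightarrow> 'h ^ 'n \<Rightarrow> 'h" where
  "grid_diff N i f = (\<lambda>x. (f (x + axis i (1 / N)) - f x) / (1 / N))"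

abbreviation grid_diffs ::
  "'h::linordered_field \<Rightarrow> 'n::finite list \<Rightarrow> ('h ^ 'n \<Rightarrow> 'h) \<Rightarrow> 'h ^ 'n \<Rightarrow> 'h" where
  "grid_diffs N is f \<equiv> foldr (grid_diff N) is f"

definition nearstandard ::
  "('h::linordered_field, 'n::finite) extension \<Rightarrow> 'h \<Rightarrow> (real ^ 'n) set \<Rightarrow> ('h ^ 'n) set" where
  "nearstandard E N \<Omega> = {x \<in> grid_domain E N \<Omega>. \<exists>y\<in>\<Omega>. vapprox x (hvec E y)}"

definition class_S0 ::
  "('h::linordered_field, 'n::finite) extension \<Rightarrow> 'h \<Rightarrow> (real ^ 'n) set \<Rightarrow> ('h ^ 'n \<Rightarrow> 'h) \<Rightarrow> bool" where
  "class_S0 E N \<Omega> f \<longleftrightarrow>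
     (\<exists>x\<in>nearstandard E N \<Omega>. hfinite (f x)) \<and>
     (\<forall>x\<in>nearstandard E N \<Omega>. \<forall>y\<in>nearstandard E N \<Omega>. vapprox x y \<longrightarrow> approx (f x) (f y))"

definition class_Sinf ::
  "('h::linordered_field, 'n::finite) extension \<Rightarrow> 'h \<Rightarrow> (real ^ 'n) set \<Rightarrow> ('h ^ 'n \<Rightarrow> 'h) \<Rightarrow> bool" where
  "class_Sinf E N \<Omega> f \<longleftrightarrow> (\<forall>is. class_S0 E N \<Omega> (grid_diffs N is f))"

definition grid_test_functions ::
  "('h::linordered_field, 'n::finite) extension \<Rightarrow> 'h \<Rightarrow> (real ^ 'n) set \<Rightarrow> ('h ^ 'n \<Rightarrow> 'h) set" where
  "grid_test_functions E N \<Omega> =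
     {f \<in> grid_functions E N \<Omega>. class_Sinf E N \<Omega> f \<and>
        (\<exists>K. compact K \<and> K \<subseteq> \<Omega> \<and>
           (\<forall>x. f x \<noteq> 0 \<longrightarrow> (\<forall>i. hfinite (x $ i)) \<and> (\<chi> i. st E (x $ i)) \<in> K))}"

definition grid_distributions ::
  "('h::linordered_field, 'n::finite) extension \<Rightarrow> 'h \<Rightarrow> (real ^ 'n) set \<Rightarrow> ('h ^ 'n \<Rightarrow> 'h) set" where
  "grid_distributions E N \<Omega> =
     {f \<in> grid_functions E N \<Omega>. \<forall>\<phi>\<in>grid_test_functions E N \<Omega>. hfinite (grid_inner E N f \<phi>)}"

definition grid_equiv ::
  "('h::linordered_field, 'n::finite) extension \<Rightarrow> 'h \<Rightarrow> (real ^ 'n) set \<Rightarrow> ('h ^ 'n \<Rightarrow> 'h) rel" where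
  "grid_equiv E N \<Omega> =
     {(f, g). f \<in> grid_distributions E N \<Omega> \<and> g \<in> grid_distributions E N \<Omega> \<and>
        (\<forall>\<phi>\<in>grid_test_functions E N \<Omega>. approx (grid_inner E N f \<phi>) (grid_inner E N g \<phi>))}"

definition grid_class ::
  "('h::linordered_field, 'n::finite) extension \<Rightarrow> 'h \<Rightarrow> (real ^ 'n) set \<Rightarrow>
   ('h ^ 'n \<Rightarrow> 'h) \<Rightarrow> ('h ^ 'n \<Rightarrow> 'h) set" where
  "grid_class E N \<Omega> f = grid_equiv E N \<Omega> `` {f}"

definition grid_restrict ::
  "('h::linordered_field, 'n::finite) extension \<Rightarrow> 'h \<Rightarrow> (real ^ 'n) set \<Rightarrow>
   (real ^ 'n \<Rightarrow> real) \<Rightarrow> 'h ^ 'n \<Rightarrow> 'h" where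
  "grid_restrict E N \<Omega> \<phi> = (\<lambda>x. if x \<in> grid_domain E N \<Omega> then hfun E \<phi> x else 0)"

text \<open>
  The value on a test function is the common value of the standard part over all representatives
  of the class \<open>C\<close>.
\<close>

definition Phi ::
  "('h::linordered_field, 'n::finite) extension \<Rightarrow> 'h \<Rightarrow> (real ^ 'n) set \<Rightarrow>
   ('h ^ 'n \<Rightarrow> 'h) set \<Rightarrow> (real ^ 'n \<Rightarrow> real) \<Rightarrow> real" where
  "Phi E N \<Omega> C = (\<lambda>\<phi>.
     if \<phi> \<in> test_functions \<Omega>
     then (THE r. \<forall>f\<in>C. r = st E (grid_inner E N f (grid_restrict E N \<Omega> \<phi>)))
     else 0)"

end

(*
  The theorem holds because \<Phi> is onto: with v = \<Phi> [u] and T_X = L_X u, the two problems say the same.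
  That \<Phi> takes values in the distributions follows by overspill, applied to a sequence of test functions
  that tends rapidly to 0. For surjectivity, a distribution T is regularized by
  F_n(x) = T(kernel(x - .)) with a kernel of width 1 / p(n) whose lattice sums telescope. If p(n)
  tends to infinity slowly enough, the pairings <F_n, \<psi>> over the grid of mesh 1 / n converge to T(\<psi>)
  and are bounded by finitely many difference quotients of \<psi>, uniformly in n. By transfer, the function
  F_N is a grid distribution representing T.
*)
theory Submission
  imports Defs
begin

section \<open>Smooth functions and their difference quotients\<close>

text \<open>The continuity of a distribution is measured by derivatives, but a grid test function
  controls only difference quotients. The two are compared after convolution with the kernel, where
  they differ by O(1/n) with a constant depending on the width 1/p; hence the slow growth of p(n),
  obtained by a diagonal choice. Telescoping makes the lattice mass of the kernel exactly 1, so no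
  Riemann sum error enters. A second obstacle: class S^\<infinity> asserts finiteness at a single
  nearstandard point, and \<Omega> need not be connected. Standard bounds for difference quotients
  come instead from walking out of the compact support in steps of noninfinitesimal length that
  change the quotient by less than 1; such a length exists by overspill. Finally, transfer is given
  for raw formulas over one untyped universe. It is repackaged as a calculus of parallel standard
  and nonstandard terms. The sort of a set is visible there only through its elements, which is why
  the empty domain is treated separately.\<close>

lemma partial_eq:
  assumes "(f has_derivative f') (at x)"
  shows "partial i f x = f' (axis i 1)"
  unfolding partial_def using frechet_derivative_at[OF assms] by simp

text \<open>Spares formulas for iterated derivatives: a class stable under \<open>partial\<close>
  contains every \<open>partials js f\<close>, by induction on \<open>js\<close>.\<close>

lemma smooth_coinduct:
  assumes "f \<in> S"
    and "\<And>g x. g \<in> S \<Longrightarrow> g differentiable at x"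
    and "\<And>g i. g \<in> S \<Longrightarrow> partial i g \<in> S"
  shows "smooth f"
proof -
  have "partials js f \<in> S" for js
    by (induction js) (use assms in auto)
  then show ?thesis
    using assms(2) by (auto simp: smooth_def)
qed

lemma smooth_differentiable: "smooth f \<Longrightarrow> f differentiable at x"
  unfolding smooth_def by (metis foldr_Nil id_apply)

lemma smooth_partials: "smooth f \<Longrightarrow> smooth (partials js f)"
  unfolding smooth_def using foldr_append[of partial _ js f] by (metis comp_apply)

lemma smooth_partial: "smooth f \<Longrightarrow> smooth (partial i f)"
  using smooth_partials[of f "[i]"] by simp

lemma smooth_has_derivative:
  "smooth f \<Longrightarrow> (f has_derivative (\<lambda>h. \<Sum>i\<in>UNIV. h $ i * partial i f x)) (at x)"
proof -
  assume "smooth f"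
  then have d: "(f has_derivative frechet_derivative f (at x)) (at x)"
    using frechet_derivative_works smooth_differentiable by blast
  interpret bounded_linear "frechet_derivative f (at x)"
    using d has_derivative_bounded_linear by blast
  have "frechet_derivative f (at x) h = (\<Sum>i\<in>UNIV. h $ i * partial i f x)" for h
  proof -
    have "h = (\<Sum>i\<in>UNIV. h $ i *\<^sub>R axis i 1)"
      using basis_expansion[of h] by (simp add: scalar_mult_eq_scaleR)
    then have "frechet_derivative f (at x) h
        = frechet_derivative f (at x) (\<Sum>i\<in>UNIV. h $ i *\<^sub>R axis i 1)"
      by simp
    also have "\<dots> = (\<Sum>i\<in>UNIV. h $ i * partial i f x)"
      by (simp add: sum scaleR partial_def)
    finally show ?thesis .
  qed
  then have "frechet_derivative f (at x) = (\<lambda>h. \<Sum>i\<in>UNIV. h $ i * partial i f x)"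
    by auto
  then show ?thesis
    using d by simp
qed

lemma smooth_continuous_on: "smooth f \<Longrightarrow> continuous_on S f"
  by (meson continuous_at_imp_continuous_on differentiable_imp_continuous_within smooth_differentiable)

text \<open>The Leibniz rule turns a product into a sum of products, so natural generating classes
  are stable under \<open>partial\<close> only up to finite sums. These sums are all that has to be
  added.\<close>

inductive_set add_closure :: "('a \<Rightarrow> real) set \<Rightarrow> ('a \<Rightarrow> real) set" for G where
  base: "g \<in> G \<Longrightarrow> g \<in> add_closure G"
| add: "f \<in> add_closure G \<Longrightarrow> g \<in> add_closure G \<Longrightarrow> (\<lambda>x. f x + g x) \<in> add_closure G"

lemma partial_add:
  assumes "f differentiable at x" and "g differentiable at x"
  shows "partial i (\<lambda>x. f x + g x) x = partial i f x + partial i g x"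
proof -
  have "((\<lambda>x. f x + g x) has_derivative
      (\<lambda>h. frechet_derivative f (at x) h + frechet_derivative g (at x) h)) (at x)"
    using assms by (intro has_derivative_add) (auto simp: frechet_derivative_works)
  from partial_eq[OF this] show ?thesis
    by (simp add: partial_def)
qed

lemma partial_mult:
  fixes f g :: "real ^ 'n::finite \<Rightarrow> real"
  assumes "f differentiable at x" and "g differentiable at x"
  shows "partial i (\<lambda>x. f x * g x) x = partial i f x * g x + f x * partial i g x"
proof -
  have "((\<lambda>x. f x * g x) has_derivative
      (\<lambda>h. f x * frechet_derivative g (at x) h + frechet_derivative f (at x) h * g x)) (at x)"
    using assms by (intro has_derivative_mult) (auto simp: frechet_derivative_works)
  from partial_eq[OF this] show ?thesis
    by (simp add: partial_def)
qed

lemma add_closure_smooth: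
  assumes "f \<in> add_closure G"
    and "\<And>g x. g \<in> G \<Longrightarrow> g differentiable at x"
    and "\<And>g i. g \<in> G \<Longrightarrow> partial i g \<in> add_closure G"
  shows "smooth f"
proof (rule smooth_coinduct[OF assms(1)])
  show diff: "g differentiable at x" if "g \<in> add_closure G" for g x
    using that by induction (auto intro: assms(2))
  show "partial i g \<in> add_closure G" if "g \<in> add_closure G" for g i
    using that
  proof induction
    case (add f g)
    have "partial i (\<lambda>x. f x + g x) = (\<lambda>x. partial i f x + partial i g x)"
      using add diff by (auto intro!: partial_add)
    then show ?case
      using add by (auto intro: add_closure.add)
  qed (rule assms(3))
qed

lemma smooth_add:
  assumes "smooth f" and "smooth g"
  shows "smooth (\<lambda>x. f x + g x)"
proof (rule add_closure_smooth[of _ "{f. smooth f}"])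
  show "(\<lambda>x. f x + g x) \<in> add_closure {f. smooth f}"
    using assms by (auto intro: add_closure.intros)
qed (auto intro: smooth_differentiable smooth_partial add_closure.base)

lemma smooth_const: "smooth (\<lambda>x. c)"
proof (rule smooth_coinduct[of _ "range (\<lambda>c x. c)"])
  have "partial i (\<lambda>x. c) = (\<lambda>x. 0)" for i :: 'a and c
    using partial_eq[OF has_derivative_const] by auto
  then show "g \<in> range (\<lambda>c x. c) \<Longrightarrow> partial i g \<in> range (\<lambda>c x. c)"
    for g :: "real ^ 'a \<Rightarrow> real" and i by auto
qed auto

lemma smooth_mult:
  assumes "smooth f" and "smooth g"
  shows "smooth (\<lambda>x. f x * g x)"
proof (rule add_closure_smooth[of _ "{(\<lambda>x. f x * g x) | f g. smooth f \<and> smooth g}"])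
  let ?G = "{(\<lambda>x. f x * g x) | f g. smooth f \<and> smooth g}"
  show "(\<lambda>x. f x * g x) \<in> add_closure ?G"
    using assms by (auto intro!: add_closure.base)
  show "h differentiable at x" if "h \<in> ?G" for h x
    using that by (auto intro: differentiable_mult[OF smooth_differentiable smooth_differentiable])
  show "partial i h \<in> add_closure ?G" if "h \<in> ?G" for h i
  proof -
    obtain f g where h: "h = (\<lambda>x. f x * g x)" "smooth f" "smooth g"
      using \<open>h \<in> ?G\<close> by blast
    have "partial i h = (\<lambda>x. partial i f x * g x + f x * partial i g x)"
      using h by (auto intro!: partial_mult smooth_differentiable)
    moreover have "(\<lambda>x. partial i f x * g x) \<in> ?G" "(\<lambda>x. f x * partial i g x) \<in> ?G"
      using h(2,3) smooth_partial by blast+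
    ultimately show ?thesis
      using add_closure.add[OF add_closure.base add_closure.base] by (simp only:)
  qed
qed

lemma smooth_sum: "(\<And>a. a \<in> A \<Longrightarrow> smooth (f a)) \<Longrightarrow> smooth (\<lambda>x. \<Sum>a\<in>A. f a x)"
  by (induction A rule: infinite_finite_induct) (auto intro: smooth_const smooth_add)

lemma smooth_prod: "(\<And>a. a \<in> A \<Longrightarrow> smooth (f a)) \<Longrightarrow> smooth (\<lambda>x. \<Prod>a\<in>A. f a x)"
  by (induction A rule: infinite_finite_induct) (auto intro: smooth_const smooth_mult)

lemma partial_inverse:
  fixes f :: "real ^ 'n::finite \<Rightarrow> real"
  assumes "f differentiable at x" and "f x \<noteq> 0"
  shows "partial i (\<lambda>x. inverse (f x)) x = - partial i f x * inverse (f x) * inverse (f x)"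
proof -
  have "((\<lambda>x. inverse (f x)) has_derivative
      (\<lambda>h. - (inverse (f x) * frechet_derivative f (at x) h * inverse (f x)))) (at x)"
    using assms by (intro Deriv.has_derivative_inverse) (auto simp: frechet_derivative_works)
  from partial_eq[OF this] show ?thesis
    by (simp add: partial_def)
qed

text \<open>Products \<open>g * (1/f)^m\<close> with smooth \<open>g\<close> form a class stable up
  to sums: differentiating the power raises \<open>m\<close> by one and produces the smooth factor
  \<open>- m * partial i f\<close>.\<close>

lemma smooth_inverse:
  assumes "smooth f" and nz: "\<And>x. f x \<noteq> 0"
  shows "smooth (\<lambda>x. inverse (f x))"
proof (rule add_closure_smooth[of _ "{(\<lambda>x. g x * inverse (f x) ^ m) | g m. smooth g}"])
  let ?G = "{(\<lambda>x. g x * inverse (f x) ^ m) | g m. smooth g}"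
  have "(\<lambda>x. 1 * inverse (f x) ^ 1) \<in> ?G"
    using smooth_const[of 1] by (intro CollectI exI[of _ "\<lambda>x. 1"] exI[of _ 1]) simp
  then show "(\<lambda>x. inverse (f x)) \<in> add_closure ?G"
    by (auto intro!: add_closure.base)
  have d: "(\<lambda>x. inverse (f x) ^ m) differentiable at x" for m x
    using nz assms(1) by (intro differentiable_power differentiable_inverse smooth_differentiable)
  show "h differentiable at x" if "h \<in> ?G" for h x
    using that d by (auto intro: differentiable_mult[OF smooth_differentiable])
  have p: "partial i (\<lambda>x. inverse (f x) ^ m) x
      = - of_nat m * partial i f x * inverse (f x) ^ Suc m" for i m x
  proof (induction m)
    case 0
    then show ?case using partial_eq[OF has_derivative_const] by auto
  next
    case (Suc m)
    have "partial i (\<lambda>x. inverse (f x) * inverse (f x) ^ m) x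
        = partial i (\<lambda>x. inverse (f x)) x * inverse (f x) ^ m
          + inverse (f x) * partial i (\<lambda>x. inverse (f x) ^ m) x"
      using d[of 1] by (intro partial_mult d) simp
    then show ?case
      using Suc partial_inverse[OF smooth_differentiable[OF assms(1)] nz]
      by (simp add: algebra_simps)
  qed
  show "partial i h \<in> add_closure ?G" if "h \<in> ?G" for h i
  proof -
    obtain g m where h: "h = (\<lambda>x. g x * inverse (f x) ^ m)" "smooth g"
      using \<open>h \<in> ?G\<close> by blast
    have "partial i h = (\<lambda>x. partial i g x * inverse (f x) ^ m
        + (- of_nat m * partial i f x * g x) * inverse (f x) ^ Suc m)"
      using h partial_mult[OF smooth_differentiable d, of g] by (auto simp: p)
    moreover have "(\<lambda>x. partial i g x * inverse (f x) ^ m) \<in> ?G"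
      using h(2) smooth_partial by blast
    moreover have "smooth (\<lambda>x. - of_nat m * partial i f x * g x)"
      using h(2) assms(1) by (intro smooth_mult smooth_const smooth_partial)
    then have "(\<lambda>x. (- of_nat m * partial i f x * g x) * inverse (f x) ^ Suc m) \<in> ?G"
      by (intro CollectI exI[of _ "\<lambda>x. - of_nat m * partial i f x * g x"] exI[of _ "Suc m"]) simp
    ultimately show ?thesis
      using add_closure.add[OF add_closure.base add_closure.base] by (simp only:)
  qed
qed

text \<open>Covers the two substitutions that occur later: translations (\<open>s = 1\<close>, for
  difference quotients) and the reflection \<open>x - y\<close> (\<open>s = - 1\<close>, for the
  kernel as a function of its second point).\<close>

lemma partials_affine:
  assumes "smooth f"
  shows "partials js (\<lambda>x. f (s *\<^sub>R x + v)) = (\<lambda>x. s ^ length js * partials js f (s *\<^sub>R x + v))"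
    (is "_ = ?g js")
    and "smooth (\<lambda>x. f (s *\<^sub>R x + v))"
proof -
  have d: "((\<lambda>x. f (s *\<^sub>R x + v)) has_derivative
      (\<lambda>h. \<Sum>i\<in>UNIV. (s *\<^sub>R h) $ i * partial i f (s *\<^sub>R x + v))) (at x)" if "smooth f" for f x
  proof -
    have "((\<lambda>x. s *\<^sub>R x + v) has_derivative (\<lambda>h. s *\<^sub>R h)) (at x)"
      by (auto intro!: derivative_eq_intros)
    then show ?thesis
      using smooth_has_derivative[OF that, of "s *\<^sub>R x + v"]
      by (rule has_derivative_compose)
  qed
  have dc: "((\<lambda>x. c * f (s *\<^sub>R x + v)) has_derivative
      (\<lambda>h. c * (\<Sum>i\<in>UNIV. (s *\<^sub>R h) $ i * partial i f (s *\<^sub>R x + v)))) (at x)" if "smooth f" for f x c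
    by (intro has_derivative_mult_right d that)
  \<comment> \<open>The factor \<open>c\<close> is carried along so that the power of
    \<open>s\<close> accumulated so far can be absorbed in the induction below.\<close>
  have p: "partial i (\<lambda>x. c * f (s *\<^sub>R x + v)) = (\<lambda>x. (s * c) * partial i f (s *\<^sub>R x + v))"
    if "smooth f" for f i c
    using partial_eq[OF dc[OF that]]
    by (auto simp: axis_def if_distrib if_distribR sum.delta cong: if_cong)
  have "partials js (\<lambda>x. f (s *\<^sub>R x + v)) = ?g js" for js
  proof (induction js)
    case (Cons j js)
    then show ?case
      using p[OF smooth_partials[OF assms]] by simp
  qed simp
  then show "partials js (\<lambda>x. f (s *\<^sub>R x + v)) = ?g js" .
  show "smooth (\<lambda>x. f (s *\<^sub>R x + v))"
    unfolding smooth_def \<open>\<And>js. partials js (\<lambda>x. f (s *\<^sub>R x + v)) = ?g js\<close>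
    using dc[OF smooth_partials[OF assms]] differentiableI by blast
qed

lemma partials_sum_cmult:
  assumes "finite A" and "\<And>a. a \<in> A \<Longrightarrow> smooth (f a)"
  shows "partials js (\<lambda>x. \<Sum>a\<in>A. c a * f a x) = (\<lambda>x. \<Sum>a\<in>A. c a * partials js (f a) x)"
proof (induction js)
  case (Cons j js)
  have "partial j (\<lambda>x. \<Sum>a\<in>A. c a * partials js (f a) x) x
      = (\<Sum>a\<in>A. c a * partial j (partials js (f a)) x)" for x
  proof -
    have "((\<lambda>x. \<Sum>a\<in>A. c a * partials js (f a) x) has_derivative
      (\<lambda>h. \<Sum>a\<in>A. c a * (\<Sum>i\<in>UNIV. h $ i * partial i (partials js (f a)) x))) (at x)"
      by (intro has_derivative_sum has_derivative_mult_right smooth_has_derivative smooth_partials assms)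
    from partial_eq[OF this] show ?thesis
      by (auto simp: axis_def if_distrib if_distribR sum.delta cong: if_cong)
  qed
  then show ?case
    using Cons by auto
qed simp

lemma partials_cmult: "smooth f \<Longrightarrow> partials js (\<lambda>x. c * f x) = (\<lambda>x. c * partials js f x)"
  using partials_sum_cmult[of "{()}" "\<lambda>_. f" js "\<lambda>_. c"] by simp

lemma partials_diff:
  assumes "smooth f" "smooth g"
  shows "partials js (\<lambda>x. f x - g x) = (\<lambda>x. partials js f x - partials js g x)"
  using partials_sum_cmult[of "UNIV :: bool set" "\<lambda>b. if b then f else g" js "\<lambda>b. if b then 1 else - 1"] assms
  by (simp add: UNIV_bool)

text \<open>A linear combination indexed by \<open>bool\<close> is the form to which
  \<open>partials_sum_cmult\<close> applies, and \<open>1 *\<^sub>R x\<close> is written out to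
  match \<open>partials_affine\<close>.\<close>

lemma grid_diff_real_alt:
  fixes f :: "real ^ 'n::finite \<Rightarrow> real"
  shows "grid_diff n i f = (\<lambda>x. \<Sum>b\<in>UNIV. (if b then n else - n) *
    (if b then \<lambda>x. f (1 *\<^sub>R x + axis i (1 / n)) else f) x)"
  by (auto simp: grid_diff_def UNIV_bool algebra_simps)

lemma
  assumes "smooth f"
  shows smooth_grid_diff: "smooth (grid_diff n i f)"
    and partials_grid_diff: "partials js (grid_diff n i f) = grid_diff n i (partials js f)"
proof -
  have s: "smooth (if b then \<lambda>x. f (1 *\<^sub>R x + axis i (1 / n)) else f)" for b
    using assms partials_affine(2)[of f 1] by auto
  show "smooth (grid_diff n i f)"
    unfolding grid_diff_real_alt by (intro smooth_sum smooth_mult smooth_const s)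
  show "partials js (grid_diff n i f) = grid_diff n i (partials js f)"
    unfolding grid_diff_real_alt partials_sum_cmult[OF finite s]
    using partials_affine(1)[OF assms, of js 1] by (auto simp: UNIV_bool)
qed

lemma smooth_grid_diffs: "smooth f \<Longrightarrow> smooth (grid_diffs n ks f)"
  by (induction ks) (auto intro: smooth_grid_diff)

lemma partials_grid_diffs:
  "smooth f \<Longrightarrow> partials js (grid_diffs n ks f) = grid_diffs n ks (partials js f)"
  by (induction ks) (auto simp: partials_grid_diff smooth_grid_diffs)

lemma has_real_derivative_partial:
  assumes "smooth f"
  shows "((\<lambda>t. f (x + axis i t)) has_real_derivative partial i f (x + axis i t)) (at t)"
proof -
  have a: "axis i s = s *\<^sub>R axis i (1::real)" for s
    by (simp add: vec_eq_iff axis_def)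
  have "((\<lambda>s. x + s *\<^sub>R axis i 1) has_derivative (\<lambda>h. h *\<^sub>R axis i (1::real))) (at t)"
    by (auto intro!: derivative_eq_intros)
  from has_derivative_compose[OF this smooth_has_derivative[OF assms]]
  have "((\<lambda>s. f (x + axis i s)) has_derivative
      (\<lambda>h. \<Sum>j\<in>UNIV. (h *\<^sub>R axis i 1) $ j * partial j f (x + axis i t))) (at t)"
    using a[symmetric] by simp
  moreover have "(\<lambda>h. \<Sum>j\<in>UNIV. (h *\<^sub>R axis i 1) $ j * partial j f (x + axis i t))
      = (*) (partial i f (x + axis i t))"
    by (auto simp: axis_def if_distrib if_distribR sum.delta cong: if_cong)
  ultimately show ?thesis
    by (simp add: has_field_derivative_def)
qed

lemma grid_diff_mean_value:
  assumes "smooth f" and "n > 0"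
  shows "\<exists>t. 0 \<le> t \<and> t \<le> 1 / n \<and> grid_diff n i f x = partial i f (x + axis i t)"
proof -
  have "\<exists>t>0. t < 1 / n \<and> f (x + axis i (1 / n)) - f (x + axis i 0)
      = (1 / n - 0) * partial i f (x + axis i t)"
    using assms by (intro MVT2 has_real_derivative_partial) auto
  then obtain t where "t > 0" "t < 1 / n" "f (x + axis i (1 / n)) - f (x + axis i 0)
      = (1 / n - 0) * partial i f (x + axis i t)"
    by blast
  moreover have "axis i (0::real) = 0"
    by (simp add: vec_eq_iff axis_def)
  ultimately show ?thesis
    using assms(2) by (intro exI[of _ t]) (auto simp: grid_diff_def)
qed

text \<open>Each difference is traded for a derivative by the one-dimensional mean value theorem.
  The outermost difference goes first and becomes the innermost derivative, whence
  \<open>rev ks\<close>; tracking the order avoids any appeal to the symmetry of mixed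
  derivatives.\<close>

lemma grid_diffs_mean_value:
  assumes "smooth f" and "n > 0"
  shows "\<exists>y. (\<forall>j. x $ j \<le> y $ j \<and> y $ j \<le> x $ j + length ks / n) \<and>
    grid_diffs n ks f x = partials (rev ks) f y"
  using assms(1)
proof (induction ks arbitrary: f x)
  case (Cons k ks)
  obtain t where t: "0 \<le> t" "t \<le> 1 / n"
    "grid_diff n k (grid_diffs n ks f) x = partial k (grid_diffs n ks f) (x + axis k t)"
    using grid_diff_mean_value[OF smooth_grid_diffs[OF Cons.prems] assms(2)] by blast
  obtain y where y: "\<And>j. (x + axis k t) $ j \<le> y $ j \<and> y $ j \<le> (x + axis k t) $ j + length ks / n"
    "grid_diffs n ks (partial k f) (x + axis k t) = partials (rev ks) (partial k f) y"
    using Cons.IH[OF smooth_partial[OF Cons.prems]] by blast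
  have "x $ j \<le> y $ j \<and> y $ j \<le> x $ j + length (k # ks) / n" for j
  proof -
    have "0 \<le> axis k t $ j" "axis k t $ j \<le> 1 / n"
      using t assms(2) by (auto simp: axis_def)
    then show ?thesis
      using y(1)[of j] by (auto simp: add_divide_distrib)
  qed
  moreover have "grid_diffs n (k # ks) f x = partials (rev (k # ks)) f y"
    using t(3) y(2) partials_grid_diffs[OF Cons.prems, of "[k]" n ks] by simp
  ultimately show ?case by blast
qed auto

section \<open>A smooth step function\<close>

text \<open>\<open>flat 0\<close> is the classical function exp(-1/t), which vanishes to infinite
  order at 0. With the powers of 1/t included, the family is closed under differentiation up to
  linear combinations.\<close>

definition flat :: "nat \<Rightarrow> real \<Rightarrow> real" where
  "flat m t = (if t > 0 then (1 / t) ^ m * exp (- (1 / t)) else 0)"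

text \<open>In the variable s = 1/t, the limit from the right is the decay of s^m / exp s at
  infinity.\<close>

lemma flat_tendsto_0: "(flat m \<longlongrightarrow> 0) (at 0)"
proof -
  have "((\<lambda>t::real. inverse t ^ m / exp (inverse t)) \<longlongrightarrow> 0) (at_right 0)"
    using filterlim_compose[OF tendsto_power_div_exp_0 filterlim_inverse_at_top_right] .
  moreover have "\<forall>\<^sub>F t in at_right 0. inverse t ^ m / exp (inverse t) = flat m t"
    by (auto simp: eventually_at_filter flat_def exp_minus inverse_eq_divide)
  ultimately have "(flat m \<longlongrightarrow> 0) (at_right 0)"
    by (blast intro: Lim_transform_eventually)
  moreover have "(flat m \<longlongrightarrow> 0) (at_left 0)"
    by (rule tendsto_eventually) (auto simp: eventually_at_filter flat_def)
  ultimately show ?thesis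
    by (simp add: filterlim_split_at)
qed

lemma flat_has_real_derivative:
  "(flat m has_real_derivative (flat (m + 2) t - m * flat (m + 1) t)) (at t)"
proof (cases t "0 :: real" rule: linorder_cases)
  case less
  have "((\<lambda>t. 0) has_real_derivative 0) (at t)" by simp
  then have "(flat m has_real_derivative 0) (at t)"
    by (rule has_field_derivative_transform_within_open[of _ _ _ "{..<0}"])
      (use less in \<open>auto simp: flat_def\<close>)
  then show ?thesis
    using less by (simp add: flat_def)
next
  case equal
  \<comment> \<open>At 0 the difference quotient of \<open>flat m\<close> is again a member of the
    family, so the limit already proved gives the derivative.\<close>
  have "(\<lambda>h. (flat m (0 + h) - flat m 0) / h) = flat (m + 1)"
    by (auto simp: flat_def divide_simps)
  then have "(flat m has_real_derivative 0) (at 0)"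
    unfolding DERIV_def using flat_tendsto_0 by simp
  then show ?thesis
    using equal by (simp add: flat_def)
next
  case greater
  have "((\<lambda>t. (1 / t) ^ m * exp (- (1 / t))) has_real_derivative
      (m * (1 / t) ^ (m - 1) * (- 1 / t\<^sup>2)) * exp (- (1 / t))
        + (1 / t) ^ m * (exp (- (1 / t)) * (1 / t\<^sup>2))) (at t)"
    using greater by (auto intro!: derivative_eq_intros simp: power2_eq_square)
  moreover have "(m * (1 / t) ^ (m - 1) * (- 1 / t\<^sup>2)) * exp (- (1 / t))
        + (1 / t) ^ m * (exp (- (1 / t)) * (1 / t\<^sup>2)) = flat (m + 2) t - m * flat (m + 1) t"
    using greater by (cases m) (auto simp: flat_def power2_eq_square field_simps)
  ultimately have "((\<lambda>t. (1 / t) ^ m * exp (- (1 / t))) has_real_derivative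
      flat (m + 2) t - m * flat (m + 1) t) (at t)"
    by simp
  then show ?thesis
    by (rule has_field_derivative_transform_within_open[of _ _ _ "{0<..}"])
      (use greater in \<open>auto simp: flat_def\<close>)
qed

lemma smooth_flat: "smooth (\<lambda>x. flat m (a + b * x $ i))"
proof (rule add_closure_smooth)
  let ?G = "{(\<lambda>x. c * flat m (a + b * x $ i)) | c m. True} :: (real ^ 'a \<Rightarrow> real) set"
  have G: "(\<lambda>x. c * flat m (a + b * x $ i)) \<in> ?G" for c m
    by blast
  show "(\<lambda>x. flat m (a + b * x $ i)) \<in> add_closure ?G"
    using G[of 1 m] by (auto intro!: add_closure.base)
  have d: "((\<lambda>x. c * flat m (a + b * x $ i)) has_derivative
      (\<lambda>h. c * ((flat (m + 2) (a + b * x $ i) - m * flat (m + 1) (a + b * x $ i)) * (b * h $ i)))) (at x)"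
    for c m and x :: "real ^ 'a"
  proof (rule has_derivative_mult_right)
    have "((\<lambda>x. x $ i) has_derivative (\<lambda>h. h $ i)) (at x)"
      by (intro bounded_linear_imp_has_derivative bounded_linear_vec_nth)
    then have "((\<lambda>x. a + b * x $ i) has_derivative (\<lambda>h. b * h $ i)) (at x)"
      by (auto intro!: derivative_eq_intros)
    from has_derivative_compose[OF this flat_has_real_derivative[unfolded has_field_derivative_def]]
    show "((\<lambda>x. flat m (a + b * x $ i)) has_derivative
      (\<lambda>h. (flat (m + 2) (a + b * x $ i) - m * flat (m + 1) (a + b * x $ i)) * (b * h $ i))) (at x)"
      by simp
  qed
  show "g differentiable at x" if "g \<in> ?G" for g x
    using that d differentiableI by blast
  show "partial j g \<in> add_closure ?G" if gG: "g \<in> ?G" for g j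
  proof -
    obtain c m where g: "g = (\<lambda>x. c * flat m (a + b * x $ i))"
      using gG by auto
    have "partial j g = (\<lambda>x. (c * b * axis j 1 $ i) * flat (m + 2) (a + b * x $ i)
        + (- c * b * m * axis j 1 $ i) * flat (m + 1) (a + b * x $ i))"
      unfolding g by (rule ext) (simp add: partial_eq[OF d] algebra_simps)
    then show ?thesis
      using add_closure.add[OF add_closure.base[OF G] add_closure.base[OF G]] by (simp only:)
  qed
qed

text \<open>The usual smooth transition from 0 on t \<le> 0 to 1 on t \<ge> 1; the denominator is
  positive because t or 1 - t is. Its rescaled increments build the kernel.\<close>

definition step :: "real \<Rightarrow> real" where
  "step t = flat 0 t * inverse (flat 0 t + flat 0 (1 - t))"

lemma flat_sum_pos: "flat 0 t + flat 0 (1 - t) > 0"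
  by (auto simp: flat_def add_pos_pos)

lemma step_eq_0: "t \<le> 0 \<Longrightarrow> step t = 0"
  by (simp add: step_def flat_def)

lemma step_eq_1: "t \<ge> 1 \<Longrightarrow> step t = 1"
  by (simp add: step_def flat_def)

lemma flat_mono: "s \<le> t \<Longrightarrow> flat 0 s \<le> flat 0 t"
  by (auto simp: flat_def frac_le)

lemma step_mono: "s \<le> t \<Longrightarrow> step s \<le> step t"
proof -
  assume "s \<le> t"
  \<comment> \<open>Monotonicity reduces to this after clearing the positive denominators; the
    products \<open>flat 0 s * flat 0 t\<close> cancel.\<close>
  then have "flat 0 s * flat 0 (1 - t) \<le> flat 0 t * flat 0 (1 - s)"
    by (intro mult_mono flat_mono) (auto simp: flat_def)
  then show ?thesis
    using flat_sum_pos[of s] flat_sum_pos[of t]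
    by (simp add: step_def field_simps)
qed

lemma smooth_step: "smooth (\<lambda>x. step (b * x $ i))"
proof -
  have "smooth (\<lambda>x. flat 0 (0 + b * x $ i) *
      inverse (flat 0 (0 + b * x $ i) + flat 0 (1 + (- b) * x $ i)))"
    using flat_sum_pos[of "b * _ $ i"]
    by (intro smooth_mult smooth_inverse smooth_add smooth_flat) (auto simp: less_le)
  then show ?thesis
    by (simp add: step_def)
qed

section \<open>Discrete regularization\<close>

definition directions :: "'n::finite list" where
  "directions = (SOME ks. distinct ks \<and> set ks = UNIV)"

lemma directions: "distinct (directions :: 'n::finite list)" "set (directions :: 'n list) = UNIV"
proof -
  have "\<exists>ks :: 'n list. distinct ks \<and> set ks = UNIV"
    using finite_distinct_list[of "UNIV :: 'n set"] by auto
  then have "distinct (directions :: 'n list) \<and> set (directions :: 'n list) = UNIV"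
    unfolding directions_def by (rule someI_ex)
  then show "distinct (directions :: 'n list)" "set (directions :: 'n list) = UNIV"
    by auto
qed

text \<open>
  The kernel is a difference quotient of all orders \<open>1\<close> of a product of steps. This form bounds its
  derivatives uniformly in \<open>n\<close>, while the product form of \<open>kernel_eq\<close> makes its sums over the
  lattice telescope.
\<close>

definition kernel :: "real \<Rightarrow> real \<Rightarrow> real ^ 'n::finite \<Rightarrow> real" where
  "kernel p n = grid_diffs n directions (\<lambda>z. \<Prod>i\<in>UNIV. step (p * z $ i))"

text \<open>A translation along axis \<open>k\<close> leaves all factors but the one at
  \<open>k\<close> unchanged.\<close>

lemma grid_diff_prod:
  fixes h :: "'n::finite \<Rightarrow> real \<Rightarrow> real"
  shows "grid_diff n k (\<lambda>z. \<Prod>i\<in>UNIV. h i (z $ i)) =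
    (\<lambda>z. \<Prod>i\<in>UNIV. (h(k := \<lambda>t. (h k (t + 1 / n) - h k t) / (1 / n))) i (z $ i))"
proof
  fix z :: "real ^ 'n"
  have p: "(\<Prod>i\<in>UNIV. g i) = g k * (\<Prod>i\<in>UNIV - {k}. g i)" for g :: "'n \<Rightarrow> real"
    by (rule prod.remove) auto
  have "(\<Prod>i\<in>UNIV - {k}. h i ((z + axis k (1 / n)) $ i)) = (\<Prod>i\<in>UNIV - {k}. h i (z $ i))"
    by (rule prod.cong) (auto simp: axis_def)
  moreover have "(\<Prod>i\<in>UNIV - {k}. (h(k := \<lambda>t. (h k (t + 1 / n) - h k t) / (1 / n))) i (z $ i))
      = (\<Prod>i\<in>UNIV - {k}. h i (z $ i))"
    by (rule prod.cong) auto
  ultimately show "grid_diff n k (\<lambda>z. \<Prod>i\<in>UNIV. h i (z $ i)) z =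
    (\<Prod>i\<in>UNIV. (h(k := \<lambda>t. (h k (t + 1 / n) - h k t) / (1 / n))) i (z $ i))"
    unfolding grid_diff_def p by (simp add: axis_def algebra_simps)
qed

text \<open>Distinct directions act on different factors, so each factor is differenced at most
  once.\<close>

lemma grid_diffs_prod:
  fixes h :: "'n::finite \<Rightarrow> real \<Rightarrow> real"
  assumes "distinct ks"
  shows "grid_diffs n ks (\<lambda>z. \<Prod>i\<in>UNIV. h i (z $ i)) = (\<lambda>z. \<Prod>i\<in>UNIV.
    (if i \<in> set ks then \<lambda>t. (h i (t + 1 / n) - h i t) / (1 / n) else h i) (z $ i))"
  using assms
proof (induction ks)
  case (Cons k ks)
  let ?h = "\<lambda>i. if i \<in> set ks then \<lambda>t. (h i (t + 1 / n) - h i t) / (1 / n) else h i"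
  have "?h(k := \<lambda>t. (?h k (t + 1 / n) - ?h k t) / (1 / n))
      = (\<lambda>i. if i \<in> set (k # ks) then \<lambda>t. (h i (t + 1 / n) - h i t) / (1 / n) else h i)"
    using Cons.prems by (auto simp: fun_eq_iff)
  note eq = this
  have IH: "grid_diffs n ks (\<lambda>z. \<Prod>i\<in>UNIV. h i (z $ i)) = (\<lambda>z. \<Prod>i\<in>UNIV. ?h i (z $ i))"
    using Cons by simp
  have "grid_diffs n (k # ks) (\<lambda>z. \<Prod>i\<in>UNIV. h i (z $ i))
      = grid_diff n k (\<lambda>z. \<Prod>i\<in>UNIV. ?h i (z $ i))"
    by (simp only: foldr_Cons comp_apply IH)
  then show ?case
    using grid_diff_prod[of n k ?h] by (simp only: eq)
qed simp

lemma kernel_eq: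
  "kernel p n z = (\<Prod>i\<in>UNIV. n * (step (p * (z $ i + 1 / n)) - step (p * z $ i)))"
  unfolding kernel_def using fun_cong[OF grid_diffs_prod[OF directions(1), of n "\<lambda>i t. step (p * t)"], of z]
  by (simp add: directions(2) mult.commute)

lemma kernel_nonneg:
  assumes "p \<ge> 0" "n > 0"
  shows "kernel p n z \<ge> 0"
  unfolding kernel_eq using assms
  by (intro prod_nonneg) (auto intro!: mult_nonneg_nonneg step_mono mult_left_mono)

text \<open>Where the coordinate is at least 1/p, both values of \<open>step\<close> are 1; where it
  is at most -1/p, both are 0. The second case relies on \<open>n \<ge> p\<close>, since one of the
  two arguments is shifted up by 1/n.\<close>

lemma kernel_eq_0:
  assumes "p > 0" "n \<ge> p" "\<bar>z $ i\<bar> \<ge> 1 / p"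
  shows "kernel p n z = 0"
proof -
  have "step (p * (z $ i + 1 / n)) = step (p * z $ i)"
  proof (cases "z $ i > 0")
    case True
    then have "p * z $ i \<ge> 1"
      using assms by (simp add: field_simps)
    moreover have "p * (z $ i + 1 / n) \<ge> p * z $ i"
      using assms by (intro mult_left_mono) auto
    ultimately show ?thesis
      using step_eq_1[of "p * (z $ i + 1 / n)"] step_eq_1[of "p * z $ i"] by linarith
  next
    case False
    then have "z $ i \<le> - (1 / p)"
      using assms(3) by linarith
    moreover have "1 / n \<le> 1 / p"
      using assms by (intro divide_left_mono) auto
    ultimately have "z $ i + 1 / n \<le> 0" "z $ i \<le> 0"
      using False by linarith+
    then have "p * (z $ i + 1 / n) \<le> 0" "p * z $ i \<le> 0"
      using assms(1) by (auto intro: mult_nonneg_nonpos)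
    then show ?thesis
      by (simp add: step_eq_0)
  qed
  then show ?thesis
    unfolding kernel_eq by (intro prod_zero) (auto intro!: bexI[of _ i])
qed

lemma smooth_prod_step: "smooth (\<lambda>z. \<Prod>i\<in>UNIV. step (p * z $ i))"
  by (intro smooth_prod smooth_step)

lemma smooth_kernel: "smooth (kernel p n)"
  unfolding kernel_def by (intro smooth_grid_diffs smooth_prod_step)

lemma partials_eq_0_on_open:
  assumes "open U" and "\<And>x. x \<in> U \<Longrightarrow> f x = 0" and "x \<in> U"
  shows "partials js f x = 0"
  using assms(3)
proof (induction js arbitrary: x)
  case (Cons j js)
  have "(partials js f has_derivative (\<lambda>h. 0)) (at x)"
    by (rule has_derivative_transform_within_open[of "\<lambda>x. 0" _ _ _ U])
      (use assms(1) Cons in auto)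
  from partial_eq[OF this] show ?case by simp
qed (simp add: assms(2))

text \<open>Supports of the kernel and of grid functions are described coordinatewise, which makes
  cubes handier than Euclidean balls.\<close>

definition cube :: "real \<Rightarrow> (real ^ 'n::finite) set" where
  "cube R = {x. \<forall>i. \<bar>x $ i\<bar> \<le> R}"

lemma compact_cube: "compact (cube R :: (real ^ 'n::finite) set)"
proof -
  have "cube R = cbox (\<chi> i::'n. - R) (\<chi> i. R)"
  proof -
    have "\<bar>a\<bar> \<le> R \<longleftrightarrow> - R \<le> a \<and> a \<le> R" for a :: real
      by auto
    then show ?thesis
      by (simp add: cube_def mem_box_cart set_eq_iff)
  qed
  then show ?thesis
    by (simp add: compact_cbox)
qed

text \<open>For fixed \<open>p\<close> the kernel is an iterated difference quotient of one function
  that does not involve \<open>n\<close>. By the mean value theorem its derivatives on the unit cube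
  are values of a fixed continuous function on a fixed larger cube; outside the unit cube they
  vanish.\<close>

lemma partials_kernel_bound:
  assumes "p \<ge> 1"
  shows "\<exists>M\<ge>0. \<forall>n\<ge>p. \<forall>z :: real ^ 'n::finite. \<bar>partials js (kernel p n) z\<bar> \<le> M"
proof -
  let ?g = "partials (rev directions @ js) (\<lambda>z::real ^ 'n. \<Prod>i\<in>UNIV. step (p * z $ i))"
  \<comment> \<open>Each of the iterated differences displaces the mean value point by at most 1/n
    \<le> 1 in a coordinate.\<close>
  let ?R = "1 + real (length (directions :: 'n list))"
  have sm: "smooth (partials js (\<lambda>z::real ^ 'n. \<Prod>i\<in>UNIV. step (p * z $ i)))"
    using smooth_partials[OF smooth_prod_step] .
  have "continuous_on (cube ?R) ?g"
    using smooth_continuous_on[OF smooth_partials[OF smooth_prod_step]] .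
  then have "compact (?g ` cube ?R)"
    by (intro compact_continuous_image compact_cube)
  then obtain M where M: "\<And>z. z \<in> cube ?R \<Longrightarrow> \<bar>?g z\<bar> \<le> M"
    using compact_imp_bounded bounded_iff[of "?g ` cube ?R"] by (auto simp: real_norm_def)
  have "\<bar>partials js (kernel p n) z\<bar> \<le> max M 0" if np: "n \<ge> p" for n z
  proof (cases "z \<in> cube 1")
    case True
    obtain y where y: "\<And>j. z $ j \<le> y $ j \<and> y $ j \<le> z $ j + length (directions :: 'n list) / n"
      "grid_diffs n directions (partials js (\<lambda>z. \<Prod>i\<in>UNIV. step (p * z $ i))) z
        = partials (rev directions) (partials js (\<lambda>z. \<Prod>i\<in>UNIV. step (p * z $ i))) y"
      using grid_diffs_mean_value[OF sm, of n z directions] np assms by auto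
    have eq: "partials js (kernel p n) z = ?g y"
      unfolding kernel_def using y(2) by (simp add: partials_grid_diffs[OF smooth_prod_step])
    have len: "length (directions :: 'n list) / n \<le> length (directions :: 'n list)"
      using that assms by (simp add: divide_le_eq mult_le_cancel_left1)
    have "\<bar>y $ j\<bar> \<le> ?R" for j
    proof -
      have z: "\<bar>z $ j\<bar> \<le> 1"
        using True by (simp add: cube_def)
      then show ?thesis
        using y(1)[of j] len by linarith
    qed
    then have "y \<in> cube ?R"
      by (simp add: cube_def)
    then show ?thesis
      using M eq by (simp add: le_max_iff_disj)
  next
    case False
    have "partials js (kernel p n) z = 0"
    proof (rule partials_eq_0_on_open[of "- cube 1"])
      show "open (- cube 1)"
        using compact_cube compact_imp_closed open_Compl by blast
      show "kernel p n x = 0" if x: "x \<in> - cube 1" for x :: "real ^ 'n"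
      proof -
        obtain i where i: "\<bar>x $ i\<bar> > 1"
          using x by (auto simp: cube_def not_le)
        have "1 / p \<le> 1"
          using assms by simp
        then show ?thesis
          using i assms np \<open>1 / p \<le> 1\<close> by (intro kernel_eq_0[of _ _ _ i]) linarith+
      qed
    qed (use False in auto)
    then show ?thesis by simp
  qed
  then show ?thesis
    by (intro exI[of _ "max M 0"]) auto
qed

section \<open>Lattice points and the lattice mass of the kernel\<close>

definition lattice :: "real \<Rightarrow> (real ^ 'n::finite) set" where
  "lattice n = {x. \<forall>i. \<exists>m::int. x $ i = m / n}"

definition box_lattice :: "real \<Rightarrow> nat \<Rightarrow> (real ^ 'n::finite) set" where
  "box_lattice n M = {x. \<forall>i. \<exists>m\<in>{- int M..int M}. x $ i = m / n}"

lemma box_lattice_bij: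
  assumes "n \<noteq> 0"
  shows "bij_betw (\<lambda>g. \<chi> i. of_int (g i) / n) (UNIV \<rightarrow>\<^sub>E {- int M..int M})
    (box_lattice n M :: (real ^ 'n::finite) set)"
proof (rule bij_betw_imageI)
  show "inj_on (\<lambda>g. \<chi> i. of_int (g i) / n) (UNIV \<rightarrow>\<^sub>E {- int M..int M})"
    using assms by (auto simp: inj_on_def vec_eq_iff)
  show "(\<lambda>g. (\<chi> i. of_int (g i) / n) :: real ^ 'n) ` (UNIV \<rightarrow>\<^sub>E {- int M..int M}) = box_lattice n M"
  proof (intro subset_antisym subsetI)
    fix x :: "real ^ 'n"
    assume "x \<in> box_lattice n M"
    then have "\<forall>i. \<exists>m. m \<in> {- int M..int M} \<and> x $ i = of_int m / n"
      unfolding box_lattice_def by blast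
    from choice[OF this] obtain g where "\<And>i. g i \<in> {- int M..int M}" "\<And>i. x $ i = of_int (g i) / n"
      by blast
    then show "x \<in> (\<lambda>g. (\<chi> i. of_int (g i) / n) :: real ^ 'n) ` (UNIV \<rightarrow>\<^sub>E {- int M..int M})"
      by (intro image_eqI[of _ _ g]) (auto simp: vec_eq_iff)
  next
    fix x :: "real ^ 'n"
    assume "x \<in> (\<lambda>g. (\<chi> i. of_int (g i) / n) :: real ^ 'n) ` (UNIV \<rightarrow>\<^sub>E {- int M..int M})"
    then obtain g where g': "g \<in> UNIV \<rightarrow>\<^sub>E {- int M..int M}" and x: "x = (\<chi> i. of_int (g i) / n)"
      by blast
    have g: "g i \<in> {- int M..int M}" for i
      using PiE_mem[OF g'] by simp
    have "\<exists>m\<in>{- int M..int M}. x $ i = m / n" for i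
      using g x by (intro bexI[of _ "g i"]) auto
    then show "x \<in> box_lattice n M"
      by (simp add: box_lattice_def)
  qed
qed

lemma finite_box_lattice: "n \<noteq> 0 \<Longrightarrow> finite (box_lattice n M)"
  using bij_betw_finite[OF box_lattice_bij] by (metis finite_PiE finite_class.finite_UNIV finite_atLeastAtMost_int)

text \<open>Distributivity, read backwards: the points of a box are the choices of one term from
  each one-dimensional sum.\<close>

lemma sum_box_lattice:
  fixes h :: "'n::finite \<Rightarrow> real \<Rightarrow> real"
  assumes "n \<noteq> 0"
  shows "(\<Sum>x\<in>box_lattice n M. \<Prod>i\<in>UNIV. h i (x $ i))
    = (\<Prod>i\<in>UNIV. \<Sum>m\<in>{- int M..int M}. h i (m / n))"
proof -
  have "(\<Prod>i\<in>UNIV. \<Sum>m\<in>{- int M..int M}. h i (m / n))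
      = (\<Sum>g\<in>UNIV \<rightarrow>\<^sub>E {- int M..int M}. \<Prod>i\<in>UNIV. h i (of_int (g i) / n))"
    by (rule prod_sum_PiE) auto
  also have "\<dots> = (\<Sum>x\<in>box_lattice n M. \<Prod>i\<in>UNIV. h i (x $ i))"
    using sum.reindex_bij_betw[OF box_lattice_bij[OF assms], of "\<lambda>x. \<Prod>i\<in>UNIV. h i (x $ i)" M]
    by simp
  finally show ?thesis by simp
qed

lemma card_box_lattice:
  assumes "n \<noteq> 0"
  shows "real (card (box_lattice n M :: (real ^ 'n::finite) set)) = (2 * real M + 1) ^ CARD('n)"
  using sum_box_lattice[OF assms, of "\<lambda>(i::'n) _. 1" M] by (simp add: add.commute)

lemma sum_telescope_int:
  fixes a :: "int \<Rightarrow> real"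
  shows "(\<Sum>m\<in>{- int M..int M}. a (m + 1) - a m) = a (1 + int M) - a (- int M)"
proof (induction M)
  case (Suc M)
  have "{- int (Suc M)..int (Suc M)} = insert (- 1 - int M) (insert (1 + int M) {- int M..int M})"
    by auto
  then show ?case
    using Suc by (simp add: add.commute)
qed simp

text \<open>The weight 1/n cancels the factor \<open>n\<close> of \<open>kernel_eq\<close> in each
  coordinate, and what remains telescopes between opposite faces of the box.\<close>

lemma sum_kernel:
  fixes y :: "real ^ 'n::finite"
  assumes "n > 0"
  shows "(1 / n) ^ CARD('n) * (\<Sum>x\<in>box_lattice n M. kernel p n (x - y)) =
    (\<Prod>i\<in>UNIV. step (p * ((real M + 1) / n - y $ i)) - step (p * (- real M / n - y $ i)))"
proof -
  have "(1 / n) ^ CARD('n) * (\<Sum>x\<in>box_lattice n M. kernel p n (x - y)) =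
    (\<Sum>x\<in>box_lattice n M. \<Prod>i\<in>UNIV. step (p * (x $ i - y $ i + 1 / n)) - step (p * (x $ i - y $ i)))"
    unfolding sum_distrib_left using assms
    by (intro sum.cong) (auto simp: kernel_eq prod.distrib power_divide)
  also have "\<dots> = (\<Prod>i\<in>UNIV. \<Sum>m\<in>{- int M..int M}.
      step (p * (of_int m / n - y $ i + 1 / n)) - step (p * (of_int m / n - y $ i)))"
    using assms by (intro sum_box_lattice) auto
  also have "\<dots> = (\<Prod>i\<in>UNIV. \<Sum>m\<in>{- int M..int M}.
      step (p * (of_int (m + 1) / n - y $ i)) - step (p * (of_int m / n - y $ i)))"
    by (simp add: add_divide_distrib algebra_simps)
  also have "\<dots> = (\<Prod>i\<in>UNIV. step (p * ((real M + 1) / n - y $ i)) - step (p * (- real M / n - y $ i)))"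
    unfolding sum_telescope_int[of "\<lambda>m. step (p * (of_int m / n - y $ i))" for i] by (simp add: add.commute)
  finally show ?thesis .
qed

lemma step_bounds: "0 \<le> step t" "step t \<le> 1"
  using step_mono[of "min t 0" t] step_mono[of t "max t 1"] step_eq_0[of "min t 0"] step_eq_1[of "max t 1"]
  by auto

text \<open>As the kernel is nonnegative, \<open>A\<close> may be enlarged to a box, where the mass
  is a product of increments of \<open>step\<close>, all in [0, 1].\<close>

lemma sum_kernel_le_1:
  fixes A :: "(real ^ 'n::finite) set"
  assumes "p \<ge> 0" "n > 0" "finite A" "A \<subseteq> lattice n"
  shows "(1 / n) ^ CARD('n) * (\<Sum>x\<in>A. kernel p n (x - y)) \<le> 1"
proof -
  have "\<exists>M. x \<in> box_lattice n M" if x: "x \<in> lattice n" for x :: "real ^ 'n"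
  proof -
    obtain g :: "'n \<Rightarrow> int" where g: "\<And>i. x $ i = g i / n"
      using x unfolding lattice_def by (auto dest!: choice)
    let ?M = "nat (Max (range (\<lambda>i. \<bar>g i\<bar>)))"
    have "\<bar>g i\<bar> \<le> int ?M" for i
    proof -
      have m: "\<bar>g i\<bar> \<le> Max (range (\<lambda>i. \<bar>g i\<bar>))"
        by (intro Max_ge) auto
      then show ?thesis
        using m order_trans[OF abs_ge_zero m] by simp
    qed
    then have "g i \<in> {- int ?M..int ?M}" for i
      by (simp add: abs_le_iff minus_le_iff)
    then show ?thesis
      using g unfolding box_lattice_def by blast
  qed
  then obtain M where M: "\<And>x. x \<in> A \<Longrightarrow> x \<in> box_lattice n (M x)"
    using assms(4) by (metis subsetD)
  \<comment> \<open>The sum of the individual box sizes serves as a common one.\<close>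
  define K where "K = (\<Sum>x\<in>A. M x)"
  have "x \<in> box_lattice n K" if "x \<in> A" for x
  proof -
    have "M x \<le> K"
      unfolding K_def using that assms(3) by (intro member_le_sum) auto
    then have sub: "{- int (M x)..int (M x)} \<subseteq> {- int K..int K}"
      by auto
    show ?thesis
      using M[OF that] subsetD[OF sub] unfolding box_lattice_def by blast
  qed
  then have "A \<subseteq> box_lattice n K"
    by blast
  then have "(\<Sum>x\<in>A. kernel p n (x - y)) \<le> (\<Sum>x\<in>box_lattice n K. kernel p n (x - y))"
    using assms by (intro sum_mono2 finite_box_lattice kernel_nonneg) auto
  then have "(1 / n) ^ CARD('n) * (\<Sum>x\<in>A. kernel p n (x - y))
      \<le> (1 / n) ^ CARD('n) * (\<Sum>x\<in>box_lattice n K. kernel p n (x - y))"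
    using assms by (intro mult_left_mono) auto
  also have "\<dots> \<le> 1"
    unfolding sum_kernel[OF assms(2)]
  proof (intro prod_le_1 conjI)
    fix i
    let ?a = "step (p * ((real K + 1) / n - y $ i))"
    let ?b = "step (p * (- real K / n - y $ i))"
    have "?b \<le> ?a"
      using assms by (intro step_mono mult_left_mono diff_right_mono divide_right_mono) auto
    then show "0 \<le> ?a - ?b" by simp
    show "?a - ?b \<le> 1"
      using step_bounds[of "p * ((real K + 1) / n - y $ i)"]
        step_bounds[of "p * (- real K / n - y $ i)"] by linarith
  qed
  finally show ?thesis .
qed

text \<open>A box reaching 1/p beyond \<open>y\<close> sees the whole rise of \<open>step\<close>:
  value 1 at the upper face, 0 at the lower. The mass is thus exactly 1, and not merely in the limit
  of fine lattices.\<close>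

lemma sum_kernel_eq_1:
  fixes y :: "real ^ 'n::finite"
  assumes "p > 0" "n > 0" and y: "\<And>i. \<bar>y $ i\<bar> + 1 / p \<le> M / n"
  shows "(1 / n) ^ CARD('n) * (\<Sum>x\<in>box_lattice n M. kernel p n (x - y)) = 1"
proof -
  have "step (p * ((real M + 1) / n - y $ i)) - step (p * (- real M / n - y $ i)) = 1" for i
  proof -
    have "real M / n \<le> (real M + 1) / n"
      using assms by (intro divide_right_mono) auto
    then have "1 / p \<le> (real M + 1) / n - y $ i"
      using y[of i] by linarith
    then have "p * (1 / p) \<le> p * ((real M + 1) / n - y $ i)"
      using assms by (intro mult_left_mono) auto
    moreover have "- real M / n - y $ i \<le> 0"
    proof -
      have "1 / p > 0" "- real M / n = - (real M / n)"
        using assms(1) by auto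
      then show ?thesis
        using y[of i] by linarith
    qed
    then have "p * (- real M / n - y $ i) \<le> 0"
      using assms by (intro mult_nonneg_nonpos) auto
    ultimately show ?thesis
      using assms step_eq_0 step_eq_1 by simp
  qed
  then show ?thesis
    by (simp add: sum_kernel[OF assms(2)])
qed

section \<open>Discrete convolution with the kernel\<close>

lemma grid_diff_nonzero:
  "grid_diff N k f x \<noteq> 0 \<Longrightarrow> f x \<noteq> 0 \<or> f (x + axis k (1 / N)) \<noteq> 0"
  by (auto simp: grid_diff_def)

text \<open>Each difference looks one grid step ahead, so nonzero values spread by at most
  \<open>length ks\<close> steps. The statement is over any ordered field because it serves real
  lattice functions and internal functions alike.\<close>

lemma grid_diffs_nonzero:
  fixes f :: "'h::linordered_field ^ 'n::finite \<Rightarrow> 'h"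
  assumes "grid_diffs N ks f x \<noteq> 0"
  shows "\<exists>y. f y \<noteq> 0 \<and> (\<forall>i. \<exists>m. m \<le> length ks \<and> y $ i = x $ i + of_nat m * (1 / N))"
  using assms
proof (induction ks arbitrary: x)
  case Nil
  then show ?case
    by (intro exI[of _ x]) (auto intro!: exI[of _ 0])
next
  case (Cons k ks)
  then consider "grid_diffs N ks f x \<noteq> 0" | "grid_diffs N ks f (x + axis k (1 / N)) \<noteq> 0"
    using grid_diff_nonzero[of N k "grid_diffs N ks f" x] by auto
  then show ?case
  proof cases
    case 1
    from Cons.IH[OF this] obtain y where y: "f y \<noteq> 0"
      "\<And>i. \<exists>m. m \<le> length ks \<and> y $ i = x $ i + of_nat m * (1 / N)"
      by blast
    have "\<exists>m. m \<le> length (k # ks) \<and> y $ i = x $ i + of_nat m * (1 / N)" for i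
      using y(2)[of i] by (auto intro: le_SucI)
    then show ?thesis
      using y(1) by blast
  next
    case 2
    from Cons.IH[OF this] obtain y where y: "f y \<noteq> 0"
      "\<And>i. \<exists>m. m \<le> length ks \<and> y $ i = (x + axis k (1 / N)) $ i + of_nat m * (1 / N)"
      by blast
    have "\<exists>m. m \<le> length (k # ks) \<and> y $ i = x $ i + of_nat m * (1 / N)" for i
    proof -
      obtain m where m: "m \<le> length ks" "y $ i = (x + axis k (1 / N)) $ i + of_nat m * (1 / N)"
        using y(2) by blast
      show ?thesis
      proof (cases "i = k")
        case True
        then show ?thesis
          using m by (intro exI[of _ "Suc m"]) (auto simp: axis_def algebra_simps)
      next
        case False
        then show ?thesis
          using m by (intro exI[of _ m]) (auto simp: axis_def)
      qed
    qed
    then show ?thesis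
      using y(1) by blast
  qed
qed

text \<open>The adjoint of regularization: pairing a regularized distribution with \<psi> will mean
  applying the distribution to \<open>conv p n \<psi>\<close>. Summing over the support keeps the
  sum finite in all uses.\<close>

definition conv :: "real \<Rightarrow> real \<Rightarrow> (real ^ 'n::finite \<Rightarrow> real) \<Rightarrow> real ^ 'n \<Rightarrow> real" where
  "conv p n \<psi> y = (1 / n) ^ CARD('n) * (\<Sum>x | \<psi> x \<noteq> 0. \<psi> x * kernel p n (x - y))"

lemma conv_superset:
  fixes \<psi> :: "real ^ 'n::finite \<Rightarrow> real"
  assumes "finite A" and "\<And>x. \<psi> x \<noteq> 0 \<Longrightarrow> x \<in> A"
  shows "conv p n \<psi> y = (1 / n) ^ CARD('n) * (\<Sum>x\<in>A. \<psi> x * kernel p n (x - y))"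
  unfolding conv_def using assms
  by (intro arg_cong2[of _ _ _ _ "(*)"] refl sum.mono_neutral_left) auto

text \<open>The kernel is nonnegative with lattice mass at most 1, so averaging cannot raise the
  supremum.\<close>

lemma conv_le:
  fixes \<psi> :: "real ^ 'n::finite \<Rightarrow> real"
  assumes "p \<ge> 0" "n > 0" "finite {x. \<psi> x \<noteq> 0}" "{x. \<psi> x \<noteq> 0} \<subseteq> lattice n"
    and \<beta>: "\<And>x. \<bar>\<psi> x\<bar> \<le> \<beta>"
  shows "\<bar>conv p n \<psi> y\<bar> \<le> \<beta>"
proof -
  have "\<beta> \<ge> 0"
    using \<beta>[of 0] by linarith
  have k: "kernel p n z \<ge> 0" for z :: "real ^ 'n"
    using assms by (intro kernel_nonneg)
  have "\<bar>conv p n \<psi> y\<bar> \<le> (1 / n) ^ CARD('n) * (\<Sum>x | \<psi> x \<noteq> 0. \<bar>\<psi> x * kernel p n (x - y)\<bar>)"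
    unfolding conv_def abs_mult[of "(1 / n) ^ CARD('n)"] using assms(2)
    by (intro mult_mono sum_abs) (auto simp: sum_nonneg)
  also have "\<dots> \<le> (1 / n) ^ CARD('n) * (\<Sum>x | \<psi> x \<noteq> 0. \<beta> * kernel p n (x - y))"
    using assms k
    by (intro mult_left_mono sum_mono) (auto simp: abs_mult abs_of_nonneg intro!: mult_right_mono)
  also have "\<dots> = \<beta> * ((1 / n) ^ CARD('n) * (\<Sum>x | \<psi> x \<noteq> 0. kernel p n (x - y)))"
    by (simp add: sum_distrib_left mult_ac)
  also have "\<dots> \<le> \<beta> * 1"
    using sum_kernel_le_1[OF assms(1-4)] \<open>\<beta> \<ge> 0\<close> by (intro mult_left_mono)
  finally show ?thesis by simp
qed

lemma finite_grid_diff_support: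
  fixes \<psi> :: "real ^ 'n::finite \<Rightarrow> real"
  assumes "finite {x. \<psi> x \<noteq> 0}"
  shows "finite {x. grid_diff n i \<psi> x \<noteq> 0}"
proof (rule finite_subset)
  show "{x. grid_diff n i \<psi> x \<noteq> 0} \<subseteq> {x. \<psi> x \<noteq> 0} \<union> (\<lambda>x. x - axis i (1 / n)) ` {x. \<psi> x \<noteq> 0}"
    by (force simp: grid_diff_def image_iff algebra_simps)
qed (use assms in auto)

lemma finite_grid_diffs_support:
  fixes \<psi> :: "real ^ 'n::finite \<Rightarrow> real"
  assumes "finite {x. \<psi> x \<noteq> 0}"
  shows "finite {x. grid_diffs n ks \<psi> x \<noteq> 0}"
  by (induction ks) (use assms finite_grid_diff_support in auto)

text \<open>A difference combines translates, and translating \<psi> amounts to translating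
  \<open>y\<close>, after a shift of the summation index.\<close>

lemma conv_grid_diff:
  fixes \<psi> :: "real ^ 'n::finite \<Rightarrow> real"
  assumes "finite {x. \<psi> x \<noteq> 0}"
  shows "conv p n (grid_diff n i \<psi>) = grid_diff n i (conv p n \<psi>)"
proof
  fix y :: "real ^ 'n"
  define v :: "real ^ 'n" where "v = axis i (1 / n)"
  \<comment> \<open>\<open>A\<close> contains the supports of \<psi> and of its translate, so one
    index set carries all sums.\<close>
  define A where "A = {x. \<psi> x \<noteq> 0} \<union> (\<lambda>x. x - v) ` {x. \<psi> x \<noteq> 0}"
  have A: "finite A" "\<And>x. \<psi> x \<noteq> 0 \<Longrightarrow> x \<in> A" "\<And>x. \<psi> x \<noteq> 0 \<Longrightarrow> x \<in> (\<lambda>x. x + v) ` A"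
    using assms by (auto simp: A_def image_Un image_image)
  have "conv p n (grid_diff n i \<psi>) y
      = (1 / n) ^ CARD('n) * (\<Sum>x\<in>A. (\<psi> (x + v) - \<psi> x) / (1 / n) * kernel p n (x - y))"
    unfolding v_def[symmetric] grid_diff_def
  proof (rule conv_superset[OF A(1)])
    fix x
    assume "(\<psi> (x + v) - \<psi> x) / (1 / n) \<noteq> 0"
    then have "\<psi> x \<noteq> 0 \<or> \<psi> (x + v) \<noteq> 0" by auto
    then show "x \<in> A"
      using A(2) unfolding A_def by (auto simp: image_iff algebra_simps intro!: exI[of _ "x + v"])
  qed
  also have "(\<Sum>x\<in>A. (\<psi> (x + v) - \<psi> x) / (1 / n) * kernel p n (x - y))
      = ((\<Sum>x\<in>A. \<psi> (x + v) * kernel p n (x - y)) - (\<Sum>x\<in>A. \<psi> x * kernel p n (x - y))) / (1 / n)"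
    unfolding sum_subtractf[symmetric] sum_divide_distrib
    by (intro sum.cong refl) (simp add: algebra_simps)
  also have "(\<Sum>x\<in>A. \<psi> (x + v) * kernel p n (x - y))
      = (\<Sum>x\<in>(\<lambda>x. x + v) ` A. \<psi> x * kernel p n (x - (y + v)))"
    by (subst sum.reindex) (auto simp: inj_on_def algebra_simps)
  finally show "conv p n (grid_diff n i \<psi>) y = grid_diff n i (conv p n \<psi>) y"
    using conv_superset[OF A(1,2), where p=p and n=n and y=y]
      conv_superset[OF finite_imageI[OF A(1)] A(3), where p=p and n=n and y="y + v"]
    by (simp add: grid_diff_def v_def[symmetric] diff_divide_distrib right_diff_distrib)
qed

lemma conv_grid_diffs:
  fixes \<psi> :: "real ^ 'n::finite \<Rightarrow> real"
  assumes "finite {x. \<psi> x \<noteq> 0}"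
  shows "conv p n (grid_diffs n ks \<psi>) = grid_diffs n ks (conv p n \<psi>)"
  by (induction ks) (use assms in \<open>auto simp: conv_grid_diff finite_grid_diffs_support\<close>)

lemma conv_alt:
  fixes \<psi> :: "real ^ 'n::finite \<Rightarrow> real"
  shows "conv p n \<psi> = (\<lambda>y. \<Sum>x | \<psi> x \<noteq> 0. ((1 / n) ^ CARD('n) * \<psi> x) * kernel p n ((- 1) *\<^sub>R y + x))"
  by (auto simp: conv_def sum_distrib_left mult.assoc)

lemma smooth_conv: "smooth (conv p n \<psi>)"
  unfolding conv_alt by (intro smooth_sum smooth_mult smooth_const partials_affine(2) smooth_kernel)

lemma partials_conv:
  fixes \<psi> :: "real ^ 'n::finite \<Rightarrow> real"
  assumes "finite {x. \<psi> x \<noteq> 0}"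
  shows "partials js (conv p n \<psi>) y = (\<Sum>x | \<psi> x \<noteq> 0. ((1 / n) ^ CARD('n) * \<psi> x) *
    ((- 1) ^ length js * partials js (kernel p n) (x - y)))"
  unfolding conv_alt partials_sum_cmult[OF assms partials_affine(2)[OF smooth_kernel]]
    partials_affine(1)[OF smooth_kernel] by simp

lemma smooth_lipschitz:
  fixes f :: "real ^ 'n::finite \<Rightarrow> real" and L :: real
  assumes "smooth f" and L: "\<And>i x. \<bar>partial i f x\<bar> \<le> L"
  shows "\<bar>f x - f y\<bar> \<le> (CARD('n) * L) * norm (x - y)"
proof -
  have o: "onorm (\<lambda>h. \<Sum>i\<in>UNIV. h $ i * partial i f x) \<le> CARD('n) * L" for x
  proof (rule onorm_le)
    fix h :: "real ^ 'n"
    have "\<bar>\<Sum>i\<in>UNIV. h $ i * partial i f x\<bar> \<le> (\<Sum>i\<in>UNIV. \<bar>h $ i * partial i f x\<bar>)"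
      by (rule sum_abs)
    also have "\<dots> \<le> (\<Sum>i\<in>(UNIV::'n set). L * norm h)"
      by (intro sum_mono) (auto simp: abs_mult mult.commute[of L] intro!: mult_mono L component_le_norm_cart)
    finally show "norm (\<Sum>i\<in>UNIV. h $ i * partial i f x) \<le> CARD('n) * L * norm h"
      by (simp add: mult_ac)
  qed
  have "norm (f x - f y) \<le> (CARD('n) * L) * norm (x - y)"
    by (rule differentiable_bound[of UNIV f "\<lambda>x h. \<Sum>i\<in>UNIV. h $ i * partial i f x"])
      (use smooth_has_derivative[OF assms(1)] o in auto)
  then show ?thesis by simp
qed

lemma lattice_cube_subset:
  assumes "n > 0" "R \<ge> 0"
  shows "lattice n \<inter> cube R \<subseteq> box_lattice n (nat \<lfloor>R * n\<rfloor>)"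
proof
  fix x :: "real ^ 'a"
  assume x: "x \<in> lattice n \<inter> cube R"
  have "\<exists>m\<in>{- int (nat \<lfloor>R * n\<rfloor>)..int (nat \<lfloor>R * n\<rfloor>)}. x $ i = m / n" for i
  proof -
    obtain m :: int where m: "x $ i = m / n"
      using x by (auto simp: lattice_def)
    have "\<bar>of_int m / n\<bar> \<le> R"
      using x unfolding m[symmetric] by (simp add: cube_def)
    then have "of_int \<bar>m\<bar> \<le> R * n"
      using assms by (simp add: field_simps)
    then have "\<bar>m\<bar> \<le> \<lfloor>R * n\<rfloor>"
      by linarith
    then show ?thesis
      using m assms mult_nonneg_nonneg[of R n] by (intro bexI[of _ m]) auto
  qed
  then show "x \<in> box_lattice n (nat \<lfloor>R * n\<rfloor>)"
    by (simp add: box_lattice_def)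
qed

lemma finite_lattice_cube: "n > 0 \<Longrightarrow> R \<ge> 0 \<Longrightarrow> finite (lattice n \<inter> cube R)"
  using finite_subset[OF lattice_cube_subset finite_box_lattice] by auto

text \<open>Bounds a Riemann sum for the volume of the cube independently of \<open>n\<close>; the
  extra 1 in the side length pays for the boundary points.\<close>

lemma card_lattice_cube:
  assumes "n \<ge> 1" "R \<ge> 0"
  shows "(1 / n) ^ CARD('n) * real (card (lattice n \<inter> cube R :: (real ^ 'n::finite) set)) \<le> (2 * R + 1) ^ CARD('n)"
proof -
  have "real (card (lattice n \<inter> cube R :: (real ^ 'n) set)) \<le> (2 * real (nat \<lfloor>R * n\<rfloor>) + 1) ^ CARD('n)"
  proof -
    have "card (lattice n \<inter> cube R :: (real ^ 'n) set) \<le> card (box_lattice n (nat \<lfloor>R * n\<rfloor>) :: (real ^ 'n) set)"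
      using assms by (intro card_mono finite_box_lattice lattice_cube_subset) auto
    then show ?thesis
      using card_box_lattice[of n "nat \<lfloor>R * n\<rfloor>", where 'n='n] assms by simp
  qed
  also have "\<dots> \<le> ((2 * R + 1) * n) ^ CARD('n)"
  proof (rule power_mono)
    have "0 \<le> R * n"
      using assms by (intro mult_nonneg_nonneg) auto
    then have "real (nat \<lfloor>R * n\<rfloor>) \<le> R * n"
      by simp
    then have "2 * real (nat \<lfloor>R * n\<rfloor>) + 1 \<le> 2 * (R * n) + n"
      using assms by linarith
    then show "2 * real (nat \<lfloor>R * n\<rfloor>) + 1 \<le> (2 * R + 1) * n"
      by (simp add: algebra_simps)
  qed simp
  finally have "(1 / n) ^ CARD('n) * real (card (lattice n \<inter> cube R :: (real ^ 'n) set))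
      \<le> (1 / n) ^ CARD('n) * ((2 * R + 1) * n) ^ CARD('n)"
    using assms by (intro mult_left_mono) auto
  also have "\<dots> = (2 * R + 1) ^ CARD('n)"
    using assms by (simp add: power_mult_distrib[symmetric])
  finally show ?thesis .
qed

text \<open>By the mean value theorem, differences of \<open>conv p n \<psi>\<close> are its
  derivatives at a point at distance O(1/n), and the derivatives of one order more are bounded
  uniformly in \<open>n\<close> through the kernel. The constant depends on \<open>p\<close>,
  \<open>R\<close> and \<open>ks\<close>.\<close>

lemma conv_error:
  assumes "p \<ge> 1" "R \<ge> 0"
  shows "\<exists>c\<ge>0. \<forall>n\<ge>p. \<forall>\<psi> :: real ^ 'n::finite \<Rightarrow> real. \<forall>\<beta>.
    {x. \<psi> x \<noteq> 0} \<subseteq> lattice n \<inter> cube R \<longrightarrow> (\<forall>x. \<bar>\<psi> x\<bar> \<le> \<beta>) \<longrightarrow>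
    (\<forall>y. \<bar>partials (rev ks) (conv p n \<psi>) y - conv p n (grid_diffs n ks \<psi>) y\<bar> \<le> c * \<beta> / n)"
proof -
  have "\<exists>M\<ge>0. \<forall>n\<ge>p. \<forall>z. \<bar>partials (i # rev ks) (kernel p n) z\<bar> \<le> M" for i
    using partials_kernel_bound[OF assms(1)] .
  then obtain M where M: "\<And>i. M i \<ge> 0"
    "\<And>i n z. n \<ge> p \<Longrightarrow> \<bar>partials (i # rev ks) (kernel p n) z\<bar> \<le> M i"
    by metis
  \<comment> \<open>Every lattice point of the support contributes at most \<beta> times a kernel
    bound; the power of \<open>2 * R + 1\<close> counts the points with their weight.\<close>
  define L where "L = (2 * R + 1) ^ CARD('n) * (\<Sum>i\<in>UNIV. M i)"
  have "L \<ge> 0"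
    unfolding L_def using assms M(1) by (intro mult_nonneg_nonneg sum_nonneg) auto
  show ?thesis
  proof (intro exI[of _ "CARD('n) * L * (CARD('n) * length ks)"] conjI allI impI)
    show "0 \<le> CARD('n) * L * (CARD('n) * length ks)"
      using \<open>L \<ge> 0\<close> by simp
    fix n \<beta> y and \<psi> :: "real ^ 'n \<Rightarrow> real"
    assume n: "p \<le> n" and supp: "{x. \<psi> x \<noteq> 0} \<subseteq> lattice n \<inter> cube R"
      and \<beta>: "\<forall>x. \<bar>\<psi> x\<bar> \<le> \<beta>"
    have "n \<ge> 1" "\<beta> \<ge> 0"
      using n assms \<beta>[rule_format, of 0] by linarith+
    have fin: "finite {x. \<psi> x \<noteq> 0}"
      using finite_subset[OF supp finite_lattice_cube] \<open>n \<ge> 1\<close> assms by auto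
    let ?f = "partials (rev ks) (conv p n \<psi>)"
    have "\<bar>partial i ?f x\<bar> \<le> L * \<beta>" for i x
    proof -
      have "\<bar>partial i ?f x\<bar> = \<bar>partials (i # rev ks) (conv p n \<psi>) x\<bar>"
        by simp
      also have "\<dots> \<le> (\<Sum>z | \<psi> z \<noteq> 0. \<bar>((1 / n) ^ CARD('n) * \<psi> z) *
          ((- 1) ^ length (i # rev ks) * partials (i # rev ks) (kernel p n) (z - x))\<bar>)"
        unfolding partials_conv[OF fin] by (rule sum_abs)
      also have "\<dots> \<le> (\<Sum>z | \<psi> z \<noteq> 0. ((1 / n) ^ CARD('n) * \<beta>) * M i)"
        unfolding abs_mult using \<open>n \<ge> 1\<close> \<open>\<beta> \<ge> 0\<close> \<beta> M(2)[OF n]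
        by (intro sum_mono mult_mono) (auto simp: power_abs intro!: mult_left_mono)
      also have "\<dots> = ((1 / n) ^ CARD('n) * card {z. \<psi> z \<noteq> 0}) * (\<beta> * M i)"
        by simp
      also have "\<dots> \<le> ((1 / n) ^ CARD('n) * card (lattice n \<inter> cube R :: (real ^ 'n) set)) * (\<beta> * M i)"
        using card_mono[OF finite_lattice_cube supp] \<open>n \<ge> 1\<close> \<open>\<beta> \<ge> 0\<close> M(1) assms
        by (intro mult_right_mono mult_left_mono) auto
      also have "\<dots> \<le> (2 * R + 1) ^ CARD('n) * (\<beta> * M i)"
        using card_lattice_cube[OF \<open>n \<ge> 1\<close> assms(2)] \<open>\<beta> \<ge> 0\<close> M(1) by (intro mult_right_mono) auto
      also have "\<dots> \<le> (2 * R + 1) ^ CARD('n) * (\<beta> * (\<Sum>i\<in>UNIV. M i))"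
        using M(1) \<open>\<beta> \<ge> 0\<close> assms by (intro mult_left_mono member_le_sum) auto
      finally show ?thesis
        by (simp add: L_def mult_ac)
    qed
    note lip = smooth_lipschitz[OF smooth_partials[OF smooth_conv] this]
    obtain z where z: "\<And>j. y $ j \<le> z $ j \<and> z $ j \<le> y $ j + length ks / n"
      "grid_diffs n ks (conv p n \<psi>) y = ?f z"
      using grid_diffs_mean_value[OF smooth_conv[of p n \<psi>], of n y ks] \<open>n \<ge> 1\<close> by auto
    have "norm (y - z) \<le> (\<Sum>i\<in>UNIV. \<bar>(y - z) $ i\<bar>)"
      by (rule norm_le_l1_cart)
    also have "\<dots> \<le> (\<Sum>i\<in>(UNIV::'n set). length ks / n)"
    proof (intro sum_mono)
      fix i show "\<bar>(y - z) $ i\<bar> \<le> length ks / n"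
        using z(1)[of i] by auto
    qed
    finally have "norm (y - z) \<le> CARD('n) * (length ks / n)"
      by simp
    then have "(CARD('n) * (L * \<beta>)) * norm (y - z) \<le> (CARD('n) * (L * \<beta>)) * (CARD('n) * (length ks / n))"
      using \<open>L \<ge> 0\<close> \<open>\<beta> \<ge> 0\<close> by (intro mult_left_mono) auto
    then show "\<bar>?f y - conv p n (grid_diffs n ks \<psi>) y\<bar> \<le> CARD('n) * L * (CARD('n) * length ks) * \<beta> / n"
      using lip[of y z] z(2) by (simp add: conv_grid_diffs[OF fin] mult_ac)
  qed
qed

section \<open>Distributions\<close>

lemma test_functionsI:
  assumes "smooth \<phi>" "compact K" "K \<subseteq> \<Omega>" "\<And>x. \<phi> x \<noteq> 0 \<Longrightarrow> x \<in> K"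
  shows "\<phi> \<in> test_functions \<Omega>"
proof -
  have "{x. \<phi> x \<noteq> 0} \<subseteq> K"
    using assms(4) by blast
  then have "closure {x. \<phi> x \<noteq> 0} \<subseteq> K" "bounded {x. \<phi> x \<noteq> 0}"
    using assms(2) by (auto simp: closure_minimal compact_imp_closed intro: bounded_subset compact_imp_bounded)
  then show ?thesis
    using assms by (auto simp: test_functions_def compact_closure)
qed

lemma test_functionsE:
  assumes "\<phi> \<in> test_functions \<Omega>"
  obtains K where "smooth \<phi>" "compact K" "K \<subseteq> \<Omega>" "\<And>x. \<phi> x \<noteq> 0 \<Longrightarrow> x \<in> K"
  using assms closure_subset[of "{x. \<phi> x \<noteq> 0}"] unfolding test_functions_def by blast

lemma zero_test_function: "(\<lambda>x. 0) \<in> test_functions \<Omega>"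
  by (rule test_functionsI[of _ "{}"]) (auto intro: smooth_const)

lemma test_function_lincomb:
  assumes "\<phi> \<in> test_functions \<Omega>" "\<psi> \<in> test_functions \<Omega>"
  shows "(\<lambda>x. c * \<phi> x + d * \<psi> x) \<in> test_functions \<Omega>"
proof -
  obtain K where K: "smooth \<phi>" "compact K" "K \<subseteq> \<Omega>" "\<And>x. \<phi> x \<noteq> 0 \<Longrightarrow> x \<in> K"
    using test_functionsE[OF assms(1)] by blast
  obtain M where M: "smooth \<psi>" "compact M" "M \<subseteq> \<Omega>" "\<And>x. \<psi> x \<noteq> 0 \<Longrightarrow> x \<in> M"
    using test_functionsE[OF assms(2)] by blast
  show ?thesis
  proof (rule test_functionsI[of _ "K \<union> M"])
    show "x \<in> K \<union> M" if "c * \<phi> x + d * \<psi> x \<noteq> 0" for x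
      using that K(4)[of x] M(4)[of x] by fastforce
    show "smooth (\<lambda>x. c * \<phi> x + d * \<psi> x)"
      by (intro smooth_add smooth_mult smooth_const K(1) M(1))
  qed (use K M in auto)
qed

lemma test_function_cmult: "\<phi> \<in> test_functions \<Omega> \<Longrightarrow> (\<lambda>x. c * \<phi> x) \<in> test_functions \<Omega>"
  using test_function_lincomb[of \<phi> \<Omega> \<phi> c 0] by simp

lemma test_function_add:
  "\<phi> \<in> test_functions \<Omega> \<Longrightarrow> \<psi> \<in> test_functions \<Omega> \<Longrightarrow> (\<lambda>x. \<phi> x + \<psi> x) \<in> test_functions \<Omega>"
  using test_function_lincomb[of \<phi> \<Omega> \<psi> 1 1] by simp

lemma distributionD:
  assumes "T \<in> distributions \<Omega>"
  shows "\<phi> \<in> test_functions \<Omega> \<Longrightarrow> \<psi> \<in> test_functions \<Omega> \<Longrightarrow> T (\<lambda>x. \<phi> x + \<psi> x) = T \<phi> + T \<psi>"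
    and "\<phi> \<in> test_functions \<Omega> \<Longrightarrow> T (\<lambda>x. c * \<phi> x) = c * T \<phi>"
    and "tends_test \<Omega> \<theta> \<psi> \<Longrightarrow> (\<lambda>n. T (\<theta> n)) \<longlonglongrightarrow> T \<psi>"
    and "T (\<lambda>x. 0) = 0"
proof -
  show "\<phi> \<in> test_functions \<Omega> \<Longrightarrow> \<psi> \<in> test_functions \<Omega> \<Longrightarrow> T (\<lambda>x. \<phi> x + \<psi> x) = T \<phi> + T \<psi>"
    and "tends_test \<Omega> \<theta> \<psi> \<Longrightarrow> (\<lambda>n. T (\<theta> n)) \<longlonglongrightarrow> T \<psi>"
    using assms by (simp_all add: distributions_def)
  show c: "\<phi> \<in> test_functions \<Omega> \<Longrightarrow> T (\<lambda>x. c * \<phi> x) = c * T \<phi>" for \<phi> c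
    using assms by (simp add: distributions_def)
  show "T (\<lambda>x. 0) = 0"
    using c[OF zero_test_function, of 0] by simp
qed

lemma distribution_sum:
  assumes "T \<in> distributions \<Omega>" "finite A" "\<And>a. a \<in> A \<Longrightarrow> f a \<in> test_functions \<Omega>"
  shows "T (\<lambda>x. \<Sum>a\<in>A. c a * f a x) = (\<Sum>a\<in>A. c a * T (f a))"
    and "(\<lambda>x. \<Sum>a\<in>A. c a * f a x) \<in> test_functions \<Omega>"
proof -
  have "T (\<lambda>x. \<Sum>a\<in>A. c a * f a x) = (\<Sum>a\<in>A. c a * T (f a)) \<and>
      (\<lambda>x. \<Sum>a\<in>A. c a * f a x) \<in> test_functions \<Omega>"
    using assms(2,3)
  proof (induction A rule: finite_induct)
    case empty
    then show ?case
      using distributionD(4)[OF assms(1)] zero_test_function by simp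
  next
    case (insert a A)
    then show ?case
      using distributionD(1,2)[OF assms(1)] by (simp add: test_function_add test_function_cmult)
  qed
  then show "T (\<lambda>x. \<Sum>a\<in>A. c a * f a x) = (\<Sum>a\<in>A. c a * T (f a))"
    and "(\<lambda>x. \<Sum>a\<in>A. c a * f a x) \<in> test_functions \<Omega>"
    by auto
qed

lemma partials_zero: "partials js (\<lambda>x. 0) = (\<lambda>x. 0)"
  using partials_cmult[OF smooth_const, of js 0 0] by simp

text \<open>Sequential continuity implies a seminorm estimate on each compact set. Otherwise there
  are counterexamples with order m and constant m + 1 for every m; normalized by their own bounds
  they tend to 0, while \<open>T\<close> exceeds 1 on them in absolute value.\<close>

lemma distribution_bounded:
  assumes T: "T \<in> distributions \<Omega>" and K: "compact K" "K \<subseteq> \<Omega>"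
  shows "\<exists>C m. C \<ge> 0 \<and> (\<forall>\<phi> \<beta>. smooth \<phi> \<longrightarrow> (\<forall>x. \<phi> x \<noteq> 0 \<longrightarrow> x \<in> K) \<longrightarrow>
    (\<forall>js x. length js \<le> m \<longrightarrow> \<bar>partials js \<phi> x\<bar> \<le> \<beta>) \<longrightarrow> \<bar>T \<phi>\<bar> \<le> C * \<beta>)"
proof (rule ccontr)
  assume neg: "\<not> ?thesis"
  have "\<exists>\<phi> \<beta>. smooth \<phi> \<and> (\<forall>x. \<phi> x \<noteq> 0 \<longrightarrow> x \<in> K) \<and>
      (\<forall>js x. length js \<le> m \<longrightarrow> \<bar>partials js \<phi> x\<bar> \<le> \<beta>) \<and> \<bar>T \<phi>\<bar> > real (Suc m) * \<beta>" for m
  proof -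
    define P where "P = (\<lambda>C. \<forall>\<phi> \<beta>. smooth \<phi> \<longrightarrow> (\<forall>x. \<phi> x \<noteq> 0 \<longrightarrow> x \<in> K) \<longrightarrow>
      (\<forall>js x. length js \<le> m \<longrightarrow> \<bar>partials js \<phi> x\<bar> \<le> \<beta>) \<longrightarrow> \<bar>T \<phi>\<bar> \<le> C * \<beta>)"
    have "\<not> P C" if "C \<ge> 0" for C
      using neg that unfolding P_def by blast
    then have "\<not> P (real (Suc m))"
      by simp
    then show ?thesis
      unfolding P_def not_all not_imp not_le by blast
  qed
  then obtain \<phi> \<beta> where \<phi>: "\<And>m. smooth (\<phi> m)" "\<And>m x. \<phi> m x \<noteq> 0 \<Longrightarrow> x \<in> K"
    "\<And>m js x. length js \<le> m \<Longrightarrow> \<bar>partials js (\<phi> m) x\<bar> \<le> \<beta> m"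
    "\<And>m. \<bar>T (\<phi> m)\<bar> > real (Suc m) * \<beta> m"
    by metis
  have test: "\<phi> m \<in> test_functions \<Omega>" for m
    using \<phi>(1,2) K by (intro test_functionsI[of _ K]) auto
  \<comment> \<open>Needed for the normalization: with a nonpositive bound \<phi> would vanish and
    could not be a counterexample.\<close>
  have pos: "\<beta> m > 0" for m
  proof (rule ccontr)
    assume "\<not> \<beta> m > 0"
    then have "\<phi> m x = 0" for x
      using \<phi>(3)[of "[]" m x] by simp
    then have "\<phi> m = (\<lambda>x. 0)" by auto
    then have "T (\<phi> m) = 0"
      using distributionD(4)[OF T] by simp
    moreover have "0 \<le> \<beta> m"
      using order_trans[OF abs_ge_zero \<phi>(3)[of "[]" m 0]] by simp
    ultimately show False
      using \<phi>(4)[of m] by (simp add: mult_less_0_iff)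
  qed
  define \<theta> where "\<theta> = (\<lambda>m x. inverse (real (Suc m) * \<beta> m) * \<phi> m x)"
  have \<theta>: "\<theta> m \<in> test_functions \<Omega>" for m
    unfolding \<theta>_def by (intro test_function_cmult test)
  have b: "\<bar>partials js (\<theta> m) x\<bar> \<le> inverse (real (Suc m))" if "length js \<le> m" for js m x
  proof -
    have "\<bar>partials js (\<theta> m) x\<bar> = inverse (real (Suc m) * \<beta> m) * \<bar>partials js (\<phi> m) x\<bar>"
      unfolding \<theta>_def using pos[of m] by (simp add: partials_cmult[OF \<phi>(1)] abs_mult)
    also have "\<dots> \<le> inverse (real (Suc m) * \<beta> m) * \<beta> m"
      using \<phi>(3)[OF that, of x] pos[of m] by (intro mult_left_mono) auto
    also have "\<dots> = inverse (real (Suc m))"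
      using pos[of m] by (simp add: inverse_mult_distrib mult.assoc del: of_nat_Suc)
    finally show ?thesis .
  qed
  have "tends_test \<Omega> \<theta> (\<lambda>x. 0)"
    unfolding tends_test_def
  proof (intro conjI allI zero_test_function \<theta>)
    show "\<exists>K. compact K \<and> K \<subseteq> \<Omega> \<and> (\<forall>n x. \<theta> n x \<noteq> 0 \<longrightarrow> x \<in> K)"
      using K \<phi>(2) by (intro exI[of _ K]) (auto simp: \<theta>_def)
    show "uniform_limit UNIV (\<lambda>n. partials js (\<theta> n)) (partials js (\<lambda>x. 0)) sequentially" for js
      unfolding partials_zero uniform_limit_iff
    proof (intro allI impI)
      fix e :: real assume "e > 0"
      have "\<forall>\<^sub>F n in sequentially. inverse (real (Suc n)) < e"
        using LIMSEQ_inverse_real_of_nat \<open>e > 0\<close> by (rule order_tendstoD)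
      then show "\<forall>\<^sub>F n in sequentially. \<forall>x\<in>UNIV. dist (partials js (\<theta> n) x) 0 < e"
        using eventually_ge_at_top[of "length js"]
        by eventually_elim (use b in \<open>auto intro: le_less_trans\<close>)
    qed
  qed
  from distributionD(3)[OF T this] have lim: "(\<lambda>m. T (\<theta> m)) \<longlonglongrightarrow> 0"
    using distributionD(4)[OF T] by simp
  have "\<bar>T (\<theta> m)\<bar> > 1" for m
  proof -
    have "\<bar>T (\<theta> m)\<bar> = inverse (real (Suc m) * \<beta> m) * \<bar>T (\<phi> m)\<bar>"
      unfolding \<theta>_def distributionD(2)[OF T test] using pos[of m] by (simp add: abs_mult)
    also have "\<dots> > inverse (real (Suc m) * \<beta> m) * (real (Suc m) * \<beta> m)"
      using \<phi>(4)[of m] pos[of m] by (intro mult_strict_left_mono) auto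
    also have "inverse (real (Suc m) * \<beta> m) * (real (Suc m) * \<beta> m) = 1"
      using pos[of m] by (intro left_inverse) (simp del: of_nat_Suc)
    finally show ?thesis .
  qed
  then have "1 \<le> \<bar>T (\<theta> m)\<bar>" for m
    by (simp add: less_imp_le)
  then have "1 \<le> \<bar>0 :: real\<bar>"
    using tendsto_rabs[OF lim] by (intro LIMSEQ_le_const[of "\<lambda>m. \<bar>T (\<theta> m)\<bar>"]) auto
  then show False by simp
qed

section \<open>Regularized distributions on the real grids\<close>

lemma kernel_support:
  fixes K :: "(real ^ 'n::finite) set"
  assumes "open \<Omega>" "compact K" "K \<subseteq> \<Omega>"
  shows "\<exists>K' p\<^sub>0. compact K' \<and> K' \<subseteq> \<Omega> \<and> p\<^sub>0 \<ge> 1 \<and>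
    (\<forall>p\<ge>p\<^sub>0. \<forall>n\<ge>p. \<forall>x\<in>K. \<forall>y. kernel p n (x - y) \<noteq> 0 \<longrightarrow> y \<in> K')"
proof -
  obtain e where e: "e > 0" "(\<Union>x\<in>K. ball x e) \<subseteq> \<Omega>"
    using compact_subset_open_imp_ball_epsilon_subset[OF assms(2,1,3)] by blast
  let ?K' = "{x + d | x d. x \<in> K \<and> d \<in> cball 0 (e / 2)}"
  have "x + d \<in> \<Omega>" if "x \<in> K" "d \<in> cball 0 (e / 2)" for x d
  proof -
    have "x + d \<in> ball x e"
      using that e(1) by (simp add: dist_norm)
    then show ?thesis
      using that(1) e(2) by blast
  qed
  then have "?K' \<subseteq> \<Omega>" by blast
  moreover have "compact ?K'"
    by (intro compact_sums assms(2) compact_cball)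
  \<comment> \<open>The kernel has radius 1/p in each coordinate; the lower bound on
    \<open>p\<close> turns this into a Euclidean distance of at most e/2.\<close>
  moreover have "y \<in> ?K'" if p: "p \<ge> max 1 (CARD('n) * 2 / e)" "n \<ge> p" and x: "x \<in> K"
    and k: "kernel p n (x - y) \<noteq> 0" for p n and x y :: "real ^ 'n"
  proof -
    have "\<bar>(y - x) $ i\<bar> \<le> 1 / p" for i
      using kernel_eq_0[of p n "x - y" i] p k by fastforce
    then have "norm (y - x) \<le> (\<Sum>i\<in>(UNIV::'n set). 1 / p)"
      by (intro order_trans[OF norm_le_l1_cart] sum_mono)
    also have "\<dots> \<le> e / 2"
      using p(1) e(1) by (simp add: field_simps)
    finally show ?thesis
      using x by (intro CollectI exI[of _ x] exI[of _ "y - x"]) simp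
  qed
  ultimately show ?thesis
    by (intro exI[of _ ?K'] exI[of _ "max 1 (CARD('n) * 2 / e)"]) auto
qed

text \<open>\<open>P n\<close> is the largest \<open>p \<le> n\<close> whose threshold
  \<open>N p\<close> has been passed. It tends to infinity because every \<open>p\<close> qualifies
  eventually.\<close>

lemma diagonal_sequence:
  fixes Q :: "nat \<Rightarrow> nat \<Rightarrow> bool"
  assumes "\<And>p. \<forall>\<^sub>F n in sequentially. Q p n"
  obtains P where "filterlim P at_top sequentially" "\<forall>\<^sub>F n in sequentially. Q (P n) n"
proof -
  obtain N where N: "\<And>p n. n \<ge> N p \<Longrightarrow> Q p n"
    using assms unfolding eventually_sequentially by metis
  define P where "P = (\<lambda>n. Max {p. p \<le> n \<and> N p \<le> n})"
  have "P n \<in> {p. p \<le> n \<and> N p \<le> n}" if "n \<ge> N 0" for n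
    unfolding P_def by (rule Max_in) (use that in auto)
  then have "\<forall>\<^sub>F n in sequentially. Q (P n) n"
    using N by (intro eventually_sequentiallyI[of "N 0"]) auto
  moreover have "P n \<ge> p" if "n \<ge> max p (N p)" for n p
    unfolding P_def using that by (intro Max_ge) auto
  then have "filterlim P at_top sequentially"
    unfolding filterlim_at_top eventually_sequentially by blast
  ultimately show thesis
    using that by blast
qed

text \<open>At a good scale, \<open>n\<close> has outgrown the constant of
  \<open>conv_error\<close>: the error is at most \<beta>/p for all orders up to p and all supports
  in a cube of radius p, which as p grows covers every order and every compact set. The error
  estimate is only asked for p \<ge> 1, so that the diagonal choice can run over all naturals. The
  type argument fixes the dimension.\<close>

definition good_scale :: "'n::finite itself \<Rightarrow> nat \<Rightarrow> nat \<Rightarrow> bool" where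
  "good_scale _ p n \<longleftrightarrow> p \<le> n \<and> (p \<ge> 1 \<longrightarrow> (\<forall>ks. length ks \<le> p \<longrightarrow>
    (\<forall>(\<psi> :: real ^ 'n \<Rightarrow> real) \<beta>. {x. \<psi> x \<noteq> 0} \<subseteq> lattice n \<inter> cube p \<longrightarrow> (\<forall>x. \<bar>\<psi> x\<bar> \<le> \<beta>) \<longrightarrow>
    (\<forall>y. \<bar>partials (rev ks) (conv p n \<psi>) y - conv p n (grid_diffs n ks \<psi>) y\<bar> \<le> \<beta> / p))))"

text \<open>Only finitely many lists of directions have length at most \<open>p\<close>. Once
  \<open>n\<close> exceeds \<open>p\<close> times the sum of their constants, every
  \<open>c ks * \<beta> / n\<close> is below \<open>\<beta> / p\<close>.\<close>

lemma eventually_good_scale: "\<forall>\<^sub>F n in sequentially. good_scale TYPE('n::finite) p n"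
proof (cases "p \<ge> 1")
  case True
  let ?S = "{ks :: 'n list. set ks \<subseteq> UNIV \<and> length ks \<le> p}"
  have "\<exists>c\<ge>0. \<forall>n\<ge>real p. \<forall>\<psi> :: real ^ 'n \<Rightarrow> real. \<forall>\<beta>.
    {x. \<psi> x \<noteq> 0} \<subseteq> lattice n \<inter> cube p \<longrightarrow> (\<forall>x. \<bar>\<psi> x\<bar> \<le> \<beta>) \<longrightarrow>
    (\<forall>y. \<bar>partials (rev ks) (conv p n \<psi>) y - conv p n (grid_diffs n ks \<psi>) y\<bar> \<le> c * \<beta> / n)" for ks
    using True by (intro conv_error) auto
  then obtain c where c: "\<And>ks. c ks \<ge> 0" "\<And>ks n (\<psi> :: real ^ 'n \<Rightarrow> real) \<beta> y. n \<ge> real p \<Longrightarrow>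
    {x. \<psi> x \<noteq> 0} \<subseteq> lattice n \<inter> cube p \<Longrightarrow> (\<And>x. \<bar>\<psi> x\<bar> \<le> \<beta>) \<Longrightarrow>
    \<bar>partials (rev ks) (conv p n \<psi>) y - conv p n (grid_diffs n ks \<psi>) y\<bar> \<le> c ks * \<beta> / n"
    by metis
  have "finite ?S"
    by (intro finite_lists_length_le) simp
  have "good_scale TYPE('n) p n" if n: "n \<ge> max p (nat \<lceil>(\<Sum>ks\<in>?S. c ks) * p\<rceil>)" for n
    unfolding good_scale_def
  proof (intro conjI impI allI)
    show "p \<le> n" using n by simp
    fix ks :: "'n list" and \<psi> :: "real ^ 'n \<Rightarrow> real" and \<beta> y
    assume ks: "length ks \<le> p" and supp: "{x. \<psi> x \<noteq> 0} \<subseteq> lattice n \<inter> cube p"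
      and \<beta>: "\<forall>x. \<bar>\<psi> x\<bar> \<le> \<beta>"
    have "c ks \<le> (\<Sum>ks\<in>?S. c ks)"
      using ks c(1) \<open>finite ?S\<close> by (intro member_le_sum) auto
    then have "c ks * p \<le> (\<Sum>ks\<in>?S. c ks) * p"
      by (intro mult_right_mono) auto
    also have "\<dots> \<le> n"
      using n by linarith
    finally have "c ks * p \<le> n" .
    moreover have "\<beta> \<ge> 0"
      using \<beta>[rule_format, of 0] by linarith
    ultimately have "(c ks * p) * \<beta> \<le> n * \<beta>"
      by (intro mult_right_mono)
    then have "c ks * \<beta> / n \<le> \<beta> / p"
      using True n by (simp add: field_simps)
    then show "\<bar>partials (rev ks) (conv p n \<psi>) y - conv p n (grid_diffs n ks \<psi>) y\<bar> \<le> \<beta> / p"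
      using c(2)[of n \<psi> \<beta> ks y] supp \<beta> n by force
  qed
  then show ?thesis
    unfolding eventually_sequentially by blast
next
  case False
  then show ?thesis
    by (intro eventually_sequentiallyI[of p]) (auto simp: good_scale_def)
qed

text \<open>The real counterpart of \<open>grid_vecs\<close>, in the same form so that it transfers;
  \<open>n\<close> is real because variables of transferred statements hold numbers.\<close>

definition std_grid :: "real \<Rightarrow> (real ^ 'n::finite) set" where
  "std_grid n = {x. \<forall>i. \<exists>m\<in>\<int>. x $ i = m * (1 / n) \<and> - (n\<^sup>2) \<le> m \<and> m \<le> n\<^sup>2}"

definition std_inner :: "real \<Rightarrow> (real ^ 'n::finite \<Rightarrow> real) \<Rightarrow> (real ^ 'n \<Rightarrow> real) \<Rightarrow> real" where
  "std_inner n f g = (1 / n) ^ CARD('n) * (\<Sum>x\<in>std_grid n. f x * g x)"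

lemma std_grid_eq: "std_grid (real n) = box_lattice (real n) (n\<^sup>2)"
proof -
  have "(\<exists>m\<in>\<int>. t = m * (1 / real n) \<and> - ((real n)\<^sup>2) \<le> m \<and> m \<le> (real n)\<^sup>2) \<longleftrightarrow>
      (\<exists>m\<in>{- int (n\<^sup>2)..int (n\<^sup>2)}. t = of_int m / real n)" (is "?L \<longleftrightarrow> ?R") for t
  proof
    assume ?L
    then obtain k :: int where k: "t = of_int k * (1 / real n)" "- ((real n)\<^sup>2) \<le> of_int k" "of_int k \<le> (real n)\<^sup>2"
      by (auto elim!: Ints_cases)
    then have "- int (n\<^sup>2) \<le> k" "k \<le> int (n\<^sup>2)"
      by (metis of_int_le_iff of_int_minus of_int_of_nat_eq of_nat_power)+
    then show ?R
      using k(1) by (intro bexI[of _ k]) auto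
  next
    assume ?R
    then obtain k :: int where k: "- int (n\<^sup>2) \<le> k" "k \<le> int (n\<^sup>2)" "t = of_int k / real n"
      by auto
    have "- ((real n)\<^sup>2) \<le> of_int k" "of_int k \<le> (real n)\<^sup>2"
      using k(1,2) by (metis of_int_le_iff of_int_minus of_int_of_nat_eq of_nat_power)+
    then show ?L
      using k(3) by (intro bexI[of _ "of_int k"]) auto
  qed
  then show ?thesis
    unfolding std_grid_def box_lattice_def by presburger
qed

lemma finite_std_grid: "n > 0 \<Longrightarrow> finite (std_grid (real n))"
  unfolding std_grid_eq by (rule finite_box_lattice) simp

lemma std_grid_lattice: "std_grid (real n) \<subseteq> lattice (real n)"
  unfolding std_grid_eq by (auto simp: box_lattice_def lattice_def)

lemma lattice_cube_std_grid:
  assumes "n > 0" "R \<ge> 0" "R \<le> real n"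
  shows "lattice (real n) \<inter> cube R \<subseteq> std_grid (real n)"
proof -
  have "nat \<lfloor>R * real n\<rfloor> \<le> n\<^sup>2"
  proof -
    have "R * real n \<le> real (n\<^sup>2)"
      using assms by (simp add: power2_eq_square mult_right_mono)
    then show ?thesis
      by linarith
  qed
  moreover have "{- int a..int a} \<subseteq> {- int b..int b}" if "a \<le> b" for a b :: nat
    using that by auto
  ultimately have "{- int (nat \<lfloor>R * real n\<rfloor>)..int (nat \<lfloor>R * real n\<rfloor>)} \<subseteq> {- int (n\<^sup>2)..int (n\<^sup>2)}"
    by blast
  then have "box_lattice (real n) (nat \<lfloor>R * real n\<rfloor>) \<subseteq> (box_lattice (real n) (n\<^sup>2) :: (real ^ 'a) set)"
    unfolding box_lattice_def by blast
  then show ?thesis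
    using lattice_cube_subset[of "real n" R] assms unfolding std_grid_eq by auto
qed

text \<open>The value at \<open>x\<close> of the grid function regularizing \<open>T\<close> at scale \<open>1 / p\<close>.\<close>

definition regularize ::
  "((real ^ 'n::finite \<Rightarrow> real) \<Rightarrow> real) \<Rightarrow> real \<Rightarrow> real \<Rightarrow> real ^ 'n \<Rightarrow> real" where
  "regularize T p n x = T (\<lambda>y. kernel p n (x - y))"

text \<open>The sum over the grid is finite, so linearity moves it inside \<open>T\<close>, where it
  becomes the discrete convolution.\<close>

lemma regularize_inner:
  fixes \<psi> :: "real ^ 'n::finite \<Rightarrow> real"
  assumes T: "T \<in> distributions \<Omega>" and K': "compact K'" "K' \<subseteq> \<Omega>"
    and supp: "{x. \<psi> x \<noteq> 0} \<subseteq> std_grid n \<inter> K" "finite (std_grid n :: (real ^ 'n) set)"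
    and k: "\<And>x y. x \<in> K \<Longrightarrow> kernel p n (x - y) \<noteq> 0 \<Longrightarrow> y \<in> K'"
  shows "std_inner n (regularize T p n) \<psi> = T (conv p n \<psi>)"
    and "conv p n \<psi> y \<noteq> 0 \<Longrightarrow> y \<in> K'"
    and "conv p n \<psi> \<in> test_functions \<Omega>"
proof -
  have fin: "finite {x. \<psi> x \<noteq> 0}"
    using supp finite_subset by blast
  have test: "(\<lambda>y. kernel p n (x - y)) \<in> test_functions \<Omega>" if "x \<in> K" for x
  proof (rule test_functionsI[OF _ K'])
    show "smooth (\<lambda>y. kernel p n (x - y))"
      using partials_affine(2)[OF smooth_kernel, of p n "- 1" x] by simp
  qed (rule k[OF that])
  have eq: "conv p n \<psi> = (\<lambda>y. \<Sum>x | \<psi> x \<noteq> 0. ((1 / n) ^ CARD('n) * \<psi> x) * kernel p n (x - y))"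
    by (auto simp: conv_def sum_distrib_left mult.assoc)
  have "T (conv p n \<psi>) = (\<Sum>x | \<psi> x \<noteq> 0. ((1 / n) ^ CARD('n) * \<psi> x) * regularize T p n x)"
    unfolding eq regularize_def
    by (rule distribution_sum(1)[OF T fin, where f="\<lambda>x y. kernel p n (x - y)"]) (use test supp in auto)
  also have "\<dots> = (\<Sum>x\<in>std_grid n. ((1 / n) ^ CARD('n) * \<psi> x) * regularize T p n x)"
    using supp by (intro sum.mono_neutral_left) auto
  finally show "std_inner n (regularize T p n) \<psi> = T (conv p n \<psi>)"
    by (simp add: std_inner_def sum_distrib_left mult_ac)
  show "conv p n \<psi> y \<noteq> 0 \<Longrightarrow> y \<in> K'" for y
  proof -
    assume "conv p n \<psi> y \<noteq> 0"
    then have "(\<Sum>x | \<psi> x \<noteq> 0. \<psi> x * kernel p n (x - y)) \<noteq> 0"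
      unfolding conv_def by simp
    from sum.not_neutral_contains_not_neutral[OF this]
    obtain x where "\<psi> x \<noteq> 0" "kernel p n (x - y) \<noteq> 0"
      by auto
    then show "y \<in> K'"
      using k supp by blast
  qed
  then show "conv p n \<psi> \<in> test_functions \<Omega>"
    using K' by (intro test_functionsI[OF smooth_conv K'])
qed

lemma compact_subset_cube:
  assumes "compact (K :: (real ^ 'n::finite) set)"
  obtains R where "R \<ge> 0" "K \<subseteq> cube R"
proof -
  obtain B where "\<And>x. x \<in> K \<Longrightarrow> norm x \<le> B"
    using compact_imp_bounded[OF assms] by (auto simp: bounded_iff)
  then have "K \<subseteq> cube (max B 0)"
    by (force simp: cube_def intro: order_trans[OF component_le_norm_cart])
  then show thesis
    using that[of "max B 0"] by simp
qed

lemma cube_mono: "R \<le> S \<Longrightarrow> cube R \<subseteq> cube S"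
  by (auto simp: cube_def intro: order_trans)

text \<open>With mesh at most 1, each difference enlarges the cube by at most 1.\<close>

lemma lattice_grid_diffs_support:
  fixes \<psi> :: "real ^ 'n::finite \<Rightarrow> real"
  assumes "n \<ge> 1" "{x. \<psi> x \<noteq> 0} \<subseteq> lattice n \<inter> cube R"
  shows "{x. grid_diffs n ks \<psi> x \<noteq> 0} \<subseteq> lattice n \<inter> cube (R + length ks)"
proof
  fix x
  assume "x \<in> {x. grid_diffs n ks \<psi> x \<noteq> 0}"
  then obtain y where y: "\<psi> y \<noteq> 0" "\<And>i. \<exists>m. m \<le> length ks \<and> y $ i = x $ i + of_nat m * (1 / n)"
    using grid_diffs_nonzero[of n ks \<psi> x] by auto
  have yl: "y \<in> lattice n" "y \<in> cube R"
    using y(1) assms(2) by auto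
  have "(\<exists>m::int. x $ i = m / n) \<and> \<bar>x $ i\<bar> \<le> R + length ks" for i
  proof -
    obtain m where m: "m \<le> length ks" "y $ i = x $ i + of_nat m * (1 / n)"
      using y(2) by blast
    obtain k :: int where k: "y $ i = k / n"
      using yl(1) by (auto simp: lattice_def)
    have "x $ i = of_int (k - int m) / n"
      using m k by (simp add: diff_divide_distrib)
    moreover have yR: "\<bar>y $ i\<bar> \<le> R" and nn: "0 \<le> real m * (1 / n)"
      using yl(2) assms(1) by (auto simp: cube_def)
    have "real m * (1 / n) \<le> real (length ks) * 1"
      using m assms(1) by (intro mult_mono) auto
    then have "\<bar>x $ i\<bar> \<le> R + length ks"
      using m yR nn by linarith
    ultimately show ?thesis by blast
  qed
  then show "x \<in> lattice n \<inter> cube (R + length ks)"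
    by (auto simp: lattice_def cube_def)
qed

text \<open>\<open>T\<close> is controlled by finitely many derivatives of
  \<open>conv (P n) n \<psi>\<close>. At a good scale these are close to convolutions of differences
  of \<psi>, which are bounded by \<beta>, and the error adds at most another \<beta>.\<close>

lemma regularize_bounded:
  fixes K :: "(real ^ 'n::finite) set"
  assumes "open \<Omega>" "T \<in> distributions \<Omega>" "compact K" "K \<subseteq> \<Omega>"
    and P: "filterlim P at_top sequentially" "\<forall>\<^sub>F n in sequentially. good_scale TYPE('n) (P n) n"
  shows "\<exists>C m. C \<ge> 0 \<and> (\<forall>\<^sub>F n in sequentially. \<forall>\<psi> \<beta>. {x. \<psi> x \<noteq> 0} \<subseteq> std_grid n \<inter> K \<longrightarrow>
    (\<forall>ks. length ks \<le> m \<longrightarrow> (\<forall>x. \<bar>grid_diffs n ks \<psi> x\<bar> \<le> \<beta>)) \<longrightarrow>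
    \<bar>std_inner n (regularize T (P n) n) \<psi>\<bar> \<le> C * \<beta>)"
proof -
  obtain K' p\<^sub>0 where K': "compact K'" "K' \<subseteq> \<Omega>" "p\<^sub>0 \<ge> 1"
    "\<And>p n x y. p \<ge> p\<^sub>0 \<Longrightarrow> n \<ge> p \<Longrightarrow> x \<in> K \<Longrightarrow> kernel p n (x - y) \<noteq> 0 \<Longrightarrow> y \<in> K'"
    using kernel_support[OF assms(1,3,4)] by blast
  obtain C m where C: "C \<ge> 0" "\<And>\<phi> \<beta>. smooth \<phi> \<Longrightarrow> (\<And>x. \<phi> x \<noteq> 0 \<Longrightarrow> x \<in> K') \<Longrightarrow>
    (\<And>js x. length js \<le> m \<Longrightarrow> \<bar>partials js \<phi> x\<bar> \<le> \<beta>) \<Longrightarrow> \<bar>T \<phi>\<bar> \<le> C * \<beta>"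
    using distribution_bounded[OF assms(2) K'(1,2)] by blast
  obtain R where R: "R \<ge> 0" "K \<subseteq> cube R"
    using compact_subset_cube[OF assms(3)] .
  \<comment> \<open>From this value on, the scale exceeds the order of \<open>T\<close> on
    \<open>K'\<close>, the radius of \<open>K\<close>, and the threshold for supports in
    \<open>K'\<close>.\<close>
  let ?p = "Suc (m + nat \<lceil>max p\<^sub>0 R\<rceil>)"
  have "\<forall>\<^sub>F n in sequentially. ?p \<le> P n"
    using P(1) by (simp add: filterlim_at_top)
  with P(2) have "\<forall>\<^sub>F n in sequentially. \<forall>\<psi> \<beta>. {x. \<psi> x \<noteq> 0} \<subseteq> std_grid n \<inter> K \<longrightarrow>
    (\<forall>ks. length ks \<le> m \<longrightarrow> (\<forall>x. \<bar>grid_diffs n ks \<psi> x\<bar> \<le> \<beta>)) \<longrightarrow>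
    \<bar>std_inner n (regularize T (P n) n) \<psi>\<bar> \<le> C * 2 * \<beta>"
  proof (eventually_elim, intro allI impI)
    fix n \<beta> and \<psi> :: "real ^ 'n \<Rightarrow> real"
    assume good: "good_scale TYPE('n) (P n) n" and Pn: "?p \<le> P n"
      and supp: "{x. \<psi> x \<noteq> 0} \<subseteq> std_grid n \<inter> K"
      and \<beta>: "\<forall>ks. length ks \<le> m \<longrightarrow> (\<forall>x. \<bar>grid_diffs n ks \<psi> x\<bar> \<le> \<beta>)"
    have p: "real (P n) \<ge> p\<^sub>0" "real (P n) \<ge> R" "P n \<ge> m" "P n \<ge> 1"
      using Pn by linarith+
    have n: "P n \<le> n"
      using good by (simp add: good_scale_def)
    have fin: "finite (std_grid n :: (real ^ 'n) set)"
      using n p by (intro finite_std_grid) auto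
    have fin': "finite {x. \<psi> x \<noteq> 0}"
      using supp fin finite_subset by blast
    have k: "y \<in> K'" if "x \<in> K" "kernel (P n) n (x - y) \<noteq> 0" for x y
      using K'(4)[OF p(1) _ that] n by simp
    note reg = regularize_inner[OF assms(2) K'(1,2) supp fin k]
    have supp': "{x. \<psi> x \<noteq> 0} \<subseteq> lattice n \<inter> cube (P n)"
      using supp std_grid_lattice R(2) cube_mono[OF p(2)] by blast
    have \<psi>: "\<forall>x. \<bar>\<psi> x\<bar> \<le> \<beta>"
      using \<beta>[rule_format, of "[]"] by simp
    have g: "\<bar>partials (rev ks) (conv (P n) n \<psi>) y - conv (P n) n (grid_diffs n ks \<psi>) y\<bar> \<le> \<beta> / P n"
      if "length ks \<le> P n" for ks y
      using good supp' \<psi> that p(4) unfolding good_scale_def by blast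
    have b: "\<bar>partials js (conv (P n) n \<psi>) y\<bar> \<le> 2 * \<beta>" if "length js \<le> m" for js y
    proof -
      have "\<bar>partials (rev (rev js)) (conv (P n) n \<psi>) y - conv (P n) n (grid_diffs n (rev js) \<psi>) y\<bar> \<le> \<beta> / P n"
        using that p(3) by (intro g) simp
      moreover have "\<bar>conv (P n) n (grid_diffs n (rev js) \<psi>) y\<bar> \<le> \<beta>"
        using p n fin' lattice_grid_diffs_support[OF _ supp', of "rev js"] \<beta> that
        by (intro conv_le finite_grid_diffs_support) auto
      moreover have "0 \<le> \<beta>"
        using order_trans[OF abs_ge_zero \<psi>[rule_format, of 0]] .
      then have "\<beta> / P n \<le> \<beta>"
        using p(4) by (simp add: divide_le_eq mult_le_cancel_left1)
      ultimately show ?thesis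
        by simp
    qed
    have "\<bar>T (conv (P n) n \<psi>)\<bar> \<le> C * (2 * \<beta>)"
      by (rule C(2)[OF smooth_conv reg(2) b])
    then show "\<bar>std_inner n (regularize T (P n) n) \<psi>\<bar> \<le> C * 2 * \<beta>"
      using reg(1) by simp
  qed
  then show ?thesis
    using C(1) by (intro exI[of _ "C * 2"] exI[of _ m]) simp
qed

section \<open>Convergence of the regularized pairings\<close>

lemma test_function_uniformly_continuous:
  assumes "\<phi> \<in> test_functions \<Omega>" "e > 0"
  shows "\<exists>\<delta>>0. \<forall>x y. (\<forall>i. \<bar>x $ i - y $ i\<bar> \<le> \<delta>) \<longrightarrow> \<bar>partials js \<phi> x - partials js \<phi> y\<bar> < e"
proof -
  obtain K where K: "smooth \<phi>" "compact K" "K \<subseteq> \<Omega>" "\<And>x. \<phi> x \<noteq> 0 \<Longrightarrow> x \<in> K"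
    using test_functionsE[OF assms(1)] by blast
  obtain R where R: "R \<ge> 0" "K \<subseteq> cube R"
    using compact_subset_cube[OF K(2)] .
  let ?g = "partials js \<phi>"
  have zero: "?g x = 0" if "x \<notin> cube R" for x
    by (rule partials_eq_0_on_open[of "- cube R"])
      (use that K(4) R compact_cube compact_imp_closed in \<open>auto intro!: open_Compl\<close>)
  have "uniformly_continuous_on (cube (R + 1)) ?g"
    by (intro compact_uniformly_continuous smooth_continuous_on smooth_partials K(1) compact_cube)
  then obtain d where d: "d > 0" "\<And>x y. x \<in> cube (R + 1) \<Longrightarrow> y \<in> cube (R + 1) \<Longrightarrow> dist y x < d \<Longrightarrow> dist (?g y) (?g x) < e"
    unfolding uniformly_continuous_on_def using assms(2) by metis
  \<comment> \<open>Points that differ by at most 1 per coordinate lie either both in the larger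
    cube or both outside \<open>cube R\<close>, where the derivative vanishes.\<close>
  let ?\<delta> = "min 1 (d / (2 * CARD('a)))"
  have "\<bar>?g x - ?g y\<bar> < e" if xy: "\<And>i. \<bar>x $ i - y $ i\<bar> \<le> ?\<delta>" for x y
  proof (cases "x \<in> cube (R + 1) \<and> y \<in> cube (R + 1)")
    case True
    have "dist x y \<le> (\<Sum>i\<in>UNIV. \<bar>(x - y) $ i\<bar>)"
      unfolding dist_norm by (rule norm_le_l1_cart)
    also have "\<dots> \<le> (\<Sum>i\<in>(UNIV :: 'a set). d / (2 * CARD('a)))"
      using xy by (intro sum_mono) auto
    also have "\<dots> = d / 2"
      by simp
    also have "\<dots> < d"
      using d(1) by simp
    finally show ?thesis
      using d(2)[of y x] True by (simp add: dist_norm)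
  next
    case False
    have "x \<notin> cube R \<and> y \<notin> cube R"
    proof -
      have tri: "\<bar>x $ i\<bar> \<le> \<bar>y $ i\<bar> + 1" "\<bar>y $ i\<bar> \<le> \<bar>x $ i\<bar> + 1" for i
        using xy[of i] by auto
      obtain i where "\<bar>x $ i\<bar> > R + 1 \<or> \<bar>y $ i\<bar> > R + 1"
        using False by (auto simp: cube_def not_le)
      then have "\<bar>x $ i\<bar> > R" "\<bar>y $ i\<bar> > R"
        using tri[of i] by linarith+
      then show ?thesis
        by (auto simp: cube_def not_le)
    qed
    then show ?thesis
      using zero assms(2) by simp
  qed
  then show ?thesis
    using d(1) by (intro exI[of _ ?\<delta>]) auto
qed

text \<open>The mean value point is within \<open>length ks / n\<close> of \<open>x\<close> in each
  coordinate, and the derivative is uniformly continuous. Two separate points \<open>x\<close> and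
  \<open>y\<close> are allowed because \<open>conv_near\<close> averages over a
  neighbourhood.\<close>

lemma grid_diffs_near_partials:
  assumes "\<phi> \<in> test_functions \<Omega>" "e > 0"
  shows "\<exists>\<delta>>0. \<forall>\<^sub>F n in sequentially. \<forall>x y. (\<forall>i. \<bar>x $ i - y $ i\<bar> \<le> \<delta>) \<longrightarrow>
    \<bar>grid_diffs (real n) ks \<phi> x - partials (rev ks) \<phi> y\<bar> < e"
proof -
  obtain d where d: "d > 0"
    "\<And>x y. (\<And>i. \<bar>x $ i - y $ i\<bar> \<le> d) \<Longrightarrow> \<bar>partials (rev ks) \<phi> x - partials (rev ks) \<phi> y\<bar> < e"
    using test_function_uniformly_continuous[OF assms, of "rev ks"] by blast
  have sm: "smooth \<phi>"
    using test_functionsE[OF assms(1)] by blast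
  have "\<bar>grid_diffs (real n) ks \<phi> x - partials (rev ks) \<phi> y\<bar> < e"
    if n: "n \<ge> Suc (nat \<lceil>2 * length ks / d\<rceil>)" and xy: "\<And>i. \<bar>x $ i - y $ i\<bar> \<le> d / 2" for n x y
  proof -
    obtain z where z: "\<And>j. x $ j \<le> z $ j \<and> z $ j \<le> x $ j + length ks / real n"
      "grid_diffs n ks \<phi> x = partials (rev ks) \<phi> z"
      using grid_diffs_mean_value[OF sm, of "real n" x ks] n by auto
    have "2 * length ks / d \<le> real n"
      using n by linarith
    then have "length ks / real n \<le> d / 2"
      using d(1) n by (simp add: field_simps)
    then have "\<bar>z $ i - y $ i\<bar> \<le> d" for i
      using z(1)[of i] xy[of i] by linarith
    then show ?thesis
      using z(2) d(2) by simp
  qed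
  then have "\<forall>n\<ge>Suc (nat \<lceil>2 * length ks / d\<rceil>). \<forall>x y. (\<forall>i. \<bar>x $ i - y $ i\<bar> \<le> d / 2) \<longrightarrow>
    \<bar>grid_diffs (real n) ks \<phi> x - partials (rev ks) \<phi> y\<bar> < e"
    by blast
  then show ?thesis
    using d(1) by (intro exI[of _ "d / 2"]) (auto simp: eventually_sequentially)
qed

lemma test_function_partials_bounded:
  assumes "\<phi> \<in> test_functions \<Omega>"
  shows "\<exists>\<beta>. \<forall>x. \<bar>partials js \<phi> x\<bar> \<le> \<beta>"
proof -
  obtain K where K: "smooth \<phi>" "compact K" "K \<subseteq> \<Omega>" "\<And>x. \<phi> x \<noteq> 0 \<Longrightarrow> x \<in> K"
    using test_functionsE[OF assms(1)] by blast
  have "compact (partials js \<phi> ` K)"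
    by (intro compact_continuous_image smooth_continuous_on smooth_partials K)
  then obtain B where B: "\<And>x. x \<in> K \<Longrightarrow> \<bar>partials js \<phi> x\<bar> \<le> B"
    using compact_imp_bounded bounded_iff[of "partials js \<phi> ` K"] by (auto simp: real_norm_def)
  have "partials js \<phi> x = 0" if "x \<notin> K" for x
    by (rule partials_eq_0_on_open[of "- K"])
      (use that K compact_imp_closed in \<open>auto intro!: open_Compl\<close>)
  then have "\<bar>partials js \<phi> x\<bar> \<le> max B 0" for x
    using B[of x] by (cases "x \<in> K") auto
  then show ?thesis by blast
qed

text \<open>The lattice mass is exactly 1, so the deviation from \<open>c\<close> is an average of
  \<open>g x - c\<close> over lattice points within 1/p of \<open>y\<close>.\<close>

lemma conv_near:
  fixes g :: "real ^ 'n::finite \<Rightarrow> real"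
  assumes "p > 0" "n \<ge> p" "R \<ge> 0" "{x. g x \<noteq> 0} \<subseteq> lattice n \<inter> cube R"
    and e: "\<And>x. x \<in> lattice n \<Longrightarrow> (\<And>i. \<bar>x $ i - y $ i\<bar> \<le> 1 / p) \<Longrightarrow> \<bar>g x - c\<bar> \<le> e"
  shows "\<bar>conv p n g y - c\<bar> \<le> e"
proof -
  \<comment> \<open>Large enough for the box to contain the support of \<open>g\<close> and to reach
    1/p beyond \<open>y\<close>.\<close>
  define M where "M = nat \<lceil>(R + norm y + 1 / p) * n\<rceil>"
  have "n > 0"
    using assms by simp
  have Mn: "R + norm y + 1 / p \<le> M / n"
  proof -
    have "(R + norm y + 1 / p) * n \<le> M"
      unfolding M_def by linarith
    then show ?thesis
      using \<open>n > 0\<close> by (simp add: field_simps)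
  qed
  have "\<bar>y $ i\<bar> + 1 / p \<le> M / n" for i
    using Mn component_le_norm_cart[of y i] assms(3) by linarith
  note one = sum_kernel_eq_1[OF assms(1) \<open>n > 0\<close> this]
  have fin: "finite (box_lattice n M :: (real ^ 'n) set)"
    using \<open>n > 0\<close> by (intro finite_box_lattice) simp
  have sup: "x \<in> box_lattice n M" if "g x \<noteq> 0" for x
  proof -
    have "\<lfloor>R * n\<rfloor> \<le> \<lceil>(R + norm y + 1 / p) * n\<rceil>"
    proof -
      have "R * n \<le> (R + norm y + 1 / p) * n"
        using assms(1) \<open>n > 0\<close> by (intro mult_right_mono) auto
      then show ?thesis
        by linarith
    qed
    then have "nat \<lfloor>R * n\<rfloor> \<le> M"
      by (simp add: M_def nat_mono)
    then have "{- int (nat \<lfloor>R * n\<rfloor>)..int (nat \<lfloor>R * n\<rfloor>)} \<subseteq> {- int M..int M}"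
      by (metis atLeastatMost_subset_iff neg_le_iff_le of_nat_mono)
    then have "box_lattice n (nat \<lfloor>R * n\<rfloor>) \<subseteq> (box_lattice n M :: (real ^ 'n) set)"
      unfolding box_lattice_def by blast
    then show ?thesis
      using that assms(4) lattice_cube_subset[OF \<open>n > 0\<close> assms(3)] by blast
  qed
  have box: "(box_lattice n M :: (real ^ 'n) set) \<subseteq> lattice n"
    by (auto simp: box_lattice_def lattice_def)
  have "conv p n g y - c = (1 / n) ^ CARD('n) * (\<Sum>x\<in>box_lattice n M. g x * kernel p n (x - y))
      - c * ((1 / n) ^ CARD('n) * (\<Sum>x\<in>box_lattice n M. kernel p n (x - y)))"
    by (simp add: one conv_superset[OF fin sup])
  also have "\<dots> = (1 / n) ^ CARD('n) * (\<Sum>x\<in>box_lattice n M. (g x - c) * kernel p n (x - y))"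
    by (simp add: left_diff_distrib sum_subtractf right_diff_distrib sum_distrib_left mult.left_commute)
  finally have "\<bar>conv p n g y - c\<bar>
      = (1 / n) ^ CARD('n) * \<bar>\<Sum>x\<in>box_lattice n M. (g x - c) * kernel p n (x - y)\<bar>"
    using \<open>n > 0\<close> by (simp add: abs_mult)
  also have "\<dots> \<le> (1 / n) ^ CARD('n) * (\<Sum>x\<in>box_lattice n M. \<bar>(g x - c) * kernel p n (x - y)\<bar>)"
    using \<open>n > 0\<close> by (intro mult_left_mono sum_abs) simp
  also have "\<dots> \<le> (1 / n) ^ CARD('n) * (\<Sum>x\<in>box_lattice n M. e * kernel p n (x - y))"
  proof (intro mult_left_mono sum_mono)
    fix x :: "real ^ 'n"
    assume x: "x \<in> box_lattice n M"
    show "\<bar>(g x - c) * kernel p n (x - y)\<bar> \<le> e * kernel p n (x - y)"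
    proof (cases "kernel p n (x - y) = 0")
      case False
      have "\<bar>x $ i - y $ i\<bar> \<le> 1 / p" for i
        using kernel_eq_0[OF assms(1,2), of "x - y" i] False by fastforce
      then have "\<bar>g x - c\<bar> \<le> e"
        using e x box by blast
      moreover have "kernel p n (x - y) \<ge> 0"
        using assms(1) \<open>n > 0\<close> by (intro kernel_nonneg) auto
      ultimately show ?thesis
        by (simp add: abs_mult mult_right_mono)
    qed simp
  qed (use \<open>n > 0\<close> in simp)
  also have "\<dots> = e * ((1 / n) ^ CARD('n) * (\<Sum>x\<in>box_lattice n M. kernel p n (x - y)))"
    by (simp add: sum_distrib_left mult.left_commute)
  finally show ?thesis
    by (simp add: one)
qed

text \<open>Difference quotients at lattice points look at lattice points only. This lets a test
  function be replaced by its finitely supported restriction.\<close>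

lemma grid_diffs_lattice_cong:
  assumes "n \<noteq> 0" "\<And>x. x \<in> lattice n \<Longrightarrow> f x = g x" "x \<in> lattice n"
  shows "grid_diffs n ks f x = grid_diffs n ks g x"
  using assms(3)
proof (induction ks arbitrary: x)
  case (Cons k ks)
  have "x + axis k (1 / n) \<in> lattice n"
    unfolding lattice_def mem_Collect_eq
  proof
    fix i
    obtain m :: int where "x $ i = m / n"
      using Cons.prems by (auto simp: lattice_def)
    then have "(x + axis k (1 / n)) $ i = of_int (if i = k then m + 1 else m) / n"
      by (auto simp: axis_def add_divide_distrib)
    then show "\<exists>m::int. (x + axis k (1 / n)) $ i = m / n" by blast
  qed
  then show ?case
    using Cons by (simp add: grid_diff_def)
qed (use assms(2) in simp)

text \<open>The discrete convolutions of \<phi> converge to \<phi> in the space of test functions,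
  and the sequential continuity of \<open>T\<close> does the rest.\<close>

lemma regularize_tendsto:
  fixes \<phi> :: "real ^ 'n::finite \<Rightarrow> real"
  assumes "open \<Omega>" "T \<in> distributions \<Omega>" "\<phi> \<in> test_functions \<Omega>"
    and P: "filterlim P at_top sequentially" "\<forall>\<^sub>F n in sequentially. good_scale TYPE('n) (P n) n"
  shows "(\<lambda>n. std_inner n (regularize T (P n) n) \<phi>) \<longlonglongrightarrow> T \<phi>"
proof -
  obtain K where K: "smooth \<phi>" "compact K" "K \<subseteq> \<Omega>" "\<And>x. \<phi> x \<noteq> 0 \<Longrightarrow> x \<in> K"
    using test_functionsE[OF assms(3)] by blast
  obtain K' p\<^sub>0 where K': "compact K'" "K' \<subseteq> \<Omega>" "p\<^sub>0 \<ge> 1"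
    "\<And>p n x y. p \<ge> p\<^sub>0 \<Longrightarrow> n \<ge> p \<Longrightarrow> x \<in> K \<Longrightarrow> kernel p n (x - y) \<noteq> 0 \<Longrightarrow> y \<in> K'"
    using kernel_support[OF assms(1) K(2,3)] by blast
  obtain R where R: "R \<ge> 0" "K \<subseteq> cube R"
    using compact_subset_cube[OF K(2)] .
  \<comment> \<open>\<open>conv\<close> sums over the support, so \<phi> is first cut down to the
    finite grid.\<close>
  define \<psi> where "\<psi> = (\<lambda>n x. if x \<in> std_grid (real n) then \<phi> x else 0)"
  define \<theta> where "\<theta> = (\<lambda>n. conv (P n) n (\<psi> n))"
  define ok where "ok = (\<lambda>n. P n \<ge> 1 \<and> real (P n) \<ge> p\<^sub>0 \<and> real (P n) \<ge> R \<and> good_scale TYPE('n) (P n) n)"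
  have PX: "\<forall>\<^sub>F n in sequentially. X \<le> real (P n)" for X
  proof -
    have "\<forall>\<^sub>F n in sequentially. nat \<lceil>X\<rceil> \<le> P n"
      using P(1) unfolding filterlim_at_top by blast
    then show ?thesis
      by eventually_elim linarith
  qed
  have "\<forall>\<^sub>F n in sequentially. ok n"
    using P(2) PX[of 1] PX[of p\<^sub>0] PX[of R] by eventually_elim (simp add: ok_def)
  then obtain n\<^sub>1 where n\<^sub>1: "\<And>n. n \<ge> n\<^sub>1 \<Longrightarrow> ok n"
    by (auto simp: eventually_sequentially)
  have supp: "{x. \<psi> n x \<noteq> 0} \<subseteq> std_grid n \<inter> K" for n
    using K(4) by (auto simp: \<psi>_def)
  have props: "P n \<le> n" "n > 0" "real n \<ge> 1" "finite (std_grid n :: (real ^ 'n) set)"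
    "{x. \<psi> n x \<noteq> 0} \<subseteq> lattice n \<inter> cube (P n)" "{x. \<psi> n x \<noteq> 0} \<subseteq> lattice n \<inter> cube R"
    "\<And>x. x \<in> lattice n \<Longrightarrow> \<psi> n x = \<phi> x" if "ok n" for n
  proof -
    show n: "P n \<le> n" "n > 0" "real n \<ge> 1"
      using that by (auto simp: ok_def good_scale_def)
    then show "finite (std_grid n :: (real ^ 'n) set)"
      by (intro finite_std_grid)
    show R': "{x. \<psi> n x \<noteq> 0} \<subseteq> lattice n \<inter> cube R"
      using supp std_grid_lattice R(2) by blast
    then show "{x. \<psi> n x \<noteq> 0} \<subseteq> lattice n \<inter> cube (P n)"
      using cube_mono[of R "P n"] that unfolding ok_def by blast
    have "lattice n \<inter> cube R \<subseteq> std_grid n"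
      using n that R(1) by (intro lattice_cube_std_grid) (auto simp: ok_def)
    then show "\<psi> n x = \<phi> x" if "x \<in> lattice n" for x
      using that K(4)[of x] R(2) by (auto simp: \<psi>_def)
  qed
  have k: "y \<in> K'" if "ok n" "x \<in> K" "kernel (P n) n (x - y) \<noteq> 0" for x y n
    using K'(4)[of "P n" n x y] props[OF that(1)] that by (auto simp: ok_def)
  note reg = regularize_inner[OF assms(2) K'(1,2) supp props(4) k]
  have inner: "std_inner n (regularize T (P n) n) \<phi> = T (\<theta> n)" if "ok n" for n
  proof -
    have "std_inner n (regularize T (P n) n) \<phi> = std_inner n (regularize T (P n) n) (\<psi> n)"
      unfolding std_inner_def \<psi>_def by (intro arg_cong2[of _ _ _ _ "(*)"] refl sum.cong) auto
    then show ?thesis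
      using reg(1)[OF that that] by (simp add: \<theta>_def)
  qed
  obtain \<beta> where \<beta>: "\<And>x. \<bar>\<phi> x\<bar> \<le> \<beta>"
    using test_function_partials_bounded[OF assms(3), of "[]"] by auto
  \<comment> \<open>The error splits into the one allowed by \<open>good_scale\<close> and the
    averaging error of \<open>conv_near\<close>.\<close>
  have close: "\<bar>partials js (\<theta> n) y - partials js \<phi> y\<bar> \<le> \<beta> / P n + e"
    if ok: "ok n" and p: "length js \<le> P n"
      and e: "\<And>x. (\<And>i. \<bar>x $ i - y $ i\<bar> \<le> 1 / P n) \<Longrightarrow> \<bar>grid_diffs n (rev js) \<phi> x - partials js \<phi> y\<bar> \<le> e"
    for js n y e
  proof -
    have "\<forall>x. \<bar>\<psi> n x\<bar> \<le> \<beta>"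
      using \<beta> order_trans[OF abs_ge_zero \<beta>] by (auto simp: \<psi>_def)
    moreover have "good_scale TYPE('n) (P n) n" "P n \<ge> 1" "length (rev js) \<le> P n"
      using ok p by (auto simp: ok_def)
    ultimately have "\<bar>partials (rev (rev js)) (\<theta> n) y - conv (P n) n (grid_diffs n (rev js) (\<psi> n)) y\<bar> \<le> \<beta> / P n"
      using props(5)[OF ok] unfolding \<theta>_def good_scale_def by blast
    moreover have "\<bar>conv (P n) n (grid_diffs n (rev js) (\<psi> n)) y - partials js \<phi> y\<bar> \<le> e"
    proof (rule conv_near)
      show "{x. grid_diffs n (rev js) (\<psi> n) x \<noteq> 0} \<subseteq> lattice n \<inter> cube (R + length (rev js))"
        by (rule lattice_grid_diffs_support[OF props(3,6)[OF ok]])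
      show "\<bar>grid_diffs n (rev js) (\<psi> n) x - partials js \<phi> y\<bar> \<le> e"
        if "x \<in> lattice n" "\<And>i. \<bar>x $ i - y $ i\<bar> \<le> 1 / P n" for x
        using grid_diffs_lattice_cong[of "real n" "\<psi> n" \<phi> x "rev js"] props(2,7)[OF ok] that e by simp
    qed (use ok props[OF ok] R(1) in \<open>auto simp: ok_def\<close>)
    ultimately show ?thesis
      by simp
  qed
  \<comment> \<open>\<open>tends_test\<close> makes demands on every index, so the finitely many bad
    scales are dropped by a shift.\<close>
  have "tends_test \<Omega> (\<lambda>n. \<theta> (n + n\<^sub>1)) \<phi>"
    unfolding tends_test_def
  proof (intro conjI allI assms(3))
    have ok: "ok (n + n\<^sub>1)" for n
      using n\<^sub>1 by simp
    show "\<theta> (n + n\<^sub>1) \<in> test_functions \<Omega>" for n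
      unfolding \<theta>_def using reg(3)[OF ok ok] .
    show "\<exists>K. compact K \<and> K \<subseteq> \<Omega> \<and> (\<forall>n x. \<theta> (n + n\<^sub>1) x \<noteq> 0 \<longrightarrow> x \<in> K)"
      unfolding \<theta>_def by (intro exI[of _ K'] conjI allI impI K'(1,2)) (rule reg(2)[OF ok ok])
    show "uniform_limit UNIV (\<lambda>n. partials js (\<theta> (n + n\<^sub>1))) (partials js \<phi>) sequentially" for js
      unfolding uniform_limit_iff
    proof (intro allI impI)
      fix e :: real assume "e > 0"
      obtain d where d: "d > 0" "\<forall>\<^sub>F n in sequentially. \<forall>x y. (\<forall>i. \<bar>x $ i - y $ i\<bar> \<le> d) \<longrightarrow>
          \<bar>grid_diffs (real n) (rev js) \<phi> x - partials (rev (rev js)) \<phi> y\<bar> < e / 2"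
        using grid_diffs_near_partials[OF assms(3), of "e / 2" "rev js"] \<open>e > 0\<close> by auto
      have "\<forall>\<^sub>F n in sequentially. \<forall>y. dist (partials js (\<theta> n) y) (partials js \<phi> y) < e"
        using d(2) PX[of "1 / d"] PX[of "3 * \<beta> / e"] PX[of "length js"] eventually_ge_at_top[of n\<^sub>1]
      proof eventually_elim
        case (elim n)
        note ok = n\<^sub>1[OF elim(5)]
        have P1: "P n \<ge> 1" using ok by (simp add: ok_def)
        have "1 / P n \<le> d" "\<beta> / P n \<le> e / 3"
          using elim(2,3) d(1) P1 \<open>e > 0\<close> by (auto simp: field_simps)
        have "\<bar>partials js (\<theta> n) y - partials js \<phi> y\<bar> \<le> \<beta> / P n + e / 2" for y
        proof (rule close[OF ok])
          show "length js \<le> P n" using elim(4) by simp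
          show "\<bar>grid_diffs n (rev js) \<phi> x - partials js \<phi> y\<bar> \<le> e / 2"
            if x: "\<And>i. \<bar>x $ i - y $ i\<bar> \<le> 1 / P n" for x
          proof -
            have "\<forall>i. \<bar>x $ i - y $ i\<bar> \<le> d"
              using order_trans[OF x \<open>1 / P n \<le> d\<close>] by blast
            then have "\<bar>grid_diffs n (rev js) \<phi> x - partials (rev (rev js)) \<phi> y\<bar> < e / 2"
              using elim(1) by blast
            then show ?thesis by simp
          qed
        qed
        then show ?case
          using \<open>\<beta> / P n \<le> e / 3\<close> \<open>e > 0\<close> by (force simp: dist_norm intro: le_less_trans)
      qed
      then have "\<forall>\<^sub>F n in sequentially. \<forall>y. dist (partials js (\<theta> (n + n\<^sub>1)) y) (partials js \<phi> y) < e"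
        by (rule sequentially_offset)
      then show "\<forall>\<^sub>F n in sequentially. \<forall>x\<in>UNIV. dist (partials js (\<theta> (n + n\<^sub>1)) x) (partials js \<phi> x) < e"
        by simp
    qed
  qed
  from distributionD(3)[OF assms(2) this]
  have "(\<lambda>n. T (\<theta> n)) \<longlonglongrightarrow> T \<phi>"
    by (rule LIMSEQ_offset)
  moreover have "\<forall>\<^sub>F n in sequentially. T (\<theta> n) = std_inner n (regularize T (P n) n) \<phi>"
    using inner n\<^sub>1 by (intro eventually_sequentiallyI[of n\<^sub>1]) simp
  ultimately show ?thesis
    by (rule Lim_transform_eventually)
qed

section \<open>Transfer of statements built from terms\<close>

text \<open>A strict bound for the indices of the free variables, used to find fresh ones. Any bound
  will do, so sums replace maxima and quantifiers do not lower it.\<close>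

primrec var_bound :: "'n::finite formula \<Rightarrow> nat" where
  "var_bound (Rel R xs) = Suc (sum_list xs)"
| "var_bound (Eq x y) = Suc (x + y)"
| "var_bound (Less x y) = Suc (x + y)"
| "var_bound (Plus x y z) = Suc (x + y + z)"
| "var_bound (Times x y z) = Suc (x + y + z)"
| "var_bound (Comp v i x) = Suc (v + x)"
| "var_bound (App f v x) = Suc (f + v + x)"
| "var_bound (Mem x y) = Suc (x + y)"
| "var_bound (Neg p) = var_bound p"
| "var_bound (Conj p q) = var_bound p + var_bound q"
| "var_bound (All x p) = var_bound p"

lemma sat_cong:
  "(\<And>i. i < var_bound p \<Longrightarrow> e i = e' i) \<Longrightarrow> sat D I e p \<longleftrightarrow> sat D I e' p"
proof (induction p arbitrary: e e')
  case (Rel R xs)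
  have eq: "map e xs = map e' xs"
    using Rel member_le_sum_list[of _ xs] by (intro map_cong) (auto simp: less_Suc_eq_le)
  show ?case by (simp only: sat.simps eq)
next
  case (Conj p q)
  have "sat D I e p \<longleftrightarrow> sat D I e' p" "sat D I e q \<longleftrightarrow> sat D I e' q"
    by (intro Conj.IH Conj.prems; simp)+
  then show ?case by simp
next
  case (All x p)
  have "sat D I (e(x := d)) p \<longleftrightarrow> sat D I (e'(x := d)) p" for d
    by (intro All.IH) (use All.prems in simp)
  then show ?case by simp
next
  case (Neg p)
  have "sat D I e p \<longleftrightarrow> sat D I e' p"
    by (intro Neg.IH Neg.prems; simp)
  then show ?case by simp
qed (simp_all)

text \<open>
  A context assigns values to numerical, vector and function variables, each indexed by the natural
  numbers; its encoding lets the formula variables alternate between the three kinds.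
\<close>

definition nv :: "nat \<Rightarrow> nat" where "nv k = 3 * k"
definition vv :: "nat \<Rightarrow> nat" where "vv k = 3 * k + 1"
definition fv :: "nat \<Rightarrow> nat" where "fv k = 3 * k + 2"

definition enc ::
  "(nat \<Rightarrow> 'r) \<Rightarrow> (nat \<Rightarrow> 'r ^ 'n::finite) \<Rightarrow> (nat \<Rightarrow> 'r ^ 'n \<Rightarrow> 'r) \<Rightarrow> nat \<Rightarrow> ('r, 'n) entity" where
  "enc a b f i = (if i mod 3 = 0 then Num (a (i div 3))
    else if i mod 3 = 1 then Vec (b (i div 3)) else Fun (f (i div 3)))"

lemma enc_simps [simp]:
  "enc a b f (nv k) = Num (a k)"
  "enc a b f (vv k) = Vec (b k)"
  "enc a b f (fv k) = Fun (f k)"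
proof -
  have "(3 * k + 1) mod 3 = 1" "(3 * k + 1) div 3 = k" "(3 * k + 2) mod 3 = 2" "(3 * k + 2) div 3 = k"
    by presburger+
  then show "enc a b f (nv k) = Num (a k)" "enc a b f (vv k) = Vec (b k)" "enc a b f (fv k) = Fun (f k)"
    unfolding enc_def nv_def vv_def fv_def by simp_all
qed

lemma enc_upd:
  "(enc a b f)(nv k := Num r) = enc (a(k := r)) b f"
  "(enc a b f)(vv k := Vec v) = enc a (b(k := v)) f"
  "(enc a b f)(fv k := Fun g) = enc a b (f(k := g))"
proof -
  have k: "i div 3 = k \<longleftrightarrow> i = 3 * k + i mod 3" for i :: nat
    by presburger
  have m: "(3 * k + 1) mod 3 = 1" "(3 * k + 1) div 3 = k" "(3 * k + 2) mod 3 = 2" "(3 * k + 2) div 3 = k"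
    by presburger+
  have "i = 3 * k \<longleftrightarrow> i mod 3 = 0 \<and> i div 3 = k" "i = 3 * k + 1 \<longleftrightarrow> i mod 3 = 1 \<and> i div 3 = k"
    "i = 3 * k + 2 \<longleftrightarrow> i mod 3 = 2 \<and> i div 3 = k" for i :: nat
    by presburger+
  note e = this
  have i3: "i mod 3 = 2" if "i mod 3 \<noteq> 0" "i mod 3 \<noteq> 1" for i :: nat
    using that by presburger
  show "(enc a b f)(nv k := Num r) = enc (a(k := r)) b f"
    "(enc a b f)(vv k := Vec v) = enc a (b(k := v)) f"
    "(enc a b f)(fv k := Fun g) = enc a b (f(k := g))"
    unfolding fun_eq_iff enc_def nv_def vv_def fv_def fun_upd_apply e using i3 by auto
qed

text \<open>Quantifiers of formulas range over entities of all sorts, so each sort needs a defining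
  formula: a number can be added to itself, a vector has a component, a function has a value at some
  vector.\<close>

definition is_num :: "nat \<Rightarrow> 'n::finite formula" where
  "is_num x = Neg (All (Suc x) (Neg (Plus x x (Suc x))))"

definition is_vec :: "nat \<Rightarrow> 'n::finite formula" where
  "is_vec x = Neg (All (Suc x) (Neg (Comp x undefined (Suc x))))"

definition is_fun :: "nat \<Rightarrow> 'n::finite formula" where
  "is_fun x = Neg (All (Suc x) (Neg (Neg (All (Suc (Suc x)) (Neg (App x (Suc x) (Suc (Suc x))))))))"

lemma sat_is_num: "(\<And>a. Num a \<in> D) \<Longrightarrow> sat D I e (is_num x) \<longleftrightarrow> (\<exists>a. e x = Num a)"
  by (auto simp: is_num_def)

lemma sat_is_vec: "(\<And>a. Num a \<in> D) \<Longrightarrow> sat D I e (is_vec x) \<longleftrightarrow> (\<exists>w. e x = Vec w)"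
  by (auto simp: is_vec_def)

lemma sat_is_fun:
  "(\<And>a. Num a \<in> D) \<Longrightarrow> (\<And>w. Vec w \<in> D) \<Longrightarrow> sat D I e (is_fun x) \<longleftrightarrow> (\<exists>g. e x = Fun g)"
  by (auto simp: is_fun_def)

text \<open>Freshness for terms outside the formula language: variables of all three kinds are
  irrelevant from index \<open>m\<close> on. The set \<open>F\<close> confines function variables to
  internal functions on the nonstandard side, since \<open>tr\<close> says nothing about other
  contexts.\<close>

definition depends ::
  "('r ^ 'n::finite \<Rightarrow> 'r) set \<Rightarrow> nat \<Rightarrow>
    ((nat \<Rightarrow> 'r) \<Rightarrow> (nat \<Rightarrow> 'r ^ 'n) \<Rightarrow> (nat \<Rightarrow> 'r ^ 'n \<Rightarrow> 'r) \<Rightarrow> 'a) \<Rightarrow> bool" where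
  "depends F m s \<longleftrightarrow> (\<forall>a a' b b' f f'. (\<forall>k. f k \<in> F) \<longrightarrow> (\<forall>k. f' k \<in> F) \<longrightarrow>
    (\<forall>i<m. a i = a' i \<and> b i = b' i \<and> f i = f' i) \<longrightarrow> s a b f = s a' b' f')"

lemma dependsD:
  assumes "depends F m s" "\<And>k. f k \<in> F" "\<And>k. f' k \<in> F"
    "\<And>i. i < m \<Longrightarrow> a i = a' i" "\<And>i. i < m \<Longrightarrow> b i = b' i" "\<And>i. i < m \<Longrightarrow> f i = f' i"
  shows "s a b f = s a' b' f'"
  by (rule assms(1)[unfolded depends_def, rule_format]) (use assms(2-) in auto)

lemma depends_mono: "depends F m s \<Longrightarrow> m \<le> m' \<Longrightarrow> depends F m' s"
  unfolding depends_def by (intro allI impI) (simp add: less_le_trans)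

lemma depends_comp2:
  "depends F m s \<Longrightarrow> depends F m' s' \<Longrightarrow> depends F (max m m') (\<lambda>a b f. g (s a b f) (s' a b f))"
  unfolding depends_def by (intro allI impI arg_cong2[of _ _ _ _ g]) (simp_all add: less_max_iff_disj)

lemma depends_upd:
  assumes "depends F m s" "\<And>k. f k \<in> F" "m \<le> x"
  shows "s (a(x := r)) b f = s a b f" "s a (b(x := v)) f = s a b f"
    "g \<in> F \<Longrightarrow> s a b (f(x := g)) = s a b f"
  by (rule dependsD[OF assms(1)]; use assms in simp)+

locale nonstandard =
  fixes E :: "('h::linordered_field, 'n::finite) extension"
  assumes ext: "nonstandard_extension E"
begin

lemma internal_num [simp]: "Num a \<in> internal E"
  and internal_vec [simp]: "Vec v \<in> internal E"
  using ext unfolding nonstandard_extension_def by blast+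

lemma transfer_sat: "sat UNIV id e p \<longleftrightarrow> sat (internal E) (star_rel E) (star E \<circ> e) p"
  using ext unfolding nonstandard_extension_def by blast

lemma internal_star: "star E c \<in> internal E"
proof -
  have "sat UNIV id (\<lambda>_. c) (Rel {[c] | c. True} [0])"
    by simp
  then show ?thesis
    unfolding transfer_sat by (simp add: internal_def)
qed

text \<open>Atoms detect sorts: \<open>Less\<close> holds between numbers only, so transferring one
  true instance forces the image of a number to be a number.\<close>

lemma star_num: "star E (Num r) = Num (hreal E r)"
proof -
  have "sat UNIV id (\<lambda>i. if i = 0 then Num r else Num (r + 1)) (Less 0 1 :: 'n formula)"
    by simp
  then have "\<exists>a. star E (Num r) = Num a"
    unfolding transfer_sat by auto
  then show ?thesis
    by (auto simp: hreal_def)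
qed

lemma star_vec: "star E (Vec v) = Vec (hvec E v)"
proof -
  have "sat UNIV id (\<lambda>i. if i = 0 then Vec v else Num (v $ undefined)) (Comp 0 undefined 1)"
    by simp
  then show ?thesis
    unfolding transfer_sat by (auto simp: hvec_def)
qed

lemma star_fun: "star E (Fun g) = Fun (hfun E g)"
proof -
  have "sat UNIV id (\<lambda>i. if i = 0 then Fun g else if i = 1 then Vec 0 else Num (g 0)) (App 0 1 2)"
    by simp
  then show ?thesis
    unfolding transfer_sat by (auto simp: hfun_def)
qed

definition ifuns :: "('h ^ 'n \<Rightarrow> 'h) set" where
  "ifuns = {g. Fun g \<in> internal E}"

text \<open>
  \<open>tr P Q\<close>: some formula expresses the property \<open>P\<close> of standard contexts and the property \<open>Q\<close> of
  nonstandard contexts. Similarly, \<open>tnum\<close>, \<open>tvec\<close> and \<open>tfun\<close> relate a standard and a nonstandard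
  term for a number, a vector and a function.
\<close>

definition tr where
  "tr P Q \<longleftrightarrow> (\<exists>p. (\<forall>a b f. P a b f \<longleftrightarrow> sat UNIV id (enc a b f) p) \<and>
    (\<forall>a b f. (\<forall>k. f k \<in> ifuns) \<longrightarrow> (Q a b f \<longleftrightarrow> sat (internal E) (star_rel E) (enc a b f) p)))"

lemma trI:
  assumes "\<forall>a b f. P a b f \<longleftrightarrow> sat UNIV id (enc a b f) p"
    and "\<And>a b f. (\<And>k. f k \<in> ifuns) \<Longrightarrow> Q a b f \<longleftrightarrow> sat (internal E) (star_rel E) (enc a b f) p"
  shows "tr P Q"
  unfolding tr_def using assms by blast

lemma trE:
  assumes "tr P Q"
  obtains p where "\<forall>a b f. P a b f \<longleftrightarrow> sat UNIV id (enc a b f) p"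
    and "\<forall>a b f. (\<forall>k. f k \<in> ifuns) \<longrightarrow> (Q a b f \<longleftrightarrow> sat (internal E) (star_rel E) (enc a b f) p)"
  using assms unfolding tr_def by blast

lemma tr_cong:
  assumes "tr P Q" "\<And>a b f. P' a b f \<longleftrightarrow> P a b f"
    and "\<And>a b f. (\<And>k. f k \<in> ifuns) \<Longrightarrow> Q' a b f \<longleftrightarrow> Q a b f"
  shows "tr P' Q'"
  using assms unfolding tr_def by auto

lemma tr_not: "tr P Q \<Longrightarrow> tr (\<lambda>a b f. \<not> P a b f) (\<lambda>a b f. \<not> Q a b f)"
proof -
  assume "tr P Q"
  then obtain p where "\<forall>a b f. P a b f \<longleftrightarrow> sat UNIV id (enc a b f) p"
    "\<forall>a b f. (\<forall>k. f k \<in> ifuns) \<longrightarrow> (Q a b f \<longleftrightarrow> sat (internal E) (star_rel E) (enc a b f) p)"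
    by (rule trE)
  then show ?thesis
    by (intro trI[where p="Neg p"]) auto
qed

lemma tr_conj:
  assumes "tr P Q" "tr P' Q'"
  shows "tr (\<lambda>a b f. P a b f \<and> P' a b f) (\<lambda>a b f. Q a b f \<and> Q' a b f)"
proof -
  obtain p where "\<forall>a b f. P a b f \<longleftrightarrow> sat UNIV id (enc a b f) p"
    "\<forall>a b f. (\<forall>k. f k \<in> ifuns) \<longrightarrow> (Q a b f \<longleftrightarrow> sat (internal E) (star_rel E) (enc a b f) p)"
    using trE[OF assms(1)] .
  moreover obtain p' where "\<forall>a b f. P' a b f \<longleftrightarrow> sat UNIV id (enc a b f) p'"
    "\<forall>a b f. (\<forall>k. f k \<in> ifuns) \<longrightarrow> (Q' a b f \<longleftrightarrow> sat (internal E) (star_rel E) (enc a b f) p')"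
    using trE[OF assms(2)] .
  ultimately show ?thesis
    by (intro trI[where p="Conj p p'"]) auto
qed

lemma tr_disj:
  "tr P Q \<Longrightarrow> tr P' Q' \<Longrightarrow> tr (\<lambda>a b f. P a b f \<or> P' a b f) (\<lambda>a b f. Q a b f \<or> Q' a b f)"
  using tr_not[OF tr_conj[OF tr_not tr_not]] by simp

lemma tr_imp:
  "tr P Q \<Longrightarrow> tr P' Q' \<Longrightarrow> tr (\<lambda>a b f. P a b f \<longrightarrow> P' a b f) (\<lambda>a b f. Q a b f \<longrightarrow> Q' a b f)"
  using tr_not[OF tr_conj[OF _ tr_not]] by simp

text \<open>All hyperreals are internal, so the quantifier relativized to numbers is the full
  quantifier on both sides.\<close>

lemma tr_all_num:
  assumes "tr P Q"
  shows "tr (\<lambda>a b f. \<forall>r. P (a(k := r)) b f) (\<lambda>a b f. \<forall>r. Q (a(k := r)) b f)"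
proof -
  obtain p where p: "\<forall>a b f. P a b f \<longleftrightarrow> sat UNIV id (enc a b f) p"
    "\<forall>a b f. (\<forall>k. f k \<in> ifuns) \<longrightarrow> (Q a b f \<longleftrightarrow> sat (internal E) (star_rel E) (enc a b f) p)"
    using trE[OF assms] .
  show ?thesis
    by (rule trI[where p="All (nv k) (Neg (Conj (is_num (nv k)) (Neg p)))"])
      (auto simp: p sat_is_num enc_upd[symmetric])
qed

lemma tr_all_vec:
  assumes "tr P Q"
  shows "tr (\<lambda>a b f. \<forall>v. P a (b(k := v)) f) (\<lambda>a b f. \<forall>v. Q a (b(k := v)) f)"
proof -
  obtain p where p: "\<forall>a b f. P a b f \<longleftrightarrow> sat UNIV id (enc a b f) p"
    "\<forall>a b f. (\<forall>k. f k \<in> ifuns) \<longrightarrow> (Q a b f \<longleftrightarrow> sat (internal E) (star_rel E) (enc a b f) p)"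
    using trE[OF assms] .
  show ?thesis
    by (rule trI[where p="All (vv k) (Neg (Conj (is_vec (vv k)) (Neg p)))"])
      (auto simp: p sat_is_vec enc_upd[symmetric])
qed

text \<open>Here the two sides part: the nonstandard quantifier reaches internal functions only,
  which also keeps the updated context admissible for \<open>tr\<close>.\<close>

lemma tr_all_fun:
  assumes "tr P Q"
  shows "tr (\<lambda>a b f. \<forall>g. P a b (f(k := g))) (\<lambda>a b f. \<forall>g\<in>ifuns. Q a b (f(k := g)))"
proof -
  obtain p where p: "\<forall>a b f. P a b f \<longleftrightarrow> sat UNIV id (enc a b f) p"
    "\<forall>a b f. (\<forall>k. f k \<in> ifuns) \<longrightarrow> (Q a b f \<longleftrightarrow> sat (internal E) (star_rel E) (enc a b f) p)"
    using trE[OF assms] .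
  let ?p = "All (fv k) (Neg (Conj (is_fun (fv k)) (Neg p)))"
  have 1: "(\<forall>g. P a b (f(k := g))) \<longleftrightarrow> sat UNIV id (enc a b f) ?p" for a b f
    by (auto simp: p sat_is_fun enc_upd[symmetric])
  have 2: "(\<forall>g\<in>ifuns. Q a b (f(k := g))) \<longleftrightarrow> sat (internal E) (star_rel E) (enc a b f) ?p"
    if f: "\<And>k. f k \<in> ifuns" for a b f
  proof -
    have "Q a b (f(k := g)) \<longleftrightarrow> sat (internal E) (star_rel E) ((enc a b f)(fv k := Fun g)) p"
      if "g \<in> ifuns" for g
      unfolding enc_upd using f that by (intro p(2)[rule_format]) simp
    then show ?thesis
      by (auto simp: sat_is_fun ifuns_def)
  qed
  show ?thesis
    by (rule trI[where p="?p"]) (use 1 2 in blast)+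
qed

lemma tr_ex_num:
  "tr P Q \<Longrightarrow> tr (\<lambda>a b f. \<exists>r. P (a(k := r)) b f) (\<lambda>a b f. \<exists>r. Q (a(k := r)) b f)"
  using tr_not[OF tr_all_num[OF tr_not]] by simp

lemma tr_ex_fun:
  "tr P Q \<Longrightarrow> tr (\<lambda>a b f. \<exists>g. P a b (f(k := g))) (\<lambda>a b f. \<exists>g\<in>ifuns. Q a b (f(k := g)))"
  using tr_not[OF tr_all_fun[OF tr_not]] by simp

lemma tr_const: "tr (\<lambda>a b f. c) (\<lambda>a b f. c)"
proof -
  have "tr (\<lambda>a b f. True) (\<lambda>a b f. True)"
    by (rule trI[where p="Eq 0 0"]) auto
  then show ?thesis
    using tr_not[of "\<lambda>a b f. True" "\<lambda>a b f. True"] by (cases c) auto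
qed

lemma tr_ball_finite:
  assumes "finite A" "\<And>i. i \<in> A \<Longrightarrow> tr (P i) (Q i)"
  shows "tr (\<lambda>a b f. \<forall>i\<in>A. P i a b f) (\<lambda>a b f. \<forall>i\<in>A. Q i a b f)"
  using assms
proof (induction A rule: finite_induct)
  case empty
  then show ?case using tr_const[of True] by simp
next
  case (insert i A)
  then show ?case using tr_conj[of "P i" "Q i"] by simp
qed

text \<open>A formula has finitely many variables. Decoding an index by \<open>div 3\<close> does
  not raise it, so one bound serves all three kinds.\<close>

lemma tr_depends:
  assumes "tr P Q"
  shows "\<exists>m. depends UNIV m P \<and> depends ifuns m Q"
proof -
  obtain p where p: "\<forall>a b f. P a b f \<longleftrightarrow> sat UNIV id (enc a b f) p"
    "\<forall>a b f. (\<forall>k. f k \<in> ifuns) \<longrightarrow> (Q a b f \<longleftrightarrow> sat (internal E) (star_rel E) (enc a b f) p)"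
    using trE[OF assms] .
  have encr: "enc a b f i = enc a' b' f' i"
    if "\<forall>i<var_bound p. a i = a' i \<and> b i = b' i \<and> f i = f' i" "i < var_bound p"
    for a a' :: "nat \<Rightarrow> real" and b b' :: "nat \<Rightarrow> real ^ 'n" and f f' i
  proof -
    have "i div 3 < var_bound p"
      using that(2) by (meson div_le_dividend le_less_trans)
    then show ?thesis
      using that(1) by (simp add: enc_def)
  qed
  have ench: "enc a b f i = enc a' b' f' i"
    if "\<forall>i<var_bound p. a i = a' i \<and> b i = b' i \<and> f i = f' i" "i < var_bound p"
    for a a' :: "nat \<Rightarrow> 'h" and b b' :: "nat \<Rightarrow> 'h ^ 'n" and f f' i
  proof -
    have "i div 3 < var_bound p"
      using that(2) by (meson div_le_dividend le_less_trans)
    then show ?thesis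
      using that(1) by (simp add: enc_def)
  qed
  have "depends UNIV (var_bound p) P"
    unfolding depends_def
  proof (intro allI impI)
    fix a a' :: "nat \<Rightarrow> real" and b b' :: "nat \<Rightarrow> real ^ 'n" and f f' :: "nat \<Rightarrow> real ^ 'n \<Rightarrow> real"
    assume eq: "\<forall>i<var_bound p. a i = a' i \<and> b i = b' i \<and> f i = f' i"
    show "P a b f = P a' b' f'"
      unfolding p(1)[rule_format] by (intro sat_cong encr[OF eq])
  qed
  moreover have "depends ifuns (var_bound p) Q"
    unfolding depends_def
  proof (intro allI impI)
    fix a a' :: "nat \<Rightarrow> 'h" and b b' :: "nat \<Rightarrow> 'h ^ 'n" and f f'
    assume f: "\<forall>k. f k \<in> ifuns" "\<forall>k. f' k \<in> ifuns"
      and eq: "\<forall>i<var_bound p. a i = a' i \<and> b i = b' i \<and> f i = f' i"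
    show "Q a b f = Q a' b' f'"
      unfolding p(2)[rule_format, OF f(1)[rule_format]] p(2)[rule_format, OF f(2)[rule_format]] by (intro sat_cong ench[OF eq])
  qed
  ultimately show ?thesis by blast
qed

text \<open>Transfer speaks only about star images of standard contexts, whereas the values of
  interest may be nonstandard. Quantifying over all variables below \<open>m\<close>, one of each
  kind per step, frees the statement from them.\<close>

lemma tr_closure:
  assumes "tr P Q" "\<And>a b f. P a b f"
  shows "\<exists>P' Q'. tr P' Q' \<and> (\<forall>a b f. P' a b f) \<and>
    (\<forall>a b f a' b' f'. (\<forall>k. f k \<in> ifuns) \<longrightarrow> (\<forall>k. f' k \<in> ifuns) \<longrightarrow> Q' a b f \<longrightarrow>
      (\<forall>i\<ge>m. a i = a' i \<and> b i = b' i \<and> f i = f' i) \<longrightarrow> Q a' b' f')"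
proof (induction m)
  case 0
  have "a = a' \<and> b = b' \<and> f = f'" if "\<forall>i\<ge>0. a i = a' i \<and> b i = b' i \<and> f i = f' i"
    for a a' :: "nat \<Rightarrow> 'h" and b b' :: "nat \<Rightarrow> 'h ^ 'n" and f f' :: "nat \<Rightarrow> 'h ^ 'n \<Rightarrow> 'h"
    using that by auto
  then show ?case
    using assms by blast
next
  case (Suc m)
  then obtain P' Q' where PQ: "tr P' Q'" "\<forall>a b f. P' a b f"
    "\<forall>a b f a' b' f'. (\<forall>k. f k \<in> ifuns) \<longrightarrow> (\<forall>k. f' k \<in> ifuns) \<longrightarrow> Q' a b f \<longrightarrow>
      (\<forall>i\<ge>m. a i = a' i \<and> b i = b' i \<and> f i = f' i) \<longrightarrow> Q a' b' f'"
    by (elim exE conjE) (rule that)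
  let ?P = "\<lambda>a b f. \<forall>g. \<forall>v. \<forall>r. P' (a(m := r)) (b(m := v)) (f(m := g))"
  let ?Q = "\<lambda>a b f. \<forall>g\<in>ifuns. \<forall>v. \<forall>r. Q' (a(m := r)) (b(m := v)) (f(m := g))"
  have "tr ?P ?Q"
    using tr_all_fun[OF tr_all_vec[OF tr_all_num[OF PQ(1)]]] .
  moreover have "Q a' b' f'" if fi: "\<forall>k. f k \<in> ifuns" "\<forall>k. f' k \<in> ifuns" "?Q a b f"
    and agree: "\<forall>i\<ge>Suc m. a i = a' i \<and> b i = b' i \<and> f i = f' i" for a b f a' b' f'
  proof (rule PQ(3)[rule_format, of "f(m := f' m)" f' "a(m := a' m)" "b(m := b' m)"])
    show "(a(m := a' m)) i = a' i \<and> (b(m := b' m)) i = b' i \<and> (f(m := f' m)) i = f' i" if "m \<le> i" for i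
      using that agree by (cases "i = m") auto
  qed (use fi in auto)
  moreover have "\<forall>a b f. ?P a b f"
    using PQ(2) by simp
  ultimately show ?case
    by (intro exI[of _ ?P] exI[of _ ?Q]) simp
qed

theorem transfer:
  assumes "tr P Q" "\<And>a b f. P a b f" "\<And>k. f k \<in> ifuns"
  shows "Q a b f"
proof -
  obtain m where m: "depends ifuns m Q"
    using tr_depends[OF assms(1)] by blast
  obtain P' Q' where PQ: "tr P' Q'" "\<forall>a b f. P' a b f"
    "\<forall>a b f a' b' f'. (\<forall>k. f k \<in> ifuns) \<longrightarrow> (\<forall>k. f' k \<in> ifuns) \<longrightarrow> Q' a b f \<longrightarrow>
      (\<forall>i\<ge>m. a i = a' i \<and> b i = b' i \<and> f i = f' i) \<longrightarrow> Q a' b' f'"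
    using tr_closure[OF assms(1,2), of m] by (elim exE conjE) (rule that)
  obtain p where p: "\<forall>a b f. P' a b f \<longleftrightarrow> sat UNIV id (enc a b f) p"
    "\<forall>a b f. (\<forall>k. f k \<in> ifuns) \<longrightarrow> (Q' a b f \<longleftrightarrow> sat (internal E) (star_rel E) (enc a b f) p)"
    using trE[OF PQ(1)] .
  \<comment> \<open>The closed statement may be evaluated at any standard context, here at zeros.
    Its quantifiers are then instantiated with the given values below \<open>m\<close>.\<close>
  let ?a = "\<lambda>_. hreal E 0" and ?b = "\<lambda>_. hvec E 0" and ?f = "\<lambda>_. hfun E (\<lambda>_. 0)"
  have "star E \<circ> enc (\<lambda>_. 0) (\<lambda>_. 0) (\<lambda>_ _. 0) = enc ?a ?b ?f"
    by (auto simp: fun_eq_iff enc_def star_num star_vec star_fun)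
  moreover have f: "\<forall>k. ?f k \<in> ifuns"
    using internal_star[of "Fun (\<lambda>_. 0)"] by (simp add: ifuns_def star_fun)
  ultimately have Q': "Q' ?a ?b ?f"
    using PQ(2) transfer_sat[of "enc (\<lambda>_. 0) (\<lambda>_. 0) (\<lambda>_ _. 0)" p] p by simp
  define a' b' f' where "a' = (\<lambda>i. if i < m then a i else ?a i)"
    and "b' = (\<lambda>i. if i < m then b i else ?b i)" and "f' = (\<lambda>i. if i < m then f i else ?f i)"
  have f': "\<forall>k. f' k \<in> ifuns"
    using f assms(3) by (simp add: f'_def)
  have "Q a' b' f'"
    by (rule PQ(3)[rule_format, OF f[rule_format] f'[rule_format] Q']) (simp add: a'_def b'_def f'_def)
  moreover have "Q a' b' f' = Q a b f"
    using assms(3) f' by (intro dependsD[OF m]) (auto simp: a'_def b'_def f'_def)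
  ultimately show ?thesis by simp
qed

end

section \<open>Parallel standard and nonstandard terms\<close>

context nonstandard
begin

text \<open>A term is captured by its graph \<open>a x = s\<close>. Freshness of \<open>x\<close> is
  built in because substitution will quantify over it.\<close>

definition tnum where
  "tnum s t \<longleftrightarrow> (\<exists>m. depends UNIV m s \<and> depends ifuns m t \<and>
    (\<forall>x\<ge>m. tr (\<lambda>a b f. a x = s a b f) (\<lambda>a b f. a x = t a b f)))"

definition tvec where
  "tvec u v \<longleftrightarrow> (\<forall>i. tnum (\<lambda>a b f. u a b f $ i) (\<lambda>a b f. v a b f $ i))"

text \<open>Function terms are judged by their values at all pairs of vector terms. This covers
  lambda terms, for which no function variable or constant is at hand.\<close>

definition tfun where
  "tfun s t \<longleftrightarrow> (\<exists>m. depends UNIV m s \<and> depends ifuns m t) \<and>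
    (\<forall>u v. tvec u v \<longrightarrow> tnum (\<lambda>a b f. s a b f (u a b f)) (\<lambda>a b f. t a b f (v a b f)))"

lemma tnumI:
  assumes "depends UNIV m s" "depends ifuns m' t"
    and "\<And>x. x \<ge> m'' \<Longrightarrow> tr (\<lambda>a b f. a x = s a b f) (\<lambda>a b f. a x = t a b f)"
  shows "tnum s t"
  unfolding tnum_def using assms
  by (intro exI[of _ "max m (max m' m'')"]) (auto elim: depends_mono)

text \<open>Substituting a term is the same as quantifying over a fresh variable that equals the
  term.\<close>

lemma tr_subst_num:
  assumes "tnum s t"
  shows "\<exists>m. depends UNIV m s \<and> depends ifuns m t \<and> (\<forall>x\<ge>m. \<forall>P Q. tr P Q \<longrightarrow>
    tr (\<lambda>a b f. P (a(x := s a b f)) b f) (\<lambda>a b f. Q (a(x := t a b f)) b f))"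
proof -
  obtain m where m: "depends UNIV m s" "depends ifuns m t"
    "\<forall>x\<ge>m. tr (\<lambda>a b f. a x = s a b f) (\<lambda>a b f. a x = t a b f)"
    using assms unfolding tnum_def by blast
  have "tr (\<lambda>a b f. P (a(x := s a b f)) b f) (\<lambda>a b f. Q (a(x := t a b f)) b f)"
    if x: "x \<ge> m" and PQ: "tr P Q" for x P Q
  proof (rule tr_cong[OF tr_all_num[OF tr_imp[OF m(3)[rule_format, OF x] PQ], of x]])
    show "P (a(x := s a b f)) b f \<longleftrightarrow> (\<forall>r. (a(x := r)) x = s (a(x := r)) b f \<longrightarrow> P (a(x := r)) b f)"
      for a b f
      using depends_upd(1)[OF m(1) _ x, of f] by simp
    show "Q (a(x := t a b f)) b f \<longleftrightarrow> (\<forall>r. (a(x := r)) x = t (a(x := r)) b f \<longrightarrow> Q (a(x := r)) b f)"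
      if "\<And>k. f k \<in> ifuns" for a b f
      using depends_upd(1)[OF m(2) that x] by simp
  qed
  then show ?thesis
    using m(1,2) by blast
qed

text \<open>The third argument stays a variable: in \<open>tnum_op2\<close> it holds the result of
  the operation.\<close>

lemma tr_pred2_rest:
  assumes "\<And>x y. tr (\<lambda>a b f. p (a x) (a y) (a z)) (\<lambda>a b f. q (a x) (a y) (a z))"
    and "tnum s t" "tnum s' t'"
  shows "tr (\<lambda>a b f. p (s a b f) (s' a b f) (a z)) (\<lambda>a b f. q (t a b f) (t' a b f) (a z))"
proof -
  obtain m where m: "depends UNIV m s" "depends ifuns m t" "\<forall>x\<ge>m. \<forall>P Q. tr P Q \<longrightarrow>
    tr (\<lambda>a b f. P (a(x := s a b f)) b f) (\<lambda>a b f. Q (a(x := t a b f)) b f)"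
    using tr_subst_num[OF assms(2)] by blast
  obtain m' where m': "\<forall>x\<ge>m'. \<forall>P Q. tr P Q \<longrightarrow>
    tr (\<lambda>a b f. P (a(x := s' a b f)) b f) (\<lambda>a b f. Q (a(x := t' a b f)) b f)"
    using tr_subst_num[OF assms(3)] by blast
  \<comment> \<open>Two different indices, beyond the variables of both terms and beyond
    \<open>z\<close>.\<close>
  let ?x = "Suc (m + m' + z)" and ?y = "Suc (Suc (m + m' + z))"
  have "tr (\<lambda>a b f. p ((a(?x := s a b f)) ?x) ((a(?x := s a b f)) ?y) ((a(?x := s a b f)) z))
      (\<lambda>a b f. q ((a(?x := t a b f)) ?x) ((a(?x := t a b f)) ?y) ((a(?x := t a b f)) z))"
    by (rule m(3)[rule_format, of ?x, OF _ assms(1)]) simp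
  then have 1: "tr (\<lambda>a b f. p (s a b f) (a ?y) (a z)) (\<lambda>a b f. q (t a b f) (a ?y) (a z))"
    by simp
  show ?thesis
  proof (rule tr_cong[OF m'[rule_format, of ?y, OF _ 1]])
    show "p (s a b f) (s' a b f) (a z) \<longleftrightarrow> p (s (a(?y := s' a b f)) b f) ((a(?y := s' a b f)) ?y) ((a(?y := s' a b f)) z)"
      for a b f
      using depends_upd(1)[OF m(1), of f ?y a "s' a b f" b] by simp
    show "q (t a b f) (t' a b f) (a z) \<longleftrightarrow> q (t (a(?y := t' a b f)) b f) ((a(?y := t' a b f)) ?y) ((a(?y := t' a b f)) z)"
      if "\<And>k. f k \<in> ifuns" for a b f
      using depends_upd(1)[OF m(2) that, of ?y a "t' a b f" b] by simp
  qed simp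
qed

lemma tr_pred2:
  assumes "\<And>x y. tr (\<lambda>a b f. p (a x) (a y)) (\<lambda>a b f. q (a x) (a y))"
    and "tnum s t" "tnum s' t'"
  shows "tr (\<lambda>a b f. p (s a b f) (s' a b f)) (\<lambda>a b f. q (t a b f) (t' a b f))"
  using tr_pred2_rest[of "\<lambda>u v w. p u v" 0 "\<lambda>u v w. q u v" s t s' t'] assms by simp

lemma tr_pred1:
  assumes "\<And>x. tr (\<lambda>a b f. p (a x)) (\<lambda>a b f. q (a x))" and "tnum s t"
  shows "tr (\<lambda>a b f. p (s a b f)) (\<lambda>a b f. q (t a b f))"
  using tr_pred2[of "\<lambda>u v. p u" "\<lambda>u v. q u" s t s t] assms by simp

lemma tnum_op2:
  assumes "\<And>x y z. tr (\<lambda>a b f. a z = g (a x) (a y)) (\<lambda>a b f. a z = h (a x) (a y))"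
    and "tnum s t" "tnum s' t'"
  shows "tnum (\<lambda>a b f. g (s a b f) (s' a b f)) (\<lambda>a b f. h (t a b f) (t' a b f))"
proof -
  obtain m m' where m: "depends UNIV m s" "depends ifuns m t" "depends UNIV m' s'" "depends ifuns m' t'"
    using assms(2,3) unfolding tnum_def by blast
  show ?thesis
    by (rule tnumI[OF depends_comp2[OF m(1,3)] depends_comp2[OF m(2,4)]])
      (rule tr_pred2_rest[of "\<lambda>u v w. w = g u v" _ "\<lambda>u v w. w = h u v", OF assms])
qed

lemma tnum_op1:
  assumes "\<And>x z. tr (\<lambda>a b f. a z = g (a x)) (\<lambda>a b f. a z = h (a x))" and "tnum s t"
  shows "tnum (\<lambda>a b f. g (s a b f)) (\<lambda>a b f. h (t a b f))"
  using tnum_op2[of "\<lambda>u v. g u" "\<lambda>u v. h u" s t s t] assms by simp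

lemma tr_eq_var: "tr (\<lambda>a b f. a x = a y) (\<lambda>a b f. a x = a y)"
  by (rule trI[where p="Eq (nv x) (nv y)"]) auto

lemma tr_less_var: "tr (\<lambda>a b f. a x < a y) (\<lambda>a b f. a x < a y)"
  by (rule trI[where p="Less (nv x) (nv y)"]) auto

lemma tr_plus_var: "tr (\<lambda>a b f. a z = a x + a y) (\<lambda>a b f. a z = a x + a y)"
  by (rule trI[where p="Plus (nv x) (nv y) (nv z)"]) auto

lemma tr_times_var: "tr (\<lambda>a b f. a z = a x * a y) (\<lambda>a b f. a z = a x * a y)"
  by (rule trI[where p="Times (nv x) (nv y) (nv z)"]) auto

lemma depends_num_var: "depends F (Suc i) (\<lambda>a b f. a i)"
  by (auto simp: depends_def)

lemma depends_fun_var: "depends F (Suc i) (\<lambda>a b f. f i)"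
  by (auto simp: depends_def)

lemma tnum_var: "tnum (\<lambda>a b f. a i) (\<lambda>a b f. a i)"
  by (rule tnumI[OF depends_num_var depends_num_var tr_eq_var])

lemma tr_eq: "tnum s t \<Longrightarrow> tnum s' t' \<Longrightarrow>
    tr (\<lambda>a b f. s a b f = s' a b f) (\<lambda>a b f. t a b f = t' a b f)"
  by (rule tr_pred2[where p="(=)" and q="(=)", OF tr_eq_var])

lemma tr_less: "tnum s t \<Longrightarrow> tnum s' t' \<Longrightarrow>
    tr (\<lambda>a b f. s a b f < s' a b f) (\<lambda>a b f. t a b f < t' a b f)"
  by (rule tr_pred2[where p="(<)" and q="(<)", OF tr_less_var])

lemma tr_le: "tnum s t \<Longrightarrow> tnum s' t' \<Longrightarrow>
    tr (\<lambda>a b f. s a b f \<le> s' a b f) (\<lambda>a b f. t a b f \<le> t' a b f)"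
  using tr_not[OF tr_less[of s' t' s t]] by (simp add: not_less)

lemma tnum_add: "tnum s t \<Longrightarrow> tnum s' t' \<Longrightarrow>
    tnum (\<lambda>a b f. s a b f + s' a b f) (\<lambda>a b f. t a b f + t' a b f)"
  by (rule tnum_op2[where g="(+)" and h="(+)", OF tr_plus_var])

lemma tnum_mult: "tnum s t \<Longrightarrow> tnum s' t' \<Longrightarrow>
    tnum (\<lambda>a b f. s a b f * s' a b f) (\<lambda>a b f. t a b f * t' a b f)"
  by (rule tnum_op2[where g="(*)" and h="(*)", OF tr_times_var])

lemma tnum_diff: "tnum s t \<Longrightarrow> tnum s' t' \<Longrightarrow>
    tnum (\<lambda>a b f. s a b f - s' a b f) (\<lambda>a b f. t a b f - t' a b f)"
proof (rule tnum_op2[where g="(-)" and h="(-)"])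
  show "tr (\<lambda>a b f. a z = a x - a y) (\<lambda>a b f. a z = a x - a y)" for x y z
    by (rule tr_cong[OF tr_plus_var[of x z y]]) (auto simp: eq_diff_eq)
qed

text \<open>A standard entity is named in formulas by the singleton relation that holds of it alone;
  transfer of this uniqueness rules out further members.\<close>

lemma star_rel_eq:
  fixes c :: "(real, 'n) entity"
  assumes "d \<in> internal E"
  shows "[d] \<in> star_rel E {[c]} \<longleftrightarrow> d = star E c"
proof -
  have "sat UNIV id (\<lambda>_. c) (All 1 (Neg (Conj (Rel {[c]} [1]) (Neg (Eq 1 0)))))"
    "sat UNIV id (\<lambda>_. c) (Rel {[c]} [0])"
    by auto
  then show ?thesis
    using assms unfolding transfer_sat by auto
qed

lemma tnum_const: "tnum (\<lambda>a b f. r) (\<lambda>a b f. hreal E r)"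
proof (rule tnumI[of 0 _ 0])
  show "tr (\<lambda>a b f. a x = r) (\<lambda>a b f. a x = hreal E r)" for x
    by (rule trI[where p="Rel {[Num r]} [nv x]"]) (auto simp: star_rel_eq star_num)
qed (auto simp: depends_def)

lemma hreal_add: "hreal E (r + s) = hreal E r + hreal E s"
proof -
  have "tr (\<lambda>a b f. r + s = (r + s)) (\<lambda>a b f. hreal E (r + s) = hreal E r + hreal E s)"
    by (intro tr_eq tnum_add tnum_const)
  from transfer[OF this, of "\<lambda>_. hfun E (\<lambda>_. 0)"] show ?thesis
    using internal_star[of "Fun (\<lambda>_. 0)"] by (simp add: star_fun ifuns_def)
qed

lemma star_ifun: "hfun E g \<in> ifuns"
  using internal_star[of "Fun g"] by (simp add: star_fun ifuns_def)

lemma transfer_closed: "tr (\<lambda>a b f. P) (\<lambda>a b f. Q) \<Longrightarrow> P \<Longrightarrow> Q"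
  using transfer[of "\<lambda>a b f. P" "\<lambda>a b f. Q" "\<lambda>_. hfun E (\<lambda>_. 0)"] star_ifun by blast

lemma hreal_mult: "hreal E (r * s) = hreal E r * hreal E s"
proof -
  have "tr (\<lambda>a b f. r * s = (r * s)) (\<lambda>a b f. hreal E (r * s) = hreal E r * hreal E s)"
    by (intro tr_eq tnum_mult tnum_const)
  then show ?thesis
    by (rule transfer_closed) simp
qed

lemma hreal_less: "hreal E r < hreal E s \<longleftrightarrow> r < s"
proof -
  have t: "tr (\<lambda>a b f. r < s) (\<lambda>a b f. hreal E r < hreal E s)" for r s
    by (intro tr_less tnum_const)
  show ?thesis
    using transfer_closed[OF t] transfer_closed[OF tr_not[OF t]] by blast
qed

lemma hreal_le: "hreal E r \<le> hreal E s \<longleftrightarrow> r \<le> s"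
  by (simp add: hreal_less not_less[symmetric])

lemma hreal_0 [simp]: "hreal E 0 = 0"
  using hreal_add[of 0 0] by simp

lemma hreal_1 [simp]: "hreal E 1 = 1"
  using hreal_mult[of 1 1] hreal_less[of 0 1] by simp

lemma hreal_diff: "hreal E (r - s) = hreal E r - hreal E s"
  using hreal_add[of "r - s" s] by simp

lemma hreal_of_nat [simp]: "hreal E (of_nat n) = of_nat n"
  by (induction n) (auto simp: hreal_add)

lemma hreal_divide: "hreal E (r / s) = hreal E r / hreal E s"
proof (cases "s = 0")
  case False
  then have "hreal E s \<noteq> 0"
    using hreal_less[of s 0] hreal_less[of 0 s] by (metis hreal_0 less_irrefl neqE)
  then show ?thesis
    using hreal_mult[of "r / s" s] False by (simp add: eq_divide_eq)
qed simp

lemma tnum_zero: "tnum (\<lambda>a b f. 0) (\<lambda>a b f. 0)" and tnum_one: "tnum (\<lambda>a b f. 1) (\<lambda>a b f. 1)"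
  using tnum_const[of 0] tnum_const[of 1] by simp_all

text \<open>Division by zero gives 0 in both fields, so the graph of division is definable without a
  side condition.\<close>

lemma tnum_divide: "tnum s t \<Longrightarrow> tnum s' t' \<Longrightarrow>
    tnum (\<lambda>a b f. s a b f / s' a b f) (\<lambda>a b f. t a b f / t' a b f)"
proof (rule tnum_op2[where g="(/)" and h="(/)"])
  show "tr (\<lambda>a b f. a z = a x / a y) (\<lambda>a b f. a z = a x / a y)" for x y z
  proof (rule tr_cong)
    show "tr (\<lambda>a b f. (a y = 0 \<and> a z = 0) \<or> (\<not> a y = 0 \<and> a x = a z * a y))
        (\<lambda>a b f. (a y = 0 \<and> a z = 0) \<or> (\<not> a y = 0 \<and> a x = a z * a y))"
      by (intro tr_disj tr_conj tr_not tr_eq tnum_var tnum_zero tr_times_var)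
  qed (auto simp: eq_divide_eq)
qed

lemma tnum_abs: "tnum s t \<Longrightarrow> tnum (\<lambda>a b f. \<bar>s a b f\<bar>) (\<lambda>a b f. \<bar>t a b f\<bar>)"
proof (rule tnum_op1[where g=abs and h=abs])
  show "tr (\<lambda>a b f. a z = \<bar>a x\<bar>) (\<lambda>a b f. a z = \<bar>a x\<bar>)" for x z
  proof (rule tr_cong)
    show "tr (\<lambda>a b f. (a x < 0 \<and> a z = 0 - a x) \<or> (\<not> a x < 0 \<and> a z = a x))
        (\<lambda>a b f. (a x < 0 \<and> a z = 0 - a x) \<or> (\<not> a x < 0 \<and> a z = a x))"
      by (intro tr_disj tr_conj tr_not tr_eq tr_less tnum_diff tnum_var tnum_zero)
  qed auto
qed

lemma tnum_power: "tnum s t \<Longrightarrow> tnum (\<lambda>a b f. s a b f ^ k) (\<lambda>a b f. t a b f ^ k)"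
  by (induction k) (auto intro: tnum_one tnum_mult)

lemma tnum_if:
  assumes "tr P Q" "tnum s t" "tnum s' t'"
  shows "tnum (\<lambda>a b f. if P a b f then s a b f else s' a b f)
    (\<lambda>a b f. if Q a b f then t a b f else t' a b f)"
proof -
  obtain k m m' where d: "depends UNIV k P" "depends ifuns k Q"
    "depends UNIV m s" "depends ifuns m t" "depends UNIV m' s'" "depends ifuns m' t'"
    using assms(2,3) tr_depends[OF assms(1)] unfolding tnum_def by blast
  have "depends F (max k (max m m')) (\<lambda>a b f. if p a b f then u a b f else v a b f)"
    if "depends F k p" "depends F m u" "depends F m' v" for F and p :: "_ \<Rightarrow> _ \<Rightarrow> _ \<Rightarrow> bool"
      and u v :: "_ \<Rightarrow> _ \<Rightarrow> _ \<Rightarrow> 'r::linordered_field"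
    using depends_comp2[OF that(1) depends_comp2[OF that(2,3), of Pair], of "\<lambda>c (x, y). if c then x else y"] by simp
  note dep = this
  show ?thesis
  proof (rule tnumI[OF dep[OF d(1,3,5)] dep[OF d(2,4,6)]])
    show "tr (\<lambda>a b f. a x = (if P a b f then s a b f else s' a b f))
        (\<lambda>a b f. a x = (if Q a b f then t a b f else t' a b f))" for x
    proof (rule tr_cong)
      show "tr (\<lambda>a b f. (P a b f \<and> a x = s a b f) \<or> (\<not> P a b f \<and> a x = s' a b f))
        (\<lambda>a b f. (Q a b f \<and> a x = t a b f) \<or> (\<not> Q a b f \<and> a x = t' a b f))"
        by (intro tr_disj tr_conj tr_not tr_eq tnum_var assms)
    qed auto
  qed
qed

lemma tvec_var: "tvec (\<lambda>a b f. b i) (\<lambda>a b f. b i)"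
  unfolding tvec_def
proof
  fix j
  show "tnum (\<lambda>a b f. b i $ j) (\<lambda>a b f. b i $ j)"
  proof (rule tnumI[of "Suc i" _ "Suc i"])
    show "tr (\<lambda>a b f. a x = b i $ j) (\<lambda>a b f. a x = b i $ j)" for x
      by (rule trI[where p="Comp (vv i) j (nv x)"]) auto
  qed (auto simp: depends_def)
qed

lemma tvec_add: "tvec u v \<Longrightarrow> tvec u' v' \<Longrightarrow>
    tvec (\<lambda>a b f. u a b f + u' a b f) (\<lambda>a b f. v a b f + v' a b f)"
  unfolding tvec_def by (simp add: tnum_add)

lemma tvec_axis: "tnum s t \<Longrightarrow> tvec (\<lambda>a b f. axis i (s a b f)) (\<lambda>a b f. axis i (t a b f))"
  unfolding tvec_def
proof
  fix j
  assume "tnum s t"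
  then show "tnum (\<lambda>a b f. axis i (s a b f) $ j) (\<lambda>a b f. axis i (t a b f) $ j)"
    using tnum_zero by (cases "j = i") (auto simp: axis_def)
qed

lemma tnum_component: "tvec u v \<Longrightarrow> tnum (\<lambda>a b f. u a b f $ i) (\<lambda>a b f. v a b f $ i)"
  by (simp add: tvec_def)

lemma tvec_depends:
  assumes "tvec u v"
  shows "\<exists>m. depends UNIV m u \<and> depends ifuns m v"
proof -
  have "\<forall>i. \<exists>m. depends UNIV m (\<lambda>a b f. u a b f $ i) \<and> depends ifuns m (\<lambda>a b f. v a b f $ i)"
    using assms unfolding tvec_def tnum_def by blast
  from choice[OF this] obtain m where m: "\<And>i. depends UNIV (m i) (\<lambda>a b f. u a b f $ i)"
    "\<And>i. depends ifuns (m i) (\<lambda>a b f. v a b f $ i)"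
    by blast
  have "m i \<le> sum m UNIV" for i
    by (rule member_le_sum) auto
  then have "depends UNIV (sum m UNIV) (\<lambda>a b f. u a b f $ i)"
    "depends ifuns (sum m UNIV) (\<lambda>a b f. v a b f $ i)" for i
    using depends_mono m by blast+
  then have "depends UNIV (sum m UNIV) u" "depends ifuns (sum m UNIV) v"
    unfolding depends_def vec_eq_iff by simp_all
  then show ?thesis by blast
qed

text \<open>As for numbers, with equality of vectors spelled out over the finitely many components,
  which are what \<open>tvec\<close> provides.\<close>

lemma tr_subst_vec:
  assumes "tvec u v"
  shows "\<exists>m. depends UNIV m u \<and> depends ifuns m v \<and> (\<forall>y\<ge>m. \<forall>P Q. tr P Q \<longrightarrow>
    tr (\<lambda>a b f. P a (b(y := u a b f)) f) (\<lambda>a b f. Q a (b(y := v a b f)) f))"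
proof -
  obtain m where m: "depends UNIV m u" "depends ifuns m v"
    using tvec_depends[OF assms] by blast
  have "tr (\<lambda>a b f. P a (b(y := u a b f)) f) (\<lambda>a b f. Q a (b(y := v a b f)) f)"
    if y: "y \<ge> m" and PQ: "tr P Q" for y P Q
  proof -
    have "tr (\<lambda>a b f. (\<forall>i\<in>UNIV. b y $ i = u a b f $ i) \<longrightarrow> P a b f)
        (\<lambda>a b f. (\<forall>i\<in>UNIV. b y $ i = v a b f $ i) \<longrightarrow> Q a b f)"
      by (intro tr_imp PQ tr_ball_finite tr_eq tnum_component tvec_var assms finite)
    from tr_all_vec[OF this, of y] show ?thesis
    proof (rule tr_cong)
      show "P a (b(y := u a b f)) f \<longleftrightarrow>
          (\<forall>w. (\<forall>i\<in>UNIV. (b(y := w)) y $ i = u a (b(y := w)) f $ i) \<longrightarrow> P a (b(y := w)) f)" for a b f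
        using depends_upd(2)[OF m(1) _ y, of f] by (simp add: vec_eq_iff[symmetric])
      show "Q a (b(y := v a b f)) f \<longleftrightarrow>
          (\<forall>w. (\<forall>i\<in>UNIV. (b(y := w)) y $ i = v a (b(y := w)) f $ i) \<longrightarrow> Q a (b(y := w)) f)"
        if "\<And>k. f k \<in> ifuns" for a b f
        using depends_upd(2)[OF m(2) that y] by (simp add: vec_eq_iff[symmetric])
    qed
  qed
  then show ?thesis
    using m by blast
qed

lemma tr_vec_pred:
  assumes "\<And>y. tr (\<lambda>a b f. p (b y)) (\<lambda>a b f. q (b y))" "tvec u v"
  shows "tr (\<lambda>a b f. p (u a b f)) (\<lambda>a b f. q (v a b f))"
proof -
  obtain m where m: "\<forall>y\<ge>m. \<forall>P Q. tr P Q \<longrightarrow>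
    tr (\<lambda>a b f. P a (b(y := u a b f)) f) (\<lambda>a b f. Q a (b(y := v a b f)) f)"
    using tr_subst_vec[OF assms(2)] by blast
  from m[rule_format, of m, OF order_refl assms(1)[of m]] show ?thesis
    by simp
qed

lemma tnum_vec_op:
  assumes "\<And>y z. tr (\<lambda>a b f. a z = g a f (b y)) (\<lambda>a b f. a z = h a f (b y))" "tvec u v"
    and "depends UNIV k (\<lambda>a b. g a)" "depends ifuns k (\<lambda>a b. h a)"
  shows "tnum (\<lambda>a b f. g a f (u a b f)) (\<lambda>a b f. h a f (v a b f))"
proof -
  obtain m where m: "depends UNIV m u" "depends ifuns m v" "\<forall>y\<ge>m. \<forall>P Q. tr P Q \<longrightarrow>
    tr (\<lambda>a b f. P a (b(y := u a b f)) f) (\<lambda>a b f. Q a (b(y := v a b f)) f)"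
    using tr_subst_vec[OF assms(2)] by blast
  have "depends F (max k m) (\<lambda>a b f. g' a f (u' a b f))" if "depends F k (\<lambda>a b. g' a)" "depends F m u'"
    for F and g' :: "_ \<Rightarrow> _ \<Rightarrow> _ \<Rightarrow> 'r::linordered_field" and u'
    using depends_comp2[OF that, of "\<lambda>g x. g x"] .
  note d = this
  show ?thesis
  proof (rule tnumI[OF d[OF assms(3) m(1)] d[OF assms(4) m(2)]])
    show "tr (\<lambda>a b f. a x = g a f (u a b f)) (\<lambda>a b f. a x = h a f (v a b f))" for x
      using m(3)[rule_format, of m, OF order_refl assms(1)[of x m]] by simp
  qed
qed

lemma tfun_var: "tfun (\<lambda>a b f. f i) (\<lambda>a b f. f i)"
  unfolding tfun_def
proof (intro conjI allI impI)
  show "\<exists>m. depends UNIV m (\<lambda>a b f. f i) \<and> depends ifuns m (\<lambda>a b f. f i)"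
    by (intro exI[of _ "Suc i"] conjI depends_fun_var)
  show "tnum (\<lambda>a b f. f i (u a b f)) (\<lambda>a b f. f i (v a b f))" if "tvec u v" for u v
  proof (rule tnum_vec_op[of "\<lambda>a f. f i" "\<lambda>a f. f i", OF _ that])
    show "tr (\<lambda>a b f. a z = f i (b y)) (\<lambda>a b f. a z = f i (b y))" for y z
      by (rule trI[where p="App (fv i) (vv y) (nv z)"]) auto
  qed (auto simp: depends_def)
qed

lemma tfun_app: "tfun s t \<Longrightarrow> tvec u v \<Longrightarrow>
    tnum (\<lambda>a b f. s a b f (u a b f)) (\<lambda>a b f. t a b f (v a b f))"
  by (simp add: tfun_def)

text \<open>The internal definition principle. That some function agrees with the term everywhere is
  trivial on the standard side; by transfer, some internal function does so on the nonstandard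
  side.\<close>

lemma tfun_internal:
  assumes "tfun s t" "\<And>k. f k \<in> ifuns"
  shows "t a b f \<in> ifuns"
proof -
  obtain m where m: "depends UNIV m s" "depends ifuns m t"
    using assms(1) unfolding tfun_def by blast
  have "tr (\<lambda>a b f. f m (b m) = s a b f (b m)) (\<lambda>a b f. f m (b m) = t a b f (b m))"
    by (intro tr_eq tfun_app tfun_var tvec_var assms(1))
  note tr = tr_ex_fun[OF tr_all_vec[OF this, of m], of m]
  have "\<exists>g\<in>ifuns. \<forall>v. (f(m := g)) m ((b(m := v)) m) = t a (b(m := v)) (f(m := g)) ((b(m := v)) m)"
  proof (rule transfer[OF tr _ assms(2)])
    fix a :: "nat \<Rightarrow> real" and b :: "nat \<Rightarrow> real ^ 'n" and f :: "nat \<Rightarrow> real ^ 'n \<Rightarrow> real"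
    show "\<exists>g. \<forall>v. (f(m := g)) m ((b(m := v)) m) = s a (b(m := v)) (f(m := g)) ((b(m := v)) m)"
      using depends_upd(2,3)[OF m(1)] by (intro exI[of _ "s a b f"]) simp
  qed
  then obtain g where g: "g \<in> ifuns" "\<And>v. g v = t a (b(m := v)) (f(m := g)) v"
    by auto
  have "g v = t a b f v" for v
  proof -
    have "t a (b(m := v)) (f(m := g)) = t a b (f(m := g))"
      using assms(2) g(1) by (intro depends_upd(2)[OF m(2)]) auto
    also have "\<dots> = t a b f"
      using assms(2) g(1) by (intro depends_upd(3)[OF m(2)]) auto
    finally show ?thesis
      using g(2)[of v] by simp
  qed
  then have "t a b f = g" by auto
  then show ?thesis
    using g(1) by simp
qed

lemma tfun_grid_diff:
  assumes "tnum n n'" "tfun s t"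
  shows "tfun (\<lambda>a b f. grid_diff (n a b f) i (s a b f)) (\<lambda>a b f. grid_diff (n' a b f) i (t a b f))"
  unfolding tfun_def
proof (intro conjI allI impI)
  obtain m m' where m: "depends UNIV m n" "depends ifuns m n'" "depends UNIV m' s" "depends ifuns m' t"
    using assms unfolding tnum_def tfun_def by blast
  show "\<exists>m. depends UNIV m (\<lambda>a b f. grid_diff (n a b f) i (s a b f)) \<and>
      depends ifuns m (\<lambda>a b f. grid_diff (n' a b f) i (t a b f))"
    using depends_comp2[OF m(1,3), of "\<lambda>n. grid_diff n i"] depends_comp2[OF m(2,4), of "\<lambda>n. grid_diff n i"]
    by blast
  show "tnum (\<lambda>a b f. grid_diff (n a b f) i (s a b f) (u a b f))
      (\<lambda>a b f. grid_diff (n' a b f) i (t a b f) (v a b f))" if "tvec u v" for u v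
    unfolding grid_diff_def
    by (intro tnum_divide tnum_diff tfun_app[OF assms(2)] tvec_add tvec_axis tnum_one assms that)
qed

lemma tfun_grid_diffs:
  assumes "tnum n n'" "tfun s t"
  shows "tfun (\<lambda>a b f. grid_diffs (n a b f) ks (s a b f)) (\<lambda>a b f. grid_diffs (n' a b f) ks (t a b f))"
proof (induction ks)
  case (Cons k ks)
  then show ?case
    using tfun_grid_diff[OF assms(1) Cons, of k] by simp
qed (use assms in simp)

lemma tfun_mult:
  assumes "tfun s t" "tfun s' t'"
  shows "tfun (\<lambda>a b f x. s a b f x * s' a b f x) (\<lambda>a b f x. t a b f x * t' a b f x)"
  unfolding tfun_def
proof (intro conjI allI impI)
  obtain m m' where m: "depends UNIV m s" "depends ifuns m t" "depends UNIV m' s'" "depends ifuns m' t'"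
    using assms unfolding tfun_def by blast
  show "\<exists>m. depends UNIV m (\<lambda>a b f x. s a b f x * s' a b f x) \<and>
      depends ifuns m (\<lambda>a b f x. t a b f x * t' a b f x)"
    using depends_comp2[OF m(1,3), of "\<lambda>g h x. g x * h x"] depends_comp2[OF m(2,4), of "\<lambda>g h x. g x * h x"]
    by blast
qed (intro tnum_mult tfun_app assms)

end

section \<open>Standard sets, families of functions and grids\<close>

context nonstandard
begin

lemma tr_rel:
  "tr (\<lambda>a b f. [Num (a x), Num (a y)] \<in> R) (\<lambda>a b f. [Num (a x), Num (a y)] \<in> star_rel E R)"
  by (rule trI[where p="Rel R [nv x, nv y]"]) auto

text \<open>Connects the two ways in which a standard set extends: as a unary relation symbol and as
  an entity.\<close>

lemma star_rel_mem:
  assumes "\<And>d. [d] \<in> R \<longleftrightarrow> mem d A" "d \<in> internal E"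
  shows "[d] \<in> star_rel E R \<longleftrightarrow> mem d (star E A)"
proof -
  have "sat UNIV id (\<lambda>_. A) (All 1 (Conj (Neg (Conj (Rel R [1]) (Neg (Mem 1 0))))
      (Neg (Conj (Mem 1 0) (Neg (Rel R [1]))))))"
    using assms(1) by auto
  then show ?thesis
    using assms(2) unfolding transfer_sat by auto
qed

lemma star_mem: "mem c A \<Longrightarrow> mem (star E c) (star E A)"
proof -
  assume "mem c A"
  then have "sat UNIV id (\<lambda>i. if i = 0 then c else A) (Mem 0 1)"
    by simp
  then show ?thesis
    unfolding transfer_sat by simp
qed

lemma mem_num_iff: "mem (Num h) X \<longleftrightarrow> (\<exists>A. X = NumSet A \<and> h \<in> A)"
  and mem_vec_iff: "mem (Vec v) X \<longleftrightarrow> (\<exists>B. X = VecSet B \<and> v \<in> B)"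
  by (cases X; simp)+

lemma mem_star_num: "A \<noteq> {} \<Longrightarrow> mem (Num h) (star E (NumSet A)) \<longleftrightarrow> h \<in> hnum_set E A"
proof -
  assume "A \<noteq> {}"
  then obtain r where "mem (Num r :: (real, 'n) entity) (NumSet A)"
    by auto
  from star_mem[OF this] show ?thesis
    by (auto simp: star_num mem_num_iff hnum_set_def)
qed

lemma mem_star_vec: "A \<noteq> {} \<Longrightarrow> mem (Vec v) (star E (VecSet A)) \<longleftrightarrow> v \<in> hvec_set E A"
proof -
  assume "A \<noteq> {}"
  then obtain r where "mem (Vec r) (VecSet A)"
    by auto
  from star_mem[OF this] show ?thesis
    by (auto simp: star_vec mem_vec_iff hvec_set_def)
qed

lemma tr_num_set: "A \<noteq> {} \<Longrightarrow> tnum s t \<Longrightarrow> tr (\<lambda>a b f. s a b f \<in> A) (\<lambda>a b f. t a b f \<in> hnum_set E A)"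
proof (rule tr_pred1)
  assume A: "A \<noteq> {}"
  have "[d] \<in> {[Num r] | r. r \<in> A} \<longleftrightarrow> mem d (NumSet A)" for d :: "(real, 'n) entity"
    by (cases d) auto
  from star_rel_mem[OF this]
  show "tr (\<lambda>a b f. a x \<in> A) (\<lambda>a b f. a x \<in> hnum_set E A)" for x
    by (intro trI[where p="Rel {[Num r] | r. r \<in> A} [nv x]"]) (auto simp: mem_star_num[OF A])
qed

lemma tr_vec_set: "A \<noteq> {} \<Longrightarrow> tvec u v \<Longrightarrow> tr (\<lambda>a b f. u a b f \<in> A) (\<lambda>a b f. v a b f \<in> hvec_set E A)"
proof (rule tr_vec_pred)
  assume A: "A \<noteq> {}"
  have "[d] \<in> {[Vec r] | r. r \<in> A} \<longleftrightarrow> mem d (VecSet A)" for d :: "(real, 'n) entity"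
    by (cases d) auto
  from star_rel_mem[OF this]
  show "tr (\<lambda>a b f. b x \<in> A) (\<lambda>a b f. b x \<in> hvec_set E A)" for x
    by (intro trI[where p="Rel {[Vec r] | r. r \<in> A} [vv x]"]) (auto simp: mem_star_vec[OF A])
qed

lemma tfun_const: "tfun (\<lambda>a b f. g) (\<lambda>a b f. hfun E g)"
  unfolding tfun_def
proof (intro conjI allI impI)
  show "\<exists>m. depends UNIV m (\<lambda>a b f. g) \<and> depends ifuns m (\<lambda>a b f. hfun E g)"
    by (auto simp: depends_def)
  show "tnum (\<lambda>a b f. g (u a b f)) (\<lambda>a b f. hfun E g (v a b f))" if "tvec u v" for u v
  proof (rule tnum_vec_op[of "\<lambda>a f. g" "\<lambda>a f. hfun E g", OF _ that])
    show "tr (\<lambda>a b f. a z = g (b y)) (\<lambda>a b f. a z = hfun E g (b y))" for y z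
    proof (rule tr_cong)
      have "tr (\<lambda>a b f. f 0 = g) (\<lambda>a b f. f 0 = hfun E g)"
        by (rule trI[where p="Rel {[Fun g]} [fv 0]"]) (auto simp: star_rel_eq star_fun ifuns_def)
      then have "tr (\<lambda>a b f. f 0 = g \<and> a z = f 0 (b y)) (\<lambda>a b f. f 0 = hfun E g \<and> a z = f 0 (b y))"
        by (intro tr_conj tr_eq tnum_var tfun_app tfun_var tvec_var)
      then show "tr (\<lambda>a b f. \<exists>h. (f(0 := h)) 0 = g \<and> a z = (f(0 := h)) 0 (b y))
          (\<lambda>a b f. \<exists>h\<in>ifuns. (f(0 := h)) 0 = hfun E g \<and> a z = (f(0 := h)) 0 (b y))"
        by (rule tr_ex_fun)
    qed (use star_ifun in auto)
  qed (auto simp: depends_def)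
qed

text \<open>Extends a family of functions to hyperreal indices. At infinite indices there is no
  standard function to which \<open>hfun\<close> could be applied.\<close>

definition hfamily :: "(real \<Rightarrow> real ^ 'n \<Rightarrow> real) \<Rightarrow> 'h \<Rightarrow> 'h ^ 'n \<Rightarrow> 'h" where
  "hfamily G n v = (THE h. [Num n, Vec v, Num h] \<in> star_rel E {[Num n, Vec v, Num (G n v)] | n v. True})"

text \<open>Existence and uniqueness of the value both transfer, so the description in
  \<open>hfamily\<close> picks the one related number.\<close>

lemma tr_family_var: "tr (\<lambda>a b f. a z = G (a x) (b y)) (\<lambda>a b f. a z = hfamily G (a x) (b y))"
proof -
  let ?R = "{[Num n, Vec v, Num (G n v)] | n v. True}"
  have tr: "tr (\<lambda>a b f. a z = G (a x) (b y)) (\<lambda>a b f. [Num (a x), Vec (b y), Num (a z)] \<in> star_rel E ?R)"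
    for x y z
    by (rule trI[where p="Rel ?R [nv x, vv y, nv z]"]) auto
  have "\<exists>h. [Num n, Vec v, Num h] \<in> star_rel E ?R" for n v
    using transfer[OF tr_ex_num[OF tr[of 1 0 0], of 1], of "\<lambda>_. hfun E (\<lambda>_. 0)" "\<lambda>_. n" "\<lambda>_. v"] star_ifun
    by simp
  moreover have "h = h'" if "[Num n, Vec v, Num h] \<in> star_rel E ?R" "[Num n, Vec v, Num h'] \<in> star_rel E ?R" for n v h h'
    using transfer[OF tr_imp[OF tr_conj[OF tr[of 1 0 0] tr[of 2 0 0]] tr_eq[OF tnum_var[of 1] tnum_var[of 2]]],
        of "\<lambda>_. hfun E (\<lambda>_. 0)" "\<lambda>i. if i = 0 then n else if i = 1 then h else h'" "\<lambda>_. v"] star_ifun that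
    by simp
  ultimately have "[Num n, Vec v, Num h] \<in> star_rel E ?R \<longleftrightarrow> h = hfamily G n v" for n v h
    unfolding hfamily_def by (metis (mono_tags, lifting) theI)
  then show ?thesis
    using tr[of z x y] by simp
qed

lemma tfun_family:
  assumes "tnum n n'"
  shows "tfun (\<lambda>a b f. G (n a b f)) (\<lambda>a b f. hfamily G (n' a b f))"
  unfolding tfun_def
proof (intro conjI allI impI)
  obtain m where m: "depends UNIV m n" "depends ifuns m n'" "\<forall>x\<ge>m. \<forall>P Q. tr P Q \<longrightarrow>
    tr (\<lambda>a b f. P (a(x := n a b f)) b f) (\<lambda>a b f. Q (a(x := n' a b f)) b f)"
    using tr_subst_num[OF assms] by blast
  have d: "depends UNIV m (\<lambda>a b f. G (n a b f))" "depends ifuns m (\<lambda>a b f. hfamily G (n' a b f))"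
    using depends_comp2[OF m(1,1), of "\<lambda>n _. G n"] depends_comp2[OF m(2,2), of "\<lambda>n _. hfamily G n"] by simp_all
  then show "\<exists>m. depends UNIV m (\<lambda>a b f. G (n a b f)) \<and> depends ifuns m (\<lambda>a b f. hfamily G (n' a b f))"
    by blast
  fix u :: "(nat \<Rightarrow> real) \<Rightarrow> (nat \<Rightarrow> real ^ 'n) \<Rightarrow> (nat \<Rightarrow> real ^ 'n \<Rightarrow> real) \<Rightarrow> real ^ 'n"
    and v :: "(nat \<Rightarrow> 'h) \<Rightarrow> (nat \<Rightarrow> 'h ^ 'n) \<Rightarrow> (nat \<Rightarrow> 'h ^ 'n \<Rightarrow> 'h) \<Rightarrow> 'h ^ 'n"
  assume uv: "tvec u v"
  obtain m' where m': "depends UNIV m' u" "depends ifuns m' v" "\<forall>y\<ge>m'. \<forall>P Q. tr P Q \<longrightarrow>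
    tr (\<lambda>a b f. P a (b(y := u a b f)) f) (\<lambda>a b f. Q a (b(y := v a b f)) f)"
    using tr_subst_vec[OF uv] by blast
  show "tnum (\<lambda>a b f. G (n a b f) (u a b f)) (\<lambda>a b f. hfamily G (n' a b f) (v a b f))"
  proof (rule tnumI)
    show "depends UNIV (max m m') (\<lambda>a b f. G (n a b f) (u a b f))"
      "depends ifuns (max m m') (\<lambda>a b f. hfamily G (n' a b f) (v a b f))"
      using depends_comp2[OF m(1) m'(1)] depends_comp2[OF m(2) m'(2)] by blast+
    show "tr (\<lambda>a b f. a z = G (n a b f) (u a b f)) (\<lambda>a b f. a z = hfamily G (n' a b f) (v a b f))" for z
    proof -
      let ?y = "max m m'" and ?x = "Suc (m + z)"
      from m(3)[rule_format, of ?x, OF _ tr_family_var[of z G ?x ?y]]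
      have "tr (\<lambda>a b f. a z = G (n a b f) (b ?y)) (\<lambda>a b f. a z = hfamily G (n' a b f) (b ?y))"
        by simp
      from m'(3)[rule_format, of ?y, OF _ this] show ?thesis
      proof (rule tr_cong)
        show "a z = G (n a b f) (u a b f) \<longleftrightarrow> a z = G (n a (b(?y := u a b f)) f) ((b(?y := u a b f)) ?y)" for a b f
          using depends_upd(2)[OF m(1), of f ?y a b "u a b f"] by simp
        show "a z = hfamily G (n' a b f) (v a b f) \<longleftrightarrow>
            a z = hfamily G (n' a (b(?y := v a b f)) f) ((b(?y := v a b f)) ?y)" if "\<And>k. f k \<in> ifuns" for a b f
          using depends_upd(2)[OF m(2) that, of ?y a b "v a b f"] by simp
      qed simp
    qed
  qed
qed

lemma tr_grid:
  assumes "tvec u v" "tnum n n'"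
  shows "tr (\<lambda>a b f. u a b f \<in> std_grid (n a b f)) (\<lambda>a b f. v a b f \<in> grid_vecs E (n' a b f))"
proof -
  have "tr (\<lambda>a b f. s a b f \<in> {m * (1 / n a b f) | m. m \<in> \<int> \<and> 0 - (n a b f)\<^sup>2 \<le> m \<and> m \<le> (n a b f)\<^sup>2})
      (\<lambda>a b f. t a b f \<in> grid E (n' a b f))" if st: "tnum s t" for s t
  proof (rule tr_pred2[OF _ st assms(2), of "\<lambda>s n. s \<in> {m * (1 / n) | m. m \<in> \<int> \<and> 0 - n\<^sup>2 \<le> m \<and> m \<le> n\<^sup>2}"
        "\<lambda>s n. s \<in> grid E n"])
    fix x y
    let ?k = "Suc (x + y)"
    have "tr (\<lambda>a b f. a ?k \<in> \<int> \<and> a x = a ?k * (1 / a y) \<and> 0 - (a y)\<^sup>2 \<le> a ?k \<and> a ?k \<le> (a y)\<^sup>2)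
        (\<lambda>a b f. a ?k \<in> hnum_set E \<int> \<and> a x = a ?k * (1 / a y) \<and> 0 - (a y)\<^sup>2 \<le> a ?k \<and> a ?k \<le> (a y)\<^sup>2)"
      by (intro tr_conj tr_num_set tr_eq tr_le tnum_mult tnum_divide tnum_diff tnum_power tnum_var tnum_one tnum_zero)
        (metis Ints_0 empty_iff)
    from tr_ex_num[OF this, of ?k]
    show "tr (\<lambda>a b f. a x \<in> {m * (1 / a y) | m. m \<in> \<int> \<and> 0 - (a y)\<^sup>2 \<le> m \<and> m \<le> (a y)\<^sup>2})
      (\<lambda>a b f. a x \<in> grid E (a y))"
      by (rule tr_cong) (auto simp: grid_def)
  qed
  then have "tr (\<lambda>a b f. \<forall>i\<in>UNIV. u a b f $ i \<in>
        {m * (1 / n a b f) | m. m \<in> \<int> \<and> 0 - (n a b f)\<^sup>2 \<le> m \<and> m \<le> (n a b f)\<^sup>2})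
      (\<lambda>a b f. \<forall>i\<in>UNIV. v a b f $ i \<in> grid E (n' a b f))"
    using assms(1) by (intro tr_ball_finite) (auto simp: tvec_def)
  then show ?thesis
    by (rule tr_cong) (auto simp: grid_vecs_def std_grid_def, (metis minus_le_iff)?)
qed

end

lemma finite_std_grid_real: "finite (std_grid n :: (real ^ 'n::finite) set)"
proof (rule finite_subset)
  let ?S = "(\<lambda>k::int. of_int k * (1 / n)) ` {- \<lceil>n\<^sup>2\<rceil>..\<lceil>n\<^sup>2\<rceil>}"
  show "finite ((\<lambda>g. (\<chi> i. g i) :: real ^ 'n) ` (UNIV \<rightarrow>\<^sub>E ?S))"
    by (intro finite_imageI finite_PiE) auto
  show "(std_grid n :: (real ^ 'n) set) \<subseteq> (\<lambda>g. (\<chi> i. g i) :: real ^ 'n) ` (UNIV \<rightarrow>\<^sub>E ?S)"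
  proof
    fix x :: "real ^ 'n"
    assume x: "x \<in> std_grid n"
    have "x $ i \<in> ?S" for i
    proof -
      obtain m where m: "m \<in> \<int>" "x $ i = m * (1 / n)" "- (n\<^sup>2) \<le> m" "m \<le> n\<^sup>2"
        using x unfolding std_grid_def by blast
      obtain k :: int where k: "m = of_int k"
        using m(1) by (elim Ints_cases)
      have "- \<lceil>n\<^sup>2\<rceil> \<le> k" "k \<le> \<lceil>n\<^sup>2\<rceil>"
        using m(3,4) unfolding k by linarith+
      then show ?thesis
        using m(2) k by (intro image_eqI[of _ _ k]) auto
    qed
    then show "x \<in> (\<lambda>g. (\<chi> i. g i) :: real ^ 'n) ` (UNIV \<rightarrow>\<^sub>E ?S)"
      by (intro image_eqI[of _ _ "\<lambda>i. x $ i"]) (auto simp: vec_eq_iff)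
  qed
qed

section \<open>Hyperfinite sums\<close>

lemma nv_distinct: "nv i = nv j \<longleftrightarrow> i = j" "nv i \<noteq> vv j" "nv i \<noteq> fv j"
  unfolding nv_def vv_def fv_def by presburger+

text \<open>
  For a formula \<open>p\<close> defining a set in terms of the vector variable \<open>0\<close>, this formula says that the
  function variable \<open>k\<close> and the numerical variable \<open>z\<close> are in the relation \<open>H\<close> with that set.
\<close>

definition hyperfinite_formula ::
  "'n::finite formula \<Rightarrow> (real, 'n) entity list set \<Rightarrow> nat \<Rightarrow> nat \<Rightarrow> nat \<Rightarrow> 'n formula" where
  "hyperfinite_formula p H w k z = Neg (All w (Neg (Conj
    (All (vv 0) (Neg (Conj (is_vec (vv 0)) (Neg (Conj (Neg (Conj (Mem (vv 0) w) (Neg p)))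
      (Neg (Conj p (Neg (Mem (vv 0) w)))))))))
    (Rel H [w, fv k, nv z]))))"

lemma sat_hyperfinite_formula:
  fixes G :: "('r::linordered_field ^ 'n::finite) set"
  assumes w: "var_bound p \<le> w" "w \<noteq> nv x" "w \<noteq> nv z" "w \<noteq> fv k" "w \<noteq> vv 0"
    and D: "\<And>a. Num a \<in> D" "\<And>v. Vec v \<in> D" and G: "0 \<in> G"
    and eq: "\<And>v. v \<in> G \<longleftrightarrow> sat D I (enc a (b(0 := v)) f) p"
  shows "sat D I (enc a b f) (hyperfinite_formula p H w k z) \<longleftrightarrow>
    VecSet G \<in> D \<and> [VecSet G, Fun (f k), Num (a z)] \<in> I H"
proof -
  have sat_w: "sat D I ((enc a b f)(w := A, vv 0 := Vec v)) p \<longleftrightarrow> sat D I (enc a (b(0 := v)) f) p"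
    for A v
    unfolding enc_upd[symmetric] by (rule sat_cong) (use w in auto)
  have sat_b: "sat D I ((enc a b f)(w := A)) (All (vv 0) (Neg (Conj (is_vec (vv 0)) (Neg
      (Conj (Neg (Conj (Mem (vv 0) w) (Neg p))) (Neg (Conj p (Neg (Mem (vv 0) w)))))))))
      \<longleftrightarrow> (\<forall>v. mem (Vec v) A \<longleftrightarrow> sat D I (enc a (b(0 := v)) f) p)" for A
    unfolding sat.simps sat_is_vec[OF D(1)] using D(2) w by (auto simp: sat_w)
  \<comment> \<open>Extensionality across sorts: since \<open>G\<close> has an element, an entity
    with the same vectors as members can only be a \<open>VecSet\<close>.\<close>
  have A: "(\<forall>v. mem (Vec v) A \<longleftrightarrow> v \<in> G) \<longleftrightarrow> A = VecSet G" for A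
  proof
    assume a: "\<forall>v. mem (Vec v) A \<longleftrightarrow> v \<in> G"
    with G obtain B where "A = VecSet B"
      by (cases A) auto
    with a show "A = VecSet G"
      by auto
  qed simp
  have "sat D I (enc a b f) (hyperfinite_formula p H w k z) \<longleftrightarrow>
      (\<exists>A\<in>D. (\<forall>v. mem (Vec v) A \<longleftrightarrow> sat D I (enc a (b(0 := v)) f) p) \<and> [A, Fun (f k), Num (a z)] \<in> I H)"
    unfolding hyperfinite_formula_def sat_b[symmetric] using w by auto
  also have "\<dots> \<longleftrightarrow> VecSet G \<in> D \<and> [VecSet G, Fun (f k), Num (a z)] \<in> I H"
    unfolding eq[symmetric] A by blast
  finally show ?thesis .
qed

context nonstandard
begin

text \<open>On the nonstandard side the formula says that the grid is internal and that the value is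
  related to it. To identify this value with \<open>hsum\<close>, which is a description, existence
  and uniqueness of the sum are transferred as well.\<close>

lemma tr_sum_var:
  "tr (\<lambda>a b f. a z = (\<Sum>v\<in>std_grid (a x). f k v)) (\<lambda>a b f. a z = hsum E (grid_vecs E (a x)) (f k))"
proof -
  let ?H = "{[VecSet B, Fun g, Num (\<Sum>x\<in>B. g x)] | B g. finite B} :: (real, 'n) entity list set"
  let ?Q = "\<lambda>z k a (b :: nat \<Rightarrow> 'h ^ 'n) f. VecSet (grid_vecs E (a x)) \<in> internal E \<and>
    [VecSet (grid_vecs E (a x)), Fun (f k), Num (a z)] \<in> star_rel E ?H"
  have tr: "tr (\<lambda>a b f. a z = (\<Sum>v\<in>std_grid (a x). f k v)) (?Q z k)" for z k
  proof -
    have tg: "tr (\<lambda>a b f. b 0 \<in> std_grid (a x)) (\<lambda>a b f. b 0 \<in> grid_vecs E (a x))"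
      by (rule tr_grid[OF tvec_var tnum_var])
    obtain p where p: "\<forall>a b f. b 0 \<in> std_grid (a x) \<longleftrightarrow> sat UNIV id (enc a b f) p"
      "\<forall>a b f. (\<forall>k. f k \<in> ifuns) \<longrightarrow> (b 0 \<in> grid_vecs E (a x) \<longleftrightarrow> sat (internal E) (star_rel E) (enc a b f) p)"
      using trE[OF tg] .
    \<comment> \<open>The set variable borrows a numerical index, large enough to be fresh. The sort
      suggested by an index binds only the encoded contexts.\<close>
    define w where "w = nv (var_bound p + x + z + k + 1)"
    have w: "var_bound p \<le> w" "w \<noteq> nv x" "w \<noteq> nv z" "w \<noteq> fv k" "w \<noteq> vv 0"
      unfolding w_def by (simp_all add: nv_distinct, simp add: nv_def)
    let ?p = "hyperfinite_formula p ?H w k z"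
    show ?thesis
    proof (rule trI[where p="?p"])
      show "\<forall>a b f. a z = (\<Sum>v\<in>std_grid (a x). f k v) \<longleftrightarrow> sat UNIV id (enc a b f) ?p"
      proof (intro allI)
        fix a :: "nat \<Rightarrow> real" and b :: "nat \<Rightarrow> real ^ 'n" and f :: "nat \<Rightarrow> real ^ 'n \<Rightarrow> real"
        have "sat UNIV id (enc a b f) ?p \<longleftrightarrow>
            VecSet (std_grid (a x) :: (real ^ 'n) set) \<in> UNIV \<and> [VecSet (std_grid (a x)), Fun (f k), Num (a z)] \<in> id ?H"
        proof -
          have G: "0 \<in> (std_grid (a x) :: (real ^ 'n) set)"
            by (auto simp: std_grid_def intro!: bexI[of _ 0])
          have eq: "v \<in> std_grid (a x) \<longleftrightarrow> sat UNIV id (enc a (b(0 := v)) f) p" for v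
            using p(1)[rule_format, of "b(0 := v)" a f] by simp
          show ?thesis
            using sat_hyperfinite_formula[OF w(1-5) UNIV_I UNIV_I G eq, of "?H"] by assumption
        qed
        then show "a z = (\<Sum>v\<in>std_grid (a x). f k v) \<longleftrightarrow> sat UNIV id (enc a b f) ?p"
          using finite_std_grid_real[of "a x", where 'n='n] by simp
      qed
      fix a :: "nat \<Rightarrow> 'h" and b :: "nat \<Rightarrow> 'h ^ 'n" and f :: "nat \<Rightarrow> 'h ^ 'n \<Rightarrow> 'h"
      assume f: "\<And>k. f k \<in> ifuns"
      show "?Q z k a b f \<longleftrightarrow> sat (internal E) (star_rel E) (enc a b f) ?p"
      proof (rule sat_hyperfinite_formula[OF w(1-5), where D="internal E" and I="star_rel E"
            and G="grid_vecs E (a x)" and H="?H" and a=a and b=b and f=f, symmetric])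
        have "0 \<in> hnum_set E \<int>"
          using star_mem[of "Num 0 :: (real, 'n) entity" "NumSet \<int>"] mem_star_num[of \<int>] by (auto simp: star_num)
        then show "0 \<in> grid_vecs E (a x)"
          by (auto simp: grid_vecs_def grid_def intro!: exI[of _ 0])
        show "v \<in> grid_vecs E (a x) \<longleftrightarrow> sat (internal E) (star_rel E) (enc a (b(0 := v)) f) p" for v
          using p(2)[rule_format, of f "b(0 := v)" a] f by simp
        show "Num r \<in> internal E" for r by (rule internal_num)
        show "Vec r \<in> internal E" for r by (rule internal_vec)
      qed
    qed
  qed
  show ?thesis
  proof (rule tr_cong[OF tr[of z k]])
    fix a :: "nat \<Rightarrow> 'h" and b :: "nat \<Rightarrow> 'h ^ 'n" and f :: "nat \<Rightarrow> 'h ^ 'n \<Rightarrow> 'h"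
    assume f: "\<And>k. f k \<in> ifuns"
    \<comment> \<open>On the standard side the sum itself is the witness. Transfer yields, besides
      the value, that the grid is an internal set.\<close>
    have "tr (\<lambda>a b f. \<exists>r. (a(Suc x := r)) (Suc x) = (\<Sum>v\<in>std_grid ((a(Suc x := r)) x). f k v))
        (\<lambda>a b f. \<exists>r. ?Q (Suc x) k (a(Suc x := r)) b f)"
      by (rule tr_ex_num[OF tr])
    from transfer[where a=a and b=b and f=f, OF this _ f]
    have "\<exists>r. ?Q (Suc x) k (a(Suc x := r)) b f"
      by simp
    then obtain r where int: "VecSet (grid_vecs E (a x)) \<in> internal E"
      and r: "[VecSet (grid_vecs E (a x)), Fun (f k), Num r] \<in> star_rel E ?H"
      by auto
    have uniq: "s = r" if s: "[VecSet (grid_vecs E (a x)), Fun (f k), Num s] \<in> star_rel E ?H" for s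
    proof -
      let ?a = "a(Suc x := r, Suc (Suc x) := s)"
      have "tr (\<lambda>a b f. a (Suc x) = (\<Sum>v\<in>std_grid (a x). f k v) \<and>
          a (Suc (Suc x)) = (\<Sum>v\<in>std_grid (a x). f k v) \<longrightarrow> a (Suc (Suc x)) = a (Suc x))
        (\<lambda>a b f. ?Q (Suc x) k a b f \<and> ?Q (Suc (Suc x)) k a b f \<longrightarrow> a (Suc (Suc x)) = a (Suc x))"
        by (intro tr_imp tr_conj tr tr_eq_var)
      from transfer[where a="?a" and b=b and f=f, OF this _ f]
      have "?Q (Suc x) k ?a b f \<and> ?Q (Suc (Suc x)) k ?a b f \<longrightarrow> ?a (Suc (Suc x)) = ?a (Suc x)"
        by simp
      then show ?thesis
        using int r s by simp
    qed
    have eq: "hsum E (grid_vecs E (a x)) (f k) = r"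
      unfolding hsum_def by (rule the_equality) (rule r, rule uniq)
    show "a z = hsum E (grid_vecs E (a x)) (f k) \<longleftrightarrow> ?Q z k a b f"
    proof
      assume "a z = hsum E (grid_vecs E (a x)) (f k)"
      then show "?Q z k a b f"
        using int r eq by simp
    next
      assume "?Q z k a b f"
      then show "a z = hsum E (grid_vecs E (a x)) (f k)"
        using uniq[of "a z"] eq by simp
    qed
  qed simp
qed

text \<open>\<open>tr_sum_var\<close> treats a function variable, so the summand is named by a fresh
  one that agrees with it everywhere. On the nonstandard side \<open>tfun_internal\<close> supplies
  the internal function.\<close>

lemma tnum_sum:
  assumes "tnum n n'" "tfun s t"
  shows "tnum (\<lambda>a b f. \<Sum>v\<in>std_grid (n a b f). s a b f v) (\<lambda>a b f. hsum E (grid_vecs E (n' a b f)) (t a b f))"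
proof -
  obtain m where m: "depends UNIV m n" "depends ifuns m n'" "\<forall>x\<ge>m. \<forall>P Q. tr P Q \<longrightarrow>
    tr (\<lambda>a b f. P (a(x := n a b f)) b f) (\<lambda>a b f. Q (a(x := n' a b f)) b f)"
    using tr_subst_num[OF assms(1)] by blast
  obtain m' where m': "depends UNIV m' s" "depends ifuns m' t"
    using assms(2) unfolding tfun_def by blast
  show ?thesis
  proof (rule tnumI)
    show "depends UNIV (max m m') (\<lambda>a b f. \<Sum>v\<in>std_grid (n a b f). s a b f v)"
      "depends ifuns (max m m') (\<lambda>a b f. hsum E (grid_vecs E (n' a b f)) (t a b f))"
      using depends_comp2[OF m(1) m'(1), of "\<lambda>n s. \<Sum>v\<in>std_grid n. s v"]
        depends_comp2[OF m(2) m'(2), of "\<lambda>n s. hsum E (grid_vecs E n) s"] by blast+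
    show "tr (\<lambda>a b f. a z = (\<Sum>v\<in>std_grid (n a b f). s a b f v))
        (\<lambda>a b f. a z = hsum E (grid_vecs E (n' a b f)) (t a b f))" for z
    proof -
      let ?x = "Suc (m + z)" and ?k = "max m m'"
      have "tr (\<lambda>a b f. a z = (\<Sum>v\<in>std_grid (n a b f). f ?k v))
          (\<lambda>a b f. a z = hsum E (grid_vecs E (n' a b f)) (f ?k))"
        using m(3)[rule_format, of ?x, OF _ tr_sum_var[where z=z and x="?x" and k="?k"]] by simp
      moreover have "tr (\<lambda>a b f. f ?k (b ?k) = s a b f (b ?k)) (\<lambda>a b f. f ?k (b ?k) = t a b f (b ?k))"
        by (intro tr_eq tfun_app tfun_var tvec_var assms(2))
      note tr_all_vec[OF this, of ?k]
      ultimately have "tr (\<lambda>a b f. a z = (\<Sum>v\<in>std_grid (n a b f). f ?k v) \<and>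
            (\<forall>v. f ?k ((b(?k := v)) ?k) = s a (b(?k := v)) f ((b(?k := v)) ?k)))
          (\<lambda>a b f. a z = hsum E (grid_vecs E (n' a b f)) (f ?k) \<and>
            (\<forall>v. f ?k ((b(?k := v)) ?k) = t a (b(?k := v)) f ((b(?k := v)) ?k)))"
        by (rule tr_conj)
      from tr_ex_fun[OF this, of ?k] show ?thesis
      proof (rule tr_cong)
        fix a :: "nat \<Rightarrow> real" and b :: "nat \<Rightarrow> real ^ 'n" and f :: "nat \<Rightarrow> real ^ 'n \<Rightarrow> real"
        have "s a (b(?k := v)) (f(?k := g)) = s a b f" "n a b (f(?k := g)) = n a b f" for g v
          using depends_upd(2,3)[OF m'(1)] depends_upd(3)[OF m(1)] by simp_all
        then show "a z = (\<Sum>v\<in>std_grid (n a b f). s a b f v) \<longleftrightarrow>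
          (\<exists>g. a z = (\<Sum>v\<in>std_grid (n a b (f(?k := g))). (f(?k := g)) ?k v) \<and>
            (\<forall>v. (f(?k := g)) ?k ((b(?k := v)) ?k) = s a (b(?k := v)) (f(?k := g)) ((b(?k := v)) ?k)))"
          by (auto simp: fun_eq_iff[symmetric])
      next
        fix a :: "nat \<Rightarrow> 'h" and b :: "nat \<Rightarrow> 'h ^ 'n" and f :: "nat \<Rightarrow> 'h ^ 'n \<Rightarrow> 'h"
        assume f: "\<And>k. f k \<in> ifuns"
        have t: "t a (b(?k := v)) (f(?k := g)) = t a b f" "n' a b (f(?k := g)) = n' a b f" if "g \<in> ifuns" for g v
        proof -
          have fg: "(f(?k := g)) i \<in> ifuns" for i
            using f that by simp
          have "t a (b(?k := v)) (f(?k := g)) = t a b (f(?k := g))"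
            by (rule depends_upd(2)[OF m'(2)]) (use fg in auto)
          also have "\<dots> = t a b f"
            by (rule depends_upd(3)[OF m'(2)]) (use f that in auto)
          finally show "t a (b(?k := v)) (f(?k := g)) = t a b f" .
          show "n' a b (f(?k := g)) = n' a b f"
            by (rule depends_upd(3)[OF m(2)]) (use f that in auto)
        qed
        have "(\<exists>g\<in>ifuns. a z = hsum E (grid_vecs E (n' a b (f(?k := g)))) ((f(?k := g)) ?k) \<and>
            (\<forall>v. (f(?k := g)) ?k ((b(?k := v)) ?k) = t a (b(?k := v)) (f(?k := g)) ((b(?k := v)) ?k))) \<longleftrightarrow>
          (\<exists>g\<in>ifuns. a z = hsum E (grid_vecs E (n' a b f)) g \<and> g = t a b f)"
          using t by (intro bex_cong refl) (auto simp: fun_eq_iff[symmetric])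
        then show "a z = hsum E (grid_vecs E (n' a b f)) (t a b f) \<longleftrightarrow>
          (\<exists>g\<in>ifuns. a z = hsum E (grid_vecs E (n' a b (f(?k := g)))) ((f(?k := g)) ?k) \<and>
            (\<forall>v. (f(?k := g)) ?k ((b(?k := v)) ?k) = t a (b(?k := v)) (f(?k := g)) ((b(?k := v)) ?k)))"
          using tfun_internal[OF assms(2), of f a b] f by auto
      qed
    qed
  qed
qed

lemma tnum_inner:
  assumes "tnum n n'" "tfun s t" "tfun s' t'"
  shows "tnum (\<lambda>a b f. std_inner (n a b f) (s a b f) (s' a b f))
    (\<lambda>a b f. grid_inner E (n' a b f) (t a b f) (t' a b f))"
  unfolding std_inner_def grid_inner_def
  by (rule tnum_mult[OF tnum_power[OF tnum_divide[OF tnum_one assms(1)]]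
    tnum_sum[OF assms(1) tfun_mult[OF assms(2,3)]]])

end

section \<open>Finite and infinitesimal numbers\<close>

context nonstandard
begin

lemma tnum_grid_diffs: "tnum n n' \<Longrightarrow> tfun s t \<Longrightarrow> tvec u v \<Longrightarrow>
    tnum (\<lambda>a b f. grid_diffs (n a b f) ks (s a b f) (u a b f))
      (\<lambda>a b f. grid_diffs (n' a b f) ks (t a b f) (v a b f))"
  using tfun_grid_diffs[of n n' s t ks] tfun_app by blast

lemma tnum_fun_var: "tvec u v \<Longrightarrow> tnum (\<lambda>a b f. f i (u a b f)) (\<lambda>a b f. f i (v a b f))"
  by (rule tfun_app[OF tfun_var])

lemma tnum_fun_const: "tvec u v \<Longrightarrow> tnum (\<lambda>a b f. g (u a b f)) (\<lambda>a b f. hfun E g (v a b f))"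
  by (rule tfun_app[OF tfun_const])

lemma tr_nat: "tnum s t \<Longrightarrow> tr (\<lambda>a b f. s a b f \<in> \<nat>) (\<lambda>a b f. t a b f \<in> hnum_set E \<nat>)"
  and tr_int: "tnum s t \<Longrightarrow> tr (\<lambda>a b f. s a b f \<in> \<int>) (\<lambda>a b f. t a b f \<in> hnum_set E \<int>)"
  using Nats_0 Ints_0 by (intro tr_num_set; blast)+

lemmas tr_intros = tr_not tr_conj tr_disj tr_imp tr_eq tr_less tr_le tr_nat tr_int
  tr_ball_finite tr_grid finite_class.finite_UNIV
  tnum_var tnum_zero tnum_one tnum_const tnum_add tnum_diff tnum_mult tnum_divide tnum_abs tnum_power
  tnum_component tnum_grid_diffs tnum_fun_var tvec_var tvec_add tvec_axis tfun_var tfun_const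

lemma transfer_all:
  assumes "tr P Q" "\<forall>a b f. P a b f" "\<forall>k. f k \<in> ifuns"
  shows "Q a b f"
  using transfer[OF assms(1) assms(2)[rule_format] assms(3)[rule_format]] .

lemma transfer_num:
  assumes "tr P Q" "\<forall>a b f. P a b f"
  shows "Q a (\<lambda>_. 0) (\<lambda>_. hfun E (\<lambda>_. 0))"
  by (rule transfer_all[OF assms]) (simp add: star_ifun)

lemma infinitesimal_iff: "infinitesimal x \<longleftrightarrow> (\<forall>e>0. \<bar>x\<bar> < hreal E e)"
proof
  assume x: "infinitesimal x"
  show "\<forall>e>0. \<bar>x\<bar> < hreal E e"
  proof (intro allI impI)
    fix e :: real assume "e > 0"
    then obtain n where "1 / real (Suc n) < e"
      using nat_approx_posE by blast
    then have "1 / of_nat (Suc n) < hreal E e"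
      using hreal_less[of "1 / real (Suc n)" e] hreal_divide[of 1 "real (Suc n)"] hreal_of_nat[of "Suc n"]
      by (simp del: of_nat_Suc)
    then show "\<bar>x\<bar> < hreal E e"
      using less_trans[OF x[unfolded infinitesimal_def, rule_format, of n]] by blast
  qed
next
  assume x: "\<forall>e>0. \<bar>x\<bar> < hreal E e"
  show "infinitesimal x"
    unfolding infinitesimal_def
  proof
    fix n
    have "hreal E (1 / real (Suc n)) = 1 / of_nat (Suc n)"
      using hreal_divide[of 1 "real (Suc n)"] hreal_of_nat[of "Suc n"] by (simp del: of_nat_Suc)
    then show "\<bar>x\<bar> < 1 / of_nat (Suc n)"
      using x[rule_format, of "1 / real (Suc n)"] by (simp del: of_nat_Suc)
  qed
qed

lemma hfinite_iff: "hfinite (x :: 'h) \<longleftrightarrow> (\<exists>r. \<bar>x\<bar> \<le> hreal E r)"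
proof
  assume "hfinite x"
  then show "\<exists>r. \<bar>x\<bar> \<le> hreal E r"
    unfolding hfinite_def by (metis hreal_of_nat)
next
  assume "\<exists>r. \<bar>x\<bar> \<le> hreal E r"
  then obtain r where r: "\<bar>x\<bar> \<le> hreal E r" by blast
  obtain n where "r \<le> real n"
    using real_arch_simple by blast
  then have "\<bar>x\<bar> \<le> of_nat n"
    using r hreal_le[of r "real n"] by simp
  then show "hfinite x"
    unfolding hfinite_def by blast
qed

lemma approxI: "(\<And>e. e > 0 \<Longrightarrow> \<bar>x - y\<bar> < hreal E e) \<Longrightarrow> approx x y"
  by (simp add: approx_def infinitesimal_iff)

lemma approxD: "approx x y \<Longrightarrow> e > 0 \<Longrightarrow> \<bar>x - y\<bar> < hreal E e"
  by (simp add: approx_def infinitesimal_iff)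

lemma approx_refl: "approx (x :: 'h) x"
  by (rule approxI) (use hreal_less[of 0] in simp)

lemma approx_sym: "approx (x :: 'h) y \<Longrightarrow> approx y x"
  by (simp add: approx_def infinitesimal_iff abs_minus_commute)

lemma hreal_half: "hreal E (e / 2) + hreal E (e / 2) = hreal E e"
  using hreal_add[of "e / 2" "e / 2"] by simp

lemma approx_add: "approx (x :: 'h) y \<Longrightarrow> approx x' y' \<Longrightarrow> approx (x + x') (y + y')"
proof (rule approxI)
  fix e :: real
  assume "approx x y" "approx x' y'" "e > 0"
  then have "\<bar>x - y\<bar> < hreal E (e / 2)" "\<bar>x' - y'\<bar> < hreal E (e / 2)"
    by (auto intro: approxD)
  then show "\<bar>x + x' - (y + y')\<bar> < hreal E e"
    using hreal_half[of e] by (simp add: abs_if split: if_splits)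
qed

lemma approx_trans: "approx (x :: 'h) y \<Longrightarrow> approx y z \<Longrightarrow> approx x z"
proof (rule approxI)
  fix e :: real
  assume "approx x y" "approx y z" "e > 0"
  then have "\<bar>x - y\<bar> < hreal E (e / 2)" "\<bar>y - z\<bar> < hreal E (e / 2)"
    by (auto intro: approxD)
  then show "\<bar>x - z\<bar> < hreal E e"
    using hreal_half[of e] by (simp add: abs_if split: if_splits)
qed

lemma approx_hreal_unique: "approx x (hreal E r) \<Longrightarrow> approx x (hreal E s) \<Longrightarrow> r = s"
proof (rule ccontr)
  assume "approx x (hreal E r)" "approx x (hreal E s)" "r \<noteq> s"
  then have "approx (hreal E r) (hreal E s)"
    using approx_sym approx_trans by blast
  then have "\<bar>hreal E r - hreal E s\<bar> < hreal E \<bar>r - s\<bar>"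
    using \<open>r \<noteq> s\<close> by (intro approxD) auto
  then show False
    using hreal_diff[of r s] hreal_diff[of s r] by (cases "r \<le> s") (auto simp: abs_if split: if_splits)
qed

lemma approx_hfinite: "approx (x :: 'h) y \<Longrightarrow> hfinite y \<Longrightarrow> hfinite x"
proof -
  assume a: "approx x y" and "hfinite y"
  then obtain r where "\<bar>y\<bar> \<le> hreal E r"
    using hfinite_iff by blast
  moreover have "\<bar>x - y\<bar> < hreal E 1"
    using a by (rule approxD) simp
  ultimately have "\<bar>x\<bar> \<le> hreal E (r + 1)"
    unfolding hreal_add by (simp add: abs_if split: if_splits)
  then show "hfinite x"
    using hfinite_iff by blast
qed

text \<open>Completeness of the reals: the standard part is the supremum of the reals whose image is
  at most \<open>x\<close>.\<close>

lemma standard_part_exists: "hfinite x \<Longrightarrow> \<exists>r. approx x (hreal E r)"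
proof -
  assume "hfinite x"
  then obtain b where b: "\<bar>x\<bar> \<le> hreal E b"
    using hfinite_iff by blast
  let ?S = "{q. hreal E q \<le> x}"
  have bd: "q \<le> b" if "q \<in> ?S" for q
  proof -
    have "hreal E q \<le> hreal E b"
      using that b by (meson abs_le_D1 mem_Collect_eq order_trans)
    then show ?thesis by (simp add: hreal_le)
  qed
  have ne: "- b \<in> ?S"
    using b hreal_diff[of 0 b] by (simp add: abs_le_iff minus_le_iff)
  have bdd: "bdd_above ?S"
    using bd by (rule bdd_aboveI)
  have "approx x (hreal E (Sup ?S))"
  proof (rule approxI)
    fix e :: real assume "e > 0"
    have "Sup ?S + e / 2 \<notin> ?S"
      using cSup_upper[OF _ bdd, of "Sup ?S + e / 2"] \<open>e > 0\<close> by auto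
    then have 1: "x < hreal E (Sup ?S) + hreal E (e / 2)"
      by (simp add: hreal_add not_le)
    obtain q where "q \<in> ?S" "Sup ?S - e / 2 < q"
      using less_cSup_iff[of ?S "Sup ?S - e / 2"] ne bdd \<open>e > 0\<close> by auto
    then have "hreal E (Sup ?S - e / 2) < x"
      using hreal_less[of "Sup ?S - e / 2" q] by (simp add: less_le_trans)
    then have 2: "hreal E (Sup ?S) - hreal E (e / 2) < x"
      by (simp add: hreal_diff)
    have 3: "hreal E (e / 2) < hreal E e"
      using \<open>e > 0\<close> by (simp add: hreal_less)
    have "x - hreal E (Sup ?S) < hreal E e" "- (x - hreal E (Sup ?S)) < hreal E e"
      using 1 2 3 by (simp_all add: algebra_simps)
    then show "\<bar>x - hreal E (Sup ?S)\<bar> < hreal E e"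
      by (simp add: abs_less_iff)
  qed
  then show ?thesis by blast
qed

lemma st_approx: "hfinite x \<Longrightarrow> approx x (hreal E (st E x))"
  unfolding st_def using standard_part_exists approx_hreal_unique by (metis (mono_tags, lifting) theI)

lemma st_eqI: "approx x (hreal E r) \<Longrightarrow> st E x = r"
  unfolding st_def using approx_hreal_unique by blast

lemma hfinite_hreal: "hfinite (hreal E r)"
proof -
  have "\<bar>hreal E r\<bar> \<le> hreal E \<bar>r\<bar>"
  proof -
    have "hreal E r \<le> hreal E \<bar>r\<bar>" "hreal E (- r) \<le> hreal E \<bar>r\<bar>"
      by (simp_all add: hreal_le)
    then show ?thesis
      using hreal_diff[of 0 r] by (simp add: abs_le_iff)
  qed
  then show ?thesis
    using hfinite_iff by blast
qed

lemma approx_cmult: "approx x y \<Longrightarrow> approx (hreal E c * x) (hreal E c * y)"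
proof (rule approxI)
  fix e :: real assume a: "approx x y" and "e > 0"
  have "\<bar>hreal E c * x - hreal E c * y\<bar> = \<bar>hreal E c\<bar> * \<bar>x - y\<bar>"
    by (simp add: abs_mult[symmetric] right_diff_distrib)
  \<comment> \<open>Adding 1 makes the factor positive, so \<open>e\<close> can be divided by it
    also when \<open>c\<close> is 0.\<close>
  also have "\<dots> \<le> hreal E (\<bar>c\<bar> + 1) * \<bar>x - y\<bar>"
  proof (rule mult_right_mono)
    have "hreal E c \<le> hreal E (\<bar>c\<bar> + 1)" "hreal E (- c) \<le> hreal E (\<bar>c\<bar> + 1)"
      unfolding hreal_le by auto
    then show "\<bar>hreal E c\<bar> \<le> hreal E (\<bar>c\<bar> + 1)"
      using hreal_diff[of 0 c] by (simp add: abs_le_iff)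
  qed simp
  also have "\<dots> < hreal E (\<bar>c\<bar> + 1) * hreal E (e / (\<bar>c\<bar> + 1))"
    using approxD[OF a, of "e / (\<bar>c\<bar> + 1)"] \<open>e > 0\<close> hreal_less[of 0 "\<bar>c\<bar> + 1"]
    by (intro mult_strict_left_mono) auto
  also have "\<dots> = hreal E e"
    unfolding hreal_mult[symmetric] by simp
  finally show "\<bar>hreal E c * x - hreal E c * y\<bar> < hreal E e" .
qed

lemma hvec_nth: "hvec E v $ i = hreal E (v $ i)"
proof -
  have "sat UNIV id (\<lambda>j. if j = 0 then Vec v else Num (v $ i)) (Comp 0 i 1)"
    by simp
  then show ?thesis
    unfolding transfer_sat by (auto simp: star_num star_vec)
qed

section \<open>Hypernatural numbers and overspill\<close>

lemma hnat_nonneg: "n \<in> hnum_set E \<nat> \<Longrightarrow> 0 \<le> n"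
proof -
  assume n: "n \<in> hnum_set E \<nat>"
  have "tr (\<lambda>a b f. a 0 \<in> \<nat> \<longrightarrow> 0 \<le> a 0) (\<lambda>a b f. a 0 \<in> hnum_set E \<nat> \<longrightarrow> 0 \<le> a 0)"
    by (intro tr_intros)
  note tr = this
  have "\<forall>(a :: nat \<Rightarrow> real) b f. a 0 \<in> \<nat> \<longrightarrow> 0 \<le> a 0"
    by (auto elim: Nats_cases)
  from transfer_num[where a="\<lambda>_. n", OF tr this] n show ?thesis
    by simp
qed

lemma hnat_pred: "n \<in> hnum_set E \<nat> \<Longrightarrow> n \<noteq> 0 \<Longrightarrow> n - 1 \<in> hnum_set E \<nat>"
proof -
  assume n: "n \<in> hnum_set E \<nat>" "n \<noteq> 0"
  have "tr (\<lambda>a b f. a 0 \<in> \<nat> \<and> \<not> a 0 = 0 \<longrightarrow> a 0 - 1 \<in> \<nat>)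
      (\<lambda>a b f. a 0 \<in> hnum_set E \<nat> \<and> \<not> a 0 = 0 \<longrightarrow> a 0 - 1 \<in> hnum_set E \<nat>)"
    by (intro tr_intros)
  note tr = this
  have "\<forall>(a :: nat \<Rightarrow> real) b f. a 0 \<in> \<nat> \<and> \<not> a 0 = 0 \<longrightarrow> a 0 - 1 \<in> \<nat>"
  proof (intro allI impI)
    fix a :: "nat \<Rightarrow> real"
    assume "a 0 \<in> \<nat> \<and> \<not> a 0 = 0"
    then obtain m where m: "a 0 = real m" "m \<noteq> 0"
      by (auto elim: Nats_cases)
    then have "a 0 - 1 = real (m - 1)"
      by simp
    then show "a 0 - 1 \<in> \<nat>"
      using of_nat_in_Nats by metis
  qed
  from transfer_num[where a="\<lambda>_. n", OF tr this] n show ?thesis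
    by simp
qed

text \<open>Induction on the standard bound; the transferred fact that no natural lies strictly
  between k and k + 1 settles one candidate at a time.\<close>

lemma hnat_le_cases: "n \<in> hnum_set E \<nat> \<Longrightarrow> n \<le> of_nat k \<Longrightarrow> \<exists>i\<le>k. n = of_nat i"
proof (induction k)
  case 0
  then show ?case
    using hnat_nonneg[of n] by (auto intro: order_antisym)
next
  case (Suc k)
  have t: "tr (\<lambda>a b f. a 0 \<in> \<nat> \<and> a 0 \<le> real (Suc k) \<longrightarrow> a 0 \<le> real k \<or> a 0 = real (Suc k))
      (\<lambda>a b f. a 0 \<in> hnum_set E \<nat> \<and> a 0 \<le> hreal E (real (Suc k)) \<longrightarrow>
        a 0 \<le> hreal E (real k) \<or> a 0 = hreal E (real (Suc k)))"
    by (intro tr_intros)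
  have "n \<le> hreal E (real k) \<or> n = hreal E (real (Suc k))"
  proof -
    have "\<forall>(a :: nat \<Rightarrow> real) b f. a 0 \<in> \<nat> \<and> a 0 \<le> real (Suc k) \<longrightarrow> a 0 \<le> real k \<or> a 0 = real (Suc k)"
      by (auto elim!: Nats_cases)
    from transfer_num[where a="\<lambda>_. n", OF t this] show ?thesis
      using Suc.prems unfolding hreal_of_nat by blast
  qed
  then show ?case
  proof
    assume "n \<le> hreal E (real k)"
    then show ?case
      using Suc.IH[OF Suc.prems(1)] by (auto intro: le_SucI)
  next
    assume "n = hreal E (real (Suc k))"
    then show ?case
      unfolding hreal_of_nat by blast
  qed
qed

definition infinite_hnat :: "'h \<Rightarrow> bool" where
  "infinite_hnat n \<longleftrightarrow> n \<in> hnum_set E \<nat> \<and> (\<forall>k::nat. of_nat k < n)"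

text \<open>The least number principle is transferred: either the property holds at all
  hypernaturals, or there is a first failure j. By hypothesis j is not standard, hence infinite, and
  then j - 1 is still infinite and has the property.\<close>

theorem overspill:
  assumes PQ: "tr P Q" and f: "\<And>k. f k \<in> ifuns"
    and Q: "\<And>i::nat. Q (a(k := of_nat i)) b f" and N: "infinite_hnat N"
  shows "\<exists>J. infinite_hnat J \<and> Q (a(k := J)) b f"
proof -
  obtain m where m: "depends UNIV m P" "depends ifuns m Q"
    using tr_depends[OF PQ] by blast
  \<comment> \<open>A fresh variable to hold the first failure.\<close>
  let ?l = "Suc (m + k)"
  have 1: "tr (\<lambda>a b f. \<forall>i. (a(k := i)) k \<in> \<nat> \<longrightarrow> P (a(k := i)) b f)
      (\<lambda>a b f. \<forall>i. (a(k := i)) k \<in> hnum_set E \<nat> \<longrightarrow> Q (a(k := i)) b f)"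
    by (rule tr_all_num[of "\<lambda>a b f. a k \<in> \<nat> \<longrightarrow> P a b f" "\<lambda>a b f. a k \<in> hnum_set E \<nat> \<longrightarrow> Q a b f"])
      (intro tr_intros PQ)
  have 2: "tr (\<lambda>a b f. \<forall>i. (a(k := i)) k \<in> \<nat> \<and> (a(k := i)) k < (a(k := i)) ?l \<longrightarrow> P (a(k := i)) b f)
      (\<lambda>a b f. \<forall>i. (a(k := i)) k \<in> hnum_set E \<nat> \<and> (a(k := i)) k < (a(k := i)) ?l \<longrightarrow> Q (a(k := i)) b f)"
    by (rule tr_all_num[of "\<lambda>a b f. a k \<in> \<nat> \<and> a k < a ?l \<longrightarrow> P a b f"
          "\<lambda>a b f. a k \<in> hnum_set E \<nat> \<and> a k < a ?l \<longrightarrow> Q a b f"])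
      (intro tr_intros PQ)
  have 3: "tr (\<lambda>a b f. \<forall>i. (a(k := i)) k = (a(k := i)) ?l \<longrightarrow> \<not> P (a(k := i)) b f)
      (\<lambda>a b f. \<forall>i. (a(k := i)) k = (a(k := i)) ?l \<longrightarrow> \<not> Q (a(k := i)) b f)"
    by (rule tr_all_num[of "\<lambda>a b f. a k = a ?l \<longrightarrow> \<not> P a b f" "\<lambda>a b f. a k = a ?l \<longrightarrow> \<not> Q a b f"])
      (intro tr_intros PQ)
  have "tr (\<lambda>a b f. (\<forall>i. i \<in> \<nat> \<longrightarrow> P (a(k := i)) b f) \<or> (\<exists>j. j \<in> \<nat> \<and>
        (\<forall>i. i \<in> \<nat> \<and> i < j \<longrightarrow> P (a(?l := j, k := i)) b f) \<and> \<not> P (a(?l := j, k := j)) b f))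
      (\<lambda>a b f. (\<forall>i. i \<in> hnum_set E \<nat> \<longrightarrow> Q (a(k := i)) b f) \<or> (\<exists>j. j \<in> hnum_set E \<nat> \<and>
        (\<forall>i. i \<in> hnum_set E \<nat> \<and> i < j \<longrightarrow> Q (a(?l := j, k := i)) b f) \<and> \<not> Q (a(?l := j, k := j)) b f))"
    using tr_disj[OF 1 tr_ex_num[OF tr_conj[OF tr_nat[OF tnum_var[of ?l]] tr_conj[OF 2 3]], of ?l]] by simp
  note tr = this
  have std: "(\<forall>i. i \<in> \<nat> \<longrightarrow> P (a(k := i)) b f) \<or> (\<exists>j. j \<in> \<nat> \<and>
        (\<forall>i. i \<in> \<nat> \<and> i < j \<longrightarrow> P (a(?l := j, k := i)) b f) \<and> \<not> P (a(?l := j, k := j)) b f)"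
    for a :: "nat \<Rightarrow> real" and b :: "nat \<Rightarrow> real ^ 'n" and f :: "nat \<Rightarrow> real ^ 'n \<Rightarrow> real"
  proof -
    have P: "P (a(?l := j, k := i)) b f \<longleftrightarrow> P (a(k := i)) b f" for i j
      using depends_upd(1)[OF m(1), of f ?l "a(k := i)" j b] by (simp add: fun_upd_twist)
    show ?thesis
    proof (cases "\<forall>i::nat. P (a(k := real i)) b f")
      case False
      then obtain j :: nat where j: "\<not> P (a(k := real j)) b f" "\<And>i. i < j \<Longrightarrow> P (a(k := real i)) b f"
        using exists_least_iff[of "\<lambda>i. \<not> P (a(k := real i)) b f"] by blast
      then show ?thesis
        unfolding P by (intro disjI2 exI[of _ "real j"]) (auto elim!: Nats_cases)
    qed (auto elim!: Nats_cases)
  qed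
  from transfer[where a=a and b=b and f=f, OF tr std f]
  have "(\<forall>i. i \<in> hnum_set E \<nat> \<longrightarrow> Q (a(k := i)) b f) \<or> (\<exists>j. j \<in> hnum_set E \<nat> \<and>
        (\<forall>i. i \<in> hnum_set E \<nat> \<and> i < j \<longrightarrow> Q (a(?l := j, k := i)) b f) \<and> \<not> Q (a(?l := j, k := j)) b f)" .
  then show ?thesis
  proof
    assume "\<forall>i. i \<in> hnum_set E \<nat> \<longrightarrow> Q (a(k := i)) b f"
    then show ?thesis
      using N unfolding infinite_hnat_def by blast
  next
    assume "\<exists>j. j \<in> hnum_set E \<nat> \<and> (\<forall>i. i \<in> hnum_set E \<nat> \<and> i < j \<longrightarrow> Q (a(?l := j, k := i)) b f) \<and>
      \<not> Q (a(?l := j, k := j)) b f"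
    then obtain j where j: "j \<in> hnum_set E \<nat>" "\<not> Q (a(?l := j, k := j)) b f"
      "\<And>i. i \<in> hnum_set E \<nat> \<Longrightarrow> i < j \<Longrightarrow> Q (a(?l := j, k := i)) b f"
      by blast
    have eq: "Q (a(?l := j, k := i)) b f \<longleftrightarrow> Q (a(k := i)) b f" for i
      using depends_upd(1)[OF m(2) f, of ?l "a(k := i)" j b] by (simp add: fun_upd_twist)
    have inf: "of_nat i < j" for i :: nat
    proof (rule ccontr)
      assume "\<not> of_nat i < j"
      then obtain i' where "j = of_nat i'"
        using hnat_le_cases[OF j(1), of i] by auto
      then show False
        using j(2) Q unfolding eq by simp
    qed
    have "j \<noteq> 0"
      using inf[of 0] by auto
    then have "j - 1 \<in> hnum_set E \<nat>"
      using j(1) hnat_pred by blast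
    moreover have "of_nat i < j - 1" for i :: nat
      using inf[of "Suc i"] by (simp add: less_diff_eq add.commute)
    moreover have "j - 1 < j" by simp
    ultimately show ?thesis
      using j(3) unfolding eq infinite_hnat_def by blast
  qed
qed

text \<open>\<open>hfact\<close> is a description, so existence and uniqueness of the factorial are
  transferred first. Then n \<le> n! carries infinity over from \<open>N\<^sub>0\<close>.\<close>

lemma infinite_hfact:
  assumes "N\<^sub>0 \<in> hnum_set E \<nat>" "\<not> hfinite N\<^sub>0"
  shows "infinite_hnat (hfact E N\<^sub>0)"
proof -
  let ?R = "{[Num (of_nat n), Num (fact n)] | n. True} :: (real, 'n) entity list set"
  have 1: "tr (\<lambda>a b f. a 0 \<in> \<nat> \<longrightarrow> (\<exists>r. [Num ((a(1 := r)) 0), Num ((a(1 := r)) 1)] \<in> ?R))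
      (\<lambda>a b f. a 0 \<in> hnum_set E \<nat> \<longrightarrow> (\<exists>r. [Num ((a(1 := r)) 0), Num ((a(1 := r)) 1)] \<in> star_rel E ?R))"
    by (intro tr_imp tr_nat tnum_var tr_ex_num[OF tr_rel])
  have "\<exists>r. [Num N\<^sub>0, Num r] \<in> star_rel E ?R"
  proof -
    have "\<forall>(a :: nat \<Rightarrow> real) b f. a 0 \<in> \<nat> \<longrightarrow> (\<exists>r. [Num ((a(1 := r)) 0), Num ((a(1 := r)) 1)] \<in> ?R)"
      by (auto elim!: Nats_cases)
    from transfer_num[where a="\<lambda>_. N\<^sub>0", OF 1 this] show ?thesis
      using assms(1) by simp
  qed
  then obtain r where r: "[Num N\<^sub>0, Num r] \<in> star_rel E ?R"
    by blast
  have 2: "tr (\<lambda>a b f. [Num (a 0), Num (a 1)] \<in> ?R \<and> [Num (a 0), Num (a 2)] \<in> ?R \<longrightarrow> a 1 = a 2)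
      (\<lambda>a b f. [Num (a 0), Num (a 1)] \<in> star_rel E ?R \<and> [Num (a 0), Num (a 2)] \<in> star_rel E ?R \<longrightarrow> a 1 = a 2)"
    by (intro tr_imp tr_conj tr_rel tr_eq tnum_var)
  have uniq: "s = r" if "[Num N\<^sub>0, Num s] \<in> star_rel E ?R" for s
  proof -
    have "\<forall>(a :: nat \<Rightarrow> real) b f. [Num (a 0), Num (a 1)] \<in> ?R \<and> [Num (a 0), Num (a 2)] \<in> ?R \<longrightarrow> a 1 = a 2"
      by auto
    from transfer_num[where a="\<lambda>i. if i = 0 then N\<^sub>0 else if i = 1 then s else r", OF 2 this] show ?thesis
      using r that by simp
  qed
  have N: "hfact E N\<^sub>0 = r"
    unfolding hfact_def by (rule the_equality) (rule r, rule uniq)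
  have 3: "tr (\<lambda>a b f. [Num (a 0), Num (a 1)] \<in> ?R \<longrightarrow> a 1 \<in> \<nat> \<and> a 0 \<le> a 1)
      (\<lambda>a b f. [Num (a 0), Num (a 1)] \<in> star_rel E ?R \<longrightarrow> a 1 \<in> hnum_set E \<nat> \<and> a 0 \<le> a 1)"
    by (intro tr_imp tr_conj tr_rel tr_nat tr_le tnum_var)
  have le: "real n \<le> fact n" for n
    using fact_ge_self[of n] by (metis of_nat_fact of_nat_le_iff)
  have "r \<in> hnum_set E \<nat>" "N\<^sub>0 \<le> r"
  proof -
    have "\<forall>(a :: nat \<Rightarrow> real) b f. [Num (a 0), Num (a 1)] \<in> ?R \<longrightarrow> a 1 \<in> \<nat> \<and> a 0 \<le> a 1"
    proof (intro allI impI)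
      fix a :: "nat \<Rightarrow> real"
      assume "[Num (a 0), Num (a 1)] \<in> ?R"
      then obtain n where "a 0 = real n" "a 1 = fact n"
        by auto
      then show "a 1 \<in> \<nat> \<and> a 0 \<le> a 1"
        using le[of n] of_nat_in_Nats[of "fact n", where 'a=real] by simp
    qed
    from transfer_num[where a="\<lambda>i. if i = 0 then N\<^sub>0 else r", OF 3 this]
    have "r \<in> hnum_set E \<nat> \<and> N\<^sub>0 \<le> r"
      using r by simp
    then show "r \<in> hnum_set E \<nat>" "N\<^sub>0 \<le> r" by simp_all
  qed
  moreover have "of_nat k < N\<^sub>0" for k
    using assms(2) hnat_nonneg[OF assms(1)] unfolding hfinite_def by (metis abs_of_nonneg not_le)
  ultimately show ?thesis
    unfolding N infinite_hnat_def by (metis less_le_trans)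
qed

end

section \<open>Grid test functions\<close>

lemma compact_box_neighbourhood:
  fixes K :: "(real ^ 'n::finite) set"
  assumes "open \<Omega>" "compact K" "K \<subseteq> \<Omega>"
  shows "\<exists>K' \<delta>. compact K' \<and> K' \<subseteq> \<Omega> \<and> \<delta> > 0 \<and>
    (\<forall>y\<in>K. \<forall>x. (\<forall>i. \<bar>x $ i - y $ i\<bar> \<le> \<delta>) \<longrightarrow> x \<in> K')"
proof -
  obtain e where e: "e > 0" "(\<Union>x\<in>K. ball x e) \<subseteq> \<Omega>"
    using compact_subset_open_imp_ball_epsilon_subset[OF assms(2,1,3)] by blast
  let ?K' = "{x + d | x d. x \<in> K \<and> d \<in> cball 0 (e / 2)}"
  have "x + d \<in> \<Omega>" if "x \<in> K" "d \<in> cball 0 (e / 2)" for x d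
  proof -
    have "x + d \<in> ball x e"
      using that e(1) by (simp add: dist_norm)
    then show ?thesis
      using that(1) e(2) by blast
  qed
  then have "?K' \<subseteq> \<Omega>" by blast
  moreover have "compact ?K'"
    by (intro compact_sums assms(2) compact_cball)
  moreover have "x \<in> ?K'" if y: "y \<in> K" and x: "\<forall>i. \<bar>x $ i - y $ i\<bar> \<le> e / 2 / CARD('n)" for x y
  proof -
    have "norm (x - y) \<le> (\<Sum>i\<in>(UNIV::'n set). e / 2 / CARD('n))"
      by (intro order_trans[OF norm_le_l1_cart] sum_mono) (use x in simp)
    then have "norm (x - y) \<le> e / 2"
      by simp
    then show ?thesis
      using y by (intro CollectI exI[of _ y] exI[of _ "x - y"]) simp
  qed
  ultimately show ?thesis
    using e(1) by (intro exI[of _ ?K'] exI[of _ "e / 2 / CARD('n)"]) auto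
qed

text \<open>Coordinates of \<open>x\<close> are at most R + S \<le> n in absolute value, so the
  numerators \<open>n * x $ i\<close> stay within n^2.\<close>

lemma std_grid_shift:
  fixes x y :: "real ^ 'n::finite"
  assumes "n \<ge> 1" "n \<ge> R + S" "y \<in> std_grid n" "\<And>i. \<bar>y $ i\<bar> \<le> R"
    "\<And>i. n * (x $ i - y $ i) \<in> \<int>" "\<And>i. \<bar>x $ i - y $ i\<bar> \<le> S"
  shows "x \<in> std_grid n"
  unfolding std_grid_def mem_Collect_eq
proof
  fix i
  obtain m where m: "m \<in> \<int>" "y $ i = m * (1 / n)"
    using assms(3) unfolding std_grid_def by blast
  have "n * x $ i = m + n * (x $ i - y $ i)"
    using m(2) assms(1) by (simp add: right_diff_distrib)
  then have "n * x $ i \<in> \<int>"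
    using m(1) assms(5)[of i] by simp
  moreover have "x $ i = (n * x $ i) * (1 / n)"
    using assms(1) by simp
  moreover have "\<bar>x $ i\<bar> \<le> n"
    using assms(2) assms(4)[of i] assms(6)[of i] by linarith
  then have "\<bar>n * x $ i\<bar> \<le> n\<^sup>2"
    using assms(1) by (simp add: abs_mult power2_eq_square)
  then have "- (n\<^sup>2) \<le> n * x $ i" "n * x $ i \<le> n\<^sup>2"
    by linarith+
  ultimately show "\<exists>m\<in>\<int>. x $ i = m * (1 / n) \<and> - (n\<^sup>2) \<le> m \<and> m \<le> n\<^sup>2"
    by blast
qed

lemma std_grid_dense:
  fixes y :: "real ^ 'n::finite"
  assumes "n \<ge> 1" "\<And>i. \<bar>y $ i\<bar> + 1 \<le> n"
  shows "\<exists>x\<in>std_grid n. \<forall>i. \<bar>x $ i - y $ i\<bar> \<le> 1 / n"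
proof (intro bexI allI)
  let ?x = "\<chi> i. of_int \<lfloor>n * y $ i\<rfloor> / n"
  show d: "\<bar>?x $ i - y $ i\<bar> \<le> 1 / n" for i
  proof -
    have "?x $ i - y $ i = (of_int \<lfloor>n * y $ i\<rfloor> - n * y $ i) / n"
      using assms(1) by (simp add: diff_divide_distrib)
    moreover have "\<bar>of_int \<lfloor>n * y $ i\<rfloor> - n * y $ i\<bar> \<le> 1"
      by linarith
    ultimately show ?thesis
      using assms(1) by (simp add: divide_right_mono)
  qed
  show "?x \<in> std_grid n"
    unfolding std_grid_def mem_Collect_eq
  proof
    fix i
    have "1 / n \<le> 1"
      using assms(1) by simp
    then have "\<bar>?x $ i\<bar> \<le> n"
      using d[of i] assms(2)[of i] by linarith
    then have "\<bar>of_int \<lfloor>n * y $ i\<rfloor>\<bar> \<le> n\<^sup>2"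
      using assms(1) by (simp add: divide_le_eq power2_eq_square)
    then have "- (n\<^sup>2) \<le> of_int \<lfloor>n * y $ i\<rfloor>" "of_int \<lfloor>n * y $ i\<rfloor> \<le> n\<^sup>2"
      by linarith+
    then show "\<exists>m\<in>\<int>. ?x $ i = m * (1 / n) \<and> - (n\<^sup>2) \<le> m \<and> m \<le> n\<^sup>2"
      by (intro bexI[of _ "of_int \<lfloor>n * y $ i\<rfloor>"]) auto
  qed
qed

section \<open>Extensions of open and compact sets\<close>

context nonstandard
begin

lemma tr_ex_vec:
  "tr P Q \<Longrightarrow> tr (\<lambda>a b f. \<exists>v. P a (b(k := v)) f) (\<lambda>a b f. \<exists>v. Q a (b(k := v)) f)"
  using tr_not[OF tr_all_vec[OF tr_not]] by simp

lemma transfer_vec: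
  assumes "tr P Q" "\<forall>a b f. P a b f"
  shows "Q a b (\<lambda>_. hfun E (\<lambda>_. 0))"
  by (rule transfer_all[OF assms]) (simp add: star_ifun)

text \<open>A neighbourhood of \<open>y\<close> of standard size inside \<open>A\<close> transfers,
  and it contains every point infinitely close to \<open>y\<close>.\<close>

lemma near_hvec_set:
  assumes "\<And>x. (\<forall>i. \<bar>x $ i - y $ i\<bar> \<le> \<delta>) \<Longrightarrow> x \<in> A" "\<delta> > 0" "vapprox x (hvec E y)"
  shows "x \<in> hvec_set E A"
proof -
  have "y \<in> A"
    using assms(1,2) by simp
  then have "tr (\<lambda>a b f. (\<forall>i\<in>UNIV. \<bar>b 0 $ i - y $ i\<bar> \<le> \<delta>) \<longrightarrow> b 0 \<in> A)
      (\<lambda>a b f. (\<forall>i\<in>UNIV. \<bar>b 0 $ i - hreal E (y $ i)\<bar> \<le> hreal E \<delta>) \<longrightarrow> b 0 \<in> hvec_set E A)"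
    by (intro tr_imp tr_ball_finite finite tr_le tnum_abs tnum_diff tnum_component tvec_var tnum_const tr_vec_set)
      auto
  note tr = this
  have "\<forall>(a :: nat \<Rightarrow> real) b (f :: nat \<Rightarrow> real ^ 'n \<Rightarrow> real). (\<forall>i\<in>UNIV. \<bar>b (0::nat) $ i - y $ i\<bar> \<le> \<delta>) \<longrightarrow> b 0 \<in> A"
    using assms(1) by blast
  from transfer_vec[where b="\<lambda>_. x", OF tr this]
  show ?thesis
    using assms(2,3) by (auto simp: vapprox_def hvec_nth intro!: less_imp_le[OF approxD])
qed

lemma open_near_hvec_set:
  assumes "open U" "y \<in> U" "vapprox x (hvec E y)"
  shows "x \<in> hvec_set E U"
proof -
  obtain K' \<delta> where "K' \<subseteq> U" "\<delta> > 0" "\<And>x. (\<forall>i. \<bar>x $ i - y $ i\<bar> \<le> \<delta>) \<Longrightarrow> x \<in> K'"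
    using compact_box_neighbourhood[OF assms(1), of "{y}"] assms(2) by auto
  then show ?thesis
    using near_hvec_set[of y \<delta> U] assms(3) by blast
qed

lemma vapprox_st:
  "(\<And>i. hfinite (x $ i)) \<Longrightarrow> vapprox x (hvec E (\<chi> i. st E (x $ i)))"
  by (simp add: vapprox_def hvec_nth st_approx)

lemma st_vec_eqI: "vapprox x (hvec E y) \<Longrightarrow> (\<chi> i. st E (x $ i)) = y"
  by (simp add: vec_eq_iff vapprox_def hvec_nth st_eqI)

text \<open>The nonstandard form of compactness. Boundedness gives finite coordinates; if the
  standard part were outside \<open>K\<close>, a whole neighbourhood of it would be, and
  \<open>x\<close> would lie in the extension of the complement.\<close>

lemma hvec_set_compact:
  assumes "compact K" "x \<in> hvec_set E K" "K \<noteq> {}"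
  shows "hfinite (x $ i)" "(\<chi> i. st E (x $ i)) \<in> K"
proof -
  obtain R where R: "K \<subseteq> cube R"
    using compact_subset_cube[OF assms(1)] .
  have fin: "hfinite (x $ i)" for i
  proof -
    have tr: "tr (\<lambda>a b f. b 0 \<in> K \<longrightarrow> \<bar>b 0 $ i\<bar> \<le> R) (\<lambda>a b f. b 0 \<in> hvec_set E K \<longrightarrow> \<bar>b 0 $ i\<bar> \<le> hreal E R)"
      by (intro tr_imp tr_le tnum_abs tnum_component tvec_var tnum_const tr_vec_set assms(3))
    have "\<forall>(a :: nat \<Rightarrow> real) b (f :: nat \<Rightarrow> real ^ 'n \<Rightarrow> real). b (0::nat) \<in> K \<longrightarrow> \<bar>b 0 $ i\<bar> \<le> R"
      using R by (auto simp: cube_def)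
    from transfer_vec[where b="\<lambda>_. x", OF tr this] show ?thesis
      using assms(2) hfinite_iff by blast
  qed
  then show "hfinite (x $ i)" .
  show "(\<chi> i. st E (x $ i)) \<in> K"
  proof (rule ccontr)
    assume n: "(\<chi> i. st E (x $ i)) \<notin> K"
    then have "x \<in> hvec_set E (- K)"
      using open_near_hvec_set[OF _ _ vapprox_st[OF fin], of "- K"] assms(1) compact_imp_closed open_Compl by blast
    moreover have ne: "- K \<noteq> {}"
      using n by blast
    have tr: "tr (\<lambda>a b f. b 0 \<in> K \<longrightarrow> \<not> b 0 \<in> - K) (\<lambda>a b f. b 0 \<in> hvec_set E K \<longrightarrow> \<not> b 0 \<in> hvec_set E (- K))"
      by (intro tr_imp tr_not tvec_var tr_vec_set assms(3) ne)
    have "\<forall>(a :: nat \<Rightarrow> real) b (f :: nat \<Rightarrow> real ^ 'n \<Rightarrow> real). b (0::nat) \<in> K \<longrightarrow> \<not> b 0 \<in> - K"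
      by simp
    from transfer_vec[where b="\<lambda>_. x", OF tr this] assms(2)
    have "x \<notin> hvec_set E (- K)" by simp
    ultimately show False by simp
  qed
qed

end

text \<open>A nonempty \<Omega> has a well determined extension, by \<open>tr_vec_set\<close>, and
  nearstandard grid points.\<close>

locale grid_setting = nonstandard E for E :: "('h::linordered_field, 'n::finite) extension" +
  fixes \<Omega> :: "(real ^ 'n) set" and N :: 'h
  assumes open_\<Omega>: "open \<Omega>" and \<Omega>_ne: "\<Omega> \<noteq> {}" and N: "infinite_hnat N"
begin

abbreviation "test \<equiv> grid_test_functions E N \<Omega>"

lemma N_nat: "N \<in> hnum_set E \<nat>" and N_gt: "hreal E r < N" and N_pos: "N > 0"
proof -
  show "N \<in> hnum_set E \<nat>"
    using N by (simp add: infinite_hnat_def)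
  have gt: "of_nat k < N" for k :: nat
    using N by (simp add: infinite_hnat_def)
  show "N > 0"
    using gt[of 0] by simp
  obtain k where "r \<le> real k"
    using real_arch_simple by blast
  then have "hreal E r \<le> of_nat k"
    using hreal_le[of r "real k"] by simp
  then show "hreal E r < N"
    using gt le_less_trans by blast
qed

lemma inverse_N: "e > 0 \<Longrightarrow> 1 / N < hreal E e"
proof -
  assume "e > 0"
  have "hreal E (1 / e) * hreal E e = 1"
    using \<open>e > 0\<close> hreal_mult[of "1 / e" e] by simp
  moreover have "hreal E (1 / e) * hreal E e < N * hreal E e"
    using N_gt \<open>e > 0\<close> hreal_less[of 0 e] by (intro mult_strict_right_mono) auto
  ultimately show ?thesis
    using N_pos by (simp add: divide_less_eq mult.commute)
qed

lemma shift_infinitesimal: "\<bar>of_nat m * (1 / N)\<bar> < hreal E e" if "e > 0"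
proof -
  have "1 / N < hreal E (e / (real m + 1))"
    using that by (intro inverse_N) auto
  then have "of_nat m * (1 / N) \<le> of_nat m * hreal E (e / (real m + 1))"
    by (intro mult_left_mono) auto
  also have "\<dots> = hreal E (real m * (e / (real m + 1)))"
    unfolding hreal_mult by simp
  also have "\<dots> < hreal E e"
    unfolding hreal_less using that by (simp add: field_simps)
  finally show ?thesis
    using N_pos by simp
qed

lemma hint_of_nat: "of_nat m \<in> hnum_set E \<int>" "- of_nat m \<in> hnum_set E \<int>"
proof -
  have "tr (\<lambda>a b f. real m \<in> \<int>) (\<lambda>a b f. hreal E (real m) \<in> hnum_set E \<int>)"
    "tr (\<lambda>a b f. 0 - real m \<in> \<int>) (\<lambda>a b f. 0 - hreal E (real m) \<in> hnum_set E \<int>)"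
    by (intro tr_int tnum_const tnum_diff tnum_zero)+
  from this[THEN transfer_closed] show "of_nat m \<in> hnum_set E \<int>" "- of_nat m \<in> hnum_set E \<int>"
    by auto
qed

text \<open>A hyperintegral number of grid steps could leave the grid only across its infinite
  boundary, which finite displacements from finite points do not reach.\<close>

lemma grid_shift:
  assumes "y \<in> grid_vecs E N" "\<And>i. hfinite (y $ i)"
    "\<And>i. N * (x $ i - y $ i) \<in> hnum_set E \<int>" "\<And>i. \<bar>x $ i - y $ i\<bar> \<le> hreal E S"
  shows "x \<in> grid_vecs E N"
proof -
  have "\<forall>i. \<exists>r. \<bar>y $ i\<bar> \<le> hreal E r"
    using assms(2) hfinite_iff by blast
  then obtain r where r: "\<And>i. \<bar>y $ i\<bar> \<le> hreal E (r i)"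
    by metis
  \<comment> \<open>There are finitely many coordinates, hence one standard bound for all.\<close>
  define R where "R = Max (range r)"
  have "r i \<le> R" for i
    unfolding R_def by (intro Max_ge) auto
  then have yR: "\<bar>y $ i\<bar> \<le> hreal E R" for i
    using order_trans[OF r[of i]] hreal_le by blast
  have tr: "tr (\<lambda>a b f. 1 \<le> a 0 \<and> R + S \<le> a 0 \<and> b 0 \<in> std_grid (a 0) \<and> (\<forall>i\<in>UNIV. \<bar>b 0 $ i\<bar> \<le> R \<and>
        a 0 * (b 1 $ i - b 0 $ i) \<in> \<int> \<and> \<bar>b 1 $ i - b 0 $ i\<bar> \<le> S) \<longrightarrow> b 1 \<in> std_grid (a 0))
      (\<lambda>a b f. 1 \<le> a 0 \<and> hreal E (R + S) \<le> a 0 \<and> b 0 \<in> grid_vecs E (a 0) \<and> (\<forall>i\<in>UNIV. \<bar>b 0 $ i\<bar> \<le> hreal E R \<and>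
        a 0 * (b 1 $ i - b 0 $ i) \<in> hnum_set E \<int> \<and> \<bar>b 1 $ i - b 0 $ i\<bar> \<le> hreal E S) \<longrightarrow> b 1 \<in> grid_vecs E (a 0))"
    by (intro tr_imp tr_conj tr_le tr_ball_finite finite tr_grid tr_int tnum_abs tnum_diff tnum_mult
        tnum_component tvec_var tnum_var tnum_one tnum_const)
  have "\<forall>a b (f :: nat \<Rightarrow> real ^ 'n \<Rightarrow> real). 1 \<le> a (0::nat) \<and> R + S \<le> a 0 \<and> b (0::nat) \<in> std_grid (a 0) \<and>
      (\<forall>i\<in>UNIV. \<bar>b 0 $ i\<bar> \<le> R \<and> a 0 * (b 1 $ i - b 0 $ i) \<in> \<int> \<and> \<bar>b 1 $ i - b 0 $ i\<bar> \<le> S) \<longrightarrow>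
      (b 1 :: real ^ 'n) \<in> std_grid (a 0)"
    using std_grid_shift by blast
  from transfer_vec[where a="\<lambda>_. N" and b="\<lambda>i. if i = 0 then y else x", OF tr this] show ?thesis
    using assms yR N_gt[of 1] N_gt[of "R + S"] by (simp add: less_imp_le)
qed

lemma nearstandardI:
  "x \<in> grid_vecs E N \<Longrightarrow> y \<in> \<Omega> \<Longrightarrow> vapprox x (hvec E y) \<Longrightarrow> x \<in> nearstandard E N \<Omega>"
  unfolding nearstandard_def grid_domain_def using open_near_hvec_set[OF open_\<Omega>] by auto

lemma nearstandardD:
  assumes "x \<in> nearstandard E N \<Omega>"
  shows "x \<in> grid_vecs E N" "x \<in> grid_domain E N \<Omega>" "hfinite (x $ i)" "\<exists>y\<in>\<Omega>. vapprox x (hvec E y)"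
proof -
  show "x \<in> grid_vecs E N" "x \<in> grid_domain E N \<Omega>" "\<exists>y\<in>\<Omega>. vapprox x (hvec E y)"
    using assms by (auto simp: nearstandard_def grid_domain_def)
  then show "hfinite (x $ i)"
    using approx_hfinite hfinite_hreal by (auto simp: vapprox_def hvec_nth)
qed

text \<open>An infinitesimal displacement keeps the standard part in \<Omega>, and
  \<open>grid_shift\<close> keeps the point on the grid.\<close>

lemma nearstandard_shift:
  assumes "z \<in> nearstandard E N \<Omega>" "\<And>i. N * (x $ i - z $ i) \<in> hnum_set E \<int>" "vapprox x z"
  shows "x \<in> nearstandard E N \<Omega>"
proof -
  have "\<bar>x $ i - z $ i\<bar> \<le> hreal E 1" for i
    using assms(3) approxD[of "x $ i" "z $ i" 1] by (auto simp: vapprox_def intro: less_imp_le)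
  then have "x \<in> grid_vecs E N"
    using grid_shift[of z x 1] nearstandardD[OF assms(1)] assms(2) by blast
  moreover obtain y where "y \<in> \<Omega>" "vapprox z (hvec E y)"
    using nearstandardD(4)[OF assms(1)] by blast
  moreover from this have "vapprox x (hvec E y)"
    using assms(3) approx_trans[of "x $ i" "z $ i" "hvec E y $ i" for i] by (simp add: vapprox_def)
  ultimately show ?thesis
    by (intro nearstandardI)
qed

lemma nearstandard_axis:
  assumes "x \<in> nearstandard E N \<Omega>"
  shows "x + axis i (1 / N) \<in> nearstandard E N \<Omega>"
proof (rule nearstandard_shift[OF assms])
  show "N * ((x + axis i (1 / N)) $ j - x $ j) \<in> hnum_set E \<int>" for j
    using hint_of_nat(1)[of 1] hint_of_nat(1)[of 0] N_pos by (auto simp: axis_def)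
  show "vapprox (x + axis i (1 / N)) x"
    unfolding vapprox_def
  proof (intro allI approxI)
    fix j and e :: real assume "e > 0"
    then show "\<bar>(x + axis i (1 / N)) $ j - x $ j\<bar> < hreal E e"
      using inverse_N[of e] N_pos hreal_less[of 0 e] by (auto simp: axis_def)
  qed
qed

lemma nearstandard_exists: "\<exists>x. x \<in> nearstandard E N \<Omega>"
proof -
  obtain y where y: "y \<in> \<Omega>"
    using \<Omega>_ne by blast
  define R where "R = norm y + 1"
  have tr: "tr (\<lambda>a b f. 1 \<le> a 0 \<and> R \<le> a 0 \<longrightarrow> (\<exists>v. (b(0 := v)) 0 \<in> std_grid (a 0) \<and>
        (\<forall>i\<in>UNIV. \<bar>(b(0 := v)) 0 $ i - y $ i\<bar> \<le> 1 / a 0)))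
      (\<lambda>a b f. 1 \<le> a 0 \<and> hreal E R \<le> a 0 \<longrightarrow> (\<exists>v. (b(0 := v)) 0 \<in> grid_vecs E (a 0) \<and>
        (\<forall>i\<in>UNIV. \<bar>(b(0 := v)) 0 $ i - hreal E (y $ i)\<bar> \<le> 1 / a 0)))"
  proof (intro tr_imp tr_conj tr_le tnum_one tnum_var tnum_const)
    have "tr (\<lambda>a b f. b 0 \<in> std_grid (a 0) \<and> (\<forall>i\<in>UNIV. \<bar>b 0 $ i - y $ i\<bar> \<le> 1 / a 0))
      (\<lambda>a b f. b 0 \<in> grid_vecs E (a 0) \<and> (\<forall>i\<in>UNIV. \<bar>b 0 $ i - hreal E (y $ i)\<bar> \<le> 1 / a 0))"
      by (intro tr_conj tr_le tr_ball_finite finite tr_grid tnum_abs tnum_diff tnum_divide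
        tnum_component tvec_var tnum_var tnum_one tnum_const)
    then show "tr (\<lambda>a b f. \<exists>v. (b(0 := v)) 0 \<in> std_grid (a 0) \<and>
        (\<forall>i\<in>UNIV. \<bar>(b(0 := v)) 0 $ i - y $ i\<bar> \<le> 1 / a 0))
      (\<lambda>a b f. \<exists>v. (b(0 := v)) 0 \<in> grid_vecs E (a 0) \<and>
        (\<forall>i\<in>UNIV. \<bar>(b(0 := v)) 0 $ i - hreal E (y $ i)\<bar> \<le> 1 / a 0))"
      by (rule tr_ex_vec)
  qed
  have "\<forall>a (b :: nat \<Rightarrow> real ^ 'n) (f :: nat \<Rightarrow> real ^ 'n \<Rightarrow> real). 1 \<le> a (0::nat) \<and> R \<le> a 0 \<longrightarrow>
      (\<exists>v. (b(0 := v)) 0 \<in> std_grid (a 0) \<and> (\<forall>i\<in>UNIV. \<bar>(b(0 := v)) 0 $ i - y $ i\<bar> \<le> 1 / a 0))"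
  proof (intro allI impI)
    fix a :: "nat \<Rightarrow> real" and b :: "nat \<Rightarrow> real ^ 'n"
    assume a: "1 \<le> a 0 \<and> R \<le> a 0"
    have "\<bar>y $ i\<bar> + 1 \<le> a 0" for i
      using a component_le_norm_cart[of y i] unfolding R_def by linarith
    then show "\<exists>v. (b(0 := v)) 0 \<in> std_grid (a 0) \<and> (\<forall>i\<in>UNIV. \<bar>(b(0 := v)) 0 $ i - y $ i\<bar> \<le> 1 / a 0)"
      using std_grid_dense[of "a 0" y] a by auto
  qed
  from transfer_vec[where a="\<lambda>_. N" and b="\<lambda>_. 0", OF tr this]
  obtain x where x: "x \<in> grid_vecs E N" "\<And>i. \<bar>x $ i - hreal E (y $ i)\<bar> \<le> 1 / N"
    using N_gt[of 1] N_gt[of R] by (auto simp: less_imp_le)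
  have "vapprox x (hvec E y)"
    unfolding vapprox_def hvec_nth using x(2) inverse_N by (auto intro!: approxI intro: le_less_trans)
  then show ?thesis
    using nearstandardI[OF x(1) y] by blast
qed

section \<open>Restriction of internal functions to the grid domain\<close>

lemma tfun_restrict:
  assumes "tnum n n'" "tfun s t"
  shows "tfun (\<lambda>a b f x. if x \<in> \<Omega> \<and> x \<in> std_grid (n a b f) then s a b f x else 0)
    (\<lambda>a b f x. if x \<in> hvec_set E \<Omega> \<and> x \<in> grid_vecs E (n' a b f) then t a b f x else 0)"
  unfolding tfun_def
proof (intro conjI allI impI)
  obtain m m' where m: "depends UNIV m n" "depends ifuns m n'" "depends UNIV m' s" "depends ifuns m' t"
    using assms unfolding tnum_def tfun_def by blast
  show "\<exists>m. depends UNIV m (\<lambda>a b f x. if x \<in> \<Omega> \<and> x \<in> std_grid (n a b f) then s a b f x else 0) \<and>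
      depends ifuns m (\<lambda>a b f x. if x \<in> hvec_set E \<Omega> \<and> x \<in> grid_vecs E (n' a b f) then t a b f x else 0)"
    using depends_comp2[OF m(1,3), of "\<lambda>n s x. if x \<in> \<Omega> \<and> x \<in> std_grid n then s x else 0"]
      depends_comp2[OF m(2,4), of "\<lambda>n s x. if x \<in> hvec_set E \<Omega> \<and> x \<in> grid_vecs E n then s x else 0"]
    by blast
qed (intro tnum_if tr_conj tr_vec_set tr_grid tfun_app assms tnum_zero \<Omega>_ne)

text \<open>Generalizes \<open>grid_restrict\<close> to internal functions that extend no standard
  function, such as members of a family at infinite index.\<close>

definition hrestrict :: "('h ^ 'n \<Rightarrow> 'h) \<Rightarrow> 'h ^ 'n \<Rightarrow> 'h" where
  "hrestrict g = (\<lambda>x. if x \<in> hvec_set E \<Omega> \<and> x \<in> grid_vecs E N then g x else 0)"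

lemma grid_restrict_eq: "grid_restrict E N \<Omega> \<phi> = hrestrict (hfun E \<phi>)"
  by (auto simp: grid_restrict_def hrestrict_def grid_domain_def fun_eq_iff)

lemma hrestrict_internal: "g \<in> ifuns \<Longrightarrow> hrestrict g \<in> ifuns"
  using tfun_internal[OF tfun_restrict[OF tnum_var[of 0] tfun_var[of 0]], where f="\<lambda>_. g" and a="\<lambda>_. N"]
  by (simp add: hrestrict_def)

lemma hrestrict_grid_function: "g \<in> ifuns \<Longrightarrow> hrestrict g \<in> grid_functions E N \<Omega>"
  using hrestrict_internal[of g] by (auto simp: grid_functions_def ifuns_def hrestrict_def grid_domain_def)

text \<open>A criterion suited to transfer: standard bounds and standard moduli of continuity for
  the difference quotients of \<open>g\<close> imply the pointwise conditions of class
  S^\<infinity>.\<close>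

lemma hrestrict_test:
  assumes g: "g \<in> ifuns" and K: "compact K" "K \<subseteq> \<Omega>" "K \<noteq> {}" "\<And>x. g x \<noteq> 0 \<Longrightarrow> x \<in> hvec_set E K"
    and bound: "\<And>ks. \<exists>\<beta>. \<forall>x. \<bar>grid_diffs N ks g x\<bar> \<le> hreal E \<beta>"
    and cont: "\<And>ks e. e > 0 \<Longrightarrow> \<exists>\<delta>>0. \<forall>x y. (\<forall>i. \<bar>x $ i - y $ i\<bar> \<le> hreal E \<delta>) \<longrightarrow>
      \<bar>grid_diffs N ks g x - grid_diffs N ks g y\<bar> < hreal E e"
  shows "hrestrict g \<in> test"
  unfolding grid_test_functions_def mem_Collect_eq
proof (intro conjI exI[of _ K] K(1,2) hrestrict_grid_function g allI impI)
  \<comment> \<open>Grid neighbours of nearstandard points are nearstandard, so the cutoff is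
    invisible to difference quotients there.\<close>
  have eq: "grid_diffs N ks (hrestrict g) x = grid_diffs N ks g x" if "x \<in> nearstandard E N \<Omega>" for ks x
    using that
  proof (induction ks arbitrary: x)
    case Nil
    then show ?case
      using nearstandardD(2)[OF Nil] by (simp add: hrestrict_def grid_domain_def)
  next
    case (Cons k ks)
    show ?case
      using Cons.IH[OF Cons.prems] Cons.IH[OF nearstandard_axis[OF Cons.prems]] by (simp add: grid_diff_def)
  qed
  show "class_Sinf E N \<Omega> (hrestrict g)"
    unfolding class_Sinf_def class_S0_def
  proof (intro allI conjI ballI impI)
    fix ks
    obtain x where x: "x \<in> nearstandard E N \<Omega>"
      using nearstandard_exists by blast
    then show "\<exists>x\<in>nearstandard E N \<Omega>. hfinite (grid_diffs N ks (hrestrict g) x)"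
      using bound[of ks] eq[OF x, of ks] hfinite_iff by metis
    fix x y
    assume x: "x \<in> nearstandard E N \<Omega>" and y: "y \<in> nearstandard E N \<Omega>" and xy: "vapprox x y"
    show "approx (grid_diffs N ks (hrestrict g) x) (grid_diffs N ks (hrestrict g) y)"
      unfolding eq[OF x] eq[OF y]
    proof (rule approxI)
      fix e :: real assume "e > 0"
      from cont[OF this, of ks] obtain \<delta> where \<delta>: "\<delta> > 0" "\<And>x y. (\<forall>i. \<bar>x $ i - y $ i\<bar> \<le> hreal E \<delta>) \<Longrightarrow>
          \<bar>grid_diffs N ks g x - grid_diffs N ks g y\<bar> < hreal E e"
        by blast
      show "\<bar>grid_diffs N ks g x - grid_diffs N ks g y\<bar> < hreal E e"
        using xy \<delta>(1) by (intro \<delta>(2)) (auto simp: vapprox_def intro!: less_imp_le[OF approxD])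
    qed
  qed
  fix x
  assume "hrestrict g x \<noteq> 0"
  then have "x \<in> hvec_set E K"
    using K(4) by (auto simp: hrestrict_def split: if_splits)
  then show "hfinite (x $ i)" for i
    using hvec_set_compact[OF K(1) _ K(3)] by blast
  show "(\<chi> i. st E (x $ i)) \<in> K"
    using hvec_set_compact[OF K(1) \<open>x \<in> hvec_set E K\<close> K(3)] by blast
qed

end

section \<open>Grid distributions act as distributions\<close>

context grid_setting
begin

lemma inner_lincomb:
  assumes "f \<in> ifuns" "g \<in> ifuns" "h \<in> ifuns" "k \<in> ifuns" "\<And>x. k x = hreal E c * g x + hreal E d * h x"
  shows "grid_inner E N f k = hreal E c * grid_inner E N f g + hreal E d * grid_inner E N f h"
proof -
  have "tr (\<lambda>a b f. f 3 (b 0) = c * f 1 (b 0) + d * f 2 (b 0))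
      (\<lambda>a b f. f 3 (b 0) = hreal E c * f 1 (b 0) + hreal E d * f 2 (b 0))"
    by (intro tr_eq tnum_add tnum_mult tnum_const tnum_fun_var tvec_var)
  note all = tr_all_vec[OF this, of 0]
  have tr: "tr (\<lambda>a b f. (\<forall>v. f 3 ((b(0 := v)) 0) = c * f 1 ((b(0 := v)) 0) + d * f 2 ((b(0 := v)) 0)) \<longrightarrow>
        std_inner (a 0) (f 0) (f 3) = c * std_inner (a 0) (f 0) (f 1) + d * std_inner (a 0) (f 0) (f 2))
      (\<lambda>a b f. (\<forall>v. f 3 ((b(0 := v)) 0) = hreal E c * f 1 ((b(0 := v)) 0) + hreal E d * f 2 ((b(0 := v)) 0)) \<longrightarrow>
        grid_inner E (a 0) (f 0) (f 3) = hreal E c * grid_inner E (a 0) (f 0) (f 1) + hreal E d * grid_inner E (a 0) (f 0) (f 2))"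
    by (intro tr_imp all tr_eq tnum_add tnum_mult tnum_const tnum_inner tnum_var tfun_var)
  have "\<forall>a (b :: nat \<Rightarrow> real ^ 'n) f. (\<forall>v. f (3::nat) ((b(0 := v)) 0) = c * f 1 ((b(0 := v)) 0) + d * f 2 ((b(0 := v)) 0)) \<longrightarrow>
        std_inner (a (0::nat)) (f 0) (f 3) = c * std_inner (a 0) (f 0) (f 1) + d * std_inner (a 0) (f 0) (f 2)"
    by (simp add: std_inner_def sum_distrib_left sum.distrib algebra_simps)
  from transfer_all[where a="\<lambda>_. N" and b="\<lambda>_. 0" and
      f="\<lambda>i. if i = 0 then f else if i = 1 then g else if i = 2 then h else k", OF tr this]
  show ?thesis
    using assms by simp
qed

lemma hfun_lincomb: "hfun E (\<lambda>x. c * \<phi> x + d * \<psi> x) x = hreal E c * hfun E \<phi> x + hreal E d * hfun E \<psi> x"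
proof -
  let ?g = "\<lambda>x. c * \<phi> x + d * \<psi> x"
  have tr: "tr (\<lambda>a b f. ?g (b 0) = c * \<phi> (b 0) + d * \<psi> (b 0))
      (\<lambda>a b f. hfun E ?g (b 0) = hreal E c * hfun E \<phi> (b 0) + hreal E d * hfun E \<psi> (b 0))"
    by (rule tr_eq[OF tnum_fun_const[OF tvec_var]]) (intro tnum_add tnum_mult tnum_const tnum_fun_const tvec_var)
  have "\<forall>(a :: nat \<Rightarrow> real) b (f :: nat \<Rightarrow> real ^ 'n \<Rightarrow> real). ?g (b (0::nat)) = c * \<phi> (b 0) + d * \<psi> (b 0)"
    by simp
  from transfer_vec[where b="\<lambda>_. x", OF tr this] show ?thesis .
qed

lemma restrict_test:
  assumes "\<phi> \<in> test_functions \<Omega>"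
  shows "hrestrict (hfun E \<phi>) \<in> test"
proof -
  obtain K where K: "smooth \<phi>" "compact K" "K \<subseteq> \<Omega>" "\<And>x. \<phi> x \<noteq> 0 \<Longrightarrow> x \<in> K"
    using test_functionsE[OF assms] by blast
  obtain y\<^sub>0 where y\<^sub>0: "y\<^sub>0 \<in> \<Omega>"
    using \<Omega>_ne by blast
  show ?thesis
  \<comment> \<open>Adding a point of \<Omega> makes the compact set nonempty, as its extension
    requires.\<close>
  proof (rule hrestrict_test[OF star_ifun, of "insert y\<^sub>0 K"])
    fix x
    assume x: "hfun E \<phi> x \<noteq> 0"
    have tr: "tr (\<lambda>a b f. \<not> \<phi> (b 0) = 0 \<longrightarrow> b 0 \<in> insert y\<^sub>0 K)
        (\<lambda>a b f. \<not> hfun E \<phi> (b 0) = 0 \<longrightarrow> b 0 \<in> hvec_set E (insert y\<^sub>0 K))"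
      by (intro tr_imp tr_not tr_eq tnum_zero tnum_fun_const tr_vec_set tvec_var) auto
    have "\<forall>(a :: nat \<Rightarrow> real) b (f :: nat \<Rightarrow> real ^ 'n \<Rightarrow> real). \<not> \<phi> (b (0::nat)) = 0 \<longrightarrow> b 0 \<in> insert y\<^sub>0 K"
      using K(4) by auto
    from transfer_vec[where b="\<lambda>_. x", OF tr this] x show "x \<in> hvec_set E (insert y\<^sub>0 K)"
      by simp
  next
    fix ks
    obtain \<beta> where \<beta>: "\<And>x. \<bar>partials (rev ks) \<phi> x\<bar> \<le> \<beta>"
      using test_function_partials_bounded[OF assms] by blast
    have tr: "tr (\<lambda>a b f. 0 < a 0 \<longrightarrow> \<bar>grid_diffs (a 0) ks \<phi> (b 0)\<bar> \<le> \<beta>)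
        (\<lambda>a b f. 0 < a 0 \<longrightarrow> \<bar>grid_diffs (a 0) ks (hfun E \<phi>) (b 0)\<bar> \<le> hreal E \<beta>)"
      by (intro tr_imp tr_less tr_le tnum_abs tnum_zero tnum_var tnum_const tnum_grid_diffs tfun_const tvec_var)
    have "\<forall>a b (f :: nat \<Rightarrow> real ^ 'n \<Rightarrow> real). 0 < a (0::nat) \<longrightarrow> \<bar>grid_diffs (a 0) ks \<phi> (b (0::nat))\<bar> \<le> \<beta>"
      using grid_diffs_mean_value[OF K(1)] \<beta> by metis
    from transfer_vec[where a="\<lambda>_. N", OF tr this]
    have "\<bar>grid_diffs N ks (hfun E \<phi>) x\<bar> \<le> hreal E \<beta>" for x
      using N_pos by simp
    then show "\<exists>\<beta>. \<forall>x. \<bar>grid_diffs N ks (hfun E \<phi>) x\<bar> \<le> hreal E \<beta>"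
      by blast
  next
    fix ks and e :: real
    assume "e > 0"
    then obtain d where d: "d > 0" "\<forall>\<^sub>F n in sequentially. \<forall>x y. (\<forall>i. \<bar>x $ i - y $ i\<bar> \<le> d) \<longrightarrow>
        \<bar>grid_diffs (real n) ks \<phi> x - partials (rev ks) \<phi> y\<bar> < e / 2"
      using grid_diffs_near_partials[OF assms, of "e / 2" ks] by auto
    then obtain n\<^sub>1 where n\<^sub>1: "\<And>n x y. n \<ge> n\<^sub>1 \<Longrightarrow> (\<forall>i. \<bar>x $ i - y $ i\<bar> \<le> d) \<Longrightarrow>
        \<bar>grid_diffs (real n) ks \<phi> x - partials (rev ks) \<phi> y\<bar> < e / 2"
      unfolding eventually_sequentially by blast
    have tr: "tr (\<lambda>a b f. a 0 \<in> \<nat> \<and> real n\<^sub>1 \<le> a 0 \<and> (\<forall>i\<in>UNIV. \<bar>b 0 $ i - b 1 $ i\<bar> \<le> d) \<longrightarrow>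
          \<bar>grid_diffs (a 0) ks \<phi> (b 0) - grid_diffs (a 0) ks \<phi> (b 1)\<bar> < e)
        (\<lambda>a b f. a 0 \<in> hnum_set E \<nat> \<and> hreal E (real n\<^sub>1) \<le> a 0 \<and> (\<forall>i\<in>UNIV. \<bar>b 0 $ i - b 1 $ i\<bar> \<le> hreal E d) \<longrightarrow>
          \<bar>grid_diffs (a 0) ks (hfun E \<phi>) (b 0) - grid_diffs (a 0) ks (hfun E \<phi>) (b 1)\<bar> < hreal E e)"
      by (intro tr_imp tr_conj tr_nat tr_less tr_le tr_ball_finite finite tnum_abs tnum_diff tnum_component
          tnum_var tnum_const tnum_grid_diffs tfun_const tvec_var)
    have "\<forall>a b (f :: nat \<Rightarrow> real ^ 'n \<Rightarrow> real). a (0::nat) \<in> \<nat> \<and> real n\<^sub>1 \<le> a 0 \<and> (\<forall>i\<in>UNIV. \<bar>b 0 $ i - b (1::nat) $ i\<bar> \<le> d) \<longrightarrow>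
          \<bar>grid_diffs (a 0) ks \<phi> (b 0) - grid_diffs (a 0) ks \<phi> (b 1)\<bar> < e"
    proof (intro allI impI)
      fix a :: "nat \<Rightarrow> real" and b :: "nat \<Rightarrow> real ^ 'n"
      assume a: "a 0 \<in> \<nat> \<and> real n\<^sub>1 \<le> a 0 \<and> (\<forall>i\<in>UNIV. \<bar>b 0 $ i - b 1 $ i\<bar> \<le> d)"
      then obtain n where n: "a 0 = real n" "n\<^sub>1 \<le> n"
        by (auto elim!: Nats_cases)
      \<comment> \<open>Both quotients are compared with the same derivative at \<open>b 1\<close>,
        which gives one modulus of continuity for all large \<open>n\<close>.\<close>
      have "\<bar>grid_diffs (real n) ks \<phi> (b 0) - partials (rev ks) \<phi> (b 1)\<bar> < e / 2"
        "\<bar>grid_diffs (real n) ks \<phi> (b 1) - partials (rev ks) \<phi> (b 1)\<bar> < e / 2"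
        using a d(1) by (intro n\<^sub>1[OF n(2)]; simp)+
      then show "\<bar>grid_diffs (a 0) ks \<phi> (b 0) - grid_diffs (a 0) ks \<phi> (b 1)\<bar> < e"
        unfolding n(1) by linarith
    qed
    note std = this
    have "\<bar>grid_diffs N ks (hfun E \<phi>) x - grid_diffs N ks (hfun E \<phi>) y\<bar> < hreal E e"
      if "\<forall>i. \<bar>x $ i - y $ i\<bar> \<le> hreal E d" for x y
      using transfer_vec[where a="\<lambda>_. N" and b="\<lambda>i. if i = 0 then x else y", OF tr std] that
        N_nat N_gt[of "real n\<^sub>1"] by (simp add: less_imp_le)
    then show "\<exists>\<delta>>0. \<forall>x y. (\<forall>i. \<bar>x $ i - y $ i\<bar> \<le> hreal E \<delta>) \<longrightarrow>
        \<bar>grid_diffs N ks (hfun E \<phi>) x - grid_diffs N ks (hfun E \<phi>) y\<bar> < hreal E e"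
      using d(1) by blast
  qed (use K y\<^sub>0 in auto)
qed

lemma distribution_internal: "f \<in> grid_distributions E N \<Omega> \<Longrightarrow> f \<in> ifuns"
  by (simp add: grid_distributions_def grid_functions_def ifuns_def)

lemma inner_finite: "f \<in> grid_distributions E N \<Omega> \<Longrightarrow> \<phi> \<in> test \<Longrightarrow> hfinite (grid_inner E N f \<phi>)"
  by (simp add: grid_distributions_def)

text \<open>The description in \<open>Phi\<close> has exactly one solution: equivalent
  representatives have infinitely close pairings with a restricted test function, and
  \<open>f\<close> is one of them.\<close>

lemma Phi_approx:
  assumes f: "f \<in> grid_distributions E N \<Omega>" and \<phi>: "\<phi> \<in> test_functions \<Omega>"
  shows "approx (grid_inner E N f (hrestrict (hfun E \<phi>))) (hreal E (Phi E N \<Omega> (grid_class E N \<Omega> f) \<phi>))"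
proof -
  let ?s = "\<lambda>g. grid_inner E N g (hrestrict (hfun E \<phi>))"
  have r: "approx (?s f) (hreal E (st E (?s f)))"
    by (rule st_approx[OF inner_finite[OF f restrict_test[OF \<phi>]]])
  have "st E (?s f) = st E (?s g)" if "g \<in> grid_class E N \<Omega> f" for g
  proof -
    have "approx (?s f) (?s g)"
      using that restrict_test[OF \<phi>] by (auto simp: grid_class_def grid_equiv_def)
    then show ?thesis
      using st_eqI[OF approx_trans[OF approx_sym r]] by simp
  qed
  moreover have "f \<in> grid_class E N \<Omega> f"
    using f approx_refl by (auto simp: grid_class_def grid_equiv_def)
  ultimately have "(THE r. \<forall>g\<in>grid_class E N \<Omega> f. r = st E (?s g)) = st E (?s f)"
    by (intro the_equality) blast+
  then have "Phi E N \<Omega> (grid_class E N \<Omega> f) \<phi> = st E (?s f)"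
    using \<phi> by (simp add: Phi_def grid_restrict_eq)
  then show ?thesis
    using r by simp
qed

lemma Phi_lincomb:
  assumes f: "f \<in> grid_distributions E N \<Omega>" and \<phi>: "\<phi> \<in> test_functions \<Omega>" "\<psi> \<in> test_functions \<Omega>"
  defines "T \<equiv> Phi E N \<Omega> (grid_class E N \<Omega> f)"
  shows "T (\<lambda>x. c * \<phi> x + d * \<psi> x) = c * T \<phi> + d * T \<psi>"
proof -
  let ?s = "\<lambda>\<phi>. grid_inner E N f (hrestrict (hfun E \<phi>))"
  have "?s (\<lambda>x. c * \<phi> x + d * \<psi> x) = hreal E c * ?s \<phi> + hreal E d * ?s \<psi>"
    by (rule inner_lincomb[OF distribution_internal[OF f] hrestrict_internal[OF star_ifun]
        hrestrict_internal[OF star_ifun] hrestrict_internal[OF star_ifun]])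
      (simp add: hrestrict_def hfun_lincomb)
  moreover have "approx (hreal E c * ?s \<phi> + hreal E d * ?s \<psi>) (hreal E (c * T \<phi> + d * T \<psi>))"
    unfolding hreal_add hreal_mult T_def by (intro approx_add approx_cmult Phi_approx f \<phi>)
  ultimately have "approx (?s (\<lambda>x. c * \<phi> x + d * \<psi> x)) (hreal E (c * T \<phi> + d * T \<psi>))"
    by simp
  then show ?thesis
    unfolding T_def by (rule approx_hreal_unique[OF Phi_approx[OF f test_function_lincomb[OF \<phi>]]])
qed

lemma hfamily_internal: "hfamily G n \<in> ifuns"
  using tfun_internal[OF tfun_family[OF tnum_var[of 0], of G], where f="\<lambda>_. hfun E (\<lambda>_. 0)" and a="\<lambda>_. n"] star_ifun
  by simp

lemma hfamily_of_nat: "hfamily G (of_nat j) = hfun E (G (real j))"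
proof
  fix v
  have tr: "tr (\<lambda>a b f. G (real j) (b 0) = G (real j) (b 0))
      (\<lambda>a b f. hfamily G (hreal E (real j)) (b 0) = hfun E (G (real j)) (b 0))"
    by (rule tr_eq[OF tfun_app[OF tfun_family[OF tnum_const] tvec_var] tnum_fun_const[OF tvec_var]])
  have "\<forall>(a :: nat \<Rightarrow> real) b (f :: nat \<Rightarrow> real ^ 'n \<Rightarrow> real). G (real j) (b (0::nat)) = G (real j) (b 0)"
    by simp
  from transfer_vec[where b="\<lambda>_. v", OF tr this] show "hfamily G (of_nat j) v = hfun E (G (real j)) v"
    by simp
qed

text \<open>
  A sequence of test functions tending to \<open>0\<close> so fast that its members of infinite index are
  infinitesimal grid test functions cannot have fast growing values, by overspill.
\<close>

lemma Phi_bounded: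
  assumes f: "f \<in> grid_distributions E N \<Omega>" and "e > 0" and \<theta>: "\<And>j. \<theta> j \<in> test_functions \<Omega>"
    and K: "compact K" "K \<subseteq> \<Omega>" "\<And>j x. \<theta> j x \<noteq> 0 \<Longrightarrow> x \<in> K"
    and small: "\<And>j js x. length js \<le> j \<Longrightarrow> \<bar>partials js (\<theta> j) x\<bar> * (real j + 1) \<le> 1"
  shows "\<exists>j. \<bar>Phi E N \<Omega> (grid_class E N \<Omega> f) (\<theta> j)\<bar> < e * (real j + 1)"
proof (rule ccontr)
  assume neg: "\<not> ?thesis"
  define T where "T = Phi E N \<Omega> (grid_class E N \<Omega> f)"
  \<comment> \<open>Rounding down extends the sequence to real indices, as \<open>hfamily\<close>
    expects.\<close>
  define G where "G = (\<lambda>r::real. \<theta> (nat \<lfloor>r\<rfloor>))"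
  have G_nat: "G (real j) = \<theta> j" for j
    by (simp add: G_def)
  have fi: "f \<in> ifuns"
    by (rule distribution_internal[OF f])
  have tr: "tr (\<lambda>a b f. e * a 0 < \<bar>std_inner (a 1) (f 0) (\<lambda>x. if x \<in> \<Omega> \<and> x \<in> std_grid (a 1) then G (a 0) x else 0)\<bar>)
      (\<lambda>a b f. hreal E e * a 0 < \<bar>grid_inner E (a 1) (f 0)
        (\<lambda>x. if x \<in> hvec_set E \<Omega> \<and> x \<in> grid_vecs E (a 1) then hfamily G (a 0) x else 0)\<bar>)"
    by (rule tr_less[OF tnum_mult[OF tnum_const tnum_var]
        tnum_abs[OF tnum_inner[OF tnum_var tfun_var tfun_restrict[OF tnum_var tfun_family[OF tnum_var]]]]])
  \<comment> \<open>The slack between i + 1 and i absorbs the infinitesimal gap between the pairing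
    and its standard part. The result no longer mentions standard parts, so overspill
    applies.\<close>
  have sp: "hreal E e * of_nat i < \<bar>grid_inner E N f (hrestrict (hfamily G (of_nat i)))\<bar>" for i
  proof -
    let ?s = "grid_inner E N f (hrestrict (hfun E (\<theta> i)))"
    have "\<bar>?s - hreal E (T (\<theta> i))\<bar> < hreal E e"
      unfolding T_def by (rule approxD[OF Phi_approx[OF f \<theta>] \<open>e > 0\<close>])
    moreover have "e * (real i + 1) \<le> \<bar>T (\<theta> i)\<bar>"
      using neg unfolding T_def by (meson not_le)
    then have "hreal E (e * real i + e) \<le> \<bar>hreal E (T (\<theta> i))\<bar>"
      using hreal_le[of "e * real i + e" "T (\<theta> i)"] hreal_le[of "e * real i + e" "- T (\<theta> i)"] hreal_diff[of 0 "T (\<theta> i)"]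
      by (auto simp: abs_if algebra_simps split: if_splits)
    then have "hreal E e * of_nat i + hreal E e \<le> \<bar>hreal E (T (\<theta> i))\<bar>"
      by (simp add: hreal_add hreal_mult)
    ultimately show ?thesis
      unfolding hfamily_of_nat G_nat by (simp add: abs_if split: if_splits)
  qed
  have fi': "(\<lambda>_. f) k \<in> ifuns" for k :: nat
    by (simp add: fi)
  have "hreal E e * ((\<lambda>_::nat. N)(0 := of_nat i)) 0 < \<bar>grid_inner E (((\<lambda>_::nat. N)(0 := of_nat i)) 1) f
      (\<lambda>x. if x \<in> hvec_set E \<Omega> \<and> x \<in> grid_vecs E (((\<lambda>_::nat. N)(0 := of_nat i)) 1)
        then hfamily G (((\<lambda>_::nat. N)(0 := of_nat i)) 0) x else 0)\<bar>" for i :: nat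
    using sp[of i] by (simp add: hrestrict_def cong: if_cong)
  from overspill[where f="\<lambda>_. f" and a="\<lambda>_. N" and k=0, OF tr fi' this N]
  obtain J where "infinite_hnat J" "hreal E e * ((\<lambda>_::nat. N)(0 := J)) 0 < \<bar>grid_inner E (((\<lambda>_::nat. N)(0 := J)) 1) f
      (\<lambda>x. if x \<in> hvec_set E \<Omega> \<and> x \<in> grid_vecs E (((\<lambda>_::nat. N)(0 := J)) 1)
        then hfamily G (((\<lambda>_::nat. N)(0 := J)) 0) x else 0)\<bar>"
    by blast
  then have J: "infinite_hnat J" "hreal E e * J < \<bar>grid_inner E N f (hrestrict (hfamily G J))\<bar>"
    by (simp_all add: hrestrict_def cong: if_cong)
  have J_gt: "hreal E r < J" for r
  proof -
    obtain k where "r \<le> real k"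
      using real_arch_simple by blast
    then have "hreal E r \<le> of_nat k"
      using hreal_le[of r "real k"] by simp
    then show ?thesis
      using J(1) le_less_trans unfolding infinite_hnat_def by blast
  qed
  have J_nat: "J \<in> hnum_set E \<nat>"
    using J(1) by (simp add: infinite_hnat_def)
  \<comment> \<open>Every standard order is below the infinite \<open>J\<close>, so the estimate
    covers all difference quotients and makes them infinitesimal.\<close>
  have d: "\<bar>grid_diffs N ks (hfamily G J) x\<bar> * (J + 1) \<le> 1" for ks x
  proof -
    have tr: "tr (\<lambda>a b f. a 0 \<in> \<nat> \<and> real (length ks) \<le> a 0 \<and> 0 < a 1 \<longrightarrow> \<bar>grid_diffs (a 1) ks (G (a 0)) (b 0)\<bar> * (a 0 + 1) \<le> 1)
        (\<lambda>a b f. a 0 \<in> hnum_set E \<nat> \<and> hreal E (real (length ks)) \<le> a 0 \<and> 0 < a 1 \<longrightarrow>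
          \<bar>grid_diffs (a 1) ks (hfamily G (a 0)) (b 0)\<bar> * (a 0 + 1) \<le> 1)"
      by (intro tr_imp tr_conj tr_nat tr_less tr_le tnum_abs tnum_mult tnum_add tnum_one tnum_zero
          tnum_var tnum_const tnum_grid_diffs tfun_family tvec_var)
    have "\<forall>a b (f :: nat \<Rightarrow> real ^ 'n \<Rightarrow> real). a (0::nat) \<in> \<nat> \<and> real (length ks) \<le> a 0 \<and> 0 < a 1 \<longrightarrow>
        \<bar>grid_diffs (a 1) ks (G (a 0)) (b (0::nat))\<bar> * (a 0 + 1) \<le> 1"
    proof (intro allI impI)
      fix a :: "nat \<Rightarrow> real" and b :: "nat \<Rightarrow> real ^ 'n"
      assume a: "a 0 \<in> \<nat> \<and> real (length ks) \<le> a 0 \<and> 0 < a 1"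
      then obtain j where j: "a 0 = real j" "length ks \<le> j"
        by (auto elim!: Nats_cases)
      have "smooth (\<theta> j)"
        using test_functionsE[OF \<theta>] by blast
      then obtain y where "grid_diffs (a 1) ks (\<theta> j) (b 0) = partials (rev ks) (\<theta> j) y"
        using grid_diffs_mean_value[of "\<theta> j" "a 1" "b 0" ks] a by blast
      then show "\<bar>grid_diffs (a 1) ks (G (a 0)) (b 0)\<bar> * (a 0 + 1) \<le> 1"
        using small[of "rev ks" j y] j by (simp add: G_nat)
    qed
    from transfer_vec[where a="\<lambda>i. if i = 0 then J else N" and b="\<lambda>_. x", OF tr this] show ?thesis
      using J_nat J_gt[of "real (length ks)"] N_pos by (simp add: less_imp_le)
  qed
  have J1: "J + 1 > 0"
    using J_gt[of 0] by (simp add: add_pos_pos)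
  have d_small: "\<bar>grid_diffs N ks (hfamily G J) x\<bar> < hreal E r" if "r > 0" for ks x r
  proof (rule ccontr)
    assume "\<not> \<bar>grid_diffs N ks (hfamily G J) x\<bar> < hreal E r"
    then have "hreal E r * (J + 1) \<le> \<bar>grid_diffs N ks (hfamily G J) x\<bar> * (J + 1)"
      using J1 by (intro mult_right_mono) auto
    also note d
    finally have "hreal E r * (J + 1) \<le> 1" .
    moreover have "hreal E r * hreal E (1 / r) < hreal E r * (J + 1)"
      using J_gt[of "1 / r"] that hreal_less[of 0 r] by (intro mult_strict_left_mono) (auto intro: less_trans[OF _ less_add_one])
    moreover have "hreal E r * hreal E (1 / r) = 1"
      using that hreal_mult[of r "1 / r"] by simp
    ultimately show False by simp
  qed
  obtain y\<^sub>0 where y\<^sub>0: "y\<^sub>0 \<in> \<Omega>"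
    using \<Omega>_ne by blast
  have "hrestrict (hfamily G J) \<in> test"
  proof (rule hrestrict_test[OF hfamily_internal, of "insert y\<^sub>0 K"])
    fix x
    assume x: "hfamily G J x \<noteq> 0"
    have tr: "tr (\<lambda>a b f. \<not> G (a 0) (b 0) = 0 \<longrightarrow> b 0 \<in> insert y\<^sub>0 K)
        (\<lambda>a b f. \<not> hfamily G (a 0) (b 0) = 0 \<longrightarrow> b 0 \<in> hvec_set E (insert y\<^sub>0 K))"
      by (intro tr_imp tr_not tr_eq[OF tfun_app[OF tfun_family[OF tnum_var] tvec_var] tnum_zero] tr_vec_set tvec_var) auto
    have "\<forall>a b (f :: nat \<Rightarrow> real ^ 'n \<Rightarrow> real). \<not> G (a (0::nat)) (b (0::nat)) = 0 \<longrightarrow> b 0 \<in> insert y\<^sub>0 K"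
      using K(3) by (auto simp: G_def)
    from transfer_vec[where a="\<lambda>_. J" and b="\<lambda>_. x", OF tr this] x show "x \<in> hvec_set E (insert y\<^sub>0 K)"
      by simp
  next
    show "\<exists>\<beta>. \<forall>x. \<bar>grid_diffs N ks (hfamily G J) x\<bar> \<le> hreal E \<beta>" for ks
      using d_small[of 1 ks] less_imp_le zero_less_one by blast
    fix ks and r :: real
    assume "r > 0"
    have "\<bar>grid_diffs N ks (hfamily G J) x - grid_diffs N ks (hfamily G J) y\<bar> < hreal E r" for x y
    proof -
      have "\<bar>grid_diffs N ks (hfamily G J) x\<bar> < hreal E (r / 2)" "\<bar>grid_diffs N ks (hfamily G J) y\<bar> < hreal E (r / 2)"
        using \<open>r > 0\<close> by (intro d_small; simp)+
      then show ?thesis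
        using hreal_half[of r] by (simp add: abs_if split: if_splits)
    qed
    then show "\<exists>\<delta>>0. \<forall>x y. (\<forall>i. \<bar>x $ i - y $ i\<bar> \<le> hreal E \<delta>) \<longrightarrow>
        \<bar>grid_diffs N ks (hfamily G J) x - grid_diffs N ks (hfamily G J) y\<bar> < hreal E r"
      using zero_less_one by blast
  qed (use K y\<^sub>0 in auto)
  \<comment> \<open>The pairing with a grid test function is finite, although it exceeds
    \<open>e * J\<close>.\<close>
  from inner_finite[OF f this] obtain r where r: "\<bar>grid_inner E N f (hrestrict (hfamily G J))\<bar> \<le> hreal E r"
    using hfinite_iff by blast
  have "hreal E r = hreal E e * hreal E (r / e)"
    using \<open>e > 0\<close> hreal_mult[of e "r / e"] by simp
  also have "\<dots> < hreal E e * J"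
    using J_gt \<open>e > 0\<close> hreal_less[of 0 e] by (intro mult_strict_left_mono) auto
  finally show False
    using J(2) r by simp
qed

text \<open>Linearity is \<open>Phi_lincomb\<close>. If sequential continuity failed, a fast
  subsequence of the differences \<open>\<phi> n - \<psi>\<close>, magnified by j + 1, would
  contradict \<open>Phi_bounded\<close>.\<close>

lemma Phi_distribution:
  assumes f: "f \<in> grid_distributions E N \<Omega>"
  shows "Phi E N \<Omega> (grid_class E N \<Omega> f) \<in> distributions \<Omega>"
proof -
  define T where "T = Phi E N \<Omega> (grid_class E N \<Omega> f)"
  note lin = Phi_lincomb[OF f, folded T_def]
  have "(\<lambda>n. T (\<phi> n)) \<longlonglongrightarrow> T \<psi>" if tends: "tends_test \<Omega> \<phi> \<psi>" for \<phi> \<psi>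
  proof (rule ccontr)
    assume n: "\<not> ?thesis"
    then obtain e where e: "e > 0" "\<And>m. \<exists>n\<ge>m. \<bar>T (\<phi> n) - T \<psi>\<bar> \<ge> e"
      unfolding LIMSEQ_iff real_norm_def not_all not_ex not_imp not_less by blast
    have test: "\<phi> n \<in> test_functions \<Omega>" "\<psi> \<in> test_functions \<Omega>" for n
      using tends by (auto simp: tends_test_def)
    have sm: "smooth (\<phi> n)" "smooth \<psi>" for n
      using test_functionsE[OF test(1)] test_functionsE[OF test(2)] by blast+
    obtain K where "compact K \<and> K \<subseteq> \<Omega> \<and> (\<forall>n x. \<phi> n x \<noteq> 0 \<longrightarrow> x \<in> K)"
      using tends unfolding tends_test_def by (elim conjE exE) (rule that, intro conjI)
    then have K: "compact K" "K \<subseteq> \<Omega>" "\<And>n x. \<phi> n x \<noteq> 0 \<Longrightarrow> x \<in> K"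
      by blast+
    define K' where "K' = closure {x. \<psi> x \<noteq> 0}"
    have K': "compact K'" "K' \<subseteq> \<Omega>" "\<And>x. \<psi> x \<noteq> 0 \<Longrightarrow> x \<in> K'"
      using test(2) closure_subset[of "{x. \<psi> x \<noteq> 0}"] unfolding K'_def test_functions_def by auto
    \<comment> \<open>Of the two factors j + 1 in the tolerance, one pays for the magnification in
      \<open>\<theta> j\<close>, the other for the smallness that \<open>Phi_bounded\<close>
      demands.\<close>
    have ex: "\<exists>n. \<bar>T (\<phi> n) - T \<psi>\<bar> \<ge> e \<and> (\<forall>js x. length js \<le> j \<longrightarrow>
        \<bar>partials js (\<phi> n) x - partials js \<psi> x\<bar> < 1 / (real j + 1)\<^sup>2)" for j
    proof -
      let ?S = "{js :: 'n list. set js \<subseteq> UNIV \<and> length js \<le> j}"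
      have "\<forall>\<^sub>F n in sequentially. \<forall>js\<in>?S. \<forall>x\<in>UNIV. dist (partials js (\<phi> n) x) (partials js \<psi> x) < 1 / (real j + 1)\<^sup>2"
      proof (rule eventually_ball_finite)
        show "finite ?S"
          by (intro finite_lists_length_le) simp
        have "0 < 1 / (real j + 1)\<^sup>2"
          by simp
        then show "\<forall>js\<in>?S. \<forall>\<^sub>F n in sequentially. \<forall>x\<in>UNIV. dist (partials js (\<phi> n) x) (partials js \<psi> x) < 1 / (real j + 1)\<^sup>2"
          using tends unfolding tends_test_def uniform_limit_iff by blast
      qed
      then obtain m where m: "\<And>n js x. n \<ge> m \<Longrightarrow> length js \<le> j \<Longrightarrow> dist (partials js (\<phi> n) x) (partials js \<psi> x) < 1 / (real j + 1)\<^sup>2"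
        unfolding eventually_sequentially by auto
      obtain n where "n \<ge> m" "\<bar>T (\<phi> n) - T \<psi>\<bar> \<ge> e"
        using e(2) by blast
      then show ?thesis
        using m by (intro exI[of _ n]) (auto simp: dist_real_def)
    qed
    from choice[OF allI[OF ex]]
    obtain n where "\<forall>j. \<bar>T (\<phi> (n j)) - T \<psi>\<bar> \<ge> e \<and> (\<forall>js x. length js \<le> j \<longrightarrow>
        \<bar>partials js (\<phi> (n j)) x - partials js \<psi> x\<bar> < 1 / (real j + 1)\<^sup>2)" ..
    then have n: "\<And>j. \<bar>T (\<phi> (n j)) - T \<psi>\<bar> \<ge> e"
      "\<And>j js x. length js \<le> j \<Longrightarrow> \<bar>partials js (\<phi> (n j)) x - partials js \<psi> x\<bar> < 1 / (real j + 1)\<^sup>2"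
      by simp_all
    define \<theta> where "\<theta> = (\<lambda>j x. (real j + 1) * \<phi> (n j) x + - (real j + 1) * \<psi> x)"
    have \<theta>_test: "\<theta> j \<in> test_functions \<Omega>" for j
      unfolding \<theta>_def by (intro test_function_lincomb test)
    have small: "\<bar>partials js (\<theta> j) x\<bar> * (real j + 1) \<le> 1" if "length js \<le> j" for j js x
    proof -
      have "\<theta> j = (\<lambda>x. (real j + 1) * (\<phi> (n j) x - \<psi> x))"
        by (auto simp: \<theta>_def algebra_simps)
      then have eq: "partials js (\<theta> j) x = (real j + 1) * (partials js (\<phi> (n j)) x - partials js \<psi> x)"
        using partials_cmult[of "\<lambda>x. \<phi> (n j) x - \<psi> x" js "real j + 1"] partials_diff[OF sm, of js "n j"]
          smooth_add[OF sm(1) smooth_mult[OF smooth_const sm(2)], of "n j" "- 1"] by simp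
      have "\<bar>partials js (\<theta> j) x\<bar> * (real j + 1) = \<bar>partials js (\<phi> (n j)) x - partials js \<psi> x\<bar> * (real j + 1)\<^sup>2"
        unfolding eq by (simp add: abs_mult power2_eq_square)
      also have "\<dots> \<le> 1 / (real j + 1)\<^sup>2 * (real j + 1)\<^sup>2"
        using n(2)[OF that, of x] by (intro mult_right_mono) auto
      also have "\<dots> = 1"
        by simp
      finally show ?thesis .
    qed
    have supp: "x \<in> K \<union> K'" if "\<theta> j x \<noteq> 0" for j x
      using that K(3)[of "n j" x] K'(3)[of x] by (cases "\<phi> (n j) x = 0") (auto simp: \<theta>_def)
    obtain j where j: "\<bar>T (\<theta> j)\<bar> < e * (real j + 1)"
      using Phi_bounded[OF f e(1) \<theta>_test compact_Un[OF K(1) K'(1)] Un_least[OF K(2) K'(2)] supp small]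
      unfolding T_def ..
    have "T (\<theta> j) = (real j + 1) * (T (\<phi> (n j)) - T \<psi>)"
      unfolding \<theta>_def lin[OF test] by (simp add: algebra_simps)
    then have "\<bar>T (\<theta> j)\<bar> = (real j + 1) * \<bar>T (\<phi> (n j)) - T \<psi>\<bar>"
      by (simp add: abs_mult)
    moreover have "(real j + 1) * e \<le> (real j + 1) * \<bar>T (\<phi> (n j)) - T \<psi>\<bar>"
      using n(1)[of j] by (intro mult_left_mono) auto
    ultimately show False
      using j by (simp add: mult.commute)
  qed
  moreover have "T \<phi> = 0" if "\<phi> \<notin> test_functions \<Omega>" for \<phi>
    using that by (simp add: T_def Phi_def)
  moreover have "T (\<lambda>x. \<phi> x + \<psi> x) = T \<phi> + T \<psi>" if "\<phi> \<in> test_functions \<Omega>" "\<psi> \<in> test_functions \<Omega>" for \<phi> \<psi>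
    using lin[OF that, of 1 1] by simp
  moreover have "T (\<lambda>x. c * \<phi> x) = c * T \<phi>" if "\<phi> \<in> test_functions \<Omega>" for c \<phi>
    using lin[OF that that, of c 0] by simp
  ultimately show ?thesis
    unfolding T_def[symmetric] distributions_def by simp
qed

end

section \<open>Every distribution is induced by a grid distribution\<close>

text \<open>Walking from \<open>x\<close> along axis \<open>i\<close> in steps of length between
  1/(2r) and 1/r, more than 4 M r steps cover a distance above 2 M and so leave the support. Each
  step changes \<open>D\<close> by less than 1, so the absolute value of \<open>D x\<close> is at
  most the number of steps.\<close>

lemma bounded_of_small_differences:
  fixes D :: "real ^ 'n::finite \<Rightarrow> real"
  assumes r: "r \<ge> 1" and n: "n \<ge> r" and "M \<ge> 0"
    and supp: "\<And>x. D x \<noteq> 0 \<Longrightarrow> \<bar>x $ i\<bar> \<le> M"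
    and diff: "\<And>x q. q \<in> \<nat> \<Longrightarrow> q * r \<le> n \<Longrightarrow> \<bar>D (x + axis i (q / n)) - D x\<bar> < 1"
  shows "\<bar>D x\<bar> \<le> 4 * M * r + 2"
proof (rule ccontr)
  assume big: "\<not> \<bar>D x\<bar> \<le> 4 * M * r + 2"
  \<comment> \<open>The largest admissible shift; as n \<ge> r, rounding down loses at most a factor
    of 2.\<close>
  define q where "q = real (nat \<lfloor>n / r\<rfloor>)"
  have t: "n / r \<ge> 1"
    using r n by simp
  then have "real_of_int \<lfloor>n / r\<rfloor> \<ge> 1" "q = real_of_int \<lfloor>n / r\<rfloor>"
    unfolding q_def by auto
  then have "q \<le> n / r" "2 * q \<ge> n / r"
    using floor_correct[of "n / r"] by linarith+
  then have q: "q * r \<le> n" "q / n \<ge> 1 / (2 * r)"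
    using r n by (auto simp: field_simps)
  have axis_add: "x + axis i s + axis i s' = x + axis i (s + s')" for x :: "real ^ 'n" and s s'
    by (simp add: vec_eq_iff axis_def)
  have step: "\<bar>D x\<bar> - real j \<le> \<bar>D (x + axis i (real j * (q / n)))\<bar>" for j
  proof (induction j)
    case 0
    have axis_0: "axis i (0::real) = (0 :: real ^ 'n)"
      by (simp add: vec_eq_iff axis_def)
    show ?case by (simp add: axis_0)
  next
    case (Suc j)
    have "\<bar>D (x + axis i (real j * (q / n)) + axis i (q / n)) - D (x + axis i (real j * (q / n)))\<bar> < 1"
      by (rule diff[OF _ q(1)]) (simp add: q_def)
    moreover have "real j * (q / n) + q / n = real (Suc j) * (q / n)"
      by (simp add: algebra_simps)
    ultimately show ?case
      using Suc unfolding axis_add by simp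
  qed
  \<comment> \<open>Beyond 4 M r, but by no more than 2, which is where the summand 2 of the bound
    comes from.\<close>
  define J where "J = nat \<lceil>4 * M * r\<rceil> + 1"
  have "0 \<le> 4 * M * r"
    using r \<open>M \<ge> 0\<close> by simp
  then have J: "4 * M * r < real J" "real J \<le> 4 * M * r + 2"
    unfolding J_def by linarith+
  have "D x \<noteq> 0"
    using big J by auto
  moreover have "D (x + axis i (real J * (q / n))) \<noteq> 0"
    using step[of J] big J by auto
  ultimately have "\<bar>x $ i\<bar> \<le> M" "\<bar>x $ i + real J * (q / n)\<bar> \<le> M"
    using supp[of x] supp[of "x + axis i (real J * (q / n))"] by (auto simp: axis_def)
  then have "real J * (q / n) \<le> 2 * M"
    by linarith
  moreover have "real J * (1 / (2 * r)) \<le> real J * (q / n)"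
    using q(2) by (intro mult_left_mono) auto
  ultimately have "real J * (1 / (2 * r)) \<le> 2 * M"
    by linarith
  then have "real J \<le> 4 * M * r"
    using r by (simp add: field_simps)
  then show False
    using J(1) by simp
qed

section \<open>Standard bounds for grid test functions, and surjectivity\<close>

context grid_setting
begin

lemma hnat_hint: "n \<in> hnum_set E \<nat> \<Longrightarrow> n \<in> hnum_set E \<int> \<and> - n \<in> hnum_set E \<int>"
proof -
  assume n: "n \<in> hnum_set E \<nat>"
  have tr: "tr (\<lambda>a b f. a 0 \<in> \<nat> \<longrightarrow> a 0 \<in> \<int> \<and> 0 - a 0 \<in> \<int>)
      (\<lambda>a b f. a 0 \<in> hnum_set E \<nat> \<longrightarrow> a 0 \<in> hnum_set E \<int> \<and> 0 - a 0 \<in> hnum_set E \<int>)"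
    by (intro tr_imp tr_conj tr_nat tr_int tnum_diff tnum_zero tnum_var)
  have "\<forall>(a :: nat \<Rightarrow> real) b f. a (0::nat) \<in> \<nat> \<longrightarrow> a 0 \<in> \<int> \<and> 0 - a 0 \<in> \<int>"
    by (auto elim!: Nats_cases)
  from transfer_num[where a="\<lambda>_. n", OF tr this] n show ?thesis
    by simp
qed

text \<open>A nonzero difference quotient at \<open>x\<close> requires a nonzero value of \<psi> a
  standard number of grid steps away, hence at infinitesimal distance. Both points share their
  standard part.\<close>

lemma test_diffs_support:
  assumes \<psi>: "\<psi> \<in> grid_functions E N \<Omega>" and K: "K \<subseteq> \<Omega>"
    "\<And>x. \<psi> x \<noteq> 0 \<Longrightarrow> (\<forall>i. hfinite (x $ i)) \<and> (\<chi> i. st E (x $ i)) \<in> K"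
    and x: "grid_diffs N ks \<psi> x \<noteq> 0"
  shows "x \<in> nearstandard E N \<Omega>" "(\<chi> i. st E (x $ i)) \<in> K"
proof -
  obtain y where y: "\<psi> y \<noteq> 0" "\<And>i. \<exists>m. m \<le> length ks \<and> y $ i = x $ i + of_nat m * (1 / N)"
    using grid_diffs_nonzero[OF x] by blast
  have "\<forall>i. \<exists>m::nat. y $ i = x $ i + of_nat m * (1 / N)"
    using y(2) by blast
  from choice[OF this] obtain m :: "'n \<Rightarrow> nat" where m: "\<And>i. y $ i = x $ i + of_nat (m i) * (1 / N)"
    by blast
  have "y \<in> grid_domain E N \<Omega>"
    using \<psi> y(1) by (auto simp: grid_functions_def)
  then have yg: "y \<in> grid_vecs E N"
    by (simp add: grid_domain_def)
  have yst: "vapprox y (hvec E (\<chi> i. st E (y $ i)))" "(\<chi> i. st E (y $ i)) \<in> K"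
    using K(2)[OF y(1)] vapprox_st[of y] by blast+
  then have yn: "y \<in> nearstandard E N \<Omega>"
    using nearstandardI[OF yg _ yst(1)] K(1) by blast
  have xy: "vapprox x y"
    unfolding vapprox_def
  proof (intro allI approxI)
    fix i and e :: real assume "e > 0"
    then show "\<bar>x $ i - y $ i\<bar> < hreal E e"
      using shift_infinitesimal[of e "m i"] m[of i] by simp
  qed
  have "N * (x $ i - y $ i) \<in> hnum_set E \<int>" for i
  proof -
    have "N * (x $ i - y $ i) = - of_nat (m i)"
      using m[of i] N_pos by simp
    then show ?thesis
      using hint_of_nat(2) by simp
  qed
  then show "x \<in> nearstandard E N \<Omega>"
    by (rule nearstandard_shift[OF yn _ xy])
  have "vapprox x (hvec E (\<chi> i. st E (y $ i)))"
    unfolding vapprox_def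
  proof
    fix i
    show "approx (x $ i) (hvec E (\<chi> i. st E (y $ i)) $ i)"
      using approx_trans[of "x $ i" "y $ i"] xy yst(1) unfolding vapprox_def by blast
  qed
  then show "(\<chi> i. st E (x $ i)) \<in> K"
    using st_vec_eqI yst(2) by metis
qed

text \<open>Class S^0 compares nearstandard points only. At other points the difference quotient is
  0, and if one of the two points is nearstandard then so is the other.\<close>

lemma test_diffs_shift:
  assumes \<psi>: "\<psi> \<in> test" and q: "q \<in> hnum_set E \<nat>" "\<And>e. e > 0 \<Longrightarrow> \<bar>q / N\<bar> < hreal E e"
  shows "approx (grid_diffs N ks \<psi> (x + axis i (q / N))) (grid_diffs N ks \<psi> x)"
proof -
  obtain K where K: "K \<subseteq> \<Omega>" "\<And>x. \<psi> x \<noteq> 0 \<Longrightarrow> (\<forall>i. hfinite (x $ i)) \<and> (\<chi> i. st E (x $ i)) \<in> K"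
    using \<psi> unfolding grid_test_functions_def by blast
  have g: "\<psi> \<in> grid_functions E N \<Omega>" and c: "class_S0 E N \<Omega> (grid_diffs N ks \<psi>)"
    using \<psi> by (auto simp: grid_test_functions_def class_Sinf_def)
  let ?y = "x + axis i (q / N)" and ?D = "grid_diffs N ks \<psi>"
  have near: "approx (x $ j) (?y $ j)" for j
  proof (rule approxI)
    fix e :: real assume "e > 0"
    then show "\<bar>x $ j - ?y $ j\<bar> < hreal E e"
      using q(2)[of e] hreal_less[of 0 e] by (cases "j = i") (simp_all add: axis_def)
  qed
  have xy: "vapprox x ?y" "vapprox ?y x"
    using near approx_sym unfolding vapprox_def by blast+
  have int: "N * (x $ j - ?y $ j) \<in> hnum_set E \<int>" "N * (?y $ j - x $ j) \<in> hnum_set E \<int>" for j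
    using hnat_hint[OF q(1)] hint_of_nat[of 0] N_pos by (auto simp: axis_def)
  consider "?D x = 0" "?D ?y = 0" | "x \<in> nearstandard E N \<Omega>" | "?y \<in> nearstandard E N \<Omega>"
    using test_diffs_support(1)[OF g K] by blast
  then show ?thesis
  proof cases
    case 1
    then show ?thesis using approx_refl[of 0] by simp
  next
    case 2
    then have "?y \<in> nearstandard E N \<Omega>"
      by (rule nearstandard_shift) (use int xy in auto)
    then show ?thesis
      using c 2 xy unfolding class_S0_def by blast
  next
    case 3
    then have "x \<in> nearstandard E N \<Omega>"
      by (rule nearstandard_shift) (use int xy in auto)
    then show ?thesis
      using c 3 xy unfolding class_S0_def by blast
  qed
qed

text \<open>Shifts by q/N with q J \<le> N are infinitesimal for every infinite \<open>J\<close> and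
  so change a difference quotient by less than 1. By overspill the same holds for some standard k in
  place of \<open>J\<close>, and then the walk of \<open>bounded_of_small_differences\<close> gives
  a standard bound.\<close>

lemma test_diffs_bounded:
  assumes \<psi>: "\<psi> \<in> test"
  shows "\<exists>\<beta>. \<forall>x. \<bar>grid_diffs N ks \<psi> x\<bar> \<le> hreal E \<beta>"
proof -
  obtain K where K: "compact K" "K \<subseteq> \<Omega>" "\<And>x. \<psi> x \<noteq> 0 \<Longrightarrow> (\<forall>i. hfinite (x $ i)) \<and> (\<chi> i. st E (x $ i)) \<in> K"
    using \<psi> unfolding grid_test_functions_def by blast
  have g: "\<psi> \<in> grid_functions E N \<Omega>"
    using \<psi> by (auto simp: grid_test_functions_def)
  then have \<psi>i: "\<psi> \<in> ifuns"
    by (simp add: grid_functions_def ifuns_def)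
  \<comment> \<open>Any coordinate direction serves for the walk.\<close>
  define i :: 'n where "i = undefined"
  obtain R where R: "R \<ge> 0" "K \<subseteq> cube R"
    using compact_subset_cube[OF K(1)] .
  let ?D = "grid_diffs N ks \<psi>"
  have supp: "\<bar>x $ i\<bar> \<le> hreal E (R + 1)" if "?D x \<noteq> 0" for x
  proof -
    have "hfinite (x $ i)"
      using nearstandardD(3)[OF test_diffs_support(1)[OF g K(2,3) that]] .
    then have "\<bar>x $ i - hreal E (st E (x $ i))\<bar> < hreal E 1"
      using approxD[OF st_approx] zero_less_one by blast
    moreover have "\<bar>st E (x $ i)\<bar> \<le> R"
      using test_diffs_support(2)[OF g K(2,3) that] R(2) by (auto simp: cube_def)
    then have "\<bar>hreal E (st E (x $ i))\<bar> \<le> hreal E R"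
      using hreal_le[of "st E (x $ i)" R] hreal_le[of "- st E (x $ i)" R] hreal_diff[of 0 "st E (x $ i)"]
      by (auto simp: abs_le_iff)
    ultimately show ?thesis
      unfolding hreal_add by (simp add: abs_if split: if_splits)
  qed
  define p where "p = (\<lambda>(r :: 'h) n g. \<forall>q. q \<in> hnum_set E \<nat> \<and> q * r \<le> n \<longrightarrow>
    (\<forall>x. \<bar>grid_diffs n ks g (x + axis i (q / n)) - grid_diffs n ks g x\<bar> < 1))"
  have "tr (\<lambda>a b f. \<bar>grid_diffs (a 1) ks (f 0) (b 0 + axis i (a 2 / a 1)) - grid_diffs (a 1) ks (f 0) (b 0)\<bar> < 1)
      (\<lambda>a b f. \<bar>grid_diffs (a 1) ks (f 0) (b 0 + axis i (a 2 / a 1)) - grid_diffs (a 1) ks (f 0) (b 0)\<bar> < 1)"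
    by (intro tr_less tnum_abs tnum_diff tnum_grid_diffs tnum_var tnum_one tnum_divide tfun_var tvec_add tvec_var tvec_axis)
  note 1 = tr_all_vec[OF this, of 0]
  have "tr (\<lambda>a b f. a 2 \<in> \<nat> \<and> a 2 * a 0 \<le> a 1 \<longrightarrow> (\<forall>v. \<bar>grid_diffs (a 1) ks (f 0) ((b(0 := v)) 0 + axis i (a 2 / a 1))
        - grid_diffs (a 1) ks (f 0) ((b(0 := v)) 0)\<bar> < 1))
      (\<lambda>a b f. a 2 \<in> hnum_set E \<nat> \<and> a 2 * a 0 \<le> a 1 \<longrightarrow> (\<forall>v. \<bar>grid_diffs (a 1) ks (f 0) ((b(0 := v)) 0 + axis i (a 2 / a 1))
        - grid_diffs (a 1) ks (f 0) ((b(0 := v)) 0)\<bar> < 1))"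
    by (intro tr_imp tr_conj tr_nat tr_le tnum_mult tnum_var 1)
  from tr_all_num[OF this, of 2]
  have trp: "tr (\<lambda>a b f. \<forall>q. q \<in> \<nat> \<and> q * a 0 \<le> a 1 \<longrightarrow>
        (\<forall>x. \<bar>grid_diffs (a 1) ks (f 0) (x + axis i (q / a 1)) - grid_diffs (a 1) ks (f 0) x\<bar> < 1))
      (\<lambda>a b f. p (a 0) (a 1) (f 0))"
    by (simp add: p_def)
  have inf: "p J N \<psi>" if J: "infinite_hnat J" for J
    unfolding p_def
  proof (intro allI impI)
    fix q x assume q: "q \<in> hnum_set E \<nat> \<and> q * J \<le> N"
    have "\<bar>q / N\<bar> < hreal E e" if "e > 0" for e
    proof -
      obtain k where "1 / e \<le> real k"
        using real_arch_simple by blast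
      then have "hreal E (1 / e) \<le> of_nat k"
        using hreal_le[of "1 / e" "real k"] by simp
      then have Je: "hreal E (1 / e) < J"
        using J le_less_trans unfolding infinite_hnat_def by blast
      have q0: "0 \<le> q"
        using hnat_nonneg q by blast
      have e0: "0 < hreal E e"
        using that hreal_less[of 0 e] by simp
      have "1 = hreal E e * hreal E (1 / e)"
        using that hreal_mult[of e "1 / e"] by simp
      also have "\<dots> < hreal E e * J"
        using Je e0 by (intro mult_strict_left_mono)
      finally have eJ: "1 < hreal E e * J" .
      show ?thesis
      proof (cases "q = 0")
        case False
        then have "q * 1 < q * (hreal E e * J)"
          using q0 eJ by (intro mult_strict_left_mono) auto
        also have "\<dots> = hreal E e * (q * J)"
          by (simp add: mult_ac)
        also have "\<dots> \<le> hreal E e * N"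
          using q e0 by (intro mult_left_mono) auto
        finally show ?thesis
          using q0 N_pos by (simp add: divide_less_eq)
      qed (use e0 in simp)
    qed
    then have "approx (?D (x + axis i (q / N))) (?D x)"
      using test_diffs_shift[OF \<psi>] q by blast
    then show "\<bar>?D (x + axis i (q / N)) - ?D x\<bar> < 1"
      using approxD[of _ _ 1] by fastforce
  qed
  \<comment> \<open>Overspill for the negation: failure at all standard k would yield failure at an
    infinite number.\<close>
  have "\<exists>k::nat. p (of_nat k) N \<psi>"
  proof (rule ccontr)
    assume "\<not> ?thesis"
    then have n: "\<not> p (((\<lambda>_::nat. N)(0 := of_nat k)) 0) (((\<lambda>_::nat. N)(0 := of_nat k)) 1) \<psi>" for k :: nat
      by simp
    have fi: "(\<lambda>_. \<psi>) k \<in> ifuns" for k :: nat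
      by (simp add: \<psi>i)
    from overspill[where f="\<lambda>_. \<psi>" and a="\<lambda>_. N" and k=0, OF tr_not[OF trp] fi n N]
    obtain J where "infinite_hnat J" "\<not> p (((\<lambda>_::nat. N)(0 := J)) 0) (((\<lambda>_::nat. N)(0 := J)) 1) \<psi>"
      by blast
    then show False
      using inf by simp
  qed
  then obtain k :: nat where k: "p (of_nat k) N \<psi>"
    by blast
  \<comment> \<open>\<open>bounded_of_small_differences\<close> asks for r \<ge> 1, and enlarging r
    leaves fewer shifts to control.\<close>
  define r where "r = real k + 1"
  have pr: "p (hreal E r) N \<psi>"
    unfolding p_def
  proof (intro allI impI)
    fix q x assume q: "q \<in> hnum_set E \<nat> \<and> q * hreal E r \<le> N"
    have "q * of_nat k \<le> q * hreal E r"
      using hnat_nonneg[of q] q by (intro mult_left_mono) (auto simp: r_def hreal_add)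
    then show "\<bar>?D (x + axis i (q / N)) - ?D x\<bar> < 1"
      using k q unfolding p_def by (meson order_trans)
  qed
  let ?B = "4 * (R + 1) * r + 2"
  have "tr (\<lambda>a b f. \<not> grid_diffs (a 1) ks (f 0) (b 0) = 0 \<longrightarrow> \<bar>b 0 $ i\<bar> \<le> R + 1)
      (\<lambda>a b f. \<not> grid_diffs (a 1) ks (f 0) (b 0) = 0 \<longrightarrow> \<bar>b 0 $ i\<bar> \<le> hreal E (R + 1))"
    by (intro tr_imp tr_not tr_eq tr_le tnum_grid_diffs tnum_var tnum_zero tnum_abs tnum_component tnum_const tfun_var tvec_var)
  note 2 = tr_all_vec[OF this, of 0]
  have tr: "tr (\<lambda>a b f. a 0 = r \<and> a 0 \<le> a 1 \<and>
        (\<forall>v. \<not> grid_diffs (a 1) ks (f 0) ((b(0 := v)) 0) = 0 \<longrightarrow> \<bar>(b(0 := v)) 0 $ i\<bar> \<le> R + 1) \<and>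
        (\<forall>q. q \<in> \<nat> \<and> q * a 0 \<le> a 1 \<longrightarrow>
          (\<forall>x. \<bar>grid_diffs (a 1) ks (f 0) (x + axis i (q / a 1)) - grid_diffs (a 1) ks (f 0) x\<bar> < 1)) \<longrightarrow>
        \<bar>grid_diffs (a 1) ks (f 0) (b 1)\<bar> \<le> ?B)
      (\<lambda>a b f. a 0 = hreal E r \<and> a 0 \<le> a 1 \<and>
        (\<forall>v. \<not> grid_diffs (a 1) ks (f 0) ((b(0 := v)) 0) = 0 \<longrightarrow> \<bar>(b(0 := v)) 0 $ i\<bar> \<le> hreal E (R + 1)) \<and>
        p (a 0) (a 1) (f 0) \<longrightarrow> \<bar>grid_diffs (a 1) ks (f 0) (b 1)\<bar> \<le> hreal E ?B)"
    by (intro tr_imp tr_conj 2 trp tr_eq tr_le tnum_abs tnum_grid_diffs tnum_var tnum_const tfun_var tvec_var)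
  have std: "\<forall>a b f. a (0::nat) = r \<and> a 0 \<le> a 1 \<and>
        (\<forall>v. \<not> grid_diffs (a 1) ks (f (0::nat)) ((b(0 := v)) (0::nat)) = 0 \<longrightarrow> \<bar>(b(0 := v)) 0 $ i\<bar> \<le> R + 1) \<and>
        (\<forall>q. q \<in> \<nat> \<and> q * a 0 \<le> a 1 \<longrightarrow>
          (\<forall>x. \<bar>grid_diffs (a 1) ks (f 0) (x + axis i (q / a 1)) - grid_diffs (a 1) ks (f 0) x\<bar> < 1)) \<longrightarrow>
        \<bar>grid_diffs (a 1) ks (f 0) (b 1)\<bar> \<le> ?B"
  proof (intro allI impI, elim conjE)
    fix a :: "nat \<Rightarrow> real" and b :: "nat \<Rightarrow> real ^ 'n" and f :: "nat \<Rightarrow> real ^ 'n \<Rightarrow> real"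
    assume a: "a 0 = r" "a 0 \<le> a 1"
      and s: "\<forall>v. \<not> grid_diffs (a 1) ks (f 0) ((b(0 := v)) 0) = 0 \<longrightarrow> \<bar>(b(0 := v)) 0 $ i\<bar> \<le> R + 1"
      and d: "\<forall>q. q \<in> \<nat> \<and> q * a 0 \<le> a 1 \<longrightarrow>
          (\<forall>x. \<bar>grid_diffs (a 1) ks (f 0) (x + axis i (q / a 1)) - grid_diffs (a 1) ks (f 0) x\<bar> < 1)"
    show "\<bar>grid_diffs (a 1) ks (f 0) (b 1)\<bar> \<le> ?B"
    proof (rule bounded_of_small_differences)
      show "\<bar>x $ i\<bar> \<le> R + 1" if "grid_diffs (a 1) ks (f 0) x \<noteq> 0" for x
        using s that by simp
      show "\<bar>grid_diffs (a 1) ks (f 0) (x + axis i (q / a 1)) - grid_diffs (a 1) ks (f 0) x\<bar> < 1"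
        if "q \<in> \<nat>" "q * r \<le> a 1" for x q
        using d that a(1) by blast
    qed (use a R(1) in \<open>auto simp: r_def\<close>)
  qed
  have "\<bar>?D x\<bar> \<le> hreal E ?B" for x
    using transfer_all[where a="\<lambda>j. if j = 0 then hreal E r else N" and b="\<lambda>_. x" and f="\<lambda>_. \<psi>", OF tr std]
      \<psi>i supp pr N_gt[of r] by (simp add: less_imp_le)
  then show ?thesis by blast
qed

text \<open>Finiteness of the pairings is transferred from \<open>regularize_bounded\<close>, fed
  with \<open>test_diffs_bounded\<close>; that they represent \<open>T\<close> is transferred from
  \<open>regularize_tendsto\<close>, one standard error at a time.\<close>

lemma Phi_surj:
  assumes T: "T \<in> distributions \<Omega>"
  shows "\<exists>f\<in>grid_distributions E N \<Omega>. Phi E N \<Omega> (grid_class E N \<Omega> f) = T"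
proof -
  obtain P where P: "filterlim P at_top sequentially" "\<forall>\<^sub>F n in sequentially. good_scale TYPE('n) (P n) n"
    using diagonal_sequence[of "good_scale TYPE('n)"] eventually_good_scale by blast
  \<comment> \<open>The scale \<open>P\<close> lives on naturals; rounding extends it to the real
    indices of \<open>hfamily\<close>.\<close>
  define F where "F = (\<lambda>r::real. regularize T (P (nat \<lfloor>r\<rfloor>)) r)"
  have F_nat: "F (real n) = regularize T (P n) n" for n
    by (simp add: F_def)
  define f where "f = hrestrict (hfamily F N)"
  have mult: "grid_inner E N f \<psi> = grid_inner E N (hfamily F N) \<psi>"
    if "\<And>x. \<psi> x \<noteq> 0 \<Longrightarrow> x \<in> grid_domain E N \<Omega>" for \<psi>
  proof -
    have "(\<lambda>x. f x * \<psi> x) = (\<lambda>x. hfamily F N x * \<psi> x)"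
      using that by (auto simp: f_def hrestrict_def grid_domain_def fun_eq_iff)
    then show ?thesis
      by (simp add: grid_inner_def)
  qed
  obtain y\<^sub>0 where y\<^sub>0: "y\<^sub>0 \<in> \<Omega>"
    using \<Omega>_ne by blast
  have "hfinite (grid_inner E N f \<psi>)" if \<psi>: "\<psi> \<in> test" for \<psi>
  proof -
    obtain K where K: "compact K" "K \<subseteq> \<Omega>" "\<And>x. \<psi> x \<noteq> 0 \<Longrightarrow> (\<forall>i. hfinite (x $ i)) \<and> (\<chi> i. st E (x $ i)) \<in> K"
      using \<psi> unfolding grid_test_functions_def by blast
    have \<psi>g: "\<psi> \<in> ifuns" "\<And>x. \<psi> x \<noteq> 0 \<Longrightarrow> x \<in> grid_domain E N \<Omega>"
      using \<psi> by (auto simp: grid_test_functions_def grid_functions_def ifuns_def)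
    obtain K\<^sub>1 \<delta> where K\<^sub>1: "compact K\<^sub>1" "K\<^sub>1 \<subseteq> \<Omega>" "\<delta> > 0"
      "\<And>y x. y \<in> K \<Longrightarrow> (\<forall>i. \<bar>x $ i - y $ i\<bar> \<le> \<delta>) \<Longrightarrow> x \<in> K\<^sub>1"
      using compact_box_neighbourhood[OF open_\<Omega> K(1,2)] by blast
    \<comment> \<open>The support of \<psi> is only infinitely close to \<open>K\<close>, hence the
      compact neighbourhood; the added point makes it nonempty.\<close>
    let ?K = "insert y\<^sub>0 K\<^sub>1"
    have "compact ?K" "?K \<subseteq> \<Omega>"
      using K\<^sub>1 y\<^sub>0 by auto
    from regularize_bounded[OF open_\<Omega> T this P]
    obtain C m where "\<forall>\<^sub>F n in sequentially. \<forall>\<psi> \<beta>. {x. \<psi> x \<noteq> 0} \<subseteq> std_grid n \<inter> ?K \<longrightarrow>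
      (\<forall>ks. length ks \<le> m \<longrightarrow> (\<forall>x. \<bar>grid_diffs n ks \<psi> x\<bar> \<le> \<beta>)) \<longrightarrow>
      \<bar>std_inner n (regularize T (P n) n) \<psi>\<bar> \<le> C * \<beta>"
      by blast
    then obtain n\<^sub>1 where n\<^sub>1: "\<And>n \<psi> \<beta>. n \<ge> n\<^sub>1 \<Longrightarrow> {x. \<psi> x \<noteq> 0} \<subseteq> std_grid n \<inter> ?K \<Longrightarrow>
      (\<forall>ks. length ks \<le> m \<longrightarrow> (\<forall>x. \<bar>grid_diffs n ks \<psi> x\<bar> \<le> \<beta>)) \<Longrightarrow>
      \<bar>std_inner n (regularize T (P n) n) \<psi>\<bar> \<le> C * \<beta>"
      unfolding eventually_sequentially by blast
    let ?S = "{ks :: 'n list. set ks \<subseteq> UNIV \<and> length ks \<le> m}"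
    have finS: "finite ?S"
      by (intro finite_lists_length_le) simp
    have "\<forall>ks. \<exists>\<beta>. \<forall>x. \<bar>grid_diffs N ks \<psi> x\<bar> \<le> hreal E \<beta>"
      using test_diffs_bounded[OF \<psi>] by blast
    from choice[OF this] obtain b where b: "\<And>ks x. \<bar>grid_diffs N ks \<psi> x\<bar> \<le> hreal E (b ks)"
      by blast
    \<comment> \<open>\<open>regularize_bounded\<close> wants one bound for all orders up to
      \<open>m\<close>, of which there are finitely many.\<close>
    define \<beta> where "\<beta> = (\<Sum>ks\<in>?S. \<bar>b ks\<bar>)"
    have \<beta>: "\<bar>grid_diffs N ks \<psi> x\<bar> \<le> hreal E \<beta>" if "ks \<in> ?S" for ks x
    proof -
      have "b ks \<le> \<bar>b ks\<bar>" by simp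
      also have "\<dots> \<le> \<beta>"
        unfolding \<beta>_def using that finS by (intro member_le_sum) auto
      finally have "hreal E (b ks) \<le> hreal E \<beta>"
        by (simp add: hreal_le)
      then show ?thesis
        using b order_trans by blast
    qed
    have supp: "x \<in> grid_vecs E N \<and> x \<in> hvec_set E ?K" if x: "\<psi> x \<noteq> 0" for x
    proof
      show "x \<in> grid_vecs E N"
        using \<psi>g(2)[OF x] by (simp add: grid_domain_def)
      have "vapprox x (hvec E (\<chi> i. st E (x $ i)))"
        using K(3)[OF x] by (intro vapprox_st) blast
      then show "x \<in> hvec_set E ?K"
        by (rule near_hvec_set[OF _ K\<^sub>1(3), rotated]) (use K\<^sub>1(4) K(3)[OF x] in blast)
    qed
    have "tr (\<lambda>a b f. \<not> f 0 (b 0) = 0 \<longrightarrow> b 0 \<in> std_grid (a 0) \<and> b 0 \<in> ?K)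
        (\<lambda>a b f. \<not> f 0 (b 0) = 0 \<longrightarrow> b 0 \<in> grid_vecs E (a 0) \<and> b 0 \<in> hvec_set E ?K)"
      by (intro tr_imp tr_not tr_conj tr_eq tnum_fun_var tnum_zero tr_grid tr_vec_set tvec_var tnum_var) auto
    note 1 = tr_all_vec[OF this, of 0]
    have "tr (\<lambda>a b f. \<forall>ks\<in>?S. \<bar>grid_diffs (a 0) ks (f 0) (b 0)\<bar> \<le> \<beta>)
        (\<lambda>a b f. \<forall>ks\<in>?S. \<bar>grid_diffs (a 0) ks (f 0) (b 0)\<bar> \<le> hreal E \<beta>)"
      by (intro tr_ball_finite finS tr_le tnum_abs tnum_grid_diffs tnum_var tnum_const tfun_var tvec_var)
    note 2 = tr_all_vec[OF this, of 0]
    have tr: "tr (\<lambda>a b f. a 0 \<in> \<nat> \<and> real n\<^sub>1 \<le> a 0 \<and>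
          (\<forall>v. \<not> f 0 ((b(0 := v)) 0) = 0 \<longrightarrow> (b(0 := v)) 0 \<in> std_grid (a 0) \<and> (b(0 := v)) 0 \<in> ?K) \<and>
          (\<forall>v. \<forall>ks\<in>?S. \<bar>grid_diffs (a 0) ks (f 0) ((b(0 := v)) 0)\<bar> \<le> \<beta>) \<longrightarrow>
          \<bar>std_inner (a 0) (F (a 0)) (f 0)\<bar> \<le> C * \<beta>)
        (\<lambda>a b f. a 0 \<in> hnum_set E \<nat> \<and> hreal E (real n\<^sub>1) \<le> a 0 \<and>
          (\<forall>v. \<not> f 0 ((b(0 := v)) 0) = 0 \<longrightarrow> (b(0 := v)) 0 \<in> grid_vecs E (a 0) \<and> (b(0 := v)) 0 \<in> hvec_set E ?K) \<and>
          (\<forall>v. \<forall>ks\<in>?S. \<bar>grid_diffs (a 0) ks (f 0) ((b(0 := v)) 0)\<bar> \<le> hreal E \<beta>) \<longrightarrow>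
          \<bar>grid_inner E (a 0) (hfamily F (a 0)) (f 0)\<bar> \<le> hreal E (C * \<beta>))"
      by (intro tr_imp tr_conj tr_nat 1 2 tr_le tnum_abs tnum_inner tnum_var tnum_const tfun_family tfun_var)
    have std: "\<forall>a b f. a (0::nat) \<in> \<nat> \<and> real n\<^sub>1 \<le> a 0 \<and>
          (\<forall>v. \<not> f (0::nat) ((b(0 := v)) (0::nat)) = 0 \<longrightarrow> (b(0 := v)) 0 \<in> std_grid (a 0) \<and> (b(0 := v)) 0 \<in> ?K) \<and>
          (\<forall>v. \<forall>ks\<in>?S. \<bar>grid_diffs (a 0) ks (f 0) ((b(0 := v)) 0)\<bar> \<le> \<beta>) \<longrightarrow>
          \<bar>std_inner (a 0) (F (a 0)) (f 0)\<bar> \<le> C * \<beta>"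
    proof (intro allI impI, elim conjE)
      fix a :: "nat \<Rightarrow> real" and b :: "nat \<Rightarrow> real ^ 'n" and f :: "nat \<Rightarrow> real ^ 'n \<Rightarrow> real"
      assume a: "a 0 \<in> \<nat>" "real n\<^sub>1 \<le> a 0"
        and s: "\<forall>v. \<not> f 0 ((b(0 := v)) 0) = 0 \<longrightarrow> (b(0 := v)) 0 \<in> std_grid (a 0) \<and> (b(0 := v)) 0 \<in> ?K"
        and d: "\<forall>v. \<forall>ks\<in>?S. \<bar>grid_diffs (a 0) ks (f 0) ((b(0 := v)) 0)\<bar> \<le> \<beta>"
      obtain n where n: "a 0 = real n" "n\<^sub>1 \<le> n"
        using a by (auto elim!: Nats_cases)
      have "{x. f 0 x \<noteq> 0} \<subseteq> std_grid n \<inter> ?K"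
        using s unfolding n(1) by auto
      moreover have "\<forall>ks. length ks \<le> m \<longrightarrow> (\<forall>x. \<bar>grid_diffs n ks (f 0) x\<bar> \<le> \<beta>)"
        using d unfolding n(1) by simp
      ultimately show "\<bar>std_inner (a 0) (F (a 0)) (f 0)\<bar> \<le> C * \<beta>"
        unfolding n(1) F_nat by (rule n\<^sub>1[OF n(2)])
    qed
    have "\<bar>grid_inner E N (hfamily F N) \<psi>\<bar> \<le> hreal E (C * \<beta>)"
      using transfer_all[where a="\<lambda>_. N" and b="\<lambda>_. 0" and f="\<lambda>_. \<psi>", OF tr std]
        \<psi>g(1) supp \<beta> N_nat N_gt[of "real n\<^sub>1"] by (simp add: less_imp_le)
    moreover have "grid_inner E N f \<psi> = grid_inner E N (hfamily F N) \<psi>"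
      by (rule mult) (rule \<psi>g(2))
    ultimately show ?thesis
      unfolding hfinite_iff by auto
  qed
  then have fg: "f \<in> grid_distributions E N \<Omega>"
    by (simp add: grid_distributions_def f_def hrestrict_grid_function hfamily_internal)
  have "Phi E N \<Omega> (grid_class E N \<Omega> f) \<phi> = T \<phi>" for \<phi>
  proof (cases "\<phi> \<in> test_functions \<Omega>")
    case True
    have "approx (grid_inner E N f (hrestrict (hfun E \<phi>))) (hreal E (T \<phi>))"
    proof (rule approxI)
      fix e :: real assume "e > 0"
      then have "\<forall>\<^sub>F n in sequentially. \<bar>std_inner n (regularize T (P n) n) \<phi> - T \<phi>\<bar> < e"
        using regularize_tendsto[OF open_\<Omega> T True P] unfolding tendsto_iff dist_real_def by blast
      then obtain n\<^sub>1 where n\<^sub>1: "\<And>n. n \<ge> n\<^sub>1 \<Longrightarrow> \<bar>std_inner n (regularize T (P n) n) \<phi> - T \<phi>\<bar> < e"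
        unfolding eventually_sequentially by blast
      have tr: "tr (\<lambda>a b f. a 0 \<in> \<nat> \<and> real n\<^sub>1 \<le> a 0 \<longrightarrow> \<bar>std_inner (a 0) (F (a 0))
            (\<lambda>x. if x \<in> \<Omega> \<and> x \<in> std_grid (a 0) then \<phi> x else 0) - T \<phi>\<bar> < e)
          (\<lambda>a b f. a 0 \<in> hnum_set E \<nat> \<and> hreal E (real n\<^sub>1) \<le> a 0 \<longrightarrow> \<bar>grid_inner E (a 0) (hfamily F (a 0))
            (\<lambda>x. if x \<in> hvec_set E \<Omega> \<and> x \<in> grid_vecs E (a 0) then hfun E \<phi> x else 0) - hreal E (T \<phi>)\<bar> < hreal E e)"
        by (intro tr_imp tr_conj tr_nat tr_le tr_less tnum_abs tnum_diff tnum_var tnum_const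
            tnum_inner[OF tnum_var tfun_family[OF tnum_var] tfun_restrict[OF tnum_var tfun_const]])
      have std: "\<forall>a (b :: nat \<Rightarrow> real ^ 'n) (f :: nat \<Rightarrow> real ^ 'n \<Rightarrow> real). a (0::nat) \<in> \<nat> \<and> real n\<^sub>1 \<le> a 0 \<longrightarrow> \<bar>std_inner (a 0) (F (a 0))
            (\<lambda>x. if x \<in> \<Omega> \<and> x \<in> std_grid (a 0) then \<phi> x else 0) - T \<phi>\<bar> < e"
      proof (intro allI impI)
        fix a :: "nat \<Rightarrow> real"
        assume "a 0 \<in> \<nat> \<and> real n\<^sub>1 \<le> a 0"
        then obtain n where n: "a 0 = real n" "n\<^sub>1 \<le> n"
          by (auto elim!: Nats_cases)
        \<comment> \<open>Test functions vanish off \<Omega>, so the cutoff built into the grid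
          restriction does not change the pairing.\<close>
        have "\<phi> x = 0" if "x \<notin> \<Omega>" for x
          using closure_subset[of "{x. \<phi> x \<noteq> 0}"] True that by (auto simp: test_functions_def)
        then have "std_inner (real n) (F (real n)) (\<lambda>x. if x \<in> \<Omega> \<and> x \<in> std_grid (real n) then \<phi> x else 0)
            = std_inner n (regularize T (P n) n) \<phi>"
          unfolding F_nat std_inner_def by (intro arg_cong2[of _ _ _ _ "(*)"] refl sum.cong) auto
        then show "\<bar>std_inner (a 0) (F (a 0)) (\<lambda>x. if x \<in> \<Omega> \<and> x \<in> std_grid (a 0) then \<phi> x else 0) - T \<phi>\<bar> < e"
          unfolding n(1) using n\<^sub>1[OF n(2)] by simp
      qed
      have "\<bar>grid_inner E N (hfamily F N) (hrestrict (hfun E \<phi>)) - hreal E (T \<phi>)\<bar> < hreal E e"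
        using transfer_vec[where a="\<lambda>_. N", OF tr std] N_nat N_gt[of "real n\<^sub>1"]
        by (simp add: less_imp_le hrestrict_def)
      moreover have "grid_inner E N f (hrestrict (hfun E \<phi>)) = grid_inner E N (hfamily F N) (hrestrict (hfun E \<phi>))"
        by (rule mult) (auto simp: hrestrict_def grid_domain_def split: if_splits)
      ultimately show "\<bar>grid_inner E N f (hrestrict (hfun E \<phi>)) - hreal E (T \<phi>)\<bar> < hreal E e"
        by simp
    qed
    then show ?thesis
      by (rule approx_hreal_unique[OF Phi_approx[OF fg True]])
  next
    case False
    then show ?thesis
      using T by (simp add: Phi_def distributions_def)
  qed
  then show ?thesis
    using fg by (intro bexI[of _ f]) auto
qed

end

section \<open>The empty domain and the range of \<Phi>\<close>

lemma test_functions_empty: "\<phi> \<in> test_functions {} \<Longrightarrow> \<phi> = (\<lambda>_. 0)"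
  using closure_subset[of "{x. \<phi> x \<noteq> 0}"] by (auto simp: test_functions_def fun_eq_iff)

context nonstandard
begin

lemma hfun_zero: "hfun E (\<lambda>_. 0) = (\<lambda>_. 0)"
proof
  fix x
  note tr = tr_eq[OF tnum_fun_const[where g="\<lambda>_. 0", OF tvec_var[of 0]] tnum_zero]
  have "\<forall>(a :: nat \<Rightarrow> real) (b :: nat \<Rightarrow> real ^ 'n) (f :: nat \<Rightarrow> real ^ 'n \<Rightarrow> real). (0::real) = 0"
    by simp
  from transfer_vec[where b="\<lambda>_. x", OF tr this] show "hfun E (\<lambda>_. 0) x = 0"
    by simp
qed

text \<open>Without nearstandard points no function is of class S^0. So there are no grid test
  functions, every grid function is a grid distribution, and all of them are equivalent.\<close>

lemma Phi_empty:
  assumes "f \<in> grid_functions E N {}"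
  shows "f \<in> grid_distributions E N {}" "Phi E N {} (grid_class E N {} f) = (\<lambda>\<phi>. 0)"
proof -
  have test: "grid_test_functions E N {} = {}"
    by (auto simp: grid_test_functions_def class_Sinf_def class_S0_def nearstandard_def)
  then show f: "f \<in> grid_distributions E N {}"
    using assms by (simp add: grid_distributions_def)
  have C: "grid_class E N {} f = grid_distributions E N {}"
    using f by (auto simp: grid_class_def grid_equiv_def test)
  have inner: "grid_inner E N g (\<lambda>_. 0) = 0" if "g \<in> ifuns" for g
  proof -
    have tr: "tr (\<lambda>a b f. std_inner (a 0) (f 0) (\<lambda>_. 0) = 0) (\<lambda>a b f. grid_inner E (a 0) (f 0) (hfun E (\<lambda>_. 0)) = 0)"
      by (intro tr_eq tnum_inner tnum_var tfun_var tfun_const tnum_zero)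
    have "\<forall>a (b :: nat \<Rightarrow> real ^ 'n) f. std_inner (a (0::nat)) (f (0::nat)) (\<lambda>_ :: real ^ 'n. 0) = 0"
      by (simp add: std_inner_def)
    from transfer_all[where a="\<lambda>_. N" and f="\<lambda>_. g", OF tr this] show ?thesis
      using that by (simp add: hfun_zero)
  qed
  have "Phi E N {} (grid_class E N {} f) \<phi> = 0" for \<phi>
  proof (cases "\<phi> \<in> test_functions {}")
    case True
    then have \<phi>: "\<phi> = (\<lambda>_. 0)"
      by (rule test_functions_empty)
    have r: "grid_restrict E N {} \<phi> = (\<lambda>_. 0)"
      unfolding \<phi> by (simp add: grid_restrict_def hfun_zero fun_eq_iff)
    have "st E (grid_inner E N g (grid_restrict E N {} \<phi>)) = 0" if "g \<in> grid_distributions E N {}" for g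
    proof -
      have "g \<in> ifuns"
        using that by (simp add: grid_distributions_def grid_functions_def ifuns_def)
      then have "grid_inner E N g (\<lambda>_. 0) = 0"
        by (rule inner)
      then show ?thesis
        unfolding r using st_eqI[of 0 0] approx_refl[of 0] by simp
    qed
    then show ?thesis
      using True f unfolding Phi_def C by (auto intro!: the_equality)
  qed (simp add: Phi_def)
  then show "Phi E N {} (grid_class E N {} f) = (\<lambda>\<phi>. 0)"
    by auto
qed

end

lemma distributions_empty: "distributions {} = {\<lambda>\<phi>. 0}"
proof -
  have "T = (\<lambda>\<phi>. 0)" if T: "T \<in> distributions {}" for T :: "(real ^ 'n::finite \<Rightarrow> real) \<Rightarrow> real"
  proof
    fix \<phi>
    have "T \<phi> = 0" if "\<phi> \<in> test_functions {}"
    proof -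
      have "T (\<lambda>x. 0 * \<phi> x) = 0 * T \<phi>"
        using T that unfolding distributions_def by blast
      moreover have "(\<lambda>x. 0 * \<phi> x) = \<phi>"
        by (simp add: test_functions_empty[OF that])
      ultimately show ?thesis
        by simp
    qed
    moreover have "T \<phi> = 0" if "\<phi> \<notin> test_functions {}"
      using T that unfolding distributions_def by blast
    ultimately show "T \<phi> = 0"
      by blast
  qed
  moreover have "(\<lambda>\<phi>. 0) \<in> distributions {}"
    by (simp add: distributions_def)
  ultimately show ?thesis
    by blast
qed

theorem Phi_image:
  fixes E :: "('h::linordered_field, 'n::finite) extension"
  assumes "nonstandard_extension E" "N\<^sub>0 \<in> hnum_set E \<nat>" "\<not> hfinite N\<^sub>0" "N = hfact E N\<^sub>0" "open \<Omega>"
  shows "(\<lambda>f. Phi E N \<Omega> (grid_class E N \<Omega> f)) ` grid_distributions E N \<Omega> = distributions \<Omega>"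
proof -
  interpret nonstandard E
    by standard (rule assms(1))
  show ?thesis
  proof (cases "\<Omega> = {}")
    case True
    have "(\<lambda>_. 0) \<in> grid_functions E N {}"
      using star_ifun[of "\<lambda>_. 0"] by (simp add: grid_functions_def ifuns_def hfun_zero)
    then show ?thesis
      using Phi_empty unfolding True distributions_empty by (auto simp: grid_distributions_def)
  next
    case False
    interpret grid_setting E \<Omega> N
      by standard (use assms False infinite_hfact in auto)
    show ?thesis
      using Phi_distribution Phi_surj by blast
  qed
qed

theorem theorem5p3:
  fixes E :: "('h::linordered_field, 'n::finite) extension"
    and \<Omega> :: "(real ^ 'n) set"
    and N\<^sub>0 N :: 'h
    and L :: "((real ^ 'n \<Rightarrow> real) \<Rightarrow> real) \<Rightarrow> ((real ^ 'n \<Rightarrow> real) \<Rightarrow> real)"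
    and L\<^sub>X :: "('h ^ 'n \<Rightarrow> 'h) \<Rightarrow> ('h ^ 'n \<Rightarrow> 'h)"
    and T :: "(real ^ 'n \<Rightarrow> real) \<Rightarrow> real"
  assumes "nonstandard_extension E"
    and "saturated E (distributions \<Omega>)"
    and "N\<^sub>0 \<in> hnum_set E \<nat>" and "\<not> hfinite N\<^sub>0"
    and "N = hfact E N\<^sub>0"
    and "open \<Omega>"
    and "linear_on_distributions \<Omega> L"
    and "\<And>f. f \<in> grid_functions E N \<Omega> \<Longrightarrow> L\<^sub>X f \<in> grid_functions E N \<Omega>"
    and "\<And>f. f \<in> grid_distributions E N \<Omega> \<Longrightarrow> L\<^sub>X f \<in> grid_distributions E N \<Omega>"
    and "\<And>f. f \<in> grid_distributions E N \<Omega> \<Longrightarrow>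
           Phi E N \<Omega> (grid_class E N \<Omega> (L\<^sub>X f)) = L (Phi E N \<Omega> (grid_class E N \<Omega> f))"
    and "T \<in> distributions \<Omega>"
  shows "(\<exists>v\<in>distributions \<Omega>. L v = T) \<longleftrightarrow>
         (\<exists>T\<^sub>X\<in>grid_distributions E N \<Omega>. Phi E N \<Omega> (grid_class E N \<Omega> T\<^sub>X) = T \<and>
            (\<exists>u\<in>grid_distributions E N \<Omega>. L\<^sub>X u = T\<^sub>X))"
proof -
  have image: "(\<lambda>f. Phi E N \<Omega> (grid_class E N \<Omega> f)) ` grid_distributions E N \<Omega> = distributions \<Omega>"
    using assms(1,3,4,5,6) by (rule Phi_image)
  show ?thesis
  proof
    assume "\<exists>v\<in>distributions \<Omega>. L v = T"
    then obtain u where u: "u \<in> grid_distributions E N \<Omega>" "L (Phi E N \<Omega> (grid_class E N \<Omega> u)) = T"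
      unfolding image[symmetric] by blast
    then show "\<exists>T\<^sub>X\<in>grid_distributions E N \<Omega>. Phi E N \<Omega> (grid_class E N \<Omega> T\<^sub>X) = T \<and>
        (\<exists>u\<in>grid_distributions E N \<Omega>. L\<^sub>X u = T\<^sub>X)"
      using assms(9)[OF u(1)] assms(10)[OF u(1)] by (intro bexI[of _ "L\<^sub>X u"] conjI bexI[of _ u]) auto
  next
    assume "\<exists>T\<^sub>X\<in>grid_distributions E N \<Omega>. Phi E N \<Omega> (grid_class E N \<Omega> T\<^sub>X) = T \<and>
        (\<exists>u\<in>grid_distributions E N \<Omega>. L\<^sub>X u = T\<^sub>X)"
    then obtain u where u: "u \<in> grid_distributions E N \<Omega>"
      "Phi E N \<Omega> (grid_class E N \<Omega> (L\<^sub>X u)) = T"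
      by blast
    moreover from u(1) have "Phi E N \<Omega> (grid_class E N \<Omega> u) \<in> distributions \<Omega>"
      unfolding image[symmetric] by blast
    ultimately show "\<exists>v\<in>distributions \<Omega>. L v = T"
      using assms(10)[OF u(1)] by (intro bexI[of _ "Phi E N \<Omega> (grid_class E N \<Omega> u)"]) auto
  qed
qed

end
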